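(* For any $\epsilon>0$, $h\in(0,1)$ and $\tau\in(0,1)$ with $(\epsilon^{-2}-\lambda_1)\tau<1$, the DIEG scheme for the stochastic Allen--Cahn equation $$\mathrm dX(t,\xi)=\Delta X(t,\xi)\,\mathrm dt+\epsilon^{-2}(X(t,\xi)-X(t,\xi)^3)\,\mathrm dt+\mathrm dW(t,\xi)$$ under the homogeneous Dirichlet boundary condition on $\mathscr O$ is uniquely ergodic.
   Context: Setting. $\mathscr O\subset\mathbb R^d$ ($d=1,2,3$) is a bounded domain with smooth boundary or a convex domain with polygonal boundary; $H=L^2(\mathscr O)$ with inner product $\langle\cdot,\cdot\rangle$ and norm $\|\cdot\|$; $\dot H^1=H_0^1(\mathscr O)$, $\dot H^{-1}$ is its dual, with duality pairing ${}_1\langle\cdot,\cdot\rangle_{-1}$; $\lambda_1>0$ is the first eigenvalue of the Dirichlet operator $-\Delta$ in $H$. $W$ is an $H$-valued $\mathbf Q$-Wiener process on a filtered probability space, where $\mathbf Q$ is a self-adjoint, positive definite, trace-class operator on $H$. Discretization. For $h\in(0,1)$, $\mathcal T_h$ is a regular family of quasi-uniform partitions of $\mathscr O$ with maximal length $h$; $V_h\subset\dot H^1$ is the space of continuous functions on $\overline{\mathscr O}$ that are piecewise linear over $\mathcal T_h$ and vanish on $\partial\mathscr O$. The operators $\Delta_h:V_h\to V_h$ and $\mathcal P_h:\dot H^{-1}\to V_h$ are defined by $\langle v^h,\Delta_hx^h\rangle=-\langle\nabla x^h,\nabla v^h\rangle$ and $\langle v^h,\mathcal P_hz\rangle={}_1\langle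 v^h,z\rangle_{-1}$ for $x^h,v^h\in V_h$, $z\in\dot H^{-1}$. With $F(x)(\xi):=\epsilon^{-2}(x(\xi)-x(\xi)^3)$, the drift-implicit Euler Galerkin (DIEG) scheme for this equation is $$X_{j+1}^h=X_j^h+\tau\Delta_hX_{j+1}^h+\tau\mathcal P_hF(X_{j+1}^h)+\mathcal P_h\delta_jW,\quad j\in\mathbb N,$$ with $\delta_jW=W((j+1)\tau)-W(j\tau)$ and $X_0^h=\mathcal P_hX_0$; for $(\epsilon^{-2}-\lambda_1)\tau<1$ it defines a $V_h$-valued homogeneous Markov chain. Uniquely ergodic means that the chain admits a unique invariant probability measure on $\mathcal B(V_h)$ (which is then ergodic). *)

theory Defs
  imports "HOL-Probability.Probability"
begin

section \<open>Domains\<close>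

text \<open>\<open>k\<close>-times continuously differentiable real functions on an open set \<open>U\<close>.\<close>

primrec cont_diff :: "nat \<Rightarrow> 'a::euclidean_space set \<Rightarrow> ('a \<Rightarrow> real) \<Rightarrow> bool" where
  "cont_diff 0 U f = continuous_on U f"
| "cont_diff (Suc k) U f =
     (\<exists>g. (\<forall>x\<in>U. GDERIV f x :> g x) \<and> (\<forall>b\<in>Basis. cont_diff k U (\<lambda>x. g x \<bullet> b)))"

definition smooth_on :: "'a::euclidean_space set \<Rightarrow> ('a \<Rightarrow> real) \<Rightarrow> bool" where
  "smooth_on U f \<longleftrightarrow> (\<forall>k. cont_diff k U f)"

definition grad :: "('a::euclidean_space \<Rightarrow> real) \<Rightarrow> 'a \<Rightarrow> 'a" where
  "grad f x = (THE g. GDERIV f x :> g)"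

text \<open>Smoothness of the boundary, by means of local defining functions.\<close>

definition smooth_boundary :: "'a::euclidean_space set \<Rightarrow> bool" where
  "smooth_boundary D \<longleftrightarrow>
     (\<forall>p\<in>frontier D. \<exists>U \<phi>. open U \<and> p \<in> U \<and> smooth_on U \<phi> \<and>
        (\<forall>x\<in>U. grad \<phi> x \<noteq> 0) \<and>
        D \<inter> U = {x\<in>U. \<phi> x < 0} \<and> frontier D \<inter> U = {x\<in>U. \<phi> x = 0})"

definition convex_polygonal :: "'a::euclidean_space set \<Rightarrow> bool" where
  "convex_polygonal D \<longleftrightarrow> convex D \<and> polytope (closure D)"

definition admissible_domain :: "'a::euclidean_space set \<Rightarrow> bool" where
  "admissible_domain D \<longleftrightarrow>
     open D \<and> connected D \<and> D \<noteq> {} \<and> bounded D \<and> (smooth_boundary D \<or> convex_polygonal D)"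

section \<open>The spaces $L^2$ and $H^1_0$\<close>

text \<open>
  Elements of $H = L^2(D)$ are represented by functions; equality in $H$ is equality almost
  everywhere on \<open>D\<close>. Values outside \<open>D\<close> are irrelevant.
\<close>

definition l2_space :: "'a::euclidean_space set \<Rightarrow> ('a \<Rightarrow> 'b::euclidean_space) set" where
  "l2_space D = {f \<in> borel_measurable (lebesgue_on D). integrable (lebesgue_on D) (\<lambda>x. (norm (f x))\<^sup>2)}"

definition l2_inner ::
    "'a::euclidean_space set \<Rightarrow> ('a \<Rightarrow> 'b::euclidean_space) \<Rightarrow> ('a \<Rightarrow> 'b) \<Rightarrow> real" where
  "l2_inner D f g = (LINT x|lebesgue_on D. f x \<bullet> g x)"

definition l2_norm :: "'a::euclidean_space set \<Rightarrow> ('a \<Rightarrow> 'b::euclidean_space) \<Rightarrow> real" where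
  "l2_norm D f = sqrt (l2_inner D f f)"

definition l2_eq ::
    "'a::euclidean_space set \<Rightarrow> ('a \<Rightarrow> 'b::euclidean_space) \<Rightarrow> ('a \<Rightarrow> 'b) \<Rightarrow> bool" where
  "l2_eq D f g \<longleftrightarrow> (AE x in lebesgue_on D. f x = g x)"

definition test_functions :: "'a::euclidean_space set \<Rightarrow> ('a \<Rightarrow> real) set" where
  "test_functions D =
     {\<phi>. smooth_on UNIV \<phi> \<and> compact (closure {x. \<phi> x \<noteq> 0}) \<and> closure {x. \<phi> x \<noteq> 0} \<subseteq> D}"

definition has_weak_gradient ::
    "'a::euclidean_space set \<Rightarrow> ('a \<Rightarrow> real) \<Rightarrow> ('a \<Rightarrow> 'a) \<Rightarrow> bool" where
  "has_weak_gradient D u g \<longleftrightarrow>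
     u \<in> l2_space D \<and> g \<in> l2_space D \<and>
     (\<forall>\<phi>\<in>test_functions D. \<forall>b\<in>Basis.
        l2_inner D u (\<lambda>x. grad \<phi> x \<bullet> b) = - l2_inner D (\<lambda>x. g x \<bullet> b) \<phi>)"

text \<open>Weak gradients are unique up to null sets, so the choice made here is immaterial.\<close>

definition weak_grad :: "'a::euclidean_space set \<Rightarrow> ('a \<Rightarrow> real) \<Rightarrow> 'a \<Rightarrow> 'a" where
  "weak_grad D u = (SOME g. has_weak_gradient D u g)"

definition H10 :: "'a::euclidean_space set \<Rightarrow> ('a \<Rightarrow> real) set" where
  "H10 D = {u. (\<exists>g. has_weak_gradient D u g) \<and>
     (\<exists>\<phi> :: nat \<Rightarrow> 'a \<Rightarrow> real. (\<forall>n. \<phi> n \<in> test_functions D) \<and>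
        (\<lambda>n. l2_norm D (\<lambda>x. \<phi> n x - u x)) \<longlonglongrightarrow> 0 \<and>
        (\<lambda>n. l2_norm D (\<lambda>x. grad (\<phi> n) x - weak_grad D u x)) \<longlonglongrightarrow> 0)}"

text \<open>
  \<open>dirichlet_laplacian D u f\<close> says that \<open>u\<close> lies in the domain of the Dirichlet operator
  $-\Delta$ in $L^2(D)$ and that $-\Delta u = f$.
\<close>

definition dirichlet_laplacian ::
    "'a::euclidean_space set \<Rightarrow> ('a \<Rightarrow> real) \<Rightarrow> ('a \<Rightarrow> real) \<Rightarrow> bool" where
  "dirichlet_laplacian D u f \<longleftrightarrow>
     u \<in> H10 D \<and> f \<in> l2_space D \<and>
     (\<forall>v\<in>H10 D. l2_inner D (weak_grad D u) (weak_grad D v) = l2_inner D f v)"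

definition dirichlet_eigenvalue :: "'a::euclidean_space set \<Rightarrow> real \<Rightarrow> bool" where
  "dirichlet_eigenvalue D l \<longleftrightarrow>
     (\<exists>u. \<not> l2_eq D u (\<lambda>_. 0) \<and> dirichlet_laplacian D u (\<lambda>x. l * u x))"

definition lambda1 :: "'a::euclidean_space set \<Rightarrow> real" where
  "lambda1 D = (LEAST l. dirichlet_eigenvalue D l)"

section \<open>The driving noise\<close>

definition orthonormal_basis ::
    "'a::euclidean_space set \<Rightarrow> (nat \<Rightarrow> 'a \<Rightarrow> real) \<Rightarrow> bool" where
  "orthonormal_basis D e \<longleftrightarrow>
     (\<forall>i. e i \<in> l2_space D) \<and>
     (\<forall>i j. l2_inner D (e i) (e j) = (if i = j then 1 else 0)) \<and>
     (\<forall>f\<in>l2_space D. (\<forall>i. l2_inner D f (e i) = 0) \<longrightarrow> l2_eq D f (\<lambda>_. 0))"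

definition l2_operator ::
    "'a::euclidean_space set \<Rightarrow> (('a \<Rightarrow> real) \<Rightarrow> ('a \<Rightarrow> real)) \<Rightarrow> bool" where
  "l2_operator D Q \<longleftrightarrow>
     (\<forall>f\<in>l2_space D. Q f \<in> l2_space D) \<and>
     (\<forall>f\<in>l2_space D. \<forall>g\<in>l2_space D. l2_eq D f g \<longrightarrow> l2_eq D (Q f) (Q g)) \<and>
     (\<forall>f\<in>l2_space D. \<forall>g\<in>l2_space D. \<forall>a b.
        l2_eq D (Q (\<lambda>x. a * f x + b * g x)) (\<lambda>x. a * Q f x + b * Q g x)) \<and>
     (\<exists>C. \<forall>f\<in>l2_space D. l2_norm D (Q f) \<le> C * l2_norm D f)"

text \<open>For a positive self-adjoint operator, being trace class means having finite trace.\<close>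

definition covariance_operator ::
    "'a::euclidean_space set \<Rightarrow> (('a \<Rightarrow> real) \<Rightarrow> ('a \<Rightarrow> real)) \<Rightarrow> bool" where
  "covariance_operator D Q \<longleftrightarrow>
     l2_operator D Q \<and>
     (\<forall>f\<in>l2_space D. \<forall>g\<in>l2_space D. l2_inner D (Q f) g = l2_inner D f (Q g)) \<and>
     (\<forall>f\<in>l2_space D. \<not> l2_eq D f (\<lambda>_. 0) \<longrightarrow> l2_inner D (Q f) f > 0) \<and>
     (\<exists>e. orthonormal_basis D e \<and> summable (\<lambda>n. l2_inner D (Q (e n)) (e n)))"

definition filtered_prob_space :: "'w measure \<Rightarrow> (real \<Rightarrow> 'w measure) \<Rightarrow> bool" where
  "filtered_prob_space M F \<longleftrightarrow>
     prob_space M \<and> (\<forall>t\<ge>0. subalgebra M (F t)) \<and>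
     (\<forall>s\<ge>0. \<forall>t\<ge>s. sets (F s) \<subseteq> sets (F t))"

definition normal_law :: "real \<Rightarrow> real \<Rightarrow> real measure" where
  "normal_law m v =
     (if v = 0 then return borel m else density lborel (normal_density m (sqrt v)))"

text \<open>
  Since $L^2(D)$ is separable, its Borel sets are generated by the functionals
  $f \mapsto \langle f, u\rangle$. Measurability, the sigma-algebra generated by an increment, and
  the centred Gaussian law with covariance \<open>(t - s) Q\<close> are therefore expressed through these
  functionals.
\<close>

definition wiener_process ::
    "'a::euclidean_space set \<Rightarrow> (('a \<Rightarrow> real) \<Rightarrow> ('a \<Rightarrow> real)) \<Rightarrow>
     'w measure \<Rightarrow> (real \<Rightarrow> 'w measure) \<Rightarrow> (real \<Rightarrow> 'w \<Rightarrow> 'a \<Rightarrow> real) \<Rightarrow> bool" where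
  "wiener_process D Q M F W \<longleftrightarrow>
     (\<forall>t\<ge>0. \<forall>\<omega>\<in>space M. W t \<omega> \<in> l2_space D) \<and>
     (\<forall>t\<ge>0. \<forall>u\<in>l2_space D. (\<lambda>\<omega>. l2_inner D (W t \<omega>) u) \<in> borel_measurable (F t)) \<and>
     (AE \<omega> in M. l2_eq D (W 0 \<omega>) (\<lambda>_. 0)) \<and>
     (AE \<omega> in M. \<forall>t\<ge>0.
        ((\<lambda>s. l2_norm D (\<lambda>x. W s \<omega> x - W t \<omega> x)) \<longlongrightarrow> 0) (at t within {0..})) \<and>
     (\<forall>s\<ge>0. \<forall>t\<ge>s.
        prob_space.indep_set M (sets (F s))
          (sigma_sets (space M)
            {(\<lambda>\<omega>. l2_inner D (\<lambda>x. W t \<omega> x - W s \<omega> x) u) -` B \<inter> space M | u B.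
               u \<in> l2_space D \<and> B \<in> sets borel})) \<and>
     (\<forall>s\<ge>0. \<forall>t\<ge>s. \<forall>u\<in>l2_space D.
        distr M borel (\<lambda>\<omega>. l2_inner D (\<lambda>x. W t \<omega> x - W s \<omega> x) u)
          = normal_law 0 ((t - s) * l2_inner D (Q u) u))"

section \<open>Finite elements\<close>

text \<open>
  A partition consists of simplices fitting together face to face. A domain with curved boundary
  has no partition into simplices alone; there, cells touching the boundary may be arbitrary
  regular closed sets. An affine function on such a cell that vanishes on a curved piece of the
  boundary vanishes on the whole cell, so this includes the usual convention of triangulating an
  inscribed polyhedron and extending the finite element functions by zero.
\<close>

definition full_simplex :: "'a::euclidean_space set \<Rightarrow> bool" where
  "full_simplex K \<longleftrightarrow> int DIM('a) simplex K"

definition curved_cell :: "'a::euclidean_space set \<Rightarrow> 'a set \<Rightarrow> bool" where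
  "curved_cell D K \<longleftrightarrow>
     compact K \<and> K = closure (interior K) \<and> connected (interior K) \<and> negligible (frontier K) \<and>
     K \<inter> frontier D \<noteq> {}"

definition partition_of :: "'a::euclidean_space set \<Rightarrow> 'a set set \<Rightarrow> bool" where
  "partition_of D T \<longleftrightarrow>
     finite T \<and> \<Union>T = closure D \<and>
     (\<forall>K\<in>T. K \<noteq> {} \<and> (full_simplex K \<or> (\<not> convex_polygonal D \<and> curved_cell D K))) \<and>
     (\<forall>K\<in>T. \<forall>L\<in>T. K \<noteq> L \<longrightarrow> interior K \<inter> interior L = {}) \<and>
     triangulation {K\<in>T. full_simplex K}"

text \<open>
  \<open>S\<close> is the set of mesh sizes for which the family is given; it need not be all of \<open>(0, 1)\<close>
  since, for instance, no partition of \<open>D\<close> has a cell of diameter larger than that of \<open>D\<close>.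
  The second part is shape regularity, the third quasi-uniformity, both uniform in \<open>h\<close>.
\<close>

definition regular_quasi_uniform_partitions ::
    "'a::euclidean_space set \<Rightarrow> real set \<Rightarrow> (real \<Rightarrow> 'a set set) \<Rightarrow> bool" where
  "regular_quasi_uniform_partitions D S T \<longleftrightarrow>
     (\<forall>h\<in>S. partition_of D (T h) \<and> Max (diameter ` T h) = h) \<and>
     (\<exists>r>0. \<forall>h\<in>S. \<forall>K\<in>T h. full_simplex K \<longrightarrow> (\<exists>c. ball c (r * diameter K) \<subseteq> K)) \<and>
     (\<exists>q>0. \<forall>h\<in>S. \<forall>K\<in>T h. full_simplex K \<longrightarrow> q * h \<le> diameter K)"

text \<open>
  Finite element functions are extended by zero outside \<open>D\<close>, so that distinct elements of \<open>V\<close> are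
  distinct as functions. On the boundary this is the boundary condition.
\<close>

definition fe_space :: "'a::euclidean_space set \<Rightarrow> 'a set set \<Rightarrow> ('a \<Rightarrow> real) set" where
  "fe_space D T =
     {v. continuous_on (closure D) v \<and>
         (\<forall>K\<in>T. \<exists>a c. \<forall>x\<in>K. v x = a \<bullet> x + c) \<and>
         (\<forall>x. x \<notin> D \<longrightarrow> v x = 0)}"

definition discrete_laplacian ::
    "'a::euclidean_space set \<Rightarrow> ('a \<Rightarrow> real) set \<Rightarrow> ('a \<Rightarrow> real) \<Rightarrow> 'a \<Rightarrow> real" where
  "discrete_laplacian D V u =
     (THE w. w \<in> V \<and>
        (\<forall>v\<in>V. l2_inner D v w = - l2_inner D (weak_grad D u) (weak_grad D v)))"

text \<open>
  Elements of $\dot H^{-1}$ are functionals on $H^1_0$, the duality pairing being evaluation;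
  \<open>l2_functional D f\<close> is \<open>f\<close> regarded as such a functional.
\<close>

definition l2_functional ::
    "'a::euclidean_space set \<Rightarrow> ('a \<Rightarrow> real) \<Rightarrow> ('a \<Rightarrow> real) \<Rightarrow> real" where
  "l2_functional D f = (\<lambda>v. l2_inner D v f)"

definition fe_projection ::
    "'a::euclidean_space set \<Rightarrow> ('a \<Rightarrow> real) set \<Rightarrow> (('a \<Rightarrow> real) \<Rightarrow> real) \<Rightarrow> 'a \<Rightarrow> real" where
  "fe_projection D V z = (THE w. w \<in> V \<and> (\<forall>v\<in>V. l2_inner D v w = z v))"

definition fe_borel :: "'a::euclidean_space set \<Rightarrow> ('a \<Rightarrow> real) set \<Rightarrow> ('a \<Rightarrow> real) measure" where
  "fe_borel D V =
     sigma V {U. openin (Metric_space.mtopology V (\<lambda>u v. l2_norm D (\<lambda>x. u x - v x))) U}"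

section \<open>The drift-implicit Euler Galerkin scheme\<close>

definition nemytskii :: "real \<Rightarrow> ('a \<Rightarrow> real) \<Rightarrow> 'a \<Rightarrow> real" where
  "nemytskii \<epsilon> x = (\<lambda>\<xi>. (x \<xi> - x \<xi> ^ 3) / \<epsilon>\<^sup>2)"

definition dieg_equation ::
    "'a::euclidean_space set \<Rightarrow> ('a \<Rightarrow> real) set \<Rightarrow> real \<Rightarrow> real \<Rightarrow>
     ('a \<Rightarrow> real) \<Rightarrow> ('a \<Rightarrow> real) \<Rightarrow> ('a \<Rightarrow> real) \<Rightarrow> bool" where
  "dieg_equation D V \<epsilon> \<tau> x dw y \<longleftrightarrow>
     (\<forall>\<xi>. y \<xi> = x \<xi> + \<tau> * discrete_laplacian D V y \<xi>
                + \<tau> * fe_projection D V (l2_functional D (nemytskii \<epsilon> y)) \<xi>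
                + fe_projection D V (l2_functional D dw) \<xi>)"

text \<open>
  The equation has exactly one solution in \<open>V\<close> whenever $(\epsilon^{-2} - \lambda_1)\tau < 1$.
\<close>

definition dieg_step ::
    "'a::euclidean_space set \<Rightarrow> ('a \<Rightarrow> real) set \<Rightarrow> real \<Rightarrow> real \<Rightarrow>
     ('a \<Rightarrow> real) \<Rightarrow> ('a \<Rightarrow> real) \<Rightarrow> 'a \<Rightarrow> real" where
  "dieg_step D V \<epsilon> \<tau> x dw = (THE y. y \<in> V \<and> dieg_equation D V \<epsilon> \<tau> x dw y)"

primrec dieg_chain ::
    "'a::euclidean_space set \<Rightarrow> ('a \<Rightarrow> real) set \<Rightarrow> real \<Rightarrow> real \<Rightarrow>
     (real \<Rightarrow> 'w \<Rightarrow> 'a \<Rightarrow> real) \<Rightarrow> ('w \<Rightarrow> 'a \<Rightarrow> real) \<Rightarrow> nat \<Rightarrow> 'w \<Rightarrow> 'a \<Rightarrow> real" where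
  "dieg_chain D V \<epsilon> \<tau> W X0 0 = (\<lambda>\<omega>. fe_projection D V (l2_functional D (X0 \<omega>)))"
| "dieg_chain D V \<epsilon> \<tau> W X0 (Suc j) =
     (\<lambda>\<omega>. dieg_step D V \<epsilon> \<tau> (dieg_chain D V \<epsilon> \<tau> W X0 j \<omega>)
            (\<lambda>\<xi>. W (real (Suc j) * \<tau>) \<omega> \<xi> - W (real j * \<tau>) \<omega> \<xi>))"

text \<open>
  The one-step transition kernel; the chain is homogeneous because the increments of \<open>W\<close> over the
  intervals \<open>[j \<tau>, (j + 1) \<tau>]\<close> are independent and identically distributed.
\<close>

definition dieg_kernel ::
    "'w measure \<Rightarrow> 'a::euclidean_space set \<Rightarrow> ('a \<Rightarrow> real) set \<Rightarrow> real \<Rightarrow> real \<Rightarrow>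
     (real \<Rightarrow> 'w \<Rightarrow> 'a \<Rightarrow> real) \<Rightarrow> ('a \<Rightarrow> real) \<Rightarrow> ('a \<Rightarrow> real) measure" where
  "dieg_kernel M D V \<epsilon> \<tau> W x = distr M (fe_borel D V) (dieg_chain D V \<epsilon> \<tau> W (\<lambda>_. x) 1)"

definition invariant_probability :: "'s measure \<Rightarrow> ('s \<Rightarrow> 's measure) \<Rightarrow> 's measure \<Rightarrow> bool" where
  "invariant_probability N P \<mu> \<longleftrightarrow>
     prob_space \<mu> \<and> sets \<mu> = sets N \<and>
     (\<forall>A\<in>sets N. emeasure \<mu> A = (\<integral>\<^sup>+x. emeasure (P x) A \<partial>\<mu>))"

definition uniquely_ergodic :: "'s measure \<Rightarrow> ('s \<Rightarrow> 's measure) \<Rightarrow> bool" where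
  "uniquely_ergodic N P \<longleftrightarrow>
     P \<in> N \<rightarrow>\<^sub>M prob_algebra N \<and> (\<exists>!\<mu>. invariant_probability N P \<mu>)"

end

theory Submission
  imports Defs "HOL-Library.Diagonal_Subsequence"
begin

text \<open>
  One step of the scheme adds a Gaussian vector to the current state and then solves the weak
  equation of the implicit step. By Rellich's theorem the Rayleigh quotient attains its infimum
  \<open>lambda1 D\<close>, so the condition on \<open>\<tau>\<close> makes the implicit step the minimiser of a coercive
  functional: it exists, is unique, depends on the data in a Lipschitz way, and by the cubic term
  grows sublinearly.

  In coordinates for which \<open>Q\<close> is the identity on the finite element space, the increments are
  vectors of independent normal variables. Observed after the noise has been added and before the
  implicit step, the chain therefore has a positive transition density. Positivity makes an invariant
  probability measure unique. Sublinear growth gives a drift condition for the \<open>L\<^sup>2\<close> norm towards a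
  bounded set on which the density has a common lower bound, and this gives existence. Invariant
  measures are carried between this chain and the scheme by the implicit step.
\<close>

text \<open>\<open>lambda1 D\<close> is a \<open>LEAST\<close> over eigenvalues, which says
  something only once a least eigenvalue is known to exist; this is why compactness enters at all.
  Likewise \<open>H10 D\<close> is a closure of test functions, so even finite element functions
  must be approximated by smooth ones before the Poincare inequality applies to them. Between noise
  and implicit step the law is an explicit product of normal densities; after the step it would be
  an image under a nonlinear map. The linear bound on the step has constant \<open>1 / coer\<close>,
  which may exceed 1 and then gives no drift; the cubic term is what makes the norm decrease far
  out. The law of an increment is given only through its scalar functionals, so the joint law of the
  coordinates has to be recovered from characteristic functions. The finite element space comes
  without a basis: a finite set of points separating its elements takes the place of dimension, and
  Gram-Schmidt over these points yields both an L2-orthonormal and a Q-orthonormal basis.\<close>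

section \<open>Gradients and differentiability of every order\<close>

lemma grad_eqI:
  fixes f :: "'a::euclidean_space \<Rightarrow> real"
  assumes "GDERIV f x :> g" shows "grad f x = g"
  unfolding grad_def
proof (rule the_equality)
  fix g' assume "GDERIV f x :> g'"
  with assms have "(\<lambda>h. h \<bullet> g) = (\<lambda>h. h \<bullet> g')"
    unfolding gderiv_def by (rule has_derivative_unique)
  then show "g' = g" by (metis inner_commute vector_eq_rdot)
qed (fact assms)

lemma GDERIV_imp_isCont: "GDERIV f x :> (g :: 'a::euclidean_space) \<Longrightarrow> isCont f x"
  unfolding gderiv_def by (rule has_derivative_continuous)

lemma GDERIV_along_line:
  fixes f :: "'a::euclidean_space \<Rightarrow> real"
  assumes "GDERIV f (x + t *\<^sub>R b) :> g"
  shows "DERIV (\<lambda>t. f (x + t *\<^sub>R b)) t :> (g \<bullet> b)"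
proof -
  have A: "((\<lambda>t. x + t *\<^sub>R b) has_derivative (\<lambda>t. t *\<^sub>R b)) (at t)"
    by (auto intro!: derivative_eq_intros)
  have "((\<lambda>t. f (x + t *\<^sub>R b)) has_derivative (\<lambda>t. (t *\<^sub>R b) \<bullet> g)) (at t)"
    using has_derivative_compose[OF A, of f "\<lambda>h. h \<bullet> g"] assms by (simp add: gderiv_def)
  then show ?thesis
    by (simp add: has_field_derivative_def mult_commute_abs inner_commute)
qed

text \<open>Serves the product rule: there the induction needs the factors themselves, and not only
  their gradients, to be of class \<open>k\<close>.\<close>

lemma cont_diff_Suc_imp: "cont_diff (Suc k) U f \<Longrightarrow> cont_diff k U f"
proof (induction k arbitrary: f)
  case 0
  then show ?case
    by (auto intro!: continuous_at_imp_continuous_on dest: GDERIV_imp_isCont)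
next
  case (Suc k)
  then obtain g where "\<forall>x\<in>U. GDERIV f x :> g x" "\<forall>b\<in>Basis. cont_diff (Suc k) U (\<lambda>x. g x \<bullet> b)"
    by (subst (asm) (2) cont_diff.simps) blast
  with Suc.IH show ?case by auto
qed

lemma cont_diff_const: "cont_diff k U (\<lambda>x::'a::euclidean_space. c)"
proof (induction k arbitrary: c)
  case (Suc k)
  then show ?case by (auto intro!: exI[of _ "\<lambda>_. 0"] GDERIV_const)
qed simp

lemma cont_diff_add: "cont_diff k U f \<Longrightarrow> cont_diff k U g \<Longrightarrow> cont_diff k U (\<lambda>x::'a::euclidean_space. f x + g x)"
proof (induction k arbitrary: f g)
  case (Suc k)
  then obtain f' g' where f': "\<forall>x\<in>U. GDERIV f x :> f' x" "\<forall>b\<in>Basis. cont_diff k U (\<lambda>x. f' x \<bullet> b)"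
    and g': "\<forall>x\<in>U. GDERIV g x :> g' x" "\<forall>b\<in>Basis. cont_diff k U (\<lambda>x. g' x \<bullet> b)"
    by auto
  then show ?case
    by (auto intro!: exI[of _ "\<lambda>x. f' x + g' x"] GDERIV_add Suc.IH simp: inner_add_left)
qed (auto intro: continuous_intros)

lemma cont_diff_mult: "cont_diff k U f \<Longrightarrow> cont_diff k U g \<Longrightarrow> cont_diff k U (\<lambda>x::'a::euclidean_space. f x * g x)"
proof (induction k arbitrary: f g)
  case (Suc k)
  then obtain f' g' where f': "\<forall>x\<in>U. GDERIV f x :> f' x" "\<forall>b\<in>Basis. cont_diff k U (\<lambda>x. f' x \<bullet> b)"
    and g': "\<forall>x\<in>U. GDERIV g x :> g' x" "\<forall>b\<in>Basis. cont_diff k U (\<lambda>x. g' x \<bullet> b)"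
    by auto
  have fg: "cont_diff k U f" "cont_diff k U g" using Suc.prems by (auto intro: cont_diff_Suc_imp simp del: cont_diff.simps)
  have "\<forall>x\<in>U. GDERIV (\<lambda>x. f x * g x) x :> f x *\<^sub>R g' x + g x *\<^sub>R f' x"
    using f' g' GDERIV_mult by blast
  moreover have "cont_diff k U (\<lambda>x. (f x *\<^sub>R g' x + g x *\<^sub>R f' x) \<bullet> b)" if "b \<in> Basis" for b
    unfolding inner_add_left inner_scaleR_left using f' g' that fg
    by (intro cont_diff_add Suc.IH) auto
  ultimately show ?case by (auto intro!: exI[of _ "\<lambda>x. f x *\<^sub>R g' x + g x *\<^sub>R f' x"])
qed (auto intro: continuous_intros)

lemma cont_diff_inner: "cont_diff k U (\<lambda>x::'a::euclidean_space. x \<bullet> b)"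
proof (cases k)
  case (Suc j)
  have "GDERIV (\<lambda>x. x \<bullet> b) x :> b" for x
    unfolding gderiv_def by (auto intro!: derivative_eq_intros)
  then show ?thesis using Suc by (auto intro!: exI[of _ "\<lambda>_. b"] cont_diff_const)
qed (auto intro: continuous_intros)

lemma smooth_on_mult: "smooth_on U f \<Longrightarrow> smooth_on U g \<Longrightarrow> smooth_on U (\<lambda>x. f x * g x)"
  by (simp add: smooth_on_def cont_diff_mult)

lemma smooth_on_scale: "smooth_on U f \<Longrightarrow> smooth_on U (\<lambda>x. c * f x)"
  by (simp add: smooth_on_def cont_diff_mult cont_diff_const)

lemma smooth_on_add: "smooth_on U f \<Longrightarrow> smooth_on U g \<Longrightarrow> smooth_on U (\<lambda>x. f x + g x)"
  by (simp add: smooth_on_def cont_diff_add)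

lemma smooth_GDERIV:
  assumes "smooth_on UNIV f" shows "GDERIV f x :> grad f x"
proof -
  have "cont_diff (Suc 0) UNIV f" using assms by (simp only: smooth_on_def)
  then obtain g where "\<forall>x. GDERIV f x :> g x" by auto
  then show ?thesis using grad_eqI by metis
qed

lemma smooth_grad:
  fixes b :: "'a::euclidean_space"
  assumes "smooth_on UNIV f" "b \<in> Basis" shows "smooth_on UNIV (\<lambda>x. grad f x \<bullet> b)"
  unfolding smooth_on_def
proof
  fix k
  have "cont_diff (Suc k) UNIV f" using assms by (simp only: smooth_on_def)
  then obtain g where g: "\<forall>x. GDERIV f x :> g x" "\<forall>b\<in>Basis. cont_diff k UNIV (\<lambda>x. g x \<bullet> b)" by auto
  then have "grad f = g" by (auto intro: grad_eqI)
  with g assms show "cont_diff k UNIV (\<lambda>x. grad f x \<bullet> b)" by simp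
qed

lemma smooth_continuous: "smooth_on U f \<Longrightarrow> continuous_on U f"
  unfolding smooth_on_def by (metis cont_diff.simps(1))

lemma smooth_grad_continuous:
  assumes "smooth_on UNIV f" shows "continuous_on UNIV (grad f)"
  using smooth_continuous[OF smooth_grad[OF assms]] by (rule continuous_on_componentwise[THEN iffD2, rule_format])

lemma grad_add: "smooth_on UNIV f \<Longrightarrow> smooth_on UNIV g \<Longrightarrow> grad (\<lambda>x. f x + g x) x = grad f x + grad g x"
  by (intro grad_eqI GDERIV_add smooth_GDERIV)

lemma grad_mult: "smooth_on UNIV f \<Longrightarrow> smooth_on UNIV g \<Longrightarrow> grad (\<lambda>x. f x * g x) x = f x *\<^sub>R grad g x + g x *\<^sub>R grad f x"
  by (intro grad_eqI GDERIV_mult smooth_GDERIV)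

lemma smooth_on_const: "smooth_on U (\<lambda>x. c)"
  by (simp add: smooth_on_def cont_diff_const)

lemma grad_const: "grad (\<lambda>x. c) x = 0"
  by (intro grad_eqI GDERIV_const)

lemma grad_scale: "smooth_on UNIV f \<Longrightarrow> grad (\<lambda>x. c * f x) x = c *\<^sub>R grad f x"
  using grad_mult[of "\<lambda>_. c" f] by (simp add: smooth_on_const grad_const)

subsection \<open>A smooth bump\<close>

text \<open>The classical flat function with a polynomial in 1/t as prefactor. Carrying the
  polynomial along closes the family under differentiation, so that smoothness follows by one
  induction.\<close>

definition exp_inv :: "real poly \<Rightarrow> real \<Rightarrow> real" where
  "exp_inv p t = (if t > 0 then poly p (1 / t) * exp (- (1 / t)) else 0)"

text \<open>From the right, substitute s = 1/t and let the exponential beat every monomial; from the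
  left the function is zero.\<close>

lemma exp_inv_tendsto_0: "(exp_inv p \<longlongrightarrow> 0) (at 0)"
proof -
  have "((\<lambda>s. poly p s * exp (- s)) \<longlongrightarrow> 0) at_top"
  proof -
    have "((\<lambda>s. \<Sum>i\<le>degree p. coeff p i * (s ^ i / exp s)) \<longlongrightarrow> (\<Sum>i\<le>degree p. coeff p i * 0)) at_top"
      by (intro tendsto_intros tendsto_power_div_exp_0)
    then show ?thesis by (simp add: poly_altdef sum_distrib_right sum_divide_distrib exp_minus field_simps)
  qed
  moreover have "filterlim (\<lambda>t::real. 1 / t) at_top (at_right 0)"
    using filterlim_inverse_at_top_right by (simp add: inverse_eq_divide)
  ultimately have "((\<lambda>t. poly p (1 / t) * exp (- (1 / t))) \<longlongrightarrow> 0) (at_right 0)"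
    by (rule filterlim_compose)
  then have "(exp_inv p \<longlongrightarrow> 0) (at_right 0)"
    by (rule tendsto_cong[THEN iffD1, rotated])
      (auto simp: eventually_at_right_field exp_inv_def intro!: exI[of _ 1])
  moreover have "(exp_inv p \<longlongrightarrow> 0) (at_left 0)"
    by (rule tendsto_eventually) (auto simp: eventually_at_left_field exp_inv_def intro!: exI[of _ "-1"])
  ultimately show ?thesis by (rule filterlim_split_at[rotated])
qed

text \<open>With s = 1/t the chain rule contributes the factor s squared, which is the polynomial
  \<open>[:0,0,1:]\<close>; \<open>p\<close> comes from the exponential and \<open>pderiv p\<close>
  from the prefactor.\<close>

lemma exp_inv_DERIV: "(exp_inv p has_real_derivative exp_inv ([:0,0,1:] * (p - pderiv p)) t) (at t)"
proof -
  consider "t > 0" | "t < 0" | "t = 0" by linarith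
  then show ?thesis
  proof cases
    case 1
    have "((\<lambda>t. poly p (1 / t) * exp (- (1 / t))) has_real_derivative
        exp_inv ([:0,0,1:] * (p - pderiv p)) t) (at t)"
      using 1 by (auto intro!: derivative_eq_intros simp: exp_inv_def field_simps power2_eq_square)
    moreover have "\<forall>\<^sub>F s in nhds t. poly p (1 / s) * exp (- (1 / s)) = exp_inv p s"
      using 1 eventually_nhds_in_open[of "{0<..}" t] by (auto elim!: eventually_mono simp: exp_inv_def)
    ultimately show ?thesis by (subst (asm) DERIV_cong_ev[OF refl _ refl])
  next
    case 2
    have "((\<lambda>t. 0) has_real_derivative exp_inv ([:0,0,1:] * (p - pderiv p)) t) (at t)"
      using 2 by (auto simp: exp_inv_def)
    moreover have "\<forall>\<^sub>F s in nhds t. 0 = exp_inv p s"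
      using 2 eventually_nhds_in_open[of "{..<0}" t] by (auto elim!: eventually_mono simp: exp_inv_def)
    ultimately show ?thesis by (subst (asm) DERIV_cong_ev[OF refl _ refl])
  next
    case 3
    \<comment> \<open>At 0 the difference quotient is again a member of the family, its polynomial
      multiplied by s, so the limit at 0 is the derivative.\<close>
    have "(exp_inv p (0 + h) - exp_inv p 0) / h = exp_inv ([:0,1:] * p) h" for h
      by (auto simp: exp_inv_def)
    then show ?thesis
      unfolding 3 DERIV_def using exp_inv_tendsto_0[of "[:0,1:] * p"] by (simp add: exp_inv_def[of _ 0])
  qed
qed

text \<open>The gradient is a function of the same kind times a linear one; hence the induction on
  the order of differentiability keeps \<open>p\<close> arbitrary.\<close>

lemma exp_inv_ball_smooth: "smooth_on UNIV (\<lambda>x::'a::euclidean_space. exp_inv p (c - x \<bullet> x))"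
  unfolding smooth_on_def
proof
  have D: "GDERIV (\<lambda>x::'a. exp_inv p (c - x \<bullet> x)) x :> exp_inv ([:0,0,1:] * (p - pderiv p)) (c - x \<bullet> x) *\<^sub>R ((- 2) *\<^sub>R x)" for p x
    by (rule GDERIV_DERIV_compose[OF _ exp_inv_DERIV])
      (auto simp: gderiv_def intro!: derivative_eq_intros simp: inner_commute)
  show "cont_diff k UNIV (\<lambda>x::'a. exp_inv p (c - x \<bullet> x))" for k
  proof (induction k arbitrary: p)
    case 0
    show ?case unfolding cont_diff.simps
      by (intro continuous_at_imp_continuous_on ballI GDERIV_imp_isCont[OF D])
  next
    case (Suc k)
    have "cont_diff k UNIV (\<lambda>x. (exp_inv q (c - x \<bullet> x) *\<^sub>R ((- 2) *\<^sub>R x)) \<bullet> b)" for b :: 'a and q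
      unfolding inner_scaleR_left by (intro cont_diff_mult Suc cont_diff_const cont_diff_inner)
    then show ?case unfolding cont_diff.simps by (intro exI conjI ballI) (rule D)
  qed
qed

lemma integrable_compact_support:
  fixes f :: "'a::euclidean_space \<Rightarrow> 'b::{banach, second_countable_topology}"
  assumes "continuous_on UNIV f" "compact S" "\<And>x. x \<notin> S \<Longrightarrow> f x = 0"
  shows "integrable lborel f"
proof -
  have "integrable lborel (\<lambda>x. indicator S x *\<^sub>R f x)"
    using assms by (intro borel_integrable_compact continuous_on_subset[OF assms(1)]) auto
  moreover have "(\<lambda>x. indicator S x *\<^sub>R f x) = f" using assms(3) by (auto simp: indicator_def)
  ultimately show ?thesis by simp
qed

text \<open>The bump \<open>exp_inv 1 (\<delta>\<^sup>2 - x \<bullet> x)\<close> is positive exactly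
  on the open ball of radius \<delta>, which is not a null set; its integral is therefore positive
  and can be divided out.\<close>

lemma mollifier_exists:
  assumes "\<delta> > 0"
  shows "\<exists>\<rho> :: 'a::euclidean_space \<Rightarrow> real. smooth_on UNIV \<rho> \<and> (\<forall>x. 0 \<le> \<rho> x) \<and> (\<forall>x. norm x \<ge> \<delta> \<longrightarrow> \<rho> x = 0)
    \<and> integrable lborel \<rho> \<and> (LINT x|lborel. \<rho> x) = 1"
proof -
  define f where "f x = exp_inv 1 (\<delta>\<^sup>2 - x \<bullet> x)" for x :: 'a
  have s: "smooth_on UNIV f" unfolding f_def by (rule exp_inv_ball_smooth)
  have pos: "f x \<ge> 0" for x by (simp add: f_def exp_inv_def)
  have out: "f x = 0 \<longleftrightarrow> norm x \<ge> \<delta>" for x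
  proof -
    have "0 < \<delta>\<^sup>2 - x \<bullet> x \<longleftrightarrow> \<not> \<delta> \<le> norm x"
      using assms abs_le_square_iff[of \<delta> "norm x"] by (simp add: dot_square_norm not_le[symmetric])
    then show ?thesis by (simp add: f_def exp_inv_def)
  qed
  have i: "integrable lborel f"
    by (rule integrable_compact_support[OF smooth_continuous[OF s], of "cball 0 \<delta>"]) (use out in auto)
  define I where "I = (LINT x|lborel. f x)"
  have "I \<noteq> 0"
  proof
    assume "I = 0"
    then have "AE x in lborel. f x = 0"
      using integral_nonneg_eq_0_iff_AE[OF i] pos by (simp add: I_def)
    then have "emeasure lborel {x. f x \<noteq> 0} = 0"
      using s[THEN smooth_continuous, THEN borel_measurable_continuous_onI] by (subst (asm) AE_iff_measurable[OF _ refl]) auto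
    moreover have "{x. f x \<noteq> 0} = ball 0 \<delta>" unfolding set_eq_iff mem_Collect_eq mem_ball_0 out not_le by simp
    ultimately have "emeasure lborel (ball (0::'a) \<delta>) = 0" by simp
    then have "ball (0::'a) \<delta> \<in> null_sets lborel" by auto
    then have "negligible (ball (0::'a) \<delta>)"
      by (simp add: negligible_iff_null_sets null_sets_completionI)
    then show False using open_not_negligible[of "ball (0::'a) \<delta>"] assms by auto
  qed
  moreover have "I \<ge> 0" unfolding I_def by (intro integral_nonneg_AE) (simp add: pos)
  ultimately have "I > 0" by simp
  then show ?thesis
    using s pos out i
    by (intro exI[of _ "\<lambda>x. (1 / I) * f x"]) (auto simp: I_def intro: smooth_on_scale[of UNIV f "1/I", simplified])
qed

subsection \<open>Mollification\<close>

text \<open>The derivative is taken under the integral and falls on \<rho>. Integrating over a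
  compact box lets continuity of \<open>u\<close> supply all integrability.\<close>

lemma convolution_GDERIV:
  fixes u \<rho> :: "'a::euclidean_space \<Rightarrow> real"
  assumes u: "continuous_on UNIV u" and \<rho>: "smooth_on UNIV \<rho>"
  shows "GDERIV (\<lambda>x. integral (cbox A B) (\<lambda>y. u y * \<rho> (x - y))) x :> integral (cbox A B) (\<lambda>y. u y *\<^sub>R grad \<rho> (x - y))"
proof -
  have cr: "continuous_on S (\<lambda>z. \<rho> (h z))" "continuous_on S (\<lambda>z. grad \<rho> (h z))" "continuous_on S (\<lambda>z. u (h z))"
    if "continuous_on S h" for S h
    using that smooth_continuous[OF \<rho>] smooth_grad_continuous[OF \<rho>] u
    by (auto intro: continuous_on_compose2)
  have "((\<lambda>x. integral (cbox A B) (\<lambda>y. u y * \<rho> (x - y))) has_derivative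
      integral (cbox A B) (\<lambda>y. blinfun_inner_left (u y *\<^sub>R grad \<rho> (x - y)))) (at x within UNIV)"
  proof (rule leibniz_rule)
    fix x t assume "t \<in> cbox A B"
    have A: "((\<lambda>x. x - t) has_derivative (\<lambda>h. h)) (at x)" by (auto intro!: derivative_eq_intros)
    have "((\<lambda>x. \<rho> (x - t)) has_derivative (\<lambda>h. h \<bullet> grad \<rho> (x - t))) (at x)"
      using has_derivative_compose[OF A smooth_GDERIV[OF \<rho>, unfolded gderiv_def]] .
    then show "((\<lambda>x. u t * \<rho> (x - t)) has_derivative blinfun_apply (blinfun_inner_left (u t *\<^sub>R grad \<rho> (x - t)))) (at x within UNIV)"
      by (auto intro!: derivative_eq_intros)
  next
    show "continuous_on (UNIV \<times> cbox A B) (\<lambda>(x, t). blinfun_inner_left (u t *\<^sub>R grad \<rho> (x - t)))"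
      unfolding split_beta
      by (intro bounded_linear.continuous_on[OF bounded_linear_blinfun_inner_left] continuous_intros cr)
  qed (auto intro!: integrable_continuous continuous_intros cr)
  also have "integral (cbox A B) (\<lambda>y. blinfun_inner_left (u y *\<^sub>R grad \<rho> (x - y)))
     = blinfun_inner_left (integral (cbox A B) (\<lambda>y. u y *\<^sub>R grad \<rho> (x - y)))"
    by (rule integral_linear[OF _ bounded_linear_blinfun_inner_left, unfolded o_def])
      (auto intro!: integrable_continuous continuous_intros cr)
  finally show ?thesis by (simp add: gderiv_def)
qed

text \<open>The components of the gradient are convolutions of the same \<open>u\<close> with
  partial derivatives of \<rho>, which are smooth again.\<close>

lemma convolution_smooth:
  fixes u \<rho> :: "'a::euclidean_space \<Rightarrow> real"
  assumes u: "continuous_on UNIV u" and \<rho>: "smooth_on UNIV \<rho>"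
  shows "smooth_on UNIV (\<lambda>x. integral (cbox A B) (\<lambda>y. u y * \<rho> (x - y)))"
  unfolding smooth_on_def
proof
  show "cont_diff k UNIV (\<lambda>x. integral (cbox A B) (\<lambda>y. u y * \<rho> (x - y)))" for k
    using \<rho>
  proof (induction k arbitrary: \<rho>)
    case 0
    show ?case using GDERIV_imp_isCont[OF convolution_GDERIV[OF u 0]]
      by (auto simp: continuous_on_eq_continuous_at)
  next
    case (Suc k)
    have cg: "continuous_on (cbox A B) (\<lambda>y. u y *\<^sub>R grad \<rho> (x - y))" for x
      using continuous_on_subset[OF u]
      by (intro continuous_on_scaleR continuous_on_compose2[OF smooth_grad_continuous[OF Suc.prems]]) (auto intro!: continuous_intros)
    have "integral (cbox A B) (\<lambda>y. u y *\<^sub>R grad \<rho> (x - y)) \<bullet> b = integral (cbox A B) (\<lambda>y. u y * (grad \<rho> (x - y) \<bullet> b))" for x b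
      by (subst integral_linear[OF integrable_continuous[OF cg] bounded_linear_inner_left, unfolded o_def, symmetric]) simp
    then have "cont_diff k UNIV (\<lambda>x. integral (cbox A B) (\<lambda>y. u y *\<^sub>R grad \<rho> (x - y)) \<bullet> b)" if "b \<in> Basis" for b
      using Suc.IH[OF smooth_grad[OF Suc.prems that]] by simp
    then show ?case unfolding cont_diff.simps
      by (intro exI conjI ballI) (rule convolution_GDERIV[OF u Suc.prems])
  qed
qed

lemma lborel_integral_diff:
  fixes f :: "'a::euclidean_space \<Rightarrow> real"
  assumes [measurable]: "f \<in> borel_measurable borel"
  shows "(LINT y|lborel. f y) = (LINT z|lborel. f (x - z))"
proof -
  have "distr lborel borel (\<lambda>z. x + (-1) *\<^sub>R z) = (lborel :: 'a measure)"
    by (subst (2) lborel_affine[of "-1" x]) (auto simp: density_1)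
  then have "(LINT y|lborel. f y) = (LINT y|distr lborel borel (\<lambda>z. x + (-1) *\<^sub>R z). f y)" by simp
  also have "\<dots> = (LINT z|lborel. f (x - z))" by (subst integral_distr) auto
  finally show ?thesis .
qed

text \<open>Differentiating in the direction \<open>g\<close> itself gives the square of the norm of
  \<open>g\<close>, bounded by \<open>L * norm g\<close>.\<close>

lemma GDERIV_norm_le_Lipschitz:
  fixes f :: "'a::euclidean_space \<Rightarrow> real"
  assumes L: "\<And>y. \<bar>f y - f x\<bar> \<le> L * norm (y - x)" and g: "GDERIV f x :> g"
  shows "norm g \<le> L"
proof -
  have "DERIV (\<lambda>t. f (x + t *\<^sub>R g)) 0 :> (g \<bullet> g)"
    by (rule GDERIV_along_line) (simp add: g)
  then have lim: "((\<lambda>t. \<bar>(f (x + t *\<^sub>R g) - f x) / t\<bar>) \<longlongrightarrow> \<bar>g \<bullet> g\<bar>) (at 0)"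
    by (intro tendsto_rabs) (simp add: DERIV_def)
  have "eventually (\<lambda>t. \<bar>(f (x + t *\<^sub>R g) - f x) / t\<bar> \<le> L * norm g) (at (0::real))"
    using L[of "x + t *\<^sub>R g" for t] by (auto simp: eventually_at divide_simps intro!: exI[of _ 1] split: if_splits) (simp add: abs_mult mult.commute mult.left_commute)
  from tendsto_upperbound[OF lim this] have "(norm g)\<^sup>2 \<le> L * norm g"
    by (simp add: power2_norm_eq_inner)
  then have "norm g * norm g \<le> L * norm g" by (simp add: power2_eq_square)
  \<comment> \<open>For \<open>g = 0\<close> the bound reduces to the sign of \<open>L\<close>,
    which the hypothesis yields at any point of distance 1 from \<open>x\<close>.\<close>
  moreover have "L \<ge> 0" if "g = 0" 
  proof -
    obtain b :: 'a where "b \<in> Basis" using nonempty_Basis by blast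
    then show ?thesis using L[of "x + b"] by simp
  qed
  ultimately show ?thesis by (cases "g = 0") auto
qed

text \<open>
  The last property of the approximation is a consequence of the locality of mollification: where
  \<open>u\<close> is affine, so is its mollification, with the same slope.
\<close>

lemma Lipschitz_approx_test_function:
  fixes u :: "'a::euclidean_space \<Rightarrow> real"
  assumes L: "\<And>x y. \<bar>u x - u y\<bar> \<le> L * norm (x - y)"
    and K: "compact K" "K \<subseteq> D" "\<And>x. x \<notin> K \<Longrightarrow> u x = 0" and D: "open D" and e: "e > 0"
  shows "\<exists>\<phi>\<in>test_functions D. (\<forall>x. \<bar>\<phi> x - u x\<bar> \<le> L * e) \<and> (\<forall>x. norm (grad \<phi> x) \<le> L) \<and>
    (\<forall>x a. (\<forall>y\<in>ball x e. u y - u x = a \<bullet> (y - x)) \<longrightarrow> grad \<phi> x = a)"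
proof -
  obtain r where r: "r > 0" "(\<Union>x\<in>K. cball x r) \<subseteq> D"
    using compact_subset_open_imp_cball_epsilon_subset[OF K(1) D K(2)] by blast
  \<comment> \<open>The bound \<open>r\<close> keeps the support inside \<open>D\<close>. The bound
    \<open>e / 2\<close> is for locality: points within \<open>e / 2\<close> of \<open>x\<close>,
    shifted by less than \<delta>, remain in \<open>ball x e\<close>.\<close>
  define \<delta> where "\<delta> = min r (e / 2)"
  have \<delta>: "\<delta> > 0" "\<delta> \<le> r" "\<delta> \<le> e / 2" using r e by (auto simp: \<delta>_def)
  obtain \<rho> :: "'a \<Rightarrow> real" where \<rho>: "smooth_on UNIV \<rho>" "\<And>x. 0 \<le> \<rho> x" "\<And>x. norm x \<ge> \<delta> \<Longrightarrow> \<rho> x = 0"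
    "integrable lborel \<rho>" "(LINT x|lborel. \<rho> x) = 1"
    using mollifier_exists[OF \<delta>(1)] by blast
  have L0: "L \<ge> 0"
  proof -
    obtain b :: 'a where "b \<in> Basis" using nonempty_Basis by blast
    then show ?thesis using L[of b 0] by simp
  qed
  have "L-lipschitz_on UNIV u" by (rule lipschitz_onI) (use L L0 in \<open>auto simp: dist_norm\<close>)
  then have uc: "continuous_on UNIV u" by (rule lipschitz_on_continuous_on)
  have \<rho>c: "continuous_on UNIV \<rho>" by (rule smooth_continuous[OF \<rho>(1)])
  have [measurable]: "u \<in> borel_measurable borel" "\<rho> \<in> borel_measurable borel"
    using uc \<rho>c by (auto intro: borel_measurable_continuous_onI)
  have "bounded K" using K(1) by (rule compact_imp_bounded)
  \<comment> \<open>Since \<open>u\<close> vanishes off \<open>K\<close>, integration over a box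
    containing \<open>K\<close> equals integration over the whole space; the box form gives
    smoothness, the other one the estimates.\<close>
  from bounded_subset_cbox_symmetric[OF this] obtain B where AB: "K \<subseteq> cbox (- B) B" by auto
  define \<phi> where "\<phi> x = integral (cbox (- B) B) (\<lambda>y. u y * \<rho> (x - y))" for x
  have \<phi>s: "smooth_on UNIV \<phi>" unfolding \<phi>_def[abs_def] by (rule convolution_smooth[OF uc \<rho>(1)])
  have \<rho>x: "continuous_on UNIV (\<lambda>y. \<rho> (x - y))" and ux: "continuous_on UNIV (\<lambda>z. u (x - z))" for x
    by (rule continuous_on_compose2[OF \<rho>c] continuous_on_compose2[OF uc]; auto intro: continuous_intros)+
  have i1: "integrable lborel (\<lambda>y. u y * \<rho> (x - y))" for x
    by (rule integrable_compact_support[OF continuous_on_mult[OF uc \<rho>x] K(1)]) (simp add: K(3))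
  have i2: "integrable lborel (\<lambda>z. c z * \<rho> z)" if "continuous_on UNIV c" for c :: "'a \<Rightarrow> real"
    by (rule integrable_compact_support[OF continuous_on_mult[OF that \<rho>c], of "cball 0 \<delta>"]) (auto simp: \<rho>(3))
  have \<phi>: "\<phi> x = (LINT z|lborel. u (x - z) * \<rho> z)" for x
  proof -
    have "\<phi> x = integral UNIV (\<lambda>y. u y * \<rho> (x - y))"
      unfolding \<phi>_def by (rule integral_restrict_UNIV[symmetric, THEN trans], rule integral_cong) (use AB K(3) in auto)
    also have "\<dots> = (LINT y|lborel. u y * \<rho> (x - y))" by (rule integral_lborel[OF i1])
    also have "\<dots> = (LINT z|lborel. u (x - z) * \<rho> (x - (x - z)))" by (rule lborel_integral_diff) auto
    finally show ?thesis by simp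
  qed
  have \<phi>d: "\<phi> x - c = (LINT z|lborel. (u (x - z) - c) * \<rho> z)" for x c
    using i2[OF ux] \<rho> by (simp add: \<phi> left_diff_distrib)
  \<comment> \<open>An average against \<rho> inherits a bound that holds only on the ball of radius
    \<delta>, because \<rho> is nonnegative, has integral 1 and lives on that ball.\<close>
  have bound: "\<bar>LINT z|lborel. c z * \<rho> z\<bar> \<le> C" if "continuous_on UNIV c" "\<And>z. norm z < \<delta> \<Longrightarrow> \<bar>c z\<bar> \<le> C" for c :: "'a \<Rightarrow> real" and C
  proof -
    have "\<bar>LINT z|lborel. c z * \<rho> z\<bar> \<le> (LINT z|lborel. norm (c z * \<rho> z))"
      using integral_norm_bound[of lborel "\<lambda>z. c z * \<rho> z"] by simp
    also have "\<dots> \<le> (LINT z|lborel. C * \<rho> z)"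
    proof (rule integral_mono)
      show "integrable lborel (\<lambda>z. norm (c z * \<rho> z))" using i2[OF that(1)] by (rule integrable_norm)
      show "norm (c z * \<rho> z) \<le> C * \<rho> z" for z
        using that(2)[of z] \<rho>(2)[of z] \<rho>(3)[of z] by (cases "norm z < \<delta>") (auto simp: abs_mult mult_right_mono)
    qed (use \<rho> in auto)
    finally show ?thesis using \<rho> by simp
  qed
  have b1: "\<bar>\<phi> x - u x\<bar> \<le> L * e" for x
    unfolding \<phi>d
  proof (rule bound)
    fix z :: 'a assume "norm z < \<delta>"
    then have "L * norm z \<le> L * e" using L0 \<delta> e by (intro mult_left_mono) auto
    then show "\<bar>u (x - z) - u x\<bar> \<le> L * e" using L[of "x - z" x] by simp
  qed (intro continuous_intros ux)
  have b2: "\<bar>\<phi> y - \<phi> x\<bar> \<le> L * norm (y - x)" for x y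
  proof -
    have "\<phi> y - \<phi> x = (LINT z|lborel. (u (y - z) - u (x - z)) * \<rho> z)"
      using i2[OF ux] by (simp add: \<phi> left_diff_distrib)
    moreover have "\<bar>u (y - z) - u (x - z)\<bar> \<le> L * norm (y - x)" for z using L[of "y - z" "x - z"] by simp
    ultimately show ?thesis using bound[OF continuous_on_diff[OF ux ux], of y x "L * norm (y - x)"] by simp
  qed
  have g1: "norm (grad \<phi> x) \<le> L" for x
    by (rule GDERIV_norm_le_Lipschitz[of \<phi> x L, OF b2 smooth_GDERIV[OF \<phi>s]])
  have g2: "grad \<phi> x = a" if a: "\<forall>y\<in>ball x e. u y - u x = a \<bullet> (y - x)" for x a
  proof -
    have loc: "\<phi> x + a \<bullet> (y - x) = \<phi> y" if y: "y \<in> ball x (e / 2)" for y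
    proof -
      have "\<phi> y - \<phi> x = (LINT z|lborel. (u (y - z) - u (x - z)) * \<rho> z)"
        using i2[OF ux] by (simp add: \<phi> left_diff_distrib)
      also have "\<dots> = (LINT z|lborel. a \<bullet> (y - x) * \<rho> z)"
      proof (intro Bochner_Integration.integral_cong refl)
        fix z
        show "(u (y - z) - u (x - z)) * \<rho> z = a \<bullet> (y - x) * \<rho> z"
        proof (cases "norm z < \<delta>")
          case True
          have "norm (x - (y - z)) \<le> norm (x - y) + norm z" using norm_triangle_ineq[of "x - y" z] by (simp add: algebra_simps)
          with True y \<delta> have "y - z \<in> ball x e" "x - z \<in> ball x e" by (auto simp: dist_norm)
          from bspec[OF a this(1)] bspec[OF a this(2)]
          have "u (y - z) - u (x - z) = a \<bullet> (y - x)" by (simp add: inner_diff_right algebra_simps)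
          then show ?thesis by simp
        qed (simp add: \<rho>(3))
      qed
      finally show ?thesis using \<rho> by simp
    qed
    have "((\<lambda>y. \<phi> x + a \<bullet> (y - x)) has_derivative (\<lambda>h. h \<bullet> a)) (at x)"
      by (auto intro!: derivative_eq_intros simp: inner_commute)
    then have "(\<phi> has_derivative (\<lambda>h. h \<bullet> a)) (at x)"
      by (rule has_derivative_transform_within_open[OF _ open_ball[of x "e / 2"]]) (use e loc in auto)
    then show ?thesis by (intro grad_eqI) (simp add: gderiv_def)
  qed
  have sub: "{x. \<phi> x \<noteq> 0} \<subseteq> {x + y |x y. x \<in> K \<and> y \<in> cball 0 \<delta>}"
  proof
    fix x assume "x \<in> {x. \<phi> x \<noteq> 0}"
    then have n: "\<phi> x \<noteq> 0" by simp
    have "\<exists>z. u (x - z) * \<rho> z \<noteq> 0"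
    proof (rule ccontr)
      assume "\<nexists>z. u (x - z) * \<rho> z \<noteq> 0"
      then have "\<phi> x = (LINT z|(lborel :: 'a measure). 0)"
        unfolding \<phi> by (intro Bochner_Integration.integral_cong) auto
      with n show False by simp
    qed
    then obtain z where "u (x - z) \<noteq> 0" "\<rho> z \<noteq> 0" by auto
    then have "x - z \<in> K" "norm z < \<delta>" using K(3) \<rho>(3) by (meson not_le)+
    then show "x \<in> {x + y |x y. x \<in> K \<and> y \<in> cball 0 \<delta>}"
      by (intro CollectI exI[of _ "x - z"] exI[of _ z]) auto
  qed
  have cK: "compact {x + y |x y. x \<in> K \<and> y \<in> cball 0 \<delta>}" by (rule compact_sums[OF K(1) compact_cball])
  have sD: "{x + y |x y. x \<in> K \<and> y \<in> cball 0 \<delta>} \<subseteq> D" 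
  proof clarify
    fix z y :: 'a assume "z \<in> K" "y \<in> cball 0 \<delta>"
    then have "z + y \<in> cball z r" using \<delta> by (auto simp: dist_norm)
    then show "z + y \<in> D" using r(2) \<open>z \<in> K\<close> by blast
  qed
  have cl: "closure {x. \<phi> x \<noteq> 0} \<subseteq> {x + y |x y. x \<in> K \<and> y \<in> cball 0 \<delta>}"
    using sub cK by (intro closure_minimal compact_imp_closed)
  have "compact (closure {x. \<phi> x \<noteq> 0})"
    using bounded_subset[OF compact_imp_bounded[OF cK] cl] by (simp add: compact_eq_bounded_closed)
  then have "\<phi> \<in> test_functions D"
    unfolding test_functions_def using \<phi>s subset_trans[OF cl sD] by simp
  then show ?thesis by (intro bexI[of _ \<phi>] conjI allI impI b1 g1 g2)
qed

subsection \<open>$L^2$ as a space with a semi-inner product\<close>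

text \<open>Positive semidefinite only, since functions equal almost everywhere are not identified.
  Instances are the L2 product, the Dirichlet form, the covariance form of \<open>Q\<close>, and the
  Dirichlet form minus its Rayleigh bound; values in a vector space admit gradients as
  elements.\<close>

locale semi_inner =
  fixes V :: "('x \<Rightarrow> 'y::real_vector) set" and B :: "('x \<Rightarrow> 'y) \<Rightarrow> ('x \<Rightarrow> 'y) \<Rightarrow> real"
  assumes lin: "f \<in> V \<Longrightarrow> g \<in> V \<Longrightarrow> (\<lambda>x. a *\<^sub>R f x + b *\<^sub>R g x) \<in> V"
    and sym: "f \<in> V \<Longrightarrow> g \<in> V \<Longrightarrow> B f g = B g f"
    and lin_left: "f \<in> V \<Longrightarrow> g \<in> V \<Longrightarrow> h \<in> V \<Longrightarrow> B (\<lambda>x. a *\<^sub>R f x + b *\<^sub>R g x) h = a * B f h + b * B g h"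
    and nonneg: "f \<in> V \<Longrightarrow> 0 \<le> B f f"
begin

lemma add: "f \<in> V \<Longrightarrow> g \<in> V \<Longrightarrow> (\<lambda>x. f x + g x) \<in> V"
  and diff: "f \<in> V \<Longrightarrow> g \<in> V \<Longrightarrow> (\<lambda>x. f x - g x) \<in> V"
  and scale: "f \<in> V \<Longrightarrow> (\<lambda>x. a *\<^sub>R f x) \<in> V"
  and zero: "f \<in> V \<Longrightarrow> (\<lambda>x. 0) \<in> V"
  using lin[of f g 1 1] lin[of f g 1 "-1"] lin[of f f a 0] lin[of f f 0 0] by simp_all

lemma add_left: "f \<in> V \<Longrightarrow> g \<in> V \<Longrightarrow> h \<in> V \<Longrightarrow> B (\<lambda>x. f x + g x) h = B f h + B g h"
  and diff_left: "f \<in> V \<Longrightarrow> g \<in> V \<Longrightarrow> h \<in> V \<Longrightarrow> B (\<lambda>x. f x - g x) h = B f h - B g h"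
  and scale_left: "f \<in> V \<Longrightarrow> h \<in> V \<Longrightarrow> B (\<lambda>x. a *\<^sub>R f x) h = a * B f h"
  and zero_left: "h \<in> V \<Longrightarrow> B (\<lambda>x. 0) h = 0"
  using lin_left[of f g h 1 1] lin_left[of f g h 1 "-1"] lin_left[of f f h a 0] lin_left[of h h h 0 0] by simp_all

lemma lin_right: "f \<in> V \<Longrightarrow> g \<in> V \<Longrightarrow> h \<in> V \<Longrightarrow> B h (\<lambda>x. a *\<^sub>R f x + b *\<^sub>R g x) = a * B h f + b * B h g"
  using lin_left[of f g h a b] lin[of f g a b] sym by simp

lemma add_right: "f \<in> V \<Longrightarrow> g \<in> V \<Longrightarrow> h \<in> V \<Longrightarrow> B h (\<lambda>x. f x + g x) = B h f + B h g"
  and diff_right: "f \<in> V \<Longrightarrow> g \<in> V \<Longrightarrow> h \<in> V \<Longrightarrow> B h (\<lambda>x. f x - g x) = B h f - B h g"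
  and scale_right: "f \<in> V \<Longrightarrow> h \<in> V \<Longrightarrow> B h (\<lambda>x. a *\<^sub>R f x) = a * B h f"
  and zero_right: "h \<in> V \<Longrightarrow> B h (\<lambda>x. 0) = 0"
  using lin_right[of f g h 1 1] lin_right[of f g h 1 "-1"] lin_right[of f f h a 0] lin_right[of h h h 0 0] by simp_all

text \<open>\<open>f0\<close> witnesses that \<open>V\<close> has a member, so that the empty sum,
  the zero function, lies in it.\<close>

lemma sum_mem: "f0 \<in> V \<Longrightarrow> (\<And>i. i \<in> I \<Longrightarrow> f i \<in> V) \<Longrightarrow> (\<lambda>x. \<Sum>i\<in>I. c i *\<^sub>R f i x) \<in> V"
proof (induction I rule: infinite_finite_induct)
  case (insert i I)
  then show ?case using lin[of "f i" "\<lambda>x. \<Sum>i\<in>I. c i *\<^sub>R f i x" "c i" 1] by simp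
qed (simp_all add: zero)

lemma sum_left:
  "h \<in> V \<Longrightarrow> (\<And>i. i \<in> I \<Longrightarrow> f i \<in> V) \<Longrightarrow> B (\<lambda>x. \<Sum>i\<in>I. c i *\<^sub>R f i x) h = (\<Sum>i\<in>I. c i * B (f i) h)"
proof (induction I rule: infinite_finite_induct)
  case (insert i I)
  then have "B (\<lambda>x. c i *\<^sub>R f i x + 1 *\<^sub>R (\<Sum>i\<in>I. c i *\<^sub>R f i x)) h
     = c i * B (f i) h + 1 * B (\<lambda>x. \<Sum>i\<in>I. c i *\<^sub>R f i x) h"
    by (intro lin_left sum_mem) auto
  with insert show ?case by simp
qed (simp_all add: zero_left)

lemma sum_right:
  assumes "h \<in> V" "\<And>i. i \<in> I \<Longrightarrow> f i \<in> V"
  shows "B h (\<lambda>x. \<Sum>i\<in>I. c i *\<^sub>R f i x) = (\<Sum>i\<in>I. c i * B h (f i))"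
proof -
  have "B h (\<lambda>x. \<Sum>i\<in>I. c i *\<^sub>R f i x) = B (\<lambda>x. \<Sum>i\<in>I. c i *\<^sub>R f i x) h"
    using assms by (intro sym sum_mem) auto
  also have "\<dots> = (\<Sum>i\<in>I. c i * B (f i) h)" using assms by (intro sum_left) auto
  also have "\<dots> = (\<Sum>i\<in>I. c i * B h (f i))" by (intro sum.cong) (auto simp: sym assms)
  finally show ?thesis .
qed

lemma expand: "f \<in> V \<Longrightarrow> g \<in> V \<Longrightarrow>
    B (\<lambda>x. a *\<^sub>R f x + b *\<^sub>R g x) (\<lambda>x. a *\<^sub>R f x + b *\<^sub>R g x) = a\<^sup>2 * B f f + 2 * a * b * B f g + b\<^sup>2 * B g g"
  using lin[of f g a b] by (simp add: lin_left lin_right sym[of g f] power2_eq_square algebra_simps)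

lemma Cauchy_Schwarz:
  assumes f: "f \<in> V" and g: "g \<in> V"
  shows "(B f g)\<^sup>2 \<le> B f f * B g g"
proof -
  have q: "0 \<le> a\<^sup>2 * B f f + 2 * a * b * B f g + b\<^sup>2 * B g g" for a b
    using nonneg[OF lin[OF f g, of a b]] by (simp add: expand f g)
  show ?thesis
  proof (cases "B g g = 0")
    case True
    have "B f g = 0"
    proof (rule ccontr)
      assume n: "B f g \<noteq> 0"
      \<comment> \<open>With \<open>B g g = 0\<close> the quadratic form is affine in
        \<open>b\<close>; this \<open>b\<close> makes its value -1.\<close>
      with q[of 1 "- (B f f + 1) / (2 * B f g)"] True show False by (simp add: field_simps)
    qed
    with True show ?thesis by simp
  next
    case False
    then have p: "B g g > 0" using nonneg[OF g] by simp
    \<comment> \<open>These coefficients are, up to scaling, those minimising the form over the line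
      through \<open>f\<close> in direction \<open>g\<close>.\<close>
    have "0 \<le> B g g * (B g g * B f f - (B f g)\<^sup>2)"
      using q[of "B g g" "- B f g"] by (simp add: power2_eq_square algebra_simps)
    with p show ?thesis by (simp add: zero_le_mult_iff mult.commute)
  qed
qed

lemma Cauchy_Schwarz_abs: "f \<in> V \<Longrightarrow> g \<in> V \<Longrightarrow> \<bar>B f g\<bar> \<le> sqrt (B f f) * sqrt (B g g)"
  using real_sqrt_le_mono[OF Cauchy_Schwarz[of f g]] by (simp add: real_sqrt_mult)

lemma triangle:
  assumes "f \<in> V" "g \<in> V"
  shows "sqrt (B (\<lambda>x. f x + g x) (\<lambda>x. f x + g x)) \<le> sqrt (B f f) + sqrt (B g g)"
proof (rule real_le_lsqrt)
  show "B (\<lambda>x. f x + g x) (\<lambda>x. f x + g x) \<le> (sqrt (B f f) + sqrt (B g g))\<^sup>2"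
    using Cauchy_Schwarz_abs[OF assms] expand[OF assms, of 1 1] assms
    by (simp add: power2_sum nonneg)
qed (simp add: nonneg assms)

lemma triangle_diff:
  assumes "f \<in> V" "g \<in> V" "h \<in> V"
  shows "sqrt (B (\<lambda>x. f x - g x) (\<lambda>x. f x - g x))
     \<le> sqrt (B (\<lambda>x. f x - h x) (\<lambda>x. f x - h x)) + sqrt (B (\<lambda>x. h x - g x) (\<lambda>x. h x - g x))"
  using triangle[OF diff[OF assms(1,3)] diff[OF assms(3,2)]] by simp

lemma norm_minus: "f \<in> V \<Longrightarrow> g \<in> V \<Longrightarrow> B (\<lambda>x. f x - g x) (\<lambda>x. f x - g x) = B (\<lambda>x. g x - f x) (\<lambda>x. g x - f x)"
  using expand[of f g 1 "-1"] expand[of f g "-1" 1] by (simp add: algebra_simps)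

text \<open>Solved for the difference, the form in which it shows a minimising sequence to be
  Cauchy.\<close>

lemma parallelogram:
  "f \<in> V \<Longrightarrow> g \<in> V \<Longrightarrow> B (\<lambda>x. f x - g x) (\<lambda>x. f x - g x)
     = 2 * B f f + 2 * B g g - B (\<lambda>x. f x + g x) (\<lambda>x. f x + g x)"
  using expand[of f g 1 "-1"] expand[of f g 1 1] by simp

lemma norm_triangle_abs:
  assumes "f \<in> V" "g \<in> V"
  shows "\<bar>sqrt (B f f) - sqrt (B g g)\<bar> \<le> sqrt (B (\<lambda>x. f x - g x) (\<lambda>x. f x - g x))"
  using triangle[OF diff[OF assms] assms(2)] triangle[OF diff[OF assms(2,1)] assms(1)] norm_minus[OF assms]
  by simp

lemma tendsto_inner:
  assumes f: "\<And>n. f n \<in> V" "f' \<in> V" "(\<lambda>n. sqrt (B (\<lambda>x. f n x - f' x) (\<lambda>x. f n x - f' x))) \<longlonglongrightarrow> 0"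
    and g: "g \<in> V"
  shows "(\<lambda>n. B (f n) g) \<longlonglongrightarrow> B f' g"
proof (rule LIM_zero_cancel, rule Lim_null_comparison)
  show "(\<lambda>n. sqrt (B (\<lambda>x. f n x - f' x) (\<lambda>x. f n x - f' x)) * sqrt (B g g)) \<longlonglongrightarrow> 0"
    using tendsto_mult_right[OF f(3), of "sqrt (B g g)"] by simp
  show "\<forall>\<^sub>F n in sequentially. norm (B (f n) g - B f' g)
      \<le> sqrt (B (\<lambda>x. f n x - f' x) (\<lambda>x. f n x - f' x)) * sqrt (B g g)"
    using Cauchy_Schwarz_abs[OF diff[OF f(1,2)] g] f g by (simp add: diff_left)
qed

lemma tendsto_norm:
  assumes f: "\<And>n. f n \<in> V" "f' \<in> V" "(\<lambda>n. sqrt (B (\<lambda>x. f n x - f' x) (\<lambda>x. f n x - f' x))) \<longlonglongrightarrow> 0"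
  shows "(\<lambda>n. sqrt (B (f n) (f n))) \<longlonglongrightarrow> sqrt (B f' f')"
  by (rule LIM_zero_cancel, rule Lim_null_comparison[OF _ f(3)])
    (simp add: norm_triangle_abs f)

end

section \<open>Square integrable functions on a domain\<close>

lemma l2_inner_integrable:
  fixes f g :: "'a::euclidean_space \<Rightarrow> 'b::euclidean_space"
  assumes "f \<in> l2_space D" "g \<in> l2_space D"
  shows "integrable (lebesgue_on D) (\<lambda>x. f x \<bullet> g x)"
proof (rule Bochner_Integration.integrable_bound)
  show "integrable (lebesgue_on D) (\<lambda>x. (norm (f x))\<^sup>2 + (norm (g x))\<^sup>2)"
    using assms by (auto simp: l2_space_def)
  show "(\<lambda>x. f x \<bullet> g x) \<in> borel_measurable (lebesgue_on D)"
    using assms by (auto simp: l2_space_def)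
  have "\<bar>a \<bullet> b\<bar> \<le> (norm a)\<^sup>2 + (norm b)\<^sup>2" for a b :: 'b
  proof -
    have "\<bar>a \<bullet> b\<bar> \<le> norm a * norm b" by (rule Cauchy_Schwarz_ineq2)
    moreover have "0 \<le> (norm a - norm b)\<^sup>2" "0 \<le> (norm a)\<^sup>2" "0 \<le> (norm b)\<^sup>2" by simp_all
    ultimately show ?thesis unfolding power2_diff by linarith
  qed
  then show "AE x in lebesgue_on D. norm (f x \<bullet> g x) \<le> norm ((norm (f x))\<^sup>2 + (norm (g x))\<^sup>2)"
    by auto
qed

interpretation l2: semi_inner "l2_space D :: ('a::euclidean_space \<Rightarrow> 'b::euclidean_space) set" "l2_inner D" for D
proof
  fix f g :: "'a \<Rightarrow> 'b" and a b assume fg: "f \<in> l2_space D" "g \<in> l2_space D"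
  note i = l2_inner_integrable[OF fg] l2_inner_integrable[OF fg(1) fg(1)] l2_inner_integrable[OF fg(2) fg(2)]
  have [measurable]: "f \<in> borel_measurable (lebesgue_on D)" "g \<in> borel_measurable (lebesgue_on D)"
    using fg by (auto simp: l2_space_def)
  have "(norm (a *\<^sub>R f x + b *\<^sub>R g x))\<^sup>2 = a\<^sup>2 * (f x \<bullet> f x) + 2 * a * b * (f x \<bullet> g x) + b\<^sup>2 * (g x \<bullet> g x)" for x
    unfolding power2_norm_eq_inner by (simp add: inner_add_left inner_add_right inner_commute power2_eq_square algebra_simps)
  with i show "(\<lambda>x. a *\<^sub>R f x + b *\<^sub>R g x) \<in> l2_space D" by (auto simp: l2_space_def)
  show "l2_inner D f g = l2_inner D g f" by (simp add: l2_inner_def inner_commute)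
  show "0 \<le> l2_inner D f f" unfolding l2_inner_def by (intro integral_nonneg_AE) auto
  fix h :: "'a \<Rightarrow> 'b" assume h: "h \<in> l2_space D"
  show "l2_inner D (\<lambda>x. a *\<^sub>R f x + b *\<^sub>R g x) h = a * l2_inner D f h + b * l2_inner D g h"
    using l2_inner_integrable[OF fg(1) h] l2_inner_integrable[OF fg(2) h]
    by (simp add: l2_inner_def inner_add_left)
qed

lemma l2_spaceD: "f \<in> l2_space D \<Longrightarrow> f \<in> borel_measurable (lebesgue_on D)"
  by (simp add: l2_space_def)

lemma l2_inner_cong_AE:
  assumes "f \<in> l2_space D" "f' \<in> l2_space D" "g \<in> l2_space D" "g' \<in> l2_space D" "l2_eq D f f'" "l2_eq D g g'"
  shows "l2_inner D f g = l2_inner D f' g'"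
  unfolding l2_inner_def
proof (rule integral_cong_AE)
  show "AE x in lebesgue_on D. f x \<bullet> g x = f' x \<bullet> g' x"
    using assms(5,6) unfolding l2_eq_def by eventually_elim simp
qed (use assms in \<open>auto dest!: l2_spaceD\<close>)

lemma l2_inner_eq_0_iff:
  assumes "f \<in> l2_space D"
  shows "l2_inner D f f = 0 \<longleftrightarrow> l2_eq D f (\<lambda>_. 0)"
  unfolding l2_inner_def l2_eq_def
  using integral_nonneg_eq_0_iff_AE[OF l2_inner_integrable[OF assms assms]] by simp

lemma l2_norm_le_of_bound:
  assumes D: "D \<in> lmeasurable" and f: "f \<in> borel_measurable (lebesgue_on D)" and b: "\<And>x. x \<in> D \<Longrightarrow> norm (f x) \<le> C"
  shows "f \<in> l2_space D" "l2_inner D f f \<le> C\<^sup>2 * measure lebesgue D"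
proof -
  have D': "D \<in> sets lebesgue" using D by auto
  have fin: "finite_measure (lebesgue_on D)" using D
    by (intro finite_measureI) (auto simp: emeasure_restrict_space fmeasurable_def)
  have b2: "(norm (f x))\<^sup>2 \<le> C\<^sup>2" if "x \<in> D" for x using b[OF that] by (intro power_mono) auto
  have [measurable]: "f \<in> borel_measurable (lebesgue_on D)" by fact
  have "integrable (lebesgue_on D) (\<lambda>x. (norm (f x))\<^sup>2)"
    by (rule finite_measure.integrable_const_bound[OF fin, of _ "C\<^sup>2"]) (use b2 in \<open>auto intro!: AE_I2\<close>)
  then show f2: "f \<in> l2_space D" using f by (simp add: l2_space_def)
  have "l2_inner D f f \<le> (LINT x|lebesgue_on D. C\<^sup>2)"
    unfolding l2_inner_def using l2_inner_integrable[OF f2 f2] b2 fin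
    by (intro integral_mono) (auto simp: power2_norm_eq_inner finite_measure.integrable_const)
  then show "l2_inner D f f \<le> C\<^sup>2 * measure lebesgue D"
    using D' by (simp add: measure_restrict_space mult.commute)
qed

text \<open>Riesz-Fischer: along a subsequence the increments have summable L1 norms, hence the
  subsequence converges almost everywhere; Fatou turns the pointwise limit into an L2 limit, and the
  Cauchy property extends this to the whole sequence.\<close>

lemma l2_complete:
  fixes f :: "nat \<Rightarrow> 'a::euclidean_space \<Rightarrow> 'b::euclidean_space"
  assumes D: "D \<in> lmeasurable" and f: "\<And>n. f n \<in> l2_space D"
    and C: "\<And>e. e > 0 \<Longrightarrow> \<exists>N. \<forall>m\<ge>N. \<forall>n\<ge>N. l2_norm D (\<lambda>x. f m x - f n x) < e"
  shows "\<exists>g\<in>l2_space D. (\<lambda>n. l2_norm D (\<lambda>x. f n x - g x)) \<longlonglongrightarrow> 0"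
proof -
  let ?M = "lebesgue_on D"
  have fm[measurable]: "f n \<in> borel_measurable ?M" for n using f by (rule l2_spaceD)
  have "\<forall>k. \<exists>N. \<forall>m\<ge>N. \<forall>n\<ge>N. l2_norm D (\<lambda>x. f m x - f n x) < (1/2)^k" by (intro allI C) simp
  then obtain N where N: "\<And>k m n. m \<ge> N k \<Longrightarrow> n \<ge> N k \<Longrightarrow> l2_norm D (\<lambda>x. f m x - f n x) < (1/2)^k"
    by metis
  \<comment> \<open>The running maximum of the thresholds \<open>N\<close> makes the chosen indices
    monotone, so that later ones remain beyond every earlier threshold.\<close>
  define r where "r = rec_nat (N 0) (\<lambda>k rk. max (N (Suc k)) rk)"
  have rS: "r (Suc k) = max (N (Suc k)) (r k)" for k by (simp add: r_def)
  have rN: "r k \<ge> N k" for k by (cases k) (auto simp: rS, simp add: r_def)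
  have rm: "mono r" by (rule monoI, rule lift_Suc_mono_le[of r]) (auto simp: rS)
  define d where "d k x = f (r (Suc k)) x - f (r k) x" for k x
  have dl: "d k \<in> l2_space D" for k unfolding d_def[abs_def] by (intro l2.diff f)
  have [measurable]: "d k \<in> borel_measurable ?M" for k using dl by (rule l2_spaceD)
  have rjk: "l2_norm D (\<lambda>x. f (r j) x - f (r k) x) < (1/2)^k" if "k \<le> j" for j k
    using N[of k "r j" "r k"] rN[of k] monoD[OF rm that] by simp
  define K where "K = sqrt (measure lebesgue D)"
  \<comment> \<open>The L1 norm is controlled by Cauchy-Schwarz against the constant 1; this is
    where \<open>D\<close> must have finite measure.\<close>
  have L1: "(\<integral>\<^sup>+x. ennreal (norm (d k x)) \<partial>?M) \<le> ennreal (K * (1/2)^k)" for k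
  proof -
    have nl: "(\<lambda>x. norm (d k x)) \<in> l2_space D" and "(\<lambda>x. 1::real) \<in> l2_space D"
      using dl[of k] D l2_norm_le_of_bound(1)[OF D, of "\<lambda>_. 1::real" 1] by (auto simp: l2_space_def)
    note cs = l2.Cauchy_Schwarz_abs[OF this]
    have i: "integrable ?M (\<lambda>x. norm (d k x))"
      using l2_inner_integrable[OF nl \<open>(\<lambda>x. 1::real) \<in> l2_space D\<close>] by simp
    have "l2_inner D (\<lambda>x. norm (d k x)) (\<lambda>x. norm (d k x)) = l2_inner D (d k) (d k)"
      by (simp add: l2_inner_def power2_norm_eq_inner[symmetric] power2_eq_square)
    moreover have "sqrt (l2_inner D (\<lambda>x. 1::real) (\<lambda>x. 1)) \<le> K"
      using l2_norm_le_of_bound(2)[OF D, of "\<lambda>_. 1::real" 1] by (simp add: K_def)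
    moreover have "sqrt (l2_inner D (d k) (d k)) \<le> (1/2)^k"
      using rjk[of k "Suc k"] by (simp add: l2_norm_def d_def[abs_def])
    moreover have "0 \<le> sqrt (l2_inner D (\<lambda>x. 1::real) (\<lambda>x. 1))"
      using l2.nonneg \<open>(\<lambda>x. 1::real) \<in> l2_space D\<close> by simp
    ultimately have "(LINT x|?M. norm (d k x)) \<le> (1/2)^k * K"
      using cs mult_mono[of "sqrt (l2_inner D (d k) (d k))" "(1/2)^k" "sqrt (l2_inner D (\<lambda>x. 1::real) (\<lambda>x. 1))" K]
      by (simp add: l2_inner_def[of D "\<lambda>x. norm (d k x)" "\<lambda>x. 1"])
    then show ?thesis using nn_integral_eq_integral[OF i] by (simp add: mult.commute ennreal_leI)
  qed
  have "(\<integral>\<^sup>+x. (\<Sum>k. ennreal (norm (d k x))) \<partial>?M) = (\<Sum>k. (\<integral>\<^sup>+x. ennreal (norm (d k x)) \<partial>?M))"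
    by (rule nn_integral_suminf) measurable
  also have "\<dots> \<le> (\<Sum>k. ennreal (K * (1/2)^k))" by (intro suminf_le L1) auto
  also have "\<dots> = ennreal (\<Sum>k. K * (1/2)^k)"
    by (intro suminf_ennreal2 summable_mult summable_geometric) (auto simp: K_def)
  finally have "(\<integral>\<^sup>+x. (\<Sum>k. ennreal (norm (d k x))) \<partial>?M) \<noteq> \<infinity>" by (auto simp: top_unique)
  then have "AE x in ?M. (\<Sum>k. ennreal (norm (d k x))) \<noteq> \<infinity>" by (intro nn_integral_PInf_AE) auto
  then have conv: "AE x in ?M. convergent (\<lambda>k. f (r k) x)"
  proof eventually_elim
    case (elim x)
    then have "summable (\<lambda>k. norm (d k x))" by (intro summable_suminf_not_top) auto
    then have "convergent (\<lambda>k. \<Sum>i<k. d i x)"       by (simp add: summable_iff_convergent[symmetric] summable_norm_cancel)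
    then have "convergent (\<lambda>k. f (r 0) x + (\<Sum>i<k. d i x))" by (intro convergent_add convergent_const)
    moreover have "f (r 0) x + (\<Sum>i<k. d i x) = f (r k) x" for k
      unfolding d_def using sum_lessThan_telescope[of "\<lambda>i. f (r i) x" k] by simp
    ultimately show ?case by simp
  qed
  define g where "g x = lim (\<lambda>k. f (r k) x)" for x
  have gm[measurable]: "g \<in> borel_measurable ?M" unfolding g_def[abs_def] by measurable
  have lim: "AE x in ?M. (\<lambda>j. f (r j) x) \<longlonglongrightarrow> g x"
    using conv by eventually_elim (simp add: g_def convergent_LIMSEQ_iff)
  have F: "(\<integral>\<^sup>+x. ennreal ((norm (g x - f (r k) x))\<^sup>2) \<partial>?M) \<le> ennreal (((1/2)^k)\<^sup>2)" for k
  proof -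
    have "(\<integral>\<^sup>+x. ennreal ((norm (g x - f (r k) x))\<^sup>2) \<partial>?M)
       = (\<integral>\<^sup>+x. liminf (\<lambda>j. ennreal ((norm (f (r j) x - f (r k) x))\<^sup>2)) \<partial>?M)"
    proof (rule nn_integral_cong_AE)
      show "AE x in ?M. ennreal ((norm (g x - f (r k) x))\<^sup>2) = liminf (\<lambda>j. ennreal ((norm (f (r j) x - f (r k) x))\<^sup>2))"
        using lim
      proof eventually_elim
        case (elim x)
        then have "(\<lambda>j. ennreal ((norm (f (r j) x - f (r k) x))\<^sup>2)) \<longlonglongrightarrow> ennreal ((norm (g x - f (r k) x))\<^sup>2)"
          by (intro tendsto_intros)
        then show ?case by (intro lim_imp_Liminf[symmetric]) auto
      qed
    qed
    also have "\<dots> \<le> liminf (\<lambda>j. (\<integral>\<^sup>+x. ennreal ((norm (f (r j) x - f (r k) x))\<^sup>2) \<partial>?M))"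
      by (rule nn_integral_liminf) measurable
    also have "\<dots> \<le> liminf (\<lambda>j. ennreal (((1/2)^k)\<^sup>2))"
    proof (rule Liminf_mono, rule eventually_sequentiallyI[of k])
      fix j assume "k \<le> j"
      have dd: "(\<lambda>x. f (r j) x - f (r k) x) \<in> l2_space D" by (intro l2.diff f)
      have "(\<integral>\<^sup>+x. ennreal ((norm (f (r j) x - f (r k) x))\<^sup>2) \<partial>?M)
         = ennreal (l2_inner D (\<lambda>x. f (r j) x - f (r k) x) (\<lambda>x. f (r j) x - f (r k) x))"
        unfolding l2_inner_def power2_norm_eq_inner
        by (intro nn_integral_eq_integral l2_inner_integrable dd) auto
      also have "\<dots> \<le> ennreal (((1/2)^k)\<^sup>2)"
        using rjk[OF \<open>k \<le> j\<close>] l2.nonneg[OF dd]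
        by (intro ennreal_leI) (metis l2_norm_def less_imp_le real_sqrt_ge_0_iff real_sqrt_pow2 power_mono)
      finally show "(\<integral>\<^sup>+x. ennreal ((norm (f (r j) x - f (r k) x))\<^sup>2) \<partial>?M) \<le> ennreal (((1/2)^k)\<^sup>2)" .
    qed
    finally show ?thesis by (simp add: Liminf_const)
  qed
  have gd: "(\<lambda>x. g x - f (r k) x) \<in> l2_space D" for k
    unfolding l2_space_def using order.strict_trans1[OF F[of k] ennreal_less_top]
    by (auto intro!: integrableI_bounded)
  have gl: "g \<in> l2_space D" using l2.add[OF gd[of 0] f[of "r 0"]] by simp
  have gn: "l2_norm D (\<lambda>x. g x - f (r k) x) \<le> (1/2)^k" for k
  proof -
    have "ennreal (l2_inner D (\<lambda>x. g x - f (r k) x) (\<lambda>x. g x - f (r k) x)) \<le> ennreal (((1/2)^k)\<^sup>2)"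
      using F[of k] unfolding l2_inner_def power2_norm_eq_inner
      by (subst nn_integral_eq_integral[symmetric]) (auto intro!: l2_inner_integrable gd)
    then show ?thesis unfolding l2_norm_def by (intro real_le_lsqrt) (auto simp: l2.nonneg gd)
  qed
  have "(\<lambda>n. l2_norm D (\<lambda>x. f n x - g x)) \<longlonglongrightarrow> 0"
  proof (rule LIMSEQ_I)
    fix e :: real assume "e > 0"
    then obtain k where k: "(1/2)^k < e / 2" using real_arch_pow_inv[of "e/2" "1/2"] by auto
    have "l2_norm D (\<lambda>x. f n x - g x) < e" if "n \<ge> N k" for n
    proof -
      have "l2_norm D (\<lambda>x. f n x - g x) \<le> l2_norm D (\<lambda>x. f n x - f (r k) x) + l2_norm D (\<lambda>x. f (r k) x - g x)"
        unfolding l2_norm_def by (intro l2.triangle_diff f gl)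
      moreover have "l2_norm D (\<lambda>x. f (r k) x - g x) = l2_norm D (\<lambda>x. g x - f (r k) x)"
        unfolding l2_norm_def by (simp add: l2.norm_minus f gl)
      ultimately show ?thesis using N[OF that rN] gn[of k] k by simp
    qed
    then show "\<exists>no. \<forall>n\<ge>no. norm (l2_norm D (\<lambda>x. f n x - g x) - 0) < e"
      by (intro exI[of _ "N k"]) (auto simp: l2_norm_def l2.nonneg l2.diff f gl)
  qed
  with gl show ?thesis by blast
qed

text \<open>Bridge between the two settings: the L2 product lives on the completed measure over
  \<open>D\<close>, whereas translation invariance and Fubini are applied to \<open>lborel\<close>
  on the whole space.\<close>

lemma lebesgue_on_integral_lborel:
  fixes f :: "'a::euclidean_space \<Rightarrow> 'b::{banach, second_countable_topology}"
  assumes f: "f \<in> borel_measurable borel" and D: "D \<in> sets lebesgue" and z: "\<And>x. x \<notin> D \<Longrightarrow> f x = 0"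
  shows "(LINT x|lebesgue_on D. f x) = (LINT x|lborel. f x)"
    and "integrable (lebesgue_on D) f \<longleftrightarrow> integrable lborel f"
proof -
  have e: "(\<lambda>x. indicator D x *\<^sub>R f x) = f" using z by (auto simp: indicator_def)
  show "(LINT x|lebesgue_on D. f x) = (LINT x|lborel. f x)"
    using f D by (simp add: integral_restrict_space e integral_completion)
  show "integrable (lebesgue_on D) f \<longleftrightarrow> integrable lborel f"
    using f D by (simp add: integrable_restrict_space e integrable_completion)
qed

lemma borel_imp_lebesgue_on: "(f :: _ \<Rightarrow> _::topological_space) \<in> borel_measurable borel \<Longrightarrow> f \<in> borel_measurable (lebesgue_on D)"
  by (intro measurable_restrict_space1 measurable_completion) simp

subsection \<open>Test functions\<close>

lemma test_functionsD:
  assumes "\<phi> \<in> test_functions D"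
  shows "smooth_on UNIV \<phi>" "compact (closure {x. \<phi> x \<noteq> 0})" "closure {x. \<phi> x \<noteq> 0} \<subseteq> D"
    "x \<notin> closure {x. \<phi> x \<noteq> 0} \<Longrightarrow> \<phi> x = 0" "x \<notin> closure {x. \<phi> x \<noteq> 0} \<Longrightarrow> grad \<phi> x = 0"
proof -
  show "smooth_on UNIV \<phi>" "compact (closure {x. \<phi> x \<noteq> 0})" "closure {x. \<phi> x \<noteq> 0} \<subseteq> D"
    using assms by (auto simp: test_functions_def)
  show "x \<notin> closure {x. \<phi> x \<noteq> 0} \<Longrightarrow> \<phi> x = 0"
    using closure_subset[of "{x. \<phi> x \<noteq> 0}"] by blast
  assume x: "x \<notin> closure {x. \<phi> x \<noteq> 0}"
  have "((\<lambda>x. 0) has_derivative (\<lambda>h. h \<bullet> 0)) (at x)" by simp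
  then have "(\<phi> has_derivative (\<lambda>h. h \<bullet> 0)) (at x)"
    by (rule has_derivative_transform_within_open[of _ _ _ _ "- closure {x. \<phi> x \<noteq> 0}"])
      (use x closure_subset[of "{x. \<phi> x \<noteq> 0}"] in auto)
  then show "grad \<phi> x = 0" by (intro grad_eqI) (simp add: gderiv_def)
qed

lemma test_functions_outside: "\<phi> \<in> test_functions D \<Longrightarrow> x \<notin> D \<Longrightarrow> \<phi> x = 0"
  and test_functions_grad_outside: "\<phi> \<in> test_functions D \<Longrightarrow> x \<notin> D \<Longrightarrow> grad \<phi> x = 0"
  using test_functionsD(3,4,5) by blast+

lemma test_functions_lin:
  assumes "\<phi> \<in> test_functions D" "\<psi> \<in> test_functions D"
  shows "(\<lambda>x. a * \<phi> x + b * \<psi> x) \<in> test_functions D"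
proof -
  have "{x. a * \<phi> x + b * \<psi> x \<noteq> 0} \<subseteq> {x. \<phi> x \<noteq> 0} \<union> {x. \<psi> x \<noteq> 0}" by auto
  from closure_mono[OF this]
  have c: "closure {x. a * \<phi> x + b * \<psi> x \<noteq> 0} \<subseteq> closure {x. \<phi> x \<noteq> 0} \<union> closure {x. \<psi> x \<noteq> 0}"
    by (simp add: closure_Un)
  have "compact (closure {x. \<phi> x \<noteq> 0} \<union> closure {x. \<psi> x \<noteq> 0})"
    using assms by (intro compact_Un test_functionsD)
  with c have "compact (closure {x. a * \<phi> x + b * \<psi> x \<noteq> 0})"
    using bounded_subset compact_imp_bounded by (blast intro: compact_eq_bounded_closed[THEN iffD2] closed_closure)
  moreover have "smooth_on UNIV (\<lambda>x. a * \<phi> x + b * \<psi> x)"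
    using assms by (intro smooth_on_add smooth_on_scale test_functionsD)
  moreover have "closure {x. a * \<phi> x + b * \<psi> x \<noteq> 0} \<subseteq> D"
    using c test_functionsD(3)[OF assms(1)] test_functionsD(3)[OF assms(2)] by (rule_tac subset_trans[OF c]) simp
  ultimately show ?thesis by (simp add: test_functions_def)
qed

lemma grad_lin:
  "smooth_on UNIV f \<Longrightarrow> smooth_on UNIV g \<Longrightarrow> grad (\<lambda>x. a * f x + b * g x) x = a *\<^sub>R grad f x + b *\<^sub>R grad g x"
  by (simp add: grad_add grad_scale smooth_on_scale)

lemma test_functions_mult:
  assumes "\<phi> \<in> test_functions D" "smooth_on UNIV \<psi>"
  shows "(\<lambda>x. \<phi> x * \<psi> x) \<in> test_functions D"
proof -
  have "{x. \<phi> x * \<psi> x \<noteq> 0} \<subseteq> {x. \<phi> x \<noteq> 0}" by auto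
  from closure_mono[OF this]
  have c: "closure {x. \<phi> x * \<psi> x \<noteq> 0} \<subseteq> closure {x. \<phi> x \<noteq> 0}" .
  have "compact (closure {x. \<phi> x * \<psi> x \<noteq> 0})"
    using bounded_subset[OF compact_imp_bounded[OF test_functionsD(2)[OF assms(1)]] c]
    by (simp add: compact_eq_bounded_closed)
  then show ?thesis
    using subset_trans[OF c test_functionsD(3)[OF assms(1)]] smooth_on_mult[OF test_functionsD(1)[OF assms(1)] assms(2)]
    by (simp add: test_functions_def)
qed

lemma test_functions_grad:
  assumes "\<phi> \<in> test_functions D" "b \<in> Basis"
  shows "(\<lambda>x. grad \<phi> x \<bullet> b) \<in> test_functions D"
proof -
  have "{x. grad \<phi> x \<bullet> b \<noteq> 0} \<subseteq> closure {x. \<phi> x \<noteq> 0}"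
    using test_functionsD(5)[OF assms(1)] by (metis (mono_tags, lifting) inner_zero_left mem_Collect_eq subsetI)
  then have c: "closure {x. grad \<phi> x \<bullet> b \<noteq> 0} \<subseteq> closure {x. \<phi> x \<noteq> 0}" by (intro closure_minimal) auto
  have "compact (closure {x. grad \<phi> x \<bullet> b \<noteq> 0})"
    using bounded_subset[OF compact_imp_bounded[OF test_functionsD(2)[OF assms(1)]] c]
    by (simp add: compact_eq_bounded_closed)
  then show ?thesis
    using subset_trans[OF c test_functionsD(3)[OF assms(1)]] smooth_grad[OF test_functionsD(1)[OF assms(1)] assms(2)]
    by (simp add: test_functions_def)
qed

lemma test_functions_mono: "D \<subseteq> E \<Longrightarrow> test_functions D \<subseteq> test_functions E"
  by (auto simp: test_functions_def)

lemma bounded_on_support: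
  fixes f :: "'a::euclidean_space \<Rightarrow> 'b::euclidean_space"
  assumes "continuous_on UNIV f" "compact K" "\<And>x. x \<notin> K \<Longrightarrow> f x = 0"
  shows "\<exists>C\<ge>0. \<forall>x. norm (f x) \<le> C"
proof -
  have "bounded (f ` K)"
    using assms by (intro compact_imp_bounded compact_continuous_image continuous_on_subset[OF assms(1)]) auto
  then obtain C where C: "\<And>x. x \<in> K \<Longrightarrow> norm (f x) \<le> C" by (auto simp: bounded_iff)
  then have "norm (f x) \<le> max 0 C" for x using assms(3)[of x] by (cases "x \<in> K") (auto intro: le_max_iff_disj[THEN iffD2])
  then show ?thesis by (intro exI[of _ "max 0 C"]) auto
qed

lemma test_functions_l2:
  assumes D: "D \<in> lmeasurable" and \<phi>: "\<phi> \<in> test_functions D"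
  shows "\<phi> \<in> l2_space D" "grad \<phi> \<in> l2_space D"
proof -
  note s = test_functionsD[OF \<phi>]
  have c: "continuous_on UNIV \<phi>" "continuous_on UNIV (grad \<phi>)"
    using s(1) by (rule smooth_continuous smooth_grad_continuous)+
  obtain C where "\<And>x. norm (\<phi> x) \<le> C" using bounded_on_support[OF c(1) s(2,4)] by auto
  then show "\<phi> \<in> l2_space D"
    by (intro l2_norm_le_of_bound(1)[OF D] borel_imp_lebesgue_on borel_measurable_continuous_onI c)
  obtain C where "\<And>x. norm (grad \<phi> x) \<le> C" using bounded_on_support[OF c(2) s(2,5)] by auto
  then show "grad \<phi> \<in> l2_space D"
    by (intro l2_norm_le_of_bound(1)[OF D] borel_imp_lebesgue_on borel_measurable_continuous_onI c)
qed

lemma lborel_integral_translate: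
  fixes f :: "'a::euclidean_space \<Rightarrow> real"
  assumes [measurable]: "f \<in> borel_measurable borel"
  shows "(LINT x|lborel. f (x + c)) = (LINT x|lborel. f x)"
proof -
  have "(LINT x|lborel. f x) = (LINT x|distr lborel borel ((+) c). f x)" by (simp add: lborel_distr_plus)
  also have "\<dots> = (LINT x|lborel. f (c + x))" by (subst integral_distr) auto
  finally show ?thesis by (simp add: add.commute)
qed

text \<open>The difference quotients have integral zero by translation invariance.\<close>

lemma integral_grad_test_function:
  fixes \<zeta> :: "'a::euclidean_space \<Rightarrow> real"
  assumes \<zeta>: "\<zeta> \<in> test_functions UNIV"
  shows "(LINT x|lborel. grad \<zeta> x \<bullet> b) = 0"
proof -
  note s = test_functionsD[OF \<zeta>]
  have c: "continuous_on UNIV \<zeta>" "continuous_on UNIV (grad \<zeta>)"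
    using s(1) by (rule smooth_continuous smooth_grad_continuous)+
  have [measurable]: "\<zeta> \<in> borel_measurable borel" "grad \<zeta> \<in> borel_measurable borel"
    using c by (auto intro: borel_measurable_continuous_onI)
  obtain L where L: "L \<ge> 0" "\<And>x. norm (grad \<zeta> x) \<le> L" using bounded_on_support[OF c(2) s(2,5)] by auto
  obtain R where "\<forall>x\<in>closure {x. \<zeta> x \<noteq> 0}. norm x \<le> R"
    using compact_imp_bounded[OF s(2)] unfolding bounded_iff by blast
  then have R: "closure {x. \<zeta> x \<noteq> 0} \<subseteq> cball 0 R" by (simp add: subset_iff)
  have R0: "\<zeta> x = 0" if "norm x > R" for x using s(4) R that by (meson linorder_not_less mem_cball_0 subsetD)
  have Lip: "\<bar>\<zeta> x - \<zeta> y\<bar> \<le> L * norm (x - y)" for x y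
  proof -
    have "norm (\<zeta> x - \<zeta> y) \<le> L * norm (x - y)"
    proof (rule differentiable_bound[OF convex_UNIV])
      show "(\<zeta> has_derivative (\<lambda>h. h \<bullet> grad \<zeta> x)) (at x within UNIV)" for x
        using smooth_GDERIV[OF s(1)] by (simp add: gderiv_def)
      show "onorm (\<lambda>h. h \<bullet> grad \<zeta> x) \<le> L" for x
      proof (rule onorm_le)
        fix h :: 'a
        have "norm (h \<bullet> grad \<zeta> x) \<le> norm h * norm (grad \<zeta> x)" using Cauchy_Schwarz_ineq2 by simp
        also have "\<dots> \<le> L * norm h" 
          by (subst mult.commute) (rule mult_right_mono[OF L(2) norm_ge_zero])
        finally show "norm (h \<bullet> grad \<zeta> x) \<le> L * norm h" .
      qed
    qed auto
    then show ?thesis by simp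
  qed
  have \<zeta>i: "integrable lborel \<zeta>" by (rule integrable_compact_support[OF c(1) s(2,4)])
  \<comment> \<open>Step sizes at most 1 keep the supports of all difference quotients in one ball,
    which provides the integrable majorant.\<close>
  define \<epsilon> where "\<epsilon> n = inverse (real (Suc n))" for n
  have \<epsilon>: "\<epsilon> n > 0" "\<epsilon> n \<le> 1" for n by (auto simp: \<epsilon>_def field_simps)
  define q where "q n x = (\<zeta> (x + \<epsilon> n *\<^sub>R b) - \<zeta> x) / \<epsilon> n" for n x
  have q0: "(LINT x|lborel. q n x) = 0" for n
  proof -
    have "integrable lborel (\<lambda>x. \<zeta> (x + \<epsilon> n *\<^sub>R b))"
    proof (rule integrable_compact_support)
      show "continuous_on UNIV (\<lambda>x. \<zeta> (x + \<epsilon> n *\<^sub>R b))"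
        by (rule continuous_on_compose2[OF c(1)]) (auto intro: continuous_intros)
      show "\<zeta> (x + \<epsilon> n *\<^sub>R b) = 0" if "x \<notin> cball (- (\<epsilon> n *\<^sub>R b)) R" for x
        using that by (intro R0) (simp add: dist_norm norm_minus_commute)
    qed simp
    then show ?thesis using \<zeta>i by (simp add: q_def lborel_integral_translate)
  qed
  have "(\<lambda>n. LINT x|lborel. q n x) \<longlonglongrightarrow> (LINT x|lborel. grad \<zeta> x \<bullet> b)"
  proof (rule integral_dominated_convergence)
    show "integrable lborel (\<lambda>x. indicator (cball 0 (R + norm b)) x *\<^sub>R (L * norm b))"
      by (intro borel_integrable_compact) auto
    show "AE x in lborel. norm (q n x) \<le> indicator (cball 0 (R + norm b)) x *\<^sub>R (L * norm b)" for n
    proof (rule AE_I2)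
      fix x
      have nb: "norm (\<epsilon> n *\<^sub>R b) \<le> norm b" using \<epsilon>[of n] by (simp add: mult_left_le_one_le)
      show "norm (q n x) \<le> indicator (cball 0 (R + norm b)) x *\<^sub>R (L * norm b)"
      proof (cases "norm x \<le> R + norm b")
        case True
        have "\<bar>\<zeta> (x + \<epsilon> n *\<^sub>R b) - \<zeta> x\<bar> \<le> \<epsilon> n * (L * norm b)" using Lip[of "x + \<epsilon> n *\<^sub>R b" x] \<epsilon>(1)[of n] by (simp add: mult.left_commute)
        then show ?thesis using True \<epsilon>(1)[of n] by (simp add: q_def divide_le_eq mult.commute)
      next
        case False
        have "norm x \<le> norm (x + \<epsilon> n *\<^sub>R b) + norm (\<epsilon> n *\<^sub>R b)"
          using norm_triangle_ineq4[of "x + \<epsilon> n *\<^sub>R b" "\<epsilon> n *\<^sub>R b"] by simp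
        with False nb have "norm (x + \<epsilon> n *\<^sub>R b) > R" "norm x > R" using norm_ge_zero[of b] by linarith+
        then show ?thesis using L(1) by (simp add: q_def R0)
      qed
    qed
    show "AE x in lborel. (\<lambda>n. q n x) \<longlonglongrightarrow> grad \<zeta> x \<bullet> b"
    proof (rule AE_I2)
      fix x
      have "DERIV (\<lambda>t. \<zeta> (x + t *\<^sub>R b)) 0 :> (grad \<zeta> x \<bullet> b)"
        by (rule GDERIV_along_line) (simp add: smooth_GDERIV[OF s(1)])
      then have "((\<lambda>t. (\<zeta> (x + t *\<^sub>R b) - \<zeta> x) / t) \<longlongrightarrow> grad \<zeta> x \<bullet> b) (at 0)" by (simp add: DERIV_def)
      moreover have "filterlim \<epsilon> (at 0) sequentially"
        unfolding filterlim_at using LIMSEQ_inverse_real_of_nat by (auto simp: \<epsilon>_def[abs_def])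
      ultimately show "(\<lambda>n. q n x) \<longlonglongrightarrow> grad \<zeta> x \<bullet> b"
        unfolding q_def by (rule filterlim_compose)
    qed
  qed (auto simp: q_def[abs_def])
  then show ?thesis using LIMSEQ_unique by (simp add: q0 LIMSEQ_const_iff)
qed

text \<open>The gradient of the product of the two functions has integral zero.\<close>

lemma integration_by_parts_test:
  fixes \<phi> \<psi> :: "'a::euclidean_space \<Rightarrow> real"
  assumes D: "D \<in> lmeasurable" and \<phi>: "\<phi> \<in> test_functions D" and \<psi>: "\<psi> \<in> test_functions D"
    and b: "b \<in> Basis"
  shows "l2_inner D \<phi> (\<lambda>x. grad \<psi> x \<bullet> b) = - l2_inner D (\<lambda>x. grad \<phi> x \<bullet> b) \<psi>"
proof -
  have D': "D \<in> sets lebesgue" using D by auto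
  note s = test_functionsD(1)[OF \<phi>] test_functionsD(1)[OF \<psi>]
  have "(\<lambda>x. \<phi> x * \<psi> x) \<in> test_functions UNIV"
    using test_functions_mult[OF \<phi> s(2)] test_functions_mono[of D UNIV] by auto
  from integral_grad_test_function[OF this, of b]
  have "(LINT x|lborel. \<phi> x * (grad \<psi> x \<bullet> b) + \<psi> x * (grad \<phi> x \<bullet> b)) = 0"
    by (simp add: grad_mult[OF s] inner_add_left)
  moreover have "(LINT x|lebesgue_on D. \<phi> x * (grad \<psi> x \<bullet> b) + \<psi> x * (grad \<phi> x \<bullet> b))
     = (LINT x|lborel. \<phi> x * (grad \<psi> x \<bullet> b) + \<psi> x * (grad \<phi> x \<bullet> b))"
  proof (rule lebesgue_on_integral_lborel(1)[OF _ D'])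
    show "(\<lambda>x. \<phi> x * (grad \<psi> x \<bullet> b) + \<psi> x * (grad \<phi> x \<bullet> b)) \<in> borel_measurable borel"
      using s by (intro borel_measurable_continuous_onI continuous_intros smooth_continuous smooth_grad_continuous)
  qed (simp add: test_functions_outside[OF \<phi>] test_functions_outside[OF \<psi>])
  moreover have "integrable (lebesgue_on D) (\<lambda>x. \<phi> x * (grad \<psi> x \<bullet> b))" "integrable (lebesgue_on D) (\<lambda>x. \<psi> x * (grad \<phi> x \<bullet> b))"
    using l2_inner_integrable[OF test_functions_l2(1)[OF D \<phi>] test_functions_l2(1)[OF D test_functions_grad[OF \<psi> b]]]
      l2_inner_integrable[OF test_functions_l2(1)[OF D \<psi>] test_functions_l2(1)[OF D test_functions_grad[OF \<phi> b]]]
    by simp_all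
  ultimately show ?thesis by (simp add: l2_inner_def mult.commute)
qed

subsection \<open>The fundamental lemma of the calculus of variations\<close>

text \<open>Cut-offs built from the distance to the complement are mollified with an error tending
  to 0. The bound 2 is the bound 1 of the cut-off plus an error of at most 1.\<close>

lemma indicator_open_approx:
  fixes U :: "'a::euclidean_space set"
  assumes U: "open U" "bounded U"
  shows "\<exists>\<phi> :: nat \<Rightarrow> 'a \<Rightarrow> real. (\<forall>n. \<phi> n \<in> test_functions U) \<and> (\<forall>n x. \<bar>\<phi> n x\<bar> \<le> 2) \<and>
    (\<forall>x. (\<lambda>n. \<phi> n x) \<longlonglongrightarrow> indicator U x)"
proof -
  \<comment> \<open>The distance \<open>infdist\<close> to an empty set is 0 by convention, so its
    positivity on \<open>U\<close> requires a nonempty complement.\<close>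
  have ne: "- U \<noteq> {}"
  proof
    assume "- U = {}"
    then have "bounded (UNIV :: 'a set)" using U by (metis Compl_empty_eq double_compl)
    then show False using not_bounded_UNIV by blast
  qed
  define d where "d x = infdist x (- U)" for x
  have dL: "\<bar>d x - d y\<bar> \<le> norm (x - y)" for x y
    using infdist_triangle_abs[of x "- U" y] by (simp add: d_def dist_norm)
  have dU: "d x = 0" if "x \<notin> U" for x using that by (simp add: d_def)
  have dpos: "d x > 0" if "x \<in> U" for x
    using infdist_pos_not_in_closed[of "- U" x] U ne that by (simp add: d_def closed_Compl)
  \<comment> \<open>This cut-off has Lipschitz constant \<open>n\<close>, vanishes where the
    distance is at most 1/n and equals 1 where it is at least 2/n.\<close>
  define u where "u n x = min 1 (real n * max 0 (d x - 1 / real n))" for n x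
  have u01: "0 \<le> u n x" "u n x \<le> 1" for n x by (auto simp: u_def)
  have ex: "\<exists>\<phi>\<in>test_functions U. \<forall>x. \<bar>\<phi> x - u n x\<bar> \<le> 1 / real n" if n: "n > 0" for n
  proof -
    have "\<bar>u n x - u n y\<bar> \<le> real n * norm (x - y)" for x y
    proof -
      have "\<bar>u n x - u n y\<bar> \<le> \<bar>real n * max 0 (d x - 1 / real n) - real n * max 0 (d y - 1 / real n)\<bar>"
        unfolding u_def by linarith
      also have "\<dots> = real n * \<bar>max 0 (d x - 1 / real n) - max 0 (d y - 1 / real n)\<bar>"
        by (simp add: right_diff_distrib[symmetric] abs_mult)
      also have "\<dots> \<le> real n * \<bar>d x - d y\<bar>" by (intro mult_left_mono) auto
      also have "\<dots> \<le> real n * norm (x - y)" by (intro mult_left_mono dL) auto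
      finally show ?thesis .
    qed
    moreover have "compact {x. 1 / real n \<le> d x}"
    proof -
      have "{x. 1 / real n \<le> d x} \<subseteq> U" using dU n by (auto simp: not_less[symmetric]) (metis divide_pos_pos not_le of_nat_0_less_iff zero_less_one)
      then have "bounded {x. 1 / real n \<le> d x}" using U bounded_subset by blast
      moreover have "closed {x. 1 / real n \<le> d x}"
        unfolding d_def by (intro closed_Collect_le continuous_intros)
      ultimately show ?thesis by (simp add: compact_eq_bounded_closed)
    qed
    moreover have "{x. 1 / real n \<le> d x} \<subseteq> U"
    proof
      fix x assume "x \<in> {x. 1 / real n \<le> d x}"
      moreover have "0 < 1 / real n" using n by simp
      ultimately have "d x \<noteq> 0" by auto
      then show "x \<in> U" using dU by blast
    qed
    moreover have "u n x = 0" if "x \<notin> {x. 1 / real n \<le> d x}" for x using that by (simp add: u_def)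
    \<comment> \<open>The approximation error is the Lipschitz constant \<open>n\<close> times the
      mollification width, so this width leaves the error 1/n.\<close>
    moreover have "1 / (real n)\<^sup>2 > 0" using n by simp
    ultimately obtain \<phi> where "\<phi> \<in> test_functions U" "\<And>x. \<bar>\<phi> x - u n x\<bar> \<le> real n * (1 / (real n)\<^sup>2)"
      using Lipschitz_approx_test_function[of "u n" "real n" "{x. 1 / real n \<le> d x}" U "1 / (real n)\<^sup>2"] U(1)
      by metis
    then show ?thesis using n by (intro bexI[of _ \<phi>]) (auto simp: power2_eq_square)
  qed
  then have "\<forall>n. \<exists>\<phi>\<in>test_functions U. \<forall>x. \<bar>\<phi> x - u (Suc n) x\<bar> \<le> 1 / real (Suc n)" by (intro allI ex) simp
  then obtain \<phi> where \<phi>: "\<And>n. \<phi> n \<in> test_functions U" "\<And>n x. \<bar>\<phi> n x - u (Suc n) x\<bar> \<le> 1 / real (Suc n)"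
    by metis
  have "\<bar>\<phi> n x\<bar> \<le> 2" for n x
  proof -
    have "1 / real (Suc n) \<le> 1" by simp
    then show ?thesis using \<phi>(2)[of n x] u01[of "Suc n" x] by linarith
  qed
  moreover have "(\<lambda>n. \<phi> n x) \<longlonglongrightarrow> indicator U x" for x
  proof -
    have "(\<lambda>n. \<phi> n x - u (Suc n) x) \<longlonglongrightarrow> 0"
      by (rule Lim_null_comparison[OF _ LIMSEQ_inverse_real_of_nat]) (use \<phi>(2) in \<open>auto simp: inverse_eq_divide\<close>)
    moreover have "(\<lambda>n. u (Suc n) x) \<longlonglongrightarrow> indicator U x"
    proof (cases "x \<in> U")
      case True
      obtain N where N: "2 / d x \<le> real N" using real_arch_simple by blast
      have "u (Suc n) x = 1" if "n \<ge> N" for n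
      proof -
        have "2 \<le> real (Suc n) * d x" using N that dpos[OF True] by (simp add: divide_le_eq) (smt (verit) mult_right_mono of_nat_mono)
        then have "1 \<le> real (Suc n) * (d x - 1 / real (Suc n))" by (simp add: right_diff_distrib)
        also have "\<dots> \<le> real (Suc n) * max 0 (d x - 1 / real (Suc n))" by (intro mult_left_mono) auto
        finally show ?thesis by (simp add: u_def)
      qed
      then show ?thesis using True
        by (intro tendsto_eventually eventually_sequentiallyI[of N]) auto
    next
      case False
      then show ?thesis by (simp add: u_def dU)
    qed
    ultimately have "(\<lambda>n. \<phi> n x - u (Suc n) x + u (Suc n) x) \<longlonglongrightarrow> 0 + indicator U x" by (rule tendsto_add)
    then show ?thesis by simp
  qed
  ultimately show ?thesis using \<phi>(1) by blast
qed

lemma l2_integrable: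
  fixes g :: "'a::euclidean_space \<Rightarrow> real"
  assumes D: "D \<in> lmeasurable" and g: "g \<in> l2_space D"
  shows "integrable (lebesgue_on D) g"
proof -
  have "(\<lambda>x. 1::real) \<in> l2_space D" using l2_norm_le_of_bound(1)[OF D, of "\<lambda>_. 1::real" 1] by simp
  from l2_inner_integrable[OF g this] show ?thesis by simp
qed

text \<open>Orthogonality passes by dominated convergence from test functions to indicators of open
  sets, then to countable intersections of these, and up to null sets to all measurable sets.
  Applied to the sets where \<open>g\<close> is positive or negative it makes both null.\<close>

lemma fundamental_lemma:
  fixes g :: "'a::euclidean_space \<Rightarrow> real"
  assumes D: "open D" "bounded D" and g: "g \<in> l2_space D"
    and orth: "\<And>\<phi>. \<phi> \<in> test_functions D \<Longrightarrow> l2_inner D g \<phi> = 0"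
  shows "l2_eq D g (\<lambda>_. 0)"
proof -
  let ?M = "lebesgue_on D"
  have Dl: "D \<in> lmeasurable" using D by (simp add: lmeasurable_open)
  then have D': "D \<in> sets lebesgue" by auto
  have gi: "integrable ?M g" by (rule l2_integrable[OF Dl g])
  have [measurable]: "g \<in> borel_measurable ?M" using g by (rule l2_spaceD)
  have dom: "(\<lambda>n. LINT x|?M. g x * s n x) \<longlonglongrightarrow> (LINT x|?M. g x * f x)"
    if s: "\<And>n. s n \<in> borel_measurable ?M" "f \<in> borel_measurable ?M" "\<And>n x. \<bar>s n x\<bar> \<le> 2" "\<And>x. x \<in> D \<Longrightarrow> (\<lambda>n. s n x) \<longlonglongrightarrow> f x"
    for s and f :: "'a \<Rightarrow> real"
  proof (rule integral_dominated_convergence[where w="\<lambda>x. 2 * norm (g x)"])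
    note [measurable] = s(1,2)
    show "(\<lambda>x. g x * f x) \<in> borel_measurable ?M" "(\<lambda>x. g x * s n x) \<in> borel_measurable ?M" for n by measurable
    show "AE x in ?M. (\<lambda>n. g x * s n x) \<longlonglongrightarrow> g x * f x"
      using s(4) by (intro AE_I2 tendsto_mult_left) simp
    show "AE x in ?M. norm (g x * s n x) \<le> 2 * norm (g x)" for n
      using mult_left_mono[OF s(3)[of n] abs_ge_zero] by (intro AE_I2) (simp add: abs_mult mult.commute)
  qed (use gi in simp)
  have op: "(LINT x|?M. g x * indicator U x) = 0" if U: "open U" "U \<subseteq> D" for U
  proof -
    have "bounded U" using U D bounded_subset by blast
    from indicator_open_approx[OF U(1) this]
    obtain \<phi> :: "nat \<Rightarrow> 'a \<Rightarrow> real" where \<phi>: "\<And>n. \<phi> n \<in> test_functions U" "\<And>n x. \<bar>\<phi> n x\<bar> \<le> 2" "\<And>x. (\<lambda>n. \<phi> n x) \<longlonglongrightarrow> indicator U x"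
      by blast
    have \<phi>D: "\<phi> n \<in> test_functions D" for n using \<phi>(1) test_functions_mono[OF U(2)] by blast
    have "(\<lambda>n. LINT x|?M. g x * \<phi> n x) \<longlonglongrightarrow> (LINT x|?M. g x * indicator U x)"
    proof (rule dom)
      show "\<phi> n \<in> borel_measurable ?M" for n
        using test_functionsD(1)[OF \<phi>D] by (intro borel_imp_lebesgue_on borel_measurable_continuous_onI smooth_continuous)
      show "(indicator U :: 'a \<Rightarrow> real) \<in> borel_measurable ?M" using U by (intro borel_imp_lebesgue_on) auto
    qed (use \<phi> in auto)
    moreover have "(LINT x|?M. g x * \<phi> n x) = 0" for n using orth[OF \<phi>D[of n]] by (simp add: l2_inner_def)
    ultimately show ?thesis by (simp add: LIMSEQ_const_iff)
  qed
  have ms: "(LINT x|?M. g x * indicator A x) = 0" if A: "A \<in> sets lebesgue" for A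
  proof -
    obtain C N where C: "gdelta C" "N \<in> null_sets lebesgue" "A \<union> N = C" "disjnt A N"
      using lebesgue_set_almost_gdelta[OF A] by metis
    from C(1) obtain U :: "nat \<Rightarrow> 'a set" where U: "\<And>n. open (U n)" "C = (\<Inter>n. U n)"
      by (auto elim!: gdelta.cases)
    \<comment> \<open>Finite intersections, cut down to \<open>D\<close>, are open subsets of
      \<open>D\<close> to which \<open>op\<close> applies, and they decrease to \<open>C\<close>
      within \<open>D\<close>.\<close>
    define O' where "O' n = D \<inter> (\<Inter>i\<in>{..n}. U i)" for n
    have O: "open (O' n)" "O' n \<subseteq> D" for n unfolding O'_def using D U by (auto intro!: open_Int open_INT)
    have Cb: "C \<in> sets borel" unfolding U(2) using U(1) by (intro sets.countable_INT) auto
    have "(\<lambda>n. LINT x|?M. g x * indicator (O' n) x) \<longlonglongrightarrow> (LINT x|?M. g x * indicator C x)"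
    proof (rule dom)
      show "(indicator (O' n) :: 'a \<Rightarrow> real) \<in> borel_measurable ?M" for n using O by (intro borel_imp_lebesgue_on) auto
      show "(indicator C :: 'a \<Rightarrow> real) \<in> borel_measurable ?M" using Cb by (intro borel_imp_lebesgue_on) auto
      fix x assume x: "x \<in> D"
      show "(\<lambda>n. indicator (O' n) x :: real) \<longlonglongrightarrow> indicator C x"
      proof (cases "x \<in> C")
        case True
        then show ?thesis using x U(2) by (simp add: O'_def)
      next
        case False
        then obtain m where "x \<notin> U m" using U(2) by auto
        then have "indicator (O' n) x = (0::real)" if "n \<ge> m" for n using that unfolding O'_def indicator_def by auto
        then show ?thesis using False by (intro tendsto_eventually eventually_sequentiallyI[of m]) auto
      qed
    qed (auto simp: indicator_def)
    then have "(LINT x|?M. g x * indicator C x) = 0" using op[OF O] by (simp add: LIMSEQ_const_iff)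
    moreover have "(LINT x|?M. g x * indicator C x) = (LINT x|?M. g x * indicator A x)"
    proof (rule integral_cong_AE)
      have "AE x in lebesgue. x \<notin> N" using C(2) by (rule AE_not_in)
      then have "AE x in ?M. x \<notin> N" using D' by (auto simp: AE_restrict_space_iff elim: eventually_mono)
      then show "AE x in ?M. g x * indicator C x = g x * indicator A x"
        by eventually_elim (use C(3) in \<open>auto simp: indicator_def\<close>)
      have [measurable]: "(indicator C :: 'a \<Rightarrow> real) \<in> borel_measurable ?M" using Cb by (intro borel_imp_lebesgue_on) auto
      have [measurable]: "(indicator A :: 'a \<Rightarrow> real) \<in> borel_measurable ?M"
        using A by (intro measurable_restrict_space1) simp
      show "(\<lambda>x. g x * indicator C x) \<in> borel_measurable ?M" "(\<lambda>x. g x * indicator A x) \<in> borel_measurable ?M"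
        by measurable
    qed
    ultimately show ?thesis by simp
  qed
  have le: "AE x in ?M. s * g x \<le> 0" for s :: real
  proof -
    let ?A = "{x\<in>D. s * g x > 0}"
    have "{x\<in>space ?M. s * g x > 0} \<in> sets ?M" by measurable
    then have A: "?A \<in> sets lebesgue" using D' by (simp add: sets_restrict_space_iff)
    have "(LINT x|?M. max 0 (s * g x)) = (LINT x|?M. s * (g x * indicator ?A x))"
      by (intro Bochner_Integration.integral_cong) (auto simp: indicator_def max_def)
    also have "\<dots> = 0" using ms[OF A] by simp
    finally have "AE x in ?M. max 0 (s * g x) = 0"
      using integral_nonneg_eq_0_iff_AE[of ?M "\<lambda>x. max 0 (s * g x)"] gi by simp
    then show ?thesis by eventually_elim (auto simp: max_def split: if_splits)
  qed
  from le[of 1] le[of "-1"] show ?thesis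
    unfolding l2_eq_def by eventually_elim simp
qed

subsection \<open>Weak gradients and $H^1_0$\<close>

lemma l2_component: "b \<in> Basis \<Longrightarrow> g \<in> l2_space D \<Longrightarrow> (\<lambda>x. g x \<bullet> b) \<in> l2_space D"
  and l2_scaleR_vec: "f \<in> l2_space D \<Longrightarrow> (\<lambda>x. f x *\<^sub>R b) \<in> l2_space D"
  for g :: "'a::euclidean_space \<Rightarrow> 'b::euclidean_space" and f :: "'a \<Rightarrow> real"
proof -
  assume b: "b \<in> Basis" and g: "g \<in> l2_space D"
  have [measurable]: "g \<in> borel_measurable (lebesgue_on D)" using g by (rule l2_spaceD)
  have "integrable (lebesgue_on D) (\<lambda>x. (norm (g x \<bullet> b))\<^sup>2)"
  proof (rule Bochner_Integration.integrable_bound)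
    show "integrable (lebesgue_on D) (\<lambda>x. (norm (g x))\<^sup>2)" using g by (simp add: l2_space_def)
    show "AE x in lebesgue_on D. norm ((norm (g x \<bullet> b))\<^sup>2) \<le> norm ((norm (g x))\<^sup>2)"
      using b by (intro AE_I2) (simp add: Basis_le_norm abs_le_square_iff[symmetric])
  qed measurable
  then show "(\<lambda>x. g x \<bullet> b) \<in> l2_space D" by (simp add: l2_space_def)
next
  assume f: "f \<in> l2_space D"
  have [measurable]: "f \<in> borel_measurable (lebesgue_on D)" using f by (rule l2_spaceD)
  show "(\<lambda>x. f x *\<^sub>R b) \<in> l2_space D"
    using f by (simp add: l2_space_def power_mult_distrib)
qed

lemma l2_inner_component: "l2_inner D (\<lambda>x. g x \<bullet> b) f = l2_inner D g (\<lambda>x. f x *\<^sub>R b)"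
  by (simp add: l2_inner_def mult.commute)

text \<open>Weak gradients are tested component by component, so the fundamental lemma applies to
  each component of the difference.\<close>

lemma weak_gradient_unique:
  assumes D: "open D" "bounded D" and g: "has_weak_gradient D u g" and g': "has_weak_gradient D u g'"
  shows "l2_eq D g g'"
proof -
  have Dl: "D \<in> lmeasurable" using D by (simp add: lmeasurable_open)
  have gl: "g \<in> l2_space D" "g' \<in> l2_space D" using g g' by (auto simp: has_weak_gradient_def)
  have "l2_eq D (\<lambda>x. g x \<bullet> b - g' x \<bullet> b) (\<lambda>_. 0)" if b: "b \<in> Basis" for b
  proof (rule fundamental_lemma[OF D])
    show "(\<lambda>x. g x \<bullet> b - g' x \<bullet> b) \<in> l2_space D" using b gl by (intro l2.diff l2_component)
    fix \<phi> assume \<phi>: "\<phi> \<in> test_functions D"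
    have "l2_inner D (\<lambda>x. g x \<bullet> b) \<phi> = l2_inner D (\<lambda>x. g' x \<bullet> b) \<phi>"
      using g g' \<phi> b by (simp add: has_weak_gradient_def)
    then show "l2_inner D (\<lambda>x. g x \<bullet> b - g' x \<bullet> b) \<phi> = 0"
      using b gl test_functions_l2(1)[OF Dl \<phi>] by (simp add: l2.diff_left l2_component)
  qed
  then have "AE x in lebesgue_on D. \<forall>b\<in>Basis. g x \<bullet> b - g' x \<bullet> b = 0"
    by (simp add: l2_eq_def AE_finite_all)
  then show ?thesis unfolding l2_eq_def by eventually_elim (simp add: euclidean_eq_iff[of "g _"])
qed

lemma l2_norm_cong:
  assumes "f \<in> l2_space D" "g \<in> l2_space D" "l2_eq D f g" shows "l2_norm D f = l2_norm D g"
  unfolding l2_norm_def using assms by (simp add: l2_inner_cong_AE[of f D g f g])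

text \<open>Since \<open>weak_grad\<close> is an arbitrary choice, convergence towards it cannot be
  checked directly. Integration by parts passes to the limit and shows \<open>g\<close> to be a weak
  gradient; uniqueness then lets it stand in for the chosen one.\<close>

lemma H10_I:
  assumes D: "open D" "bounded D" and \<phi>: "\<And>n. \<phi> n \<in> test_functions D"
    and u: "u \<in> l2_space D" and g: "g \<in> l2_space D"
    and cu: "(\<lambda>n. l2_norm D (\<lambda>x. \<phi> n x - u x)) \<longlonglongrightarrow> 0"
    and cg: "(\<lambda>n. l2_norm D (\<lambda>x. grad (\<phi> n) x - g x)) \<longlonglongrightarrow> 0"
  shows "u \<in> H10 D" "l2_eq D (weak_grad D u) g" "weak_grad D u \<in> l2_space D"
proof -
  have Dl: "D \<in> lmeasurable" using D by (simp add: lmeasurable_open)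
  note \<phi>l = test_functions_l2[OF Dl \<phi>]
  have w: "has_weak_gradient D u g"
    unfolding has_weak_gradient_def
  proof (intro conjI u g ballI)
    fix \<psi> and b :: 'a assume \<psi>: "\<psi> \<in> test_functions D" and b: "b \<in> Basis"
    have "(\<lambda>n. l2_inner D (\<phi> n) (\<lambda>x. grad \<psi> x \<bullet> b)) \<longlonglongrightarrow> l2_inner D u (\<lambda>x. grad \<psi> x \<bullet> b)"
      using cu test_functions_l2(1)[OF Dl test_functions_grad[OF \<psi> b]]
      by (intro l2.tendsto_inner \<phi>l u) (simp_all add: l2_norm_def)
    moreover have "(\<lambda>n. l2_inner D (grad (\<phi> n)) (\<lambda>x. \<psi> x *\<^sub>R b)) \<longlonglongrightarrow> l2_inner D g (\<lambda>x. \<psi> x *\<^sub>R b)"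
      using cg test_functions_l2(1)[OF Dl \<psi>]
      by (intro l2.tendsto_inner \<phi>l g l2_scaleR_vec) (simp_all add: l2_norm_def)
    then have "(\<lambda>n. - l2_inner D (grad (\<phi> n)) (\<lambda>x. \<psi> x *\<^sub>R b)) \<longlonglongrightarrow> - l2_inner D g (\<lambda>x. \<psi> x *\<^sub>R b)"
      by (rule tendsto_minus)
    moreover have "l2_inner D (\<phi> n) (\<lambda>x. grad \<psi> x \<bullet> b) = - l2_inner D (grad (\<phi> n)) (\<lambda>x. \<psi> x *\<^sub>R b)" for n
      using integration_by_parts_test[OF Dl \<phi> \<psi> b] by (simp add: l2_inner_component)
    ultimately show "l2_inner D u (\<lambda>x. grad \<psi> x \<bullet> b) = - l2_inner D (\<lambda>x. g x \<bullet> b) \<psi>"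
      using LIMSEQ_unique by (simp add: l2_inner_component)
  qed
  then have w': "has_weak_gradient D u (weak_grad D u)"
    unfolding weak_grad_def by (rule someI[of "has_weak_gradient D u"])
  then show wl: "weak_grad D u \<in> l2_space D" by (simp add: has_weak_gradient_def)
  show eq: "l2_eq D (weak_grad D u) g" by (rule weak_gradient_unique[OF D w' w])
  have "l2_norm D (\<lambda>x. grad (\<phi> n) x - weak_grad D u x) = l2_norm D (\<lambda>x. grad (\<phi> n) x - g x)" for n
  proof (rule l2_norm_cong)
    show "l2_eq D (\<lambda>x. grad (\<phi> n) x - weak_grad D u x) (\<lambda>x. grad (\<phi> n) x - g x)"
      using eq unfolding l2_eq_def by eventually_elim simp
  qed (intro l2.diff \<phi>l wl g)+
  with cg have "(\<lambda>n. l2_norm D (\<lambda>x. grad (\<phi> n) x - weak_grad D u x)) \<longlonglongrightarrow> 0" by simp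
  then show "u \<in> H10 D" unfolding H10_def using w \<phi> cu by blast
qed

lemma H10D:
  assumes "u \<in> H10 D"
  shows "u \<in> l2_space D" "weak_grad D u \<in> l2_space D"
    "\<exists>\<phi>. (\<forall>n. \<phi> n \<in> test_functions D) \<and> (\<lambda>n. l2_norm D (\<lambda>x. \<phi> n x - u x)) \<longlonglongrightarrow> 0 \<and>
        (\<lambda>n. l2_norm D (\<lambda>x. grad (\<phi> n) x - weak_grad D u x)) \<longlonglongrightarrow> 0"
proof -
  obtain g where "has_weak_gradient D u g" using assms by (auto simp: H10_def)
  then have "has_weak_gradient D u (weak_grad D u)" unfolding weak_grad_def by (rule someI[of "has_weak_gradient D u"])
  then show "u \<in> l2_space D" "weak_grad D u \<in> l2_space D" by (auto simp: has_weak_gradient_def)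
qed (use assms in \<open>auto simp: H10_def\<close>)

lemma test_functions_H10:
  assumes D: "open D" "bounded D" and \<phi>: "\<phi> \<in> test_functions D"
  shows "\<phi> \<in> H10 D" "l2_eq D (weak_grad D \<phi>) (grad \<phi>)"
proof -
  have Dl: "D \<in> lmeasurable" using D by (simp add: lmeasurable_open)
  note \<phi>l = test_functions_l2[OF Dl \<phi>]
  show "\<phi> \<in> H10 D" "l2_eq D (weak_grad D \<phi>) (grad \<phi>)"
    using H10_I[OF D \<phi> \<phi>l] by (simp_all add: l2_norm_def l2_inner_def)
qed

lemma l2_norm_lin_tendsto:
  fixes f g :: "nat \<Rightarrow> 'a::euclidean_space \<Rightarrow> 'b::euclidean_space"
  assumes f: "\<And>n. f n \<in> l2_space D" "f' \<in> l2_space D" "(\<lambda>n. l2_norm D (\<lambda>x. f n x - f' x)) \<longlonglongrightarrow> 0"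
    and g: "\<And>n. g n \<in> l2_space D" "g' \<in> l2_space D" "(\<lambda>n. l2_norm D (\<lambda>x. g n x - g' x)) \<longlonglongrightarrow> 0"
  shows "(\<lambda>n. l2_norm D (\<lambda>x. (a *\<^sub>R f n x + b *\<^sub>R g n x) - (a *\<^sub>R f' x + b *\<^sub>R g' x))) \<longlonglongrightarrow> 0"
proof (rule Lim_null_comparison)
  have "norm (l2_norm D (\<lambda>x. (a *\<^sub>R f n x + b *\<^sub>R g n x) - (a *\<^sub>R f' x + b *\<^sub>R g' x)))
      \<le> \<bar>a\<bar> * l2_norm D (\<lambda>x. f n x - f' x) + \<bar>b\<bar> * l2_norm D (\<lambda>x. g n x - g' x)" for n
  proof -
    have 1: "(\<lambda>x. f n x - f' x) \<in> l2_space D" "(\<lambda>x. g n x - g' x) \<in> l2_space D"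
      using f g by (auto intro: l2.diff)
    have 2: "(\<lambda>x. a *\<^sub>R (f n x - f' x)) \<in> l2_space D" "(\<lambda>x. b *\<^sub>R (g n x - g' x)) \<in> l2_space D"
      using 1 by (auto intro: l2.scale)
    have "(\<lambda>x. (a *\<^sub>R f n x + b *\<^sub>R g n x) - (a *\<^sub>R f' x + b *\<^sub>R g' x)) = (\<lambda>x. a *\<^sub>R (f n x - f' x) + b *\<^sub>R (g n x - g' x))"
      by (simp add: algebra_simps)
    moreover have "l2_norm D (\<lambda>x. a *\<^sub>R (f n x - f' x)) = \<bar>a\<bar> * l2_norm D (\<lambda>x. f n x - f' x)"
      "l2_norm D (\<lambda>x. b *\<^sub>R (g n x - g' x)) = \<bar>b\<bar> * l2_norm D (\<lambda>x. g n x - g' x)"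
      using 1 2 unfolding l2_norm_def
      by (simp_all add: l2.scale_left l2.scale_right mult.assoc[symmetric] real_sqrt_mult)
    ultimately show ?thesis using l2.triangle[OF 2] l2.nonneg[OF l2.add[OF 2]] by (simp add: l2_norm_def)
  qed
  then show "\<forall>\<^sub>F n in sequentially. norm (l2_norm D (\<lambda>x. (a *\<^sub>R f n x + b *\<^sub>R g n x) - (a *\<^sub>R f' x + b *\<^sub>R g' x)))
      \<le> \<bar>a\<bar> * l2_norm D (\<lambda>x. f n x - f' x) + \<bar>b\<bar> * l2_norm D (\<lambda>x. g n x - g' x)" by simp
  show "(\<lambda>n. \<bar>a\<bar> * l2_norm D (\<lambda>x. f n x - f' x) + \<bar>b\<bar> * l2_norm D (\<lambda>x. g n x - g' x)) \<longlonglongrightarrow> 0"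
    using tendsto_add[OF tendsto_mult_right_zero[OF f(3), of "\<bar>a\<bar>"] tendsto_mult_right_zero[OF g(3), of "\<bar>b\<bar>"]] by simp
qed

lemma H10_lin:
  fixes u v :: "'a::euclidean_space \<Rightarrow> real"
  assumes D: "open D" "bounded D" and u: "u \<in> H10 D" and v: "v \<in> H10 D"
  shows "(\<lambda>x. a * u x + b * v x) \<in> H10 D"
    "l2_eq D (weak_grad D (\<lambda>x. a * u x + b * v x)) (\<lambda>x. a *\<^sub>R weak_grad D u x + b *\<^sub>R weak_grad D v x)"
proof -
  have Dl: "D \<in> lmeasurable" using D by (simp add: lmeasurable_open)
  note ul = H10D(1,2)[OF u] and vl = H10D(1,2)[OF v]
  obtain \<phi> where \<phi>: "\<And>n. \<phi> n \<in> test_functions D" "(\<lambda>n. l2_norm D (\<lambda>x. \<phi> n x - u x)) \<longlonglongrightarrow> 0"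
        "(\<lambda>n. l2_norm D (\<lambda>x. grad (\<phi> n) x - weak_grad D u x)) \<longlonglongrightarrow> 0" using H10D(3)[OF u] by blast
  obtain \<psi> where \<psi>: "\<And>n. \<psi> n \<in> test_functions D" "(\<lambda>n. l2_norm D (\<lambda>x. \<psi> n x - v x)) \<longlonglongrightarrow> 0"
        "(\<lambda>n. l2_norm D (\<lambda>x. grad (\<psi> n) x - weak_grad D v x)) \<longlonglongrightarrow> 0" using H10D(3)[OF v] by blast
  note \<phi>l = test_functions_l2[OF Dl \<phi>(1)] and \<psi>l = test_functions_l2[OF Dl \<psi>(1)]
  have 1: "(\<lambda>x. a * \<phi> n x + b * \<psi> n x) \<in> test_functions D" for n using \<phi> \<psi> by (intro test_functions_lin)
  have 2: "(\<lambda>x. a * u x + b * v x) \<in> l2_space D" using l2.lin[OF ul(1) vl(1), of a b] by simp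
  have 3: "(\<lambda>x. a *\<^sub>R weak_grad D u x + b *\<^sub>R weak_grad D v x) \<in> l2_space D" by (rule l2.lin[OF ul(2) vl(2)])
  have 4: "(\<lambda>n. l2_norm D (\<lambda>x. (a * \<phi> n x + b * \<psi> n x) - (a * u x + b * v x))) \<longlonglongrightarrow> 0"
    using l2_norm_lin_tendsto[OF \<phi>l(1) ul(1) \<phi>(2) \<psi>l(1) vl(1) \<psi>(2), of a b] by simp
  have 5: "(\<lambda>n. l2_norm D (\<lambda>x. grad (\<lambda>x. a * \<phi> n x + b * \<psi> n x) x - (a *\<^sub>R weak_grad D u x + b *\<^sub>R weak_grad D v x))) \<longlonglongrightarrow> 0"
    using l2_norm_lin_tendsto[OF \<phi>l(2) ul(2) \<phi>(3) \<psi>l(2) vl(2) \<psi>(3), of a b]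
    by (simp add: grad_lin[OF test_functionsD(1)[OF \<phi>(1)] test_functionsD(1)[OF \<psi>(1)]])
  show "(\<lambda>x. a * u x + b * v x) \<in> H10 D"
    "l2_eq D (weak_grad D (\<lambda>x. a * u x + b * v x)) (\<lambda>x. a *\<^sub>R weak_grad D u x + b *\<^sub>R weak_grad D v x)"
    by (rule H10_I[OF D 1 2 3 4 5])+
qed

definition dirichlet_form :: "'a::euclidean_space set \<Rightarrow> ('a \<Rightarrow> real) \<Rightarrow> ('a \<Rightarrow> real) \<Rightarrow> real" where
  "dirichlet_form D u v = l2_inner D (weak_grad D u) (weak_grad D v)"

text \<open>\<open>weak_grad\<close> is linear only up to null sets, which suffices under the
  integral.\<close>

lemma semi_inner_H10:
  assumes D: "open D" "bounded D"
  shows "semi_inner (H10 D) (dirichlet_form D)"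
proof
  fix u v a b assume uv: "u \<in> H10 D" "v \<in> H10 D"
  note lin = H10_lin[OF D uv, of a b]
  show l: "(\<lambda>x. a *\<^sub>R u x + b *\<^sub>R v x) \<in> H10 D" using lin by simp
  note wl = H10D(2)[OF uv(1)] H10D(2)[OF uv(2)] H10D(2)[OF l]
  show "dirichlet_form D u v = dirichlet_form D v u" unfolding dirichlet_form_def by (intro l2.sym wl)
  show "0 \<le> dirichlet_form D u u" unfolding dirichlet_form_def by (intro l2.nonneg wl)
  fix w assume w: "w \<in> H10 D"
  have "dirichlet_form D (\<lambda>x. a *\<^sub>R u x + b *\<^sub>R v x) w
     = l2_inner D (\<lambda>x. a *\<^sub>R weak_grad D u x + b *\<^sub>R weak_grad D v x) (weak_grad D w)"
    unfolding dirichlet_form_def using lin(2)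
    by (intro l2_inner_cong_AE wl H10D(2)[OF w] l2.lin) (simp_all add: l2_eq_def)
  then show "dirichlet_form D (\<lambda>x. a *\<^sub>R u x + b *\<^sub>R v x) w = a * dirichlet_form D u w + b * dirichlet_form D v w"
    unfolding dirichlet_form_def by (simp add: l2.lin_left wl H10D(2)[OF w])
qed

section \<open>Averages and translations of test functions\<close>

text \<open>Nonnegativity of the variance of \<open>f\<close> under the uniform distribution on
  \<open>A\<close>.\<close>

lemma square_average_le:
  fixes f :: "'a::euclidean_space \<Rightarrow> real"
  assumes A[measurable]: "A \<in> sets borel" and c: "emeasure lborel A = ennreal c" "c > 0"
    and f[measurable]: "f \<in> borel_measurable borel" and B: "\<And>x. \<bar>f x\<bar> \<le> B"
  shows "ennreal (((LINT x|lborel. f x * indicator A x) / c)\<^sup>2)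
      \<le> (\<integral>\<^sup>+x. ennreal ((f x)\<^sup>2) * indicator A x \<partial>lborel) / ennreal c"
proof -
  let ?w = "\<lambda>x. indicator A x / c :: real"
  define U where "U = density lborel (\<lambda>x. ennreal (?w x))"
  have w: "ennreal (?w x) = indicator A x / ennreal c" for x
    using c by (simp add: divide_ennreal[symmetric] ennreal_indicator)
  interpret prob_space U
  proof
    have "emeasure U (space U) = (\<integral>\<^sup>+x. indicator A x / ennreal c \<partial>lborel)"
      by (simp add: U_def emeasure_density w)
    also have "\<dots> = 1" using c by (simp add: nn_integral_divide ennreal_divide_self)
    finally show "emeasure U (space U) = 1" .
  qed
  have fU[measurable]: "f \<in> borel_measurable U" by (simp add: U_def)
  have i1: "integrable U f" using B by (intro integrable_const_bound[of _ B]) auto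
  have i2: "integrable U (\<lambda>x. (f x)\<^sup>2)"
  proof (intro integrable_const_bound[of _ "B\<^sup>2"] AE_I2)
    show "norm ((f x)\<^sup>2) \<le> B\<^sup>2" for x
      using B[of x] abs_le_square_iff[of "f x" B] by auto
  qed auto
  have "expectation f = (LINT x|lborel. ?w x *\<^sub>R f x)"
    unfolding U_def using c by (intro integral_density) auto
  also have "\<dots> = (LINT x|lborel. f x * indicator A x) / c" by (simp add: mult.commute)
  finally have E: "expectation f = (LINT x|lborel. f x * indicator A x) / c" .
  have "(expectation f)\<^sup>2 \<le> expectation (\<lambda>x. (f x)\<^sup>2)"
    using variance_positive[of f] variance_eq[OF i1 i2] by simp
  then have "ennreal ((expectation f)\<^sup>2) \<le> ennreal (expectation (\<lambda>x. (f x)\<^sup>2))" by (rule ennreal_leI)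
  also have "\<dots> = (\<integral>\<^sup>+x. ennreal ((f x)\<^sup>2) \<partial>U)" using i2 by (intro nn_integral_eq_integral[symmetric]) auto
  also have "\<dots> = (\<integral>\<^sup>+x. ennreal (?w x) * ennreal ((f x)\<^sup>2) \<partial>lborel)"
    unfolding U_def by (intro nn_integral_density) auto
  also have "\<dots> = (\<integral>\<^sup>+x. ennreal ((f x)\<^sup>2) * indicator A x / ennreal c \<partial>lborel)"
    by (simp add: w divide_ennreal_def ac_simps)
  also have "\<dots> = (\<integral>\<^sup>+x. ennreal ((f x)\<^sup>2) * indicator A x \<partial>lborel) / ennreal c"
    by (intro nn_integral_divide) auto
  finally show ?thesis by (simp add: E)
qed

lemma nn_integral_translate:
  fixes f :: "'a::euclidean_space \<Rightarrow> ennreal"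
  assumes [measurable]: "f \<in> borel_measurable borel"
  shows "(\<integral>\<^sup>+x. f (x + c) \<partial>lborel) = (\<integral>\<^sup>+x. f x \<partial>lborel)"
proof -
  have "(\<integral>\<^sup>+x. f x \<partial>lborel) = (\<integral>\<^sup>+x. f x \<partial>distr lborel borel ((+) c))" by (simp add: lborel_distr_plus)
  also have "\<dots> = (\<integral>\<^sup>+x. f (c + x) \<partial>lborel)" by (subst nn_integral_distr) auto
  finally show ?thesis by (simp add: add.commute)
qed

lemma test_function_borel:
  assumes "\<phi> \<in> test_functions D"
  shows "\<phi> \<in> borel_measurable borel" "grad \<phi> \<in> borel_measurable borel"
  using smooth_continuous[OF test_functionsD(1)[OF assms]] smooth_grad_continuous[OF test_functionsD(1)[OF assms]]
  by (auto intro: borel_measurable_continuous_onI)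

lemma test_function_bounded:
  assumes "\<phi> \<in> test_functions D"
  shows "\<exists>B\<ge>0. \<forall>x. \<bar>\<phi> x\<bar> \<le> B" "\<exists>B\<ge>0. \<forall>x. norm (grad \<phi> x) \<le> B"
  using bounded_on_support[OF smooth_continuous[OF test_functionsD(1)[OF assms]] test_functionsD(2,4)[OF assms]]
    bounded_on_support[OF smooth_grad_continuous[OF test_functionsD(1)[OF assms]] test_functionsD(2,5)[OF assms]]
  by auto

text \<open>Extended nonnegative and over the whole space, so that Tonelli and translation apply
  without integrability conditions; for test functions it is the squared L2 norm of the
  gradient.\<close>

definition energy :: "('a::euclidean_space \<Rightarrow> real) \<Rightarrow> ennreal" where
  "energy \<phi> = (\<integral>\<^sup>+x. ennreal ((norm (grad \<phi> x))\<^sup>2) \<partial>lborel)"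

text \<open>The increment is the integral of the directional derivative over the segment; squaring
  is handled by the average inequality over [0, 1], and integrating in \<open>x\<close> before
  \<open>t\<close> removes the shift.\<close>

lemma translation_estimate:
  fixes \<phi> :: "'a::euclidean_space \<Rightarrow> real"
  assumes \<phi>: "\<phi> \<in> test_functions D"
  shows "(\<integral>\<^sup>+x. ennreal ((\<phi> (x + z) - \<phi> x)\<^sup>2) \<partial>lborel) \<le> ennreal ((norm z)\<^sup>2) * energy \<phi>"
proof -
  note [measurable] = test_function_borel[OF \<phi>]
  note s = test_functionsD(1)[OF \<phi>]
  obtain B where B: "B \<ge> 0" "\<And>x. norm (grad \<phi> x) \<le> B" using test_function_bounded(2)[OF \<phi>] by blast
  have pw: "ennreal ((\<phi> (x + z) - \<phi> x)\<^sup>2)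
      \<le> (\<integral>\<^sup>+t. ennreal ((norm z)\<^sup>2) * (ennreal ((norm (grad \<phi> (x + t *\<^sub>R z)))\<^sup>2) * indicator {0..1} t) \<partial>lborel)" for x
  proof -
    define f where "f t = grad \<phi> (x + t *\<^sub>R z) \<bullet> z" for t :: real
    have d: "DERIV (\<lambda>t. \<phi> (x + t *\<^sub>R z)) t :> f t" for t
      unfolding f_def by (rule GDERIV_along_line) (rule smooth_GDERIV[OF s])
    have fc: "continuous_on UNIV f"
      unfolding f_def
      by (intro continuous_on_inner continuous_on_compose2[OF smooth_grad_continuous[OF s]]) (auto intro!: continuous_intros)
    have "(LINT t|lborel. f t * indicator {0..1} t) = \<phi> (x + 1 *\<^sub>R z) - \<phi> (x + 0 *\<^sub>R z)"
      using fc d by (intro integral_FTC_Icc_real) (auto simp: continuous_on_eq_continuous_at)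
    moreover have "\<bar>f t\<bar> \<le> B * norm z" for t
      unfolding f_def using Cauchy_Schwarz_ineq2 mult_right_mono[OF B(2) norm_ge_zero] by (rule order_trans)
    moreover have "f \<in> borel_measurable borel" using fc by (rule borel_measurable_continuous_onI)
    ultimately have "ennreal ((\<phi> (x + z) - \<phi> x)\<^sup>2) \<le> (\<integral>\<^sup>+t. ennreal ((f t)\<^sup>2) * indicator {0..1} t \<partial>lborel)"
      using square_average_le[of "{0..1::real}" 1 f "B * norm z"] by (simp add: divide_ennreal_def)
    also have "\<dots> \<le> (\<integral>\<^sup>+t. ennreal ((norm z)\<^sup>2) * (ennreal ((norm (grad \<phi> (x + t *\<^sub>R z)))\<^sup>2) * indicator {0..1} t) \<partial>lborel)"
    proof (intro nn_integral_mono)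
      fix t
      have "(f t)\<^sup>2 \<le> (norm (grad \<phi> (x + t *\<^sub>R z)) * norm z)\<^sup>2"
        unfolding f_def by (rule abs_le_square_iff[THEN iffD1]) (simp add: Cauchy_Schwarz_ineq2)
      then have "ennreal ((f t)\<^sup>2) \<le> ennreal ((norm z)\<^sup>2) * ennreal ((norm (grad \<phi> (x + t *\<^sub>R z)))\<^sup>2)"
        by (simp add: ennreal_mult[symmetric] power_mult_distrib mult.commute ennreal_leI)
      then show "ennreal ((f t)\<^sup>2) * indicator {0..1} t \<le> ennreal ((norm z)\<^sup>2) * (ennreal ((norm (grad \<phi> (x + t *\<^sub>R z)))\<^sup>2) * indicator {0..1} t)"
        by (auto simp: indicator_def)
    qed
    finally show ?thesis .
  qed
  have "(\<integral>\<^sup>+x. ennreal ((\<phi> (x + z) - \<phi> x)\<^sup>2) \<partial>lborel)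
     \<le> (\<integral>\<^sup>+x. (\<integral>\<^sup>+t. ennreal ((norm z)\<^sup>2) * (ennreal ((norm (grad \<phi> (x + t *\<^sub>R z)))\<^sup>2) * indicator {0..1} t) \<partial>lborel) \<partial>lborel)"
    by (intro nn_integral_mono pw)
  also have "\<dots> = (\<integral>\<^sup>+t. (\<integral>\<^sup>+x. ennreal ((norm z)\<^sup>2) * (ennreal ((norm (grad \<phi> (x + t *\<^sub>R z)))\<^sup>2) * indicator {0..1} t) \<partial>lborel) \<partial>lborel)"
    by (rule lborel_pair.Fubini'[symmetric]) measurable
  also have "\<dots> = (\<integral>\<^sup>+t. ennreal ((norm z)\<^sup>2) * energy \<phi> * indicator {0..1::real} t \<partial>lborel)"
  proof (intro nn_integral_cong)
    fix t :: real
    have "(\<integral>\<^sup>+x. ennreal ((norm z)\<^sup>2) * (ennreal ((norm (grad \<phi> (x + t *\<^sub>R z)))\<^sup>2) * indicator {0..1} t) \<partial>lborel)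
       = ennreal ((norm z)\<^sup>2) * ((\<integral>\<^sup>+x. ennreal ((norm (grad \<phi> (x + t *\<^sub>R z)))\<^sup>2) \<partial>lborel) * indicator {0..1} t)"
      by (simp add: nn_integral_cmult nn_integral_multc)
    also have "(\<integral>\<^sup>+x. ennreal ((norm (grad \<phi> (x + t *\<^sub>R z)))\<^sup>2) \<partial>lborel) = energy \<phi>"
      unfolding energy_def by (rule nn_integral_translate) measurable
    finally show "(\<integral>\<^sup>+x. ennreal ((norm z)\<^sup>2) * (ennreal ((norm (grad \<phi> (x + t *\<^sub>R z)))\<^sup>2) * indicator {0..1} t) \<partial>lborel)
       = ennreal ((norm z)\<^sup>2) * energy \<phi> * indicator {0..1} t" by (simp add: mult.assoc)
  qed
  also have "\<dots> = ennreal ((norm z)\<^sup>2) * energy \<phi>" by (simp add: nn_integral_cmult)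
  finally show ?thesis .
qed

subsection \<open>Averages over the cells of a lattice\<close>

text \<open>Scaled by 1/m, this is the lower corner of the half-open lattice cube of side 1/m that
  contains \<open>x\<close>. It is kept as a vector with integer components, so that measurability
  is that of a map into the space itself.\<close>

definition cell_index :: "nat \<Rightarrow> 'a::euclidean_space \<Rightarrow> 'a" where
  "cell_index m x = (\<Sum>b\<in>Basis. of_int \<lfloor>real m * (x \<bullet> b)\<rfloor> *\<^sub>R b)"

lemma cell_index_measurable[measurable]: "cell_index m \<in> borel_measurable borel"
  unfolding cell_index_def by measurable

lemma cell_index_inner: "b \<in> Basis \<Longrightarrow> cell_index m x \<bullet> b = of_int \<lfloor>real m * (x \<bullet> b)\<rfloor>"
  unfolding cell_index_def by simp

lemma countable_range_cell_index: "countable (range (cell_index m :: 'a::euclidean_space \<Rightarrow> 'a))"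
proof (rule countable_subset)
  show "range (cell_index m) \<subseteq> (\<lambda>f. \<Sum>b\<in>(Basis :: 'a set). of_int (f b) *\<^sub>R b) ` (PiE Basis (\<lambda>_. UNIV :: int set))"
  proof
    fix k :: 'a assume "k \<in> range (cell_index m)"
    then obtain x where x: "k = cell_index m x" by auto
    then have "k = (\<Sum>b\<in>Basis. of_int ((\<lambda>b\<in>Basis. \<lfloor>real m * (x \<bullet> b)\<rfloor>) b) *\<^sub>R b)"
      unfolding cell_index_def by simp
    then show "k \<in> (\<lambda>f. \<Sum>b\<in>(Basis :: 'a set). of_int (f b) *\<^sub>R b) ` (PiE Basis (\<lambda>_. UNIV :: int set))"
      by (intro image_eqI[of _ _ "\<lambda>b\<in>Basis. \<lfloor>real m * (x \<bullet> b)\<rfloor>"]) auto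
  qed
  show "countable ((\<lambda>f. \<Sum>b\<in>(Basis :: 'a set). of_int (f b) *\<^sub>R b) ` (PiE Basis (\<lambda>_. UNIV :: int set)))"
    by (intro countable_image countable_PiE) auto
qed

definition cell :: "nat \<Rightarrow> 'a::euclidean_space \<Rightarrow> 'a set" where
  "cell m k = {x. cell_index m x = k}"

lemma cell_measurable[measurable]: "cell m k \<in> sets borel"
  unfolding cell_def using measurable_sets[OF cell_index_measurable, of "{k}" m] by (simp add: vimage_def)

text \<open>The half-open cell lies between an open and a closed box of equal volume.\<close>

lemma emeasure_cell:
  fixes y :: "'a::euclidean_space"
  assumes m: "m > 0"
  shows "emeasure lborel (cell m (cell_index m y)) = ennreal ((1 / real m) ^ DIM('a))"
proof -
  let ?k = "cell_index m y"
  define l where "l = (1 / real m) *\<^sub>R ?k"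
  define u where "u = (1 / real m) *\<^sub>R (?k + One)"
  have lu: "l \<bullet> b \<le> u \<bullet> b" "(u - l) \<bullet> b = 1 / real m" if "b \<in> Basis" for b
    using m that by (auto simp: l_def u_def inner_add_left inner_diff_left field_simps)
  have c: "x \<in> cell m ?k \<longleftrightarrow> (\<forall>b\<in>Basis. ?k \<bullet> b \<le> real m * (x \<bullet> b) \<and> real m * (x \<bullet> b) < ?k \<bullet> b + 1)" for x :: 'a
    unfolding cell_def mem_Collect_eq euclidean_eq_iff[of "cell_index m x"]
    by (simp add: cell_index_inner floor_eq_iff)
  have 1: "box l u \<subseteq> cell m ?k"
    unfolding subset_iff c mem_box l_def u_def using m by (simp add: inner_add_left field_simps less_imp_le)
  have 2: "cell m ?k \<subseteq> cbox l u"
    unfolding subset_iff c mem_box l_def u_def using m by (simp add: inner_add_left field_simps less_imp_le)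
  have "emeasure lborel (box l u) = ennreal ((1 / real m) ^ DIM('a))"
    "emeasure lborel (cbox l u) = ennreal ((1 / real m) ^ DIM('a))"
    using lu by simp_all
  then show ?thesis
    using emeasure_mono[OF 1, of lborel] emeasure_mono[OF 2, of lborel] by simp
qed

lemma cell_diff:
  fixes x y :: "'a::euclidean_space"
  assumes m: "m > 0" and "cell_index m x = cell_index m y"
  shows "x - y \<in> cbox (- ((1 / real m) *\<^sub>R One)) ((1 / real m) *\<^sub>R One)"
  unfolding mem_box
proof
  fix b :: 'a assume b: "b \<in> Basis"
  have "\<lfloor>real m * (x \<bullet> b)\<rfloor> = \<lfloor>real m * (y \<bullet> b)\<rfloor>"
    using assms(2) cell_index_inner[OF b, of m x] cell_index_inner[OF b, of m y] by simp
  then have "\<bar>real m * (x \<bullet> b) - real m * (y \<bullet> b)\<bar> \<le> 1" by linarith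
  then have "real m * \<bar>x \<bullet> b - y \<bullet> b\<bar> \<le> 1" by (simp add: right_diff_distrib[symmetric] abs_mult)
  then have "\<bar>x \<bullet> b - y \<bullet> b\<bar> \<le> 1 / real m" using m by (simp add: field_simps)
  then show "- ((1 / real m) *\<^sub>R One) \<bullet> b \<le> (x - y) \<bullet> b \<and> (x - y) \<bullet> b \<le> (1 / real m) *\<^sub>R One \<bullet> b"
    using b by (simp add: inner_diff_left abs_le_iff)
qed

text \<open>The denominator is the volume of a cell; for \<open>m = 0\<close> division by zero makes
  the average 0.\<close>

definition cell_average :: "nat \<Rightarrow> ('a::euclidean_space \<Rightarrow> real) \<Rightarrow> 'a \<Rightarrow> real" where
  "cell_average m \<phi> y = (LINT x|lborel. \<phi> x * indicator (cell m (cell_index m y)) x) / (1 / real m) ^ DIM('a)"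

lemma cell_average_measurable[measurable]:
  assumes [measurable]: "\<phi> \<in> borel_measurable borel"
  shows "cell_average m \<phi> \<in> borel_measurable borel"
proof -
  \<comment> \<open>Membership of \<open>x\<close> in the cell of \<open>y\<close> is expressed by a
    vanishing difference of indices, which is jointly measurable in both points.\<close>
  have "(\<lambda>p. \<phi> (snd p) * indicator {0} (cell_index m (snd p) - cell_index m (fst p)))
      \<in> borel_measurable (borel \<Otimes>\<^sub>M lborel)" by measurable
  then have 1: "(\<lambda>y. LINT x|lborel. \<phi> x * indicator {0} (cell_index m x - cell_index m y)) \<in> borel_measurable borel"
    by (intro lborel.borel_measurable_lebesgue_integral) (simp add: split_beta)
  have 2: "(indicator (cell m (cell_index m y)) x :: real) = indicator {0} (cell_index m x - cell_index m y)" for x y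
    by (simp add: indicator_def cell_def)
  show ?thesis unfolding cell_average_def 2 using 1 by (rule borel_measurable_divide) simp
qed

text \<open>A Poincare inequality on cells: the deviation from the average is an average of
  increments, each controlled by the translation estimate for a shift of length at most the diagonal
  of a cell.\<close>

lemma cell_average_approx:
  fixes \<phi> :: "'a::euclidean_space \<Rightarrow> real"
  assumes \<phi>: "\<phi> \<in> test_functions D" and m: "m > 0"
  shows "(\<integral>\<^sup>+y. ennreal ((\<phi> y - cell_average m \<phi> y)\<^sup>2) \<partial>lborel)
      \<le> ennreal (2 ^ DIM('a) * (norm (One :: 'a))\<^sup>2 / (real m)\<^sup>2) * energy \<phi>"
proof -
  note [measurable] = test_function_borel[OF \<phi>]
  obtain B where B: "B \<ge> 0" "\<And>x. \<bar>\<phi> x\<bar> \<le> B" using test_function_bounded(1)[OF \<phi>] by blast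
  define s where "s = 1 / real m"
  have s: "s > 0" using m by (simp add: s_def)
  define v where "v = s ^ DIM('a)"
  have v: "v > 0" using s by (simp add: v_def)
  \<comment> \<open>Differences of points of one cell lie in this cube, which no longer depends on
    the cell; replacing the cell by it costs the ratio of volumes, 2 to the power of the dimension,
    and leaves an integral over shifts alone.\<close>
  define Q where "Q = cbox (- (s *\<^sub>R One)) (s *\<^sub>R One :: 'a)"
  have Qm[measurable]: "Q \<in> sets borel" by (simp add: Q_def)
  have Qv: "emeasure lborel Q = ennreal (2 ^ DIM('a) * v)"
  proof -
    have "(\<Prod>b\<in>(Basis :: 'a set). (s *\<^sub>R One - (- (s *\<^sub>R One))) \<bullet> b) = (\<Prod>b\<in>(Basis :: 'a set). 2 * s)"
      by (intro prod.cong refl) (simp add: inner_add_left)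
    then show ?thesis
      unfolding Q_def using s by (subst emeasure_lborel_cbox) (auto simp: v_def power_mult_distrib)
  qed
  have Qn: "norm z \<le> s * norm (One :: 'a)" if "z \<in> Q" for z
  proof -
    have "norm z \<le> norm (s *\<^sub>R One :: 'a)"
    proof (rule norm_le_componentwise)
      fix b :: 'a assume "b \<in> Basis"
      then show "\<bar>z \<bullet> b\<bar> \<le> \<bar>(s *\<^sub>R One) \<bullet> b\<bar>"
        using that s by (auto simp: Q_def mem_box abs_le_iff dest!: bspec)
    qed
    then show ?thesis using s by simp
  qed
  have pw: "ennreal ((\<phi> y - cell_average m \<phi> y)\<^sup>2) \<le> (\<integral>\<^sup>+z. ennreal ((\<phi> (y + z) - \<phi> y)\<^sup>2) * indicator Q z \<partial>lborel) / ennreal v" for y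
  proof -
    let ?A = "cell m (cell_index m y)"
    have A: "emeasure lborel ?A = ennreal v" using emeasure_cell[OF m, of y] by (simp add: v_def s_def)
    have iA: "integrable lborel (\<lambda>x. c * indicator ?A x)" for c :: real using A by (simp add: integrable_mult_right)
    have i\<phi>: "integrable lborel (\<lambda>x. \<phi> x * indicator ?A x)"
      by (rule Bochner_Integration.integrable_bound[OF iA[of B]]) (use B in \<open>auto simp: indicator_def intro!: AE_I2\<close>)
    have "(LINT x|lborel. (\<phi> y - \<phi> x) * indicator ?A x) = \<phi> y * v - (LINT x|lborel. \<phi> x * indicator ?A x)"
      using iA[of "\<phi> y"] i\<phi> A v by (simp add: left_diff_distrib measure_def)
    then have "(LINT x|lborel. (\<phi> y - \<phi> x) * indicator ?A x) / v = \<phi> y - cell_average m \<phi> y"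
      using v by (simp add: cell_average_def v_def[symmetric] s_def[symmetric] diff_divide_distrib)
    moreover have "\<bar>\<phi> y - \<phi> x\<bar> \<le> 2 * B" for x using B(2)[of x] B(2)[of y] by linarith
    ultimately have "ennreal ((\<phi> y - cell_average m \<phi> y)\<^sup>2) \<le> (\<integral>\<^sup>+x. ennreal ((\<phi> y - \<phi> x)\<^sup>2) * indicator ?A x \<partial>lborel) / ennreal v"
      using square_average_le[OF cell_measurable A v, of "\<lambda>x. \<phi> y - \<phi> x" "2 * B"] by simp
    also have "(\<integral>\<^sup>+x. ennreal ((\<phi> y - \<phi> x)\<^sup>2) * indicator ?A x \<partial>lborel)
        \<le> (\<integral>\<^sup>+x. ennreal ((\<phi> y - \<phi> x)\<^sup>2) * indicator Q (x - y) \<partial>lborel)"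
      using cell_diff[OF m, of _ y] by (intro nn_integral_mono mult_left_mono) (auto simp: indicator_def cell_def Q_def s_def)
    also have "\<dots> = (\<integral>\<^sup>+z. ennreal ((\<phi> y - \<phi> (z + y))\<^sup>2) * indicator Q (z + y - y) \<partial>lborel)"
      by (rule nn_integral_translate[symmetric]) measurable
    also have "\<dots> = (\<integral>\<^sup>+z. ennreal ((\<phi> (y + z) - \<phi> y)\<^sup>2) * indicator Q z \<partial>lborel)"
      by (simp add: add.commute power2_commute)
    finally show ?thesis by (simp add: divide_right_mono_ennreal)
  qed
  have "(\<integral>\<^sup>+y. ennreal ((\<phi> y - cell_average m \<phi> y)\<^sup>2) \<partial>lborel)
     \<le> (\<integral>\<^sup>+y. (\<integral>\<^sup>+z. ennreal ((\<phi> (y + z) - \<phi> y)\<^sup>2) * indicator Q z \<partial>lborel) / ennreal v \<partial>lborel)"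
    by (intro nn_integral_mono pw)
  also have "\<dots> = (\<integral>\<^sup>+y. (\<integral>\<^sup>+z. ennreal ((\<phi> (y + z) - \<phi> y)\<^sup>2) * indicator Q z \<partial>lborel) \<partial>lborel) / ennreal v"
    by (rule nn_integral_divide) measurable
  also have "(\<integral>\<^sup>+y. (\<integral>\<^sup>+z. ennreal ((\<phi> (y + z) - \<phi> y)\<^sup>2) * indicator Q z \<partial>lborel) \<partial>lborel)
     = (\<integral>\<^sup>+z. (\<integral>\<^sup>+y. ennreal ((\<phi> (y + z) - \<phi> y)\<^sup>2) * indicator Q z \<partial>lborel) \<partial>lborel)"
    by (rule lborel_pair.Fubini'[symmetric]) measurable
  also have "\<dots> \<le> (\<integral>\<^sup>+z. ennreal ((s * norm (One :: 'a))\<^sup>2) * energy \<phi> * indicator Q z \<partial>lborel)"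
  proof (intro nn_integral_mono)
    fix z :: 'a
    have "(\<integral>\<^sup>+y. ennreal ((\<phi> (y + z) - \<phi> y)\<^sup>2) * indicator Q z \<partial>lborel)
       = (\<integral>\<^sup>+y. ennreal ((\<phi> (y + z) - \<phi> y)\<^sup>2) \<partial>lborel) * indicator Q z"
      by (rule nn_integral_multc) measurable
    also have "\<dots> \<le> ennreal ((norm z)\<^sup>2) * energy \<phi> * indicator Q z"
      by (intro mult_right_mono translation_estimate[OF \<phi>]) auto
    also have "\<dots> \<le> ennreal ((s * norm (One :: 'a))\<^sup>2) * energy \<phi> * indicator Q z"
      using Qn[of z] s by (cases "z \<in> Q") (auto intro!: mult_right_mono ennreal_leI power_mono)
    finally show "(\<integral>\<^sup>+y. ennreal ((\<phi> (y + z) - \<phi> y)\<^sup>2) * indicator Q z \<partial>lborel) \<le> ennreal ((s * norm (One :: 'a))\<^sup>2) * energy \<phi> * indicator Q z" .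
  qed
  also have "\<dots> = ennreal ((s * norm (One :: 'a))\<^sup>2) * energy \<phi> * ennreal (2 ^ DIM('a) * v)"
    by (simp add: nn_integral_cmult Qv)
  finally have "(\<integral>\<^sup>+y. ennreal ((\<phi> y - cell_average m \<phi> y)\<^sup>2) \<partial>lborel)
     \<le> ennreal ((s * norm (One :: 'a))\<^sup>2) * energy \<phi> * ennreal (2 ^ DIM('a) * v) / ennreal v"
    by (simp add: divide_right_mono_ennreal)
  also have "\<dots> = ennreal ((s * norm (One :: 'a))\<^sup>2) * energy \<phi> * (ennreal (2 ^ DIM('a) * v) / ennreal v)"
    by (simp add: divide_ennreal_def mult.assoc)
  also have "ennreal (2 ^ DIM('a) * v) / ennreal v = ennreal (2 ^ DIM('a))"
    using v by (simp add: divide_ennreal)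
  also have "ennreal ((s * norm (One :: 'a))\<^sup>2) * energy \<phi> * ennreal (2 ^ DIM('a))
     = ennreal (2 ^ DIM('a) * (norm (One :: 'a))\<^sup>2 / (real m)\<^sup>2) * energy \<phi>"
  proof -
    have "ennreal ((s * norm (One :: 'a))\<^sup>2) * ennreal (2 ^ DIM('a)) = ennreal (2 ^ DIM('a) * (norm (One :: 'a))\<^sup>2 / (real m)\<^sup>2)"
      by (simp add: ennreal_mult[symmetric] s_def power_mult_distrib power_divide mult.commute)
    then show ?thesis by (metis mult.assoc mult.commute)
  qed
  finally show ?thesis .
qed

section \<open>Compactness of sequences with bounded energy\<close>

text \<open>Bolzano-Weierstrass for each index, combined by a diagonal subsequence.\<close>

lemma bounded_family_subseq:
  fixes X :: "nat \<Rightarrow> nat \<Rightarrow> real"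
  assumes B: "\<And>n i. \<bar>X n i\<bar> \<le> B"
  shows "\<exists>r. strict_mono r \<and> (\<forall>i. convergent (\<lambda>n. X (r n) i))"
proof -
  interpret subseqs "\<lambda>i s. convergent (\<lambda>n. X (s n) i)"
  proof
    fix i and s :: "nat \<Rightarrow> nat" assume "strict_mono s"
    have "bounded (range (\<lambda>n. X (s n) i))" using B by (auto simp: bounded_iff)
    from bounded_imp_convergent_subsequence[OF this] obtain l r where "strict_mono r" "((\<lambda>n. X (s n) i) \<circ> r) \<longlonglongrightarrow> l" by blast
    then show "\<exists>r'. strict_mono r' \<and> convergent (\<lambda>n. X ((s \<circ> r') n) i)"
      by (intro exI[of _ r]) (auto simp: o_def convergent_def)
  qed
  have "convergent (\<lambda>n. X (diagseq n) i)" for i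
  proof -
    have "convergent (\<lambda>n. X ((diagseq \<circ> ((+) (Suc i))) n) i)"
    proof (rule diagseq_holds)
      fix r s n assume "strict_mono (r :: nat \<Rightarrow> nat)" "convergent (\<lambda>k. X (s k) n)"
      then show "convergent (\<lambda>k. X ((s \<circ> r) k) n)"
        using convergent_subseq_convergent[of "\<lambda>k. X (s k) n" r] by (simp add: o_def)
    qed
    \<comment> \<open>Only from position \<open>Suc i\<close> on is the diagonal sequence a
      subsequence of the one selected for index \<open>i\<close>; the initial terms do not affect
      convergence.\<close>
    then have "convergent (\<lambda>n. X (diagseq (n + Suc i)) i)" by (simp add: o_def add.commute)
    then show ?thesis by (subst (asm) convergent_ignore_initial_segment)
  qed
  then show ?thesis using subseq_diagseq by blast
qed

lemma bounded_countable_family_subseq: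
  fixes X :: "nat \<Rightarrow> 'i \<Rightarrow> real"
  assumes I: "countable I" and B: "\<And>n i. i \<in> I \<Longrightarrow> \<bar>X n i\<bar> \<le> B"
  shows "\<exists>r. strict_mono r \<and> (\<forall>i\<in>I. convergent (\<lambda>n. X (r n) i))"
proof (cases "I = {}")
  case True
  then show ?thesis by (intro exI[of _ id]) (auto simp: strict_mono_def)
next
  case False
  have "\<exists>r. strict_mono r \<and> (\<forall>j. convergent (\<lambda>n. X (r n) (from_nat_into I j)))"
    using B from_nat_into[OF False] by (intro bounded_family_subseq[of _ B]) auto
  then show ?thesis using from_nat_into_surj[OF I] by metis
qed

lemma energy_eq:
  assumes D: "D \<in> lmeasurable" and \<phi>: "\<phi> \<in> test_functions D"
  shows "energy \<phi> = ennreal (l2_inner D (grad \<phi>) (grad \<phi>))"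
proof -
  have D': "D \<in> sets lebesgue" using D by auto
  note [measurable] = test_function_borel[OF \<phi>]
  have m: "(\<lambda>x. (norm (grad \<phi> x))\<^sup>2) \<in> borel_measurable borel" by measurable
  have "integrable (lebesgue_on D) (\<lambda>x. (norm (grad \<phi> x))\<^sup>2)"
    using test_functions_l2(2)[OF D \<phi>] by (simp add: l2_space_def)
  then have i: "integrable lborel (\<lambda>x. (norm (grad \<phi> x))\<^sup>2)"
    using lebesgue_on_integral_lborel(2)[OF m D'] test_functions_grad_outside[OF \<phi>] by simp
  have "energy \<phi> = ennreal (LINT x|lborel. (norm (grad \<phi> x))\<^sup>2)"
    unfolding energy_def using i by (intro nn_integral_eq_integral) auto
  also have "(LINT x|lborel. (norm (grad \<phi> x))\<^sup>2) = (LINT x|lebesgue_on D. (norm (grad \<phi> x))\<^sup>2)"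
    by (rule lebesgue_on_integral_lborel(1)[OF m D', symmetric]) (simp add: test_functions_grad_outside[OF \<phi>])
  finally show ?thesis by (simp add: l2_inner_def power2_norm_eq_inner)
qed

text \<open>
  The averages over the cells of a lattice of width \<open>1/m\<close> approximate \<open>\<phi> n\<close>
  uniformly in \<open>n\<close>, and for fixed \<open>m\<close> they depend on finitely many functionals.
\<close>

lemma Rellich:
  fixes \<phi> :: "nat \<Rightarrow> 'a::euclidean_space \<Rightarrow> real"
  assumes D: "open D" "bounded D" and \<phi>: "\<And>n. \<phi> n \<in> test_functions D"
    and b0: "\<And>n. l2_inner D (\<phi> n) (\<phi> n) \<le> 1" and b1: "\<And>n. l2_inner D (grad (\<phi> n)) (grad (\<phi> n)) \<le> \<Gamma>"
  shows "\<exists>r :: nat \<Rightarrow> nat. strict_mono r \<and> (\<forall>e>0. \<exists>N. \<forall>i\<ge>N. \<forall>j\<ge>N. l2_norm D (\<lambda>x. \<phi> (r i) x - \<phi> (r j) x) < e)"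
proof -
  have Dl: "D \<in> lmeasurable" using D by (simp add: lmeasurable_open)
  then have D': "D \<in> sets lebesgue" by auto
  have Db[measurable]: "D \<in> sets borel" using D by simp
  note \<phi>m[measurable] = test_function_borel[OF \<phi>]
  note \<phi>l = test_functions_l2[OF Dl \<phi>]
  define K where "K = sqrt (measure lebesgue D)"
  \<comment> \<open>Cauchy-Schwarz against an indicator bounds every integral over a Borel set by
    one constant, as the diagonal argument requires.\<close>
  have a: "\<bar>LINT x|lborel. \<phi> n x * indicator A x\<bar> \<le> K" if [measurable]: "A \<in> sets borel" for n and A :: "'a set"
  proof -
    have Al: "(indicator A :: 'a \<Rightarrow> real) \<in> l2_space D" "l2_inner D (indicator A :: 'a \<Rightarrow> real) (indicator A) \<le> 1 * measure lebesgue D"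
      using l2_norm_le_of_bound[OF Dl borel_imp_lebesgue_on, of "indicator A :: 'a \<Rightarrow> real" 1] by (auto simp: indicator_def)
    have "(LINT x|lborel. \<phi> n x * indicator A x) = l2_inner D (\<phi> n) (indicator A :: 'a \<Rightarrow> real)"
      unfolding l2_inner_def inner_real_def
      by (rule lebesgue_on_integral_lborel(1)[symmetric, OF _ D']) (auto simp: test_functions_outside[OF \<phi>])
    also have "\<bar>\<dots>\<bar> \<le> sqrt (l2_inner D (\<phi> n) (\<phi> n)) * sqrt (l2_inner D (indicator A :: 'a \<Rightarrow> real) (indicator A))"
      by (rule l2.Cauchy_Schwarz_abs[OF \<phi>l(1) Al(1)])
    also have "\<dots> \<le> 1 * K"
      unfolding K_def using b0[of n] Al by (intro mult_mono) (auto intro: l2.nonneg)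
    finally show ?thesis by simp
  qed
  \<comment> \<open>All cells of all lattices at once form a countable index set, so one subsequence
    makes the cell integrals converge for every width.\<close>
  define I where "I = (SIGMA m:UNIV. range (cell_index m :: 'a \<Rightarrow> 'a))"
  have "countable I" unfolding I_def by (intro countable_SIGMA countable_range_cell_index) auto
  then obtain r where r: "strict_mono r" "\<And>i. i \<in> I \<Longrightarrow> convergent (\<lambda>n. LINT x|lborel. \<phi> (r n) x * indicator (cell (fst i) (snd i)) x)"
    using bounded_countable_family_subseq[of I "\<lambda>n i. LINT x|lborel. \<phi> n x * indicator (cell (fst i) (snd i)) x" K] a by auto
  define \<psi> where "\<psi> n = \<phi> (r n)" for n
  have \<psi>: "\<psi> n \<in> test_functions D" "\<psi> n \<in> l2_space D" for n using \<phi> \<phi>l by (auto simp: \<psi>_def)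
  note [measurable] = test_function_borel[OF \<psi>(1)]
  define A where "A m n = cell_average m (\<psi> n)" for m n
  have Am[measurable]: "A m n \<in> borel_measurable borel" for m n unfolding A_def by measurable
  have conv: "convergent (\<lambda>n. A m n y)" for m y
    unfolding A_def cell_average_def divide_inverse
    using r(2)[of "(m, cell_index m y)"] by (intro convergent_mult convergent_const) (simp add: I_def \<psi>_def)
  have Ab: "\<bar>A m n y\<bar> \<le> K / (1 / real m) ^ DIM('a)" for m n y
    unfolding A_def cell_average_def abs_divide \<psi>_def by (auto intro!: divide_right_mono a)
  have Al: "A m n \<in> l2_space D" for m n
    using Ab by (intro l2_norm_le_of_bound(1)[OF Dl borel_imp_lebesgue_on]) auto
  define a' where "a' m y = lim (\<lambda>n. A m n y)" for m y
  have lim: "(\<lambda>n. A m n y) \<longlonglongrightarrow> a' m y" for m y unfolding a'_def using conv by (simp add: convergent_LIMSEQ_iff)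
  have a'm[measurable]: "a' m \<in> borel_measurable borel" for m unfolding a'_def[abs_def] by measurable
  have a'b: "\<bar>a' m y\<bar> \<le> K / (1 / real m) ^ DIM('a)" for m y
    using lim[of m y] Ab by (intro LIMSEQ_le_const2[OF tendsto_rabs[OF lim]]) auto
  have a'l: "a' m \<in> l2_space D" for m
    using a'b by (intro l2_norm_le_of_bound(1)[OF Dl borel_imp_lebesgue_on]) auto
  \<comment> \<open>For fixed \<open>m\<close> the averages converge at every point and share a
    constant bound, so they converge in L2 on the bounded domain.\<close>
  have Aconv: "(\<lambda>n. l2_norm D (\<lambda>x. A m n x - a' m x)) \<longlonglongrightarrow> 0" for m
  proof -
    define c where "c = K / (1 / real m) ^ DIM('a)"
    have "(\<lambda>n. LINT x|lebesgue_on D. (A m n x - a' m x) * (A m n x - a' m x)) \<longlonglongrightarrow> (LINT x|lebesgue_on D. 0)"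
    proof (rule integral_dominated_convergence)
      have "(\<lambda>x. (2 * c)\<^sup>2 :: real) \<in> l2_space D" using l2_norm_le_of_bound(1)[OF Dl, of "\<lambda>_. (2 * c)\<^sup>2" "(2 * c)\<^sup>2"] by simp
      then show "integrable (lebesgue_on D) (\<lambda>x. (2 * c)\<^sup>2)" by (rule l2_integrable[OF Dl])
      show "AE x in lebesgue_on D. norm ((A m n x - a' m x) * (A m n x - a' m x)) \<le> (2 * c)\<^sup>2" for n
      proof (rule AE_I2)
        fix x
        have "\<bar>A m n x - a' m x\<bar> \<le> \<bar>2 * c\<bar>" using Ab[of m n x] a'b[of m x] unfolding c_def[symmetric] by linarith
        then show "norm ((A m n x - a' m x) * (A m n x - a' m x)) \<le> (2 * c)\<^sup>2"
          unfolding abs_le_square_iff by (simp add: power2_eq_square)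
      qed
      show "AE x in lebesgue_on D. (\<lambda>n. (A m n x - a' m x) * (A m n x - a' m x)) \<longlonglongrightarrow> 0"
        using tendsto_mult[OF LIM_zero[OF lim] LIM_zero[OF lim]] by (intro AE_I2) simp
    qed (auto intro!: borel_imp_lebesgue_on)
    then have "(\<lambda>n. sqrt (l2_inner D (\<lambda>x. A m n x - a' m x) (\<lambda>x. A m n x - a' m x))) \<longlonglongrightarrow> sqrt 0"
      unfolding l2_inner_def by (intro tendsto_real_sqrt) simp
    then show ?thesis by (simp add: l2_norm_def)
  qed
  define \<Gamma>' where "\<Gamma>' = max 0 \<Gamma>"
  have \<Gamma>': "\<Gamma>' \<ge> 0" "\<Gamma> \<le> \<Gamma>'" by (auto simp: \<Gamma>'_def)
  define C where "C = 2 ^ DIM('a) * (norm (One :: 'a))\<^sup>2 * \<Gamma>'"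
  have near: "l2_norm D (\<lambda>x. \<psi> n x - A m n x) \<le> sqrt C / real m" if m: "m > 0" for n m
  proof -
    have dl: "(\<lambda>x. \<psi> n x - A m n x) \<in> l2_space D" by (intro l2.diff \<psi> Al)
    have "energy (\<psi> n) \<le> ennreal (\<Gamma>')"
      unfolding energy_eq[OF Dl \<psi>(1)] using b1[of "r n"] \<Gamma>' by (intro ennreal_leI) (simp add: \<psi>_def)
    then have e: "(\<integral>\<^sup>+y. ennreal ((\<psi> n y - A m n y)\<^sup>2) \<partial>lborel)
        \<le> ennreal (2 ^ DIM('a) * (norm (One :: 'a))\<^sup>2 / (real m)\<^sup>2) * ennreal (\<Gamma>')"
      unfolding A_def by (rule order_trans[OF cell_average_approx[OF \<psi>(1) m] mult_left_mono[OF _ zero_le]])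
    have "ennreal (l2_inner D (\<lambda>x. \<psi> n x - A m n x) (\<lambda>x. \<psi> n x - A m n x))
       = (\<integral>\<^sup>+y. ennreal ((\<psi> n y - A m n y)\<^sup>2) \<partial>lebesgue_on D)"
      unfolding l2_inner_def inner_real_def power2_eq_square
      using l2_inner_integrable[OF dl dl] by (intro nn_integral_eq_integral[symmetric]) auto
    also have "\<dots> = (\<integral>\<^sup>+y. ennreal ((\<psi> n y - A m n y)\<^sup>2) * indicator D y \<partial>lebesgue)"
      using D' by (simp add: nn_integral_restrict_space)
    also have "\<dots> = (\<integral>\<^sup>+y. ennreal ((\<psi> n y - A m n y)\<^sup>2) * indicator D y \<partial>lborel)"
      by (rule nn_integral_completion) measurable
    also have "\<dots> \<le> (\<integral>\<^sup>+y. ennreal ((\<psi> n y - A m n y)\<^sup>2) \<partial>lborel)"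
      by (intro nn_integral_mono) (auto simp: indicator_def)
    also have "\<dots> \<le> ennreal (C / (real m)\<^sup>2)"
      using e \<Gamma>' by (simp add: ennreal_mult[symmetric] C_def)
    finally have "l2_inner D (\<lambda>x. \<psi> n x - A m n x) (\<lambda>x. \<psi> n x - A m n x) \<le> C / (real m)\<^sup>2"
      using \<Gamma>' by (simp add: C_def)
    from real_sqrt_le_mono[OF this] show ?thesis using m by (simp add: l2_norm_def real_sqrt_divide)
  qed
  have "\<exists>N. \<forall>i\<ge>N. \<forall>j\<ge>N. l2_norm D (\<lambda>x. \<psi> i x - \<psi> j x) < e" if e: "e > 0" for e
  proof -
    \<comment> \<open>The distance of two members is split into four parts of size below
      \<open>e / 4\<close>: two deviations from averages and two deviations of averages from their
      limit.\<close>
    obtain m where m: "m > 0" "sqrt C / real m < e / 4"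
    proof -
      obtain m where "sqrt C * 4 / e < real m" using reals_Archimedean2 by blast
      moreover have "0 \<le> sqrt C * 4 / e" using e \<Gamma>' by (simp add: C_def)
      ultimately have m: "real m > 0" by linarith
      have "sqrt C / real m < e / 4" using \<open>sqrt C * 4 / e < real m\<close> m e by (simp add: field_simps)
      with m have "m > 0" "sqrt C / real m < e / 4" by simp_all
      then show ?thesis by (rule that)
    qed
    obtain N where N: "\<And>n. n \<ge> N \<Longrightarrow> l2_norm D (\<lambda>x. A m n x - a' m x) < e / 4"
      using LIMSEQ_D[OF Aconv[of m], of "e / 4"] e by (auto simp: l2_norm_def l2.nonneg l2.diff Al a'l)
    have "l2_norm D (\<lambda>x. \<psi> i x - \<psi> j x) < e" if ij: "i \<ge> N" "j \<ge> N" for i j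
    proof -
      note T = l2.triangle_diff[where D = D, folded l2_norm_def]
      have sym: "l2_norm D (\<lambda>x. A m j x - \<psi> j x) = l2_norm D (\<lambda>x. \<psi> j x - A m j x)"
        "l2_norm D (\<lambda>x. a' m x - A m j x) = l2_norm D (\<lambda>x. A m j x - a' m x)"
        unfolding l2_norm_def by (simp_all add: l2.norm_minus[OF \<psi>(2) Al] l2.norm_minus[OF a'l Al])
      have "l2_norm D (\<lambda>x. \<psi> i x - \<psi> j x) \<le> l2_norm D (\<lambda>x. \<psi> i x - A m i x) + l2_norm D (\<lambda>x. A m i x - \<psi> j x)"
        by (intro T \<psi> Al)
      also have "l2_norm D (\<lambda>x. A m i x - \<psi> j x) \<le> l2_norm D (\<lambda>x. A m i x - a' m x) + l2_norm D (\<lambda>x. a' m x - \<psi> j x)"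
        by (intro T \<psi> Al a'l)
      also have "l2_norm D (\<lambda>x. a' m x - \<psi> j x) \<le> l2_norm D (\<lambda>x. a' m x - A m j x) + l2_norm D (\<lambda>x. A m j x - \<psi> j x)"
        by (intro T \<psi> Al a'l)
      finally show ?thesis
        using near[OF m(1), of i] near[OF m(1), of j] m(2) N[OF ij(1)] N[OF ij(2)] sym by linarith
    qed
    then show ?thesis by blast
  qed
  then show ?thesis using r(1) unfolding \<psi>_def by (intro exI[of _ r] conjI allI impI)
qed


subsection \<open>The first eigenvalue\<close>

lemma dirichlet_form_test:
  assumes D: "open D" "bounded D" and \<phi>: "\<phi> \<in> test_functions D"
  shows "dirichlet_form D \<phi> \<phi> = l2_inner D (grad \<phi>) (grad \<phi>)"
proof -
  have Dl: "D \<in> lmeasurable" using D by (simp add: lmeasurable_open)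
  note h = test_functions_H10[OF D \<phi>]
  show ?thesis unfolding dirichlet_form_def
    by (intro l2_inner_cong_AE h(2) H10D(2)[OF h(1)] test_functions_l2(2)[OF Dl \<phi>])
qed

text \<open>Were all test functions orthogonal to the constant 1, that constant would vanish almost
  everywhere on a nonempty open set. Thus the infimum of the Rayleigh quotient is taken over a
  nonempty set.\<close>

lemma normalised_test_function_exists:
  fixes D :: "'a::euclidean_space set"
  assumes D: "open D" "bounded D" "D \<noteq> {}"
  shows "\<exists>\<phi>\<in>test_functions D. l2_inner D \<phi> \<phi> = 1"
proof -
  have Dl: "D \<in> lmeasurable" using D by (simp add: lmeasurable_open)
  then have D': "D \<in> sets lebesgue" by auto
  have one: "(\<lambda>x::'a. 1::real) \<in> l2_space D" using l2_norm_le_of_bound(1)[OF Dl, of "\<lambda>_. 1::real" 1] by simp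
  have "\<not> l2_eq D (\<lambda>x. 1::real) (\<lambda>_. 0)"
  proof
    assume "l2_eq D (\<lambda>x. 1::real) (\<lambda>_. 0)"
    then have "AE x in lebesgue. x \<notin> D" using D' by (simp add: l2_eq_def AE_restrict_space_iff)
    then have "D \<in> null_sets lebesgue" using D' by (simp add: AE_iff_null_sets)
    then show False using D open_not_negligible[of D] by (simp add: negligible_iff_null_sets)
  qed
  then obtain \<phi> where \<phi>: "\<phi> \<in> test_functions D" "l2_inner D (\<lambda>x. 1) \<phi> \<noteq> 0"
    using fundamental_lemma[OF D(1,2) one] by blast
  note l = test_functions_l2(1)[OF Dl \<phi>(1)]
  have "l2_inner D \<phi> \<phi> \<noteq> 0"
    using l2.Cauchy_Schwarz[OF one l] \<phi>(2) by auto
  then have p: "l2_inner D \<phi> \<phi> > 0" using l2.nonneg[OF l] by simp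
  define c where "c = 1 / sqrt (l2_inner D \<phi> \<phi>)"
  have "(\<lambda>x. c * \<phi> x + 0 * \<phi> x) \<in> test_functions D" by (intro test_functions_lin \<phi>)
  then have c\<phi>: "(\<lambda>x. c *\<^sub>R \<phi> x) \<in> test_functions D" by simp
  have "l2_inner D (\<lambda>x. c *\<^sub>R \<phi> x) (\<lambda>x. c *\<^sub>R \<phi> x) = c * (c * l2_inner D \<phi> \<phi>)"
    using l l2.scale[OF l, of c] by (simp only: l2.scale_left l2.scale_right)
  also have "\<dots> = 1" using p by (simp add: c_def)
  finally show ?thesis using c\<phi> by blast
qed

text \<open>
  The infimum \<open>m\<close> of the Rayleigh quotient is attained: along a minimising sequence that converges
  in $L^2$ the gradients form a Cauchy sequence, by the parallelogram identity. The minimiser is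
  an eigenfunction since the form \<open>B\<close> below is positive semidefinite and vanishes there.
\<close>

lemma Poincare:
  fixes D :: "'a::euclidean_space set"
  assumes D: "open D" "bounded D" "D \<noteq> {}" and v: "v \<in> H10 D"
  shows "lambda1 D * l2_inner D v v \<le> dirichlet_form D v v"
proof -
  have Dl: "D \<in> lmeasurable" using D by (simp add: lmeasurable_open)
  interpret H: semi_inner "H10 D" "dirichlet_form D" by (rule semi_inner_H10[OF D(1,2)])
  define R where "R = {dirichlet_form D \<phi> \<phi> |\<phi>. \<phi> \<in> test_functions D \<and> l2_inner D \<phi> \<phi> = 1}"
  note tH = test_functions_H10(1)[OF D(1,2)]
  have Rne: "R \<noteq> {}" using normalised_test_function_exists[OF D] by (auto simp: R_def)
  have Rb: "bdd_below R" unfolding R_def by (rule bdd_belowI[of _ 0]) (auto intro: H.nonneg tH)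
  define m where "m = Inf R"
  have mt: "m * l2_inner D \<phi> \<phi> \<le> dirichlet_form D \<phi> \<phi>" if \<phi>: "\<phi> \<in> test_functions D" for \<phi>
  proof (cases "l2_inner D \<phi> \<phi> = 0")
    case True
    then show ?thesis using H.nonneg[OF tH[OF \<phi>]] by simp
  next
    case False
    note l = test_functions_l2(1)[OF Dl \<phi>]
    have p: "l2_inner D \<phi> \<phi> > 0" using False l2.nonneg[OF l] by simp
    define c where "c = 1 / sqrt (l2_inner D \<phi> \<phi>)"
    have c2: "c * (c * l2_inner D \<phi> \<phi>) = 1" using p by (simp add: c_def)
    have "(\<lambda>x. c * \<phi> x + 0 * \<phi> x) \<in> test_functions D" by (intro test_functions_lin \<phi>)
    then have c\<phi>: "(\<lambda>x. c *\<^sub>R \<phi> x) \<in> test_functions D" by simp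
    have "l2_inner D (\<lambda>x. c *\<^sub>R \<phi> x) (\<lambda>x. c *\<^sub>R \<phi> x) = c * (c * l2_inner D \<phi> \<phi>)"
      using l l2.scale[OF l, of c] by (simp only: l2.scale_left l2.scale_right)
    moreover have "dirichlet_form D (\<lambda>x. c *\<^sub>R \<phi> x) (\<lambda>x. c *\<^sub>R \<phi> x) = c * (c * dirichlet_form D \<phi> \<phi>)"
      using tH[OF \<phi>] H.scale[OF tH[OF \<phi>], of c] by (simp only: H.scale_left H.scale_right)
    ultimately have "c * (c * dirichlet_form D \<phi> \<phi>) \<in> R"
      unfolding R_def using c\<phi> c2 by (intro CollectI exI[of _ "\<lambda>x. c *\<^sub>R \<phi> x"]) simp
    then have "m \<le> c * (c * dirichlet_form D \<phi> \<phi>)" unfolding m_def using Rb by (rule cInf_lower)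
    also have "c * (c * dirichlet_form D \<phi> \<phi>) = dirichlet_form D \<phi> \<phi> / l2_inner D \<phi> \<phi>"
      using p by (simp add: c_def)
    finally show ?thesis using p by (simp add: field_simps)
  qed
  \<comment> \<open>By density of the test functions: both sides are limits along an approximating
    sequence.\<close>
  have mH: "m * l2_inner D u u \<le> dirichlet_form D u u" if u: "u \<in> H10 D" for u
  proof -
    obtain \<phi> where \<phi>: "\<And>n. \<phi> n \<in> test_functions D" "(\<lambda>n. l2_norm D (\<lambda>x. \<phi> n x - u x)) \<longlonglongrightarrow> 0"
        "(\<lambda>n. l2_norm D (\<lambda>x. grad (\<phi> n) x - weak_grad D u x)) \<longlonglongrightarrow> 0" using H10D(3)[OF u] by blast
    have "(\<lambda>n. sqrt (l2_inner D (\<phi> n) (\<phi> n))) \<longlonglongrightarrow> sqrt (l2_inner D u u)"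
      using \<phi>(2) by (intro l2.tendsto_norm test_functions_l2[OF Dl \<phi>(1)] H10D[OF u]) (simp add: l2_norm_def)
    from tendsto_mult[OF this this] have "(\<lambda>n. l2_inner D (\<phi> n) (\<phi> n)) \<longlonglongrightarrow> l2_inner D u u"
      by (simp add: l2.nonneg test_functions_l2[OF Dl \<phi>(1)] H10D[OF u])
    then have 1: "(\<lambda>n. m * l2_inner D (\<phi> n) (\<phi> n)) \<longlonglongrightarrow> m * l2_inner D u u" by (rule tendsto_mult_left)
    have "(\<lambda>n. sqrt (l2_inner D (grad (\<phi> n)) (grad (\<phi> n)))) \<longlonglongrightarrow> sqrt (l2_inner D (weak_grad D u) (weak_grad D u))"
      using \<phi>(3) by (intro l2.tendsto_norm test_functions_l2[OF Dl \<phi>(1)] H10D[OF u]) (simp add: l2_norm_def)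
    from tendsto_mult[OF this this] have 2: "(\<lambda>n. l2_inner D (grad (\<phi> n)) (grad (\<phi> n))) \<longlonglongrightarrow> dirichlet_form D u u"
      by (simp add: l2.nonneg test_functions_l2[OF Dl \<phi>(1)] H10D[OF u] dirichlet_form_def)
    show ?thesis
      using mt[OF \<phi>(1)] by (intro LIMSEQ_le[OF 1 2]) (simp add: dirichlet_form_test[OF D(1,2) \<phi>(1)])
  qed
  have "\<exists>\<phi>\<in>test_functions D. l2_inner D \<phi> \<phi> = 1 \<and> dirichlet_form D \<phi> \<phi> < m + 1 / real (Suc n)" for n
  proof -
    have "\<exists>r\<in>R. r < m + 1 / real (Suc n)" unfolding m_def by (rule cInf_lessD[OF Rne]) simp
    then show ?thesis by (auto simp: R_def)
  qed
  then obtain \<phi> where \<phi>: "\<And>n. \<phi> n \<in> test_functions D" "\<And>n. l2_inner D (\<phi> n) (\<phi> n) = 1"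
    "\<And>n. dirichlet_form D (\<phi> n) (\<phi> n) < m + 1 / real (Suc n)" by metis
  have "l2_inner D (grad (\<phi> n)) (grad (\<phi> n)) \<le> m + 1" for n
  proof -
    have "1 / real (Suc n) \<le> 1" by simp
    then show ?thesis using \<phi>(3)[of n] unfolding dirichlet_form_test[OF D(1,2) \<phi>(1)] by linarith
  qed
  from Rellich[of D \<phi>, OF D(1,2) \<phi>(1) _ this] \<phi>(2)
  obtain r :: "nat \<Rightarrow> nat" where r: "strict_mono r" "\<And>e. e > 0 \<Longrightarrow> \<exists>N. \<forall>i\<ge>N. \<forall>j\<ge>N. l2_norm D (\<lambda>x. \<phi> (r i) x - \<phi> (r j) x) < e" by auto
  define \<psi> where "\<psi> n = \<phi> (r n)" for n
  have \<psi>: "\<psi> n \<in> test_functions D" "l2_inner D (\<psi> n) (\<psi> n) = 1" for n using \<phi> by (auto simp: \<psi>_def)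
  note \<psi>l = test_functions_l2[OF Dl \<psi>(1)] and \<psi>H = tH[OF \<psi>(1)]
  have \<psi>m: "dirichlet_form D (\<psi> n) (\<psi> n) < m + 1 / real (Suc n)" for n
  proof -
    have "1 / real (Suc (r n)) \<le> 1 / real (Suc n)" using seq_suble[OF r(1), of n] by (simp add: field_simps)
    then show ?thesis using \<phi>(3)[of "r n"] by (simp add: \<psi>_def)
  qed
  \<comment> \<open>Each form value exceeds \<open>m\<close> by less than
    \<open>1 / real (Suc n)\<close>, and by \<open>mH\<close> the form of the sum is at least
    \<open>m\<close> times its squared L2 norm; the multiples of \<open>m\<close> cancel up to the
    last term.\<close>
  have par: "l2_inner D (\<lambda>x. grad (\<psi> i) x - grad (\<psi> j) x) (\<lambda>x. grad (\<psi> i) x - grad (\<psi> j) x)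
      \<le> 2 / real (Suc i) + 2 / real (Suc j) + m * (l2_norm D (\<lambda>x. \<psi> i x - \<psi> j x))\<^sup>2" for i j
  proof -
    have "(\<lambda>x. 1 * \<psi> i x + (-1) * \<psi> j x) \<in> test_functions D" by (intro test_functions_lin \<psi>)
    then have d: "(\<lambda>x. \<psi> i x - \<psi> j x) \<in> test_functions D" by simp
    have "grad (\<lambda>x. \<psi> i x - \<psi> j x) = (\<lambda>x. grad (\<psi> i) x - grad (\<psi> j) x)"
      using grad_lin[OF test_functionsD(1)[OF \<psi>(1)[of i]] test_functionsD(1)[OF \<psi>(1)[of j]], of 1 "-1"] by (intro ext) simp
    then have "l2_inner D (\<lambda>x. grad (\<psi> i) x - grad (\<psi> j) x) (\<lambda>x. grad (\<psi> i) x - grad (\<psi> j) x)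
       = dirichlet_form D (\<lambda>x. \<psi> i x - \<psi> j x) (\<lambda>x. \<psi> i x - \<psi> j x)"
      using dirichlet_form_test[OF D(1,2) d] by simp
    also have "\<dots> = 2 * dirichlet_form D (\<psi> i) (\<psi> i) + 2 * dirichlet_form D (\<psi> j) (\<psi> j)
        - dirichlet_form D (\<lambda>x. \<psi> i x + \<psi> j x) (\<lambda>x. \<psi> i x + \<psi> j x)"
      by (rule H.parallelogram[OF \<psi>H \<psi>H])
    finally have 1: "l2_inner D (\<lambda>x. grad (\<psi> i) x - grad (\<psi> j) x) (\<lambda>x. grad (\<psi> i) x - grad (\<psi> j) x) = \<dots>" .
    have "m * l2_inner D (\<lambda>x. \<psi> i x + \<psi> j x) (\<lambda>x. \<psi> i x + \<psi> j x)
        \<le> dirichlet_form D (\<lambda>x. \<psi> i x + \<psi> j x) (\<lambda>x. \<psi> i x + \<psi> j x)"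
      by (intro mH H.add \<psi>H)
    moreover have "l2_inner D (\<lambda>x. \<psi> i x + \<psi> j x) (\<lambda>x. \<psi> i x + \<psi> j x) = 4 - (l2_norm D (\<lambda>x. \<psi> i x - \<psi> j x))\<^sup>2"
      using l2.parallelogram[OF \<psi>l(1) \<psi>l(1), of i j] l2.nonneg[OF l2.diff[OF \<psi>l(1) \<psi>l(1)], of i j]
      by (simp add: l2_norm_def \<psi>)
    ultimately have "m * 4 - m * (l2_norm D (\<lambda>x. \<psi> i x - \<psi> j x))\<^sup>2
        \<le> dirichlet_form D (\<lambda>x. \<psi> i x + \<psi> j x) (\<lambda>x. \<psi> i x + \<psi> j x)"
      by (simp add: right_diff_distrib)
    then show ?thesis unfolding 1 using \<psi>m[of i] \<psi>m[of j] by simp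
  qed
  have "\<exists>N. \<forall>i\<ge>N. \<forall>j\<ge>N. l2_norm D (\<lambda>x. grad (\<psi> i) x - grad (\<psi> j) x) < e" if e: "e > 0" for e
  proof -
    \<comment> \<open>Chosen so that \<bar>m\<bar> times its square is at most half the square of
      \<open>e\<close>, the other half being left for the two excesses; adding 1 covers
      \<open>m = 0\<close>.\<close>
    define \<delta> where "\<delta> = sqrt (e\<^sup>2 / (2 * (\<bar>m\<bar> + 1)))"
    have \<delta>: "\<delta> > 0" "m * \<delta>\<^sup>2 \<le> e\<^sup>2 / 2" using e by (auto simp: \<delta>_def field_simps abs_if)
    obtain N1 where N1: "\<And>i j. i \<ge> N1 \<Longrightarrow> j \<ge> N1 \<Longrightarrow> l2_norm D (\<lambda>x. \<psi> i x - \<psi> j x) < \<delta>"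
      using r(2)[OF \<delta>(1)] unfolding \<psi>_def by blast
    obtain N2 where N2: "8 / e\<^sup>2 < real N2" using reals_Archimedean2 by blast
    have small: "2 / real (Suc i) < e\<^sup>2 / 4" if "i \<ge> N2" for i
    proof -
      have "8 / e\<^sup>2 < real (Suc i)" using N2 that by simp
      then show ?thesis using e by (simp add: field_simps)
    qed
    have "l2_norm D (\<lambda>x. grad (\<psi> i) x - grad (\<psi> j) x) < e" if ij: "i \<ge> max N1 N2" "j \<ge> max N1 N2" for i j
    proof -
      let ?n = "l2_norm D (\<lambda>x. \<psi> i x - \<psi> j x)"
      have n: "0 \<le> ?n" "?n < \<delta>" using N1[of i j] ij by (auto simp: l2_norm_def l2.nonneg l2.diff \<psi>l)
      have "m * ?n\<^sup>2 \<le> \<bar>m\<bar> * ?n\<^sup>2" by (intro mult_right_mono) auto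
      also have "\<dots> \<le> \<bar>m\<bar> * \<delta>\<^sup>2" using n by (intro mult_left_mono power_mono) auto
      also have "\<dots> \<le> e\<^sup>2 / 2" using e by (simp add: \<delta>_def field_simps)
      finally have "l2_inner D (\<lambda>x. grad (\<psi> i) x - grad (\<psi> j) x) (\<lambda>x. grad (\<psi> i) x - grad (\<psi> j) x) < e\<^sup>2"
        using par[of i j] small[of i] small[of j] ij by simp
      from real_sqrt_less_mono[OF this] show ?thesis using e by (simp add: l2_norm_def)
    qed
    then show ?thesis by blast
  qed
  from l2_complete[OF Dl \<psi>l(2) this] obtain g where g: "g \<in> l2_space D" "(\<lambda>n. l2_norm D (\<lambda>x. grad (\<psi> n) x - g x)) \<longlonglongrightarrow> 0" by blast
  have c\<psi>: "\<exists>N. \<forall>i\<ge>N. \<forall>j\<ge>N. l2_norm D (\<lambda>x. \<psi> i x - \<psi> j x) < e" if "e > 0" for e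
    unfolding \<psi>_def by (rule r(2)[OF that])
  from l2_complete[OF Dl \<psi>l(1) c\<psi>] obtain u where u: "u \<in> l2_space D" "(\<lambda>n. l2_norm D (\<lambda>x. \<psi> n x - u x)) \<longlonglongrightarrow> 0" by blast
  note uH = H10_I[OF D(1,2) \<psi>(1) u(1) g(1) u(2) g(2)]
  have "(\<lambda>n. sqrt (l2_inner D (\<psi> n) (\<psi> n))) \<longlonglongrightarrow> sqrt (l2_inner D u u)"
    using u by (intro l2.tendsto_norm \<psi>l) (simp_all add: l2_norm_def)
  then have u1: "l2_inner D u u = 1" by (simp add: \<psi> LIMSEQ_const_iff)
  have ug: "dirichlet_form D u u = l2_inner D g g"
    unfolding dirichlet_form_def by (intro l2_inner_cong_AE uH g)
  have "(\<lambda>n. sqrt (l2_inner D (grad (\<psi> n)) (grad (\<psi> n)))) \<longlonglongrightarrow> sqrt (l2_inner D g g)"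
    using g by (intro l2.tendsto_norm \<psi>l) (simp_all add: l2_norm_def)
  from tendsto_mult[OF this this] have "(\<lambda>n. dirichlet_form D (\<psi> n) (\<psi> n)) \<longlonglongrightarrow> dirichlet_form D u u"
    by (simp add: l2.nonneg \<psi>l g ug dirichlet_form_test[OF D(1,2) \<psi>(1)])
  moreover have "(\<lambda>n. m + inverse (real (Suc n))) \<longlonglongrightarrow> m + 0"
    by (intro tendsto_add tendsto_const LIMSEQ_inverse_real_of_nat)
  ultimately have "dirichlet_form D u u \<le> m"
    using \<psi>m by (intro LIMSEQ_le[of _ _ _ "m"]) (auto simp: inverse_eq_divide less_imp_le)
  then have um: "dirichlet_form D u u = m" using mH[OF uH(1)] u1 by simp
  define B where "B f g = dirichlet_form D f g - m * l2_inner D f g" for f g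
  interpret B: semi_inner "H10 D" B
  proof
    fix f g a b assume fg: "f \<in> H10 D" "g \<in> H10 D"
    show "(\<lambda>x. a *\<^sub>R f x + b *\<^sub>R g x) \<in> H10 D" by (rule H.lin[OF fg])
    show "B f g = B g f" using H.sym[OF fg] l2.sym[OF H10D(1)[OF fg(1)] H10D(1)[OF fg(2)]] by (simp add: B_def)
    show "0 \<le> B f f" using mH[OF fg(1)] by (simp add: B_def)
    fix h assume h: "h \<in> H10 D"
    show "B (\<lambda>x. a *\<^sub>R f x + b *\<^sub>R g x) h = a * B f h + b * B g h"
      unfolding B_def H.lin_left[OF fg h] l2.lin_left[OF H10D(1)[OF fg(1)] H10D(1)[OF fg(2)] H10D(1)[OF h]]
      by (simp add: algebra_simps)
  qed
  have Bu: "B u u = 0" using um u1 by (simp add: B_def)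
  \<comment> \<open>Cauchy-Schwarz for the semidefinite \<open>B\<close> makes \<open>u\<close>
    orthogonal to everything as soon as \<open>B u u = 0\<close>; this is the eigenvalue equation in
    weak form.\<close>
  have eq: "dirichlet_form D u w = m * l2_inner D u w" if "w \<in> H10 D" for w
    using B.Cauchy_Schwarz[OF uH(1) that] Bu by (simp add: B_def)
  have "dirichlet_eigenvalue D m"
    unfolding dirichlet_eigenvalue_def dirichlet_laplacian_def
  proof (intro exI conjI ballI)
    show "\<not> l2_eq D u (\<lambda>_. 0)" using u1 l2_inner_eq_0_iff[OF u(1)] by simp
    show "(\<lambda>x. m * u x) \<in> l2_space D" using l2.scale[OF u(1), of m] by simp
    fix w assume w: "w \<in> H10 D"
    show "l2_inner D (weak_grad D u) (weak_grad D w) = l2_inner D (\<lambda>x. m * u x) w"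
      using eq[OF w] l2.scale_left[OF u(1) H10D(1)[OF w], of m] by (simp add: dirichlet_form_def)
  qed (rule uH(1))
  \<comment> \<open>Every eigenvalue is the Rayleigh quotient of its eigenfunction, so
    \<open>m\<close> is the least one and the \<open>LEAST\<close> in \<open>lambda1\<close> has a
    value.\<close>
  moreover have "m \<le> l" if ev: "dirichlet_eigenvalue D l" for l
  proof -
    obtain w where w: "\<not> l2_eq D w (\<lambda>_. 0)" "dirichlet_laplacian D w (\<lambda>x. l * w x)"
      using ev by (auto simp: dirichlet_eigenvalue_def)
    then have wH: "w \<in> H10 D" by (simp add: dirichlet_laplacian_def)
    then have "dirichlet_form D w w = l * l2_inner D w w"
      using w(2) l2.scale_left[OF H10D(1)[OF wH] H10D(1)[OF wH], of l] by (simp add: dirichlet_laplacian_def dirichlet_form_def)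
    moreover have "l2_inner D w w > 0"
      using w(1) l2_inner_eq_0_iff[OF H10D(1)[OF wH]] l2.nonneg[OF H10D(1)[OF wH]] by simp
    ultimately show ?thesis using mH[OF wH] by simp
  qed
  ultimately have "lambda1 D = m" unfolding lambda1_def by (rule Least_equality)
  with mH[OF v] show ?thesis by simp
qed

subsection \<open>Finite element functions\<close>

text \<open>Induction on the number of sets. Let \<open>t\<close> be the last point of a set
  containing \<open>a\<close>: up to \<open>t\<close> that set gives the estimate, and beyond
  \<open>t\<close> the remaining sets cover the interval.\<close>

lemma Lipschitz_closed_cover_real:
  fixes g :: "real \<Rightarrow> real"
  assumes "finite \<C>" "\<And>C. C \<in> \<C> \<Longrightarrow> closed C" "{a..b} \<subseteq> \<Union>\<C>" "a \<le> b"
    and "continuous_on {a..b} g"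
    and "\<And>C s t. C \<in> \<C> \<Longrightarrow> s \<in> C \<Longrightarrow> t \<in> C \<Longrightarrow> \<bar>g s - g t\<bar> \<le> L * \<bar>s - t\<bar>"
  shows "\<bar>g b - g a\<bar> \<le> L * (b - a)"
  using assms
proof (induction "card \<C>" arbitrary: \<C> a rule: less_induct)
  case less
  obtain C where C: "C \<in> \<C>" "a \<in> C" using less.prems(3,4) by fastforce
  have cl: "closed (C \<inter> {a..b})" using less.prems(2)[OF C(1)] by (intro closed_Int) auto
  define t where "t = Sup (C \<inter> {a..b})"
  have bdd: "bdd_above (C \<inter> {a..b})" by (rule bdd_aboveI[of _ b]) auto
  have ne: "C \<inter> {a..b} \<noteq> {}" using C less.prems(4) by auto
  have t: "t \<in> C" "t \<in> {a..b}" using closed_contains_Sup[OF ne bdd cl] by (auto simp: t_def)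
  have ga: "\<bar>g t - g a\<bar> \<le> L * (t - a)" using less.prems(6)[OF C(1) t(1) C(2)] t(2) by simp
  have gb: "\<bar>g b - g t\<bar> \<le> L * (b - t)"
  proof (cases "t = b")
    case False
    then have tb: "t < b" using t by auto
    \<comment> \<open>The point \<open>t\<close> itself need not lie in any other set, so the
      induction hypothesis is used from \<open>s > t\<close> only; continuity lets \<open>s\<close>
      tend to \<open>t\<close>.\<close>
    have h: "0 \<le> L * (b - s) - \<bar>g b - g s\<bar>" if s: "s \<in> {t<..b}" for s
    proof -
      have "card (\<C> - {C}) < card \<C>" using C(1) less.prems(1) by (intro card_Diff1_less)
      moreover have "{s..b} \<subseteq> \<Union>(\<C> - {C})"
      proof
        fix x assume x: "x \<in> {s..b}"
        have "x \<notin> C"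
        proof
          assume "x \<in> C"
          then have "x \<le> t" unfolding t_def using x s t by (intro cSup_upper bdd) auto
          then show False using x s by auto
        qed
        moreover have "x \<in> {a..b}" using x s t by auto
        then have "x \<in> \<Union>\<C>" using less.prems(3) by blast
        ultimately show "x \<in> \<Union>(\<C> - {C})" by auto
      qed
      moreover have "continuous_on {s..b} g" using s t by (intro continuous_on_subset[OF less.prems(5)]) auto
      ultimately have "\<bar>g b - g s\<bar> \<le> L * (b - s)"
        using less.prems s by (intro less.hyps[of "\<C> - {C}" s]) auto
      then show ?thesis by simp
    qed
    have "closure {t<..b} = {t..b}" using tb by simp
    then have "0 \<le> L * (b - t) - \<bar>g b - g t\<bar>"
      using t tb by (intro continuous_ge_on_closure[of "{t<..b}" "\<lambda>s. L * (b - s) - \<bar>g b - g s\<bar>" t 0] h)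
        (auto intro!: continuous_intros continuous_on_subset[OF less.prems(5)])
    then show ?thesis by simp
  qed simp
  have "\<bar>g b - g a\<bar> \<le> L * (b - t) + L * (t - a)" using ga gb by linarith
  then show ?case by (simp add: algebra_simps)
qed

text \<open>Restrict to the segment between the points. Cells need not be convex, so the segment may
  enter and leave one of them repeatedly, and the cover of the parameter interval consists of
  general closed sets.\<close>

lemma Lipschitz_closed_cover:
  fixes f :: "'a::euclidean_space \<Rightarrow> real"
  assumes fin: "finite \<C>" and cl: "\<And>C. C \<in> \<C> \<Longrightarrow> closed C" and cov: "\<Union>\<C> = UNIV"
    and cont: "continuous_on UNIV f"
    and L: "\<And>C x y. C \<in> \<C> \<Longrightarrow> x \<in> C \<Longrightarrow> y \<in> C \<Longrightarrow> \<bar>f x - f y\<bar> \<le> L * norm (x - y)"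
  shows "\<bar>f x - f y\<bar> \<le> L * norm (x - y)"
proof -
  define p where "p t = y + t *\<^sub>R (x - y)" for t :: real
  have pc: "continuous_on S p" for S unfolding p_def by (intro continuous_intros)
  have "\<bar>f (p 1) - f (p 0)\<bar> \<le> (L * norm (x - y)) * (1 - 0)"
  proof (rule Lipschitz_closed_cover_real[where \<C> = "(\<lambda>C. p -` C) ` \<C>"])
    show "finite ((\<lambda>C. p -` C) ` \<C>)" using fin by simp
    show "closed C" if "C \<in> (\<lambda>C. p -` C) ` \<C>" for C
      using that cl pc[of UNIV] by (auto simp: continuous_on_closed_vimage)
    show "{0..1} \<subseteq> \<Union>((\<lambda>C. p -` C) ` \<C>)" using cov by auto
    show "continuous_on {0..1} (\<lambda>t. f (p t))" by (rule continuous_on_compose2[OF cont pc]) auto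
    fix C s t assume "C \<in> (\<lambda>C. p -` C) ` \<C>" "s \<in> C" "t \<in> C"
    then have "\<bar>f (p s) - f (p t)\<bar> \<le> L * norm (p s - p t)" using L by auto
    also have "p s - p t = (s - t) *\<^sub>R (x - y)" by (simp add: p_def algebra_simps)
    finally show "\<bar>f (p s) - f (p t)\<bar> \<le> L * norm (x - y) * \<bar>s - t\<bar>" by (simp add: ac_simps)
  qed simp
  then show ?thesis by (simp add: p_def)
qed

lemma l2_dominated_convergence:
  fixes s :: "nat \<Rightarrow> 'a::euclidean_space \<Rightarrow> 'b::euclidean_space"
  assumes D: "D \<in> lmeasurable" and s: "\<And>n. s n \<in> borel_measurable (lebesgue_on D)" and f: "f \<in> borel_measurable (lebesgue_on D)"
    and b: "\<And>n x. norm (s n x) \<le> C" "\<And>x. norm (f x) \<le> C"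
    and lim: "AE x in lebesgue_on D. (\<lambda>n. s n x) \<longlonglongrightarrow> f x"
  shows "(\<lambda>n. l2_norm D (\<lambda>x. s n x - f x)) \<longlonglongrightarrow> 0"
proof -
  note [measurable] = s f
  have "(\<lambda>n. LINT x|lebesgue_on D. (s n x - f x) \<bullet> (s n x - f x)) \<longlonglongrightarrow> (LINT x|lebesgue_on D. 0)"
  proof (rule integral_dominated_convergence)
    have "(\<lambda>x::'a. (2 * C)\<^sup>2 :: real) \<in> l2_space D" using l2_norm_le_of_bound(1)[OF D, of "\<lambda>_. (2 * C)\<^sup>2" "(2 * C)\<^sup>2"] by simp
    then show "integrable (lebesgue_on D) (\<lambda>x. (2 * C)\<^sup>2)" by (rule l2_integrable[OF D])
    show "AE x in lebesgue_on D. norm ((s n x - f x) \<bullet> (s n x - f x)) \<le> (2 * C)\<^sup>2" for n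
    proof (rule AE_I2)
      fix x
      have "norm (s n x - f x) \<le> 2 * C" using norm_triangle_ineq4[of "s n x" "f x"] b(1)[of n x] b(2)[of x] by linarith
      then show "norm ((s n x - f x) \<bullet> (s n x - f x)) \<le> (2 * C)\<^sup>2"
        using power_mono[of "norm (s n x - f x)" "2 * C" 2] by (simp add: power2_norm_eq_inner[symmetric])
    qed
    show "AE x in lebesgue_on D. (\<lambda>n. (s n x - f x) \<bullet> (s n x - f x)) \<longlonglongrightarrow> 0"
      using lim
    proof eventually_elim
      case (elim x)
      from LIM_zero[OF this] have "(\<lambda>n. (s n x - f x) \<bullet> (s n x - f x)) \<longlonglongrightarrow> 0 \<bullet> (0 :: 'b)" by (intro tendsto_inner)
      then show ?case by simp
    qed
  qed auto
  then have "(\<lambda>n. sqrt (l2_inner D (\<lambda>x. s n x - f x) (\<lambda>x. s n x - f x))) \<longlonglongrightarrow> sqrt 0"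
    unfolding l2_inner_def by (intro tendsto_real_sqrt) simp
  then show ?thesis by (simp add: l2_norm_def)
qed

text \<open>
  Cutting off the values in \<open>[-1/n, 1/n]\<close> makes the support compact, and mollification then gives a
  test function. Near a point where \<open>v\<close> is affine and nonzero, or locally constant, the gradient of
  the approximation is eventually equal to that of \<open>v\<close>.
\<close>

lemma Lipschitz_piecewise_affine_H10:
  fixes v :: "'a::euclidean_space \<Rightarrow> real"
  assumes D: "open D" "bounded D" and L: "\<And>x y. \<bar>v x - v y\<bar> \<le> L * norm (x - y)" and L0: "L \<ge> 0"
    and out: "\<And>x. x \<notin> D \<Longrightarrow> v x = 0"
    and N: "negligible N"
    and aff: "\<And>x. x \<notin> N \<Longrightarrow> \<exists>a r. r > 0 \<and> (\<forall>y\<in>ball x r. v y - v x = a \<bullet> (y - x)) \<and> (v x \<noteq> 0 \<or> a = 0)"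
  shows "v \<in> H10 D"
proof -
  have Dl: "D \<in> lmeasurable" using D by (simp add: lmeasurable_open)
  then have D': "D \<in> sets lebesgue" by auto
  have "L-lipschitz_on UNIV v" by (rule lipschitz_onI) (use L L0 in \<open>auto simp: dist_norm\<close>)
  then have vc: "continuous_on UNIV v" by (rule lipschitz_on_continuous_on)
  define \<epsilon> where "\<epsilon> n = 1 / real (Suc n)" for n
  have \<epsilon>: "\<epsilon> n > 0" for n by (simp add: \<epsilon>_def)
  have \<epsilon>0: "\<epsilon> \<longlonglongrightarrow> 0" using LIMSEQ_inverse_real_of_nat by (simp add: \<epsilon>_def[abs_def] inverse_eq_divide)
  define w where "w n x = v x - max (- \<epsilon> n) (min (\<epsilon> n) (v x))" for n x
  have wv: "\<bar>w n x - v x\<bar> \<le> \<epsilon> n" for n x using \<epsilon>[of n] by (auto simp: w_def)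
  have "\<exists>\<phi>\<in>test_functions D. (\<forall>x. \<bar>\<phi> x - w n x\<bar> \<le> L * \<epsilon> n) \<and> (\<forall>x. norm (grad \<phi> x) \<le> L) \<and>
    (\<forall>x a. (\<forall>y\<in>ball x (\<epsilon> n). w n y - w n x = a \<bullet> (y - x)) \<longrightarrow> grad \<phi> x = a)" for n
  proof (rule Lipschitz_approx_test_function[where K = "{x. \<epsilon> n \<le> \<bar>v x\<bar>}"])
    have "\<bar>w n x - w n y\<bar> \<le> \<bar>v x - v y\<bar>" for x y using \<epsilon>[of n] unfolding w_def by linarith
    then show "\<bar>w n x - w n y\<bar> \<le> L * norm (x - y)" for x y using L order_trans by blast
    show sub: "{x. \<epsilon> n \<le> \<bar>v x\<bar>} \<subseteq> D"
    proof (intro subsetI, rule ccontr)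
      fix x assume "x \<in> {x. \<epsilon> n \<le> \<bar>v x\<bar>}" "x \<notin> D"
      then show False using out[of x] \<epsilon>[of n] by simp
    qed
    have "closed {x. \<epsilon> n \<le> \<bar>v x\<bar>}" using vc by (intro closed_Collect_le continuous_intros)
    then show "compact {x. \<epsilon> n \<le> \<bar>v x\<bar>}" using bounded_subset[OF D(2) sub] by (simp add: compact_eq_bounded_closed)
    show "w n x = 0" if "x \<notin> {x. \<epsilon> n \<le> \<bar>v x\<bar>}" for x using that by (auto simp: w_def)
  qed (use D \<epsilon> in auto)
  then obtain \<phi> where \<phi>: "\<And>n. \<phi> n \<in> test_functions D" "\<And>n x. \<bar>\<phi> n x - w n x\<bar> \<le> L * \<epsilon> n" "\<And>n x. norm (grad (\<phi> n) x) \<le> L"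
    "\<And>n x a. (\<forall>y\<in>ball x (\<epsilon> n). w n y - w n x = a \<bullet> (y - x)) \<Longrightarrow> grad (\<phi> n) x = a"
    by metis
  note \<phi>m[measurable] = test_function_borel[OF \<phi>(1)]
  have conv: "convergent (\<lambda>n. grad (\<phi> n) x)" if xN: "x \<notin> N" for x
  proof -
    obtain a r where ar: "r > 0" "\<And>y. y \<in> ball x r \<Longrightarrow> v y - v x = a \<bullet> (y - x)" "v x \<noteq> 0 \<or> a = 0"
      using aff[OF xN] by blast
    have "\<exists>\<delta>>0. \<forall>n. \<epsilon> n < \<delta> \<longrightarrow> grad (\<phi> n) x = a"
    proof (cases "a = 0")
      case True
      show ?thesis
      proof (intro exI[of _ r] conjI allI impI \<phi>(4) ballI ar(1))
        fix n y assume "\<epsilon> n < r" "y \<in> ball x (\<epsilon> n)"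
        then have "v y = v x" using ar(2)[of y] True by simp
        then show "w n y - w n x = a \<bullet> (y - x)" by (simp add: w_def True)
      qed
    next
      case False
      then have vx: "v x \<noteq> 0" using ar(3) by simp
      \<comment> \<open>Within \<delta> of \<open>x\<close>, and for a threshold below \<delta>, the
        value of \<open>v\<close> changes by so little that it keeps its sign and stays beyond the
        threshold; there \<open>w n\<close> and \<open>v\<close> differ by a constant.\<close>
      define \<delta> where "\<delta> = min r (\<bar>v x\<bar> / (2 * (L + 1)))"
      have "\<delta> \<le> \<bar>v x\<bar> / (2 * (L + 1))" by (simp add: \<delta>_def)
      from mult_left_mono[OF this, of "L + 1"] have "(L + 1) * \<delta> \<le> (L + 1) * (\<bar>v x\<bar> / (2 * (L + 1)))" using L0 by linarith
      moreover have "M * (\<bar>v x\<bar> / (2 * M)) = \<bar>v x\<bar> / 2" if "M > 0" for M using that by simp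
      ultimately have "(L + 1) * \<delta> \<le> \<bar>v x\<bar> / 2" using L0 by (metis add_nonneg_pos zero_less_one)
      moreover have "\<delta> > 0" "\<delta> \<le> r" using ar(1) vx L0 by (auto simp: \<delta>_def)
      ultimately have \<delta>: "\<delta> > 0" "\<delta> \<le> r" "(L + 1) * \<delta> \<le> \<bar>v x\<bar> / 2" by auto
      show ?thesis
      proof (intro exI[of _ \<delta>] conjI allI impI \<phi>(4) ballI \<delta>(1))
        fix n y assume n: "\<epsilon> n < \<delta>" and y: "y \<in> ball x (\<epsilon> n)"
        have yx: "norm (y - x) < \<delta>" using n y by (simp add: dist_norm norm_minus_commute)
        have "\<bar>v y - v x\<bar> \<le> L * norm (y - x)" by (rule L)
        also have "\<dots> \<le> L * \<delta>" using yx L0 by (intro mult_left_mono) auto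
        finally have vy: "\<bar>v y - v x\<bar> + \<epsilon> n < \<bar>v x\<bar>" using \<delta>(3) n vx by (simp add: algebra_simps)
        have "w n y - w n x = v y - v x"
        proof (cases "v x > 0")
          case True
          then have "v y > \<epsilon> n" "v x > \<epsilon> n" using vy by linarith+
          then show ?thesis using \<epsilon>[of n] by (simp add: w_def)
        next
          case False
          then have "v y < - \<epsilon> n" "v x < - \<epsilon> n" using vy by linarith+
          then show ?thesis using \<epsilon>[of n] by (simp add: w_def)
        qed
        also have "\<dots> = a \<bullet> (y - x)" using yx \<delta>(2) by (intro ar(2)) (simp add: dist_norm norm_minus_commute)
        finally show "w n y - w n x = a \<bullet> (y - x)" .
      qed
    qed
    then obtain \<delta> where \<delta>: "\<delta> > 0" "\<And>n. \<epsilon> n < \<delta> \<Longrightarrow> grad (\<phi> n) x = a" by blast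
    have "eventually (\<lambda>n. \<epsilon> n < \<delta>) sequentially" using \<epsilon>0 \<delta>(1) by (rule order_tendstoD)
    then have "eventually (\<lambda>n. grad (\<phi> n) x = a) sequentially" by eventually_elim (rule \<delta>(2))
    then show ?thesis by (rule convergentI[OF tendsto_eventually])
  qed
  \<comment> \<open>Where the gradients do not converge, \<open>lim\<close> is unspecified; the test
    on its norm makes \<open>g\<close> bounded by \<open>L\<close> everywhere and changes it only on
    a null set.\<close>
  define g where "g x = (if norm (lim (\<lambda>n. grad (\<phi> n) x)) \<le> L then lim (\<lambda>n. grad (\<phi> n) x) else 0)" for x
  have gm[measurable]: "g \<in> borel_measurable borel" unfolding g_def[abs_def] by measurable
  have gb: "norm (g x) \<le> L" for x using L0 by (simp add: g_def)
  have "N \<in> null_sets lebesgue" using N by (simp add: negligible_iff_null_sets)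
  then have "AE x in lebesgue. x \<notin> N" by (rule AE_not_in)
  then have "AE x in lebesgue_on D. x \<notin> N" using D' by (auto simp: AE_restrict_space_iff elim: eventually_mono)
  then have limg: "AE x in lebesgue_on D. (\<lambda>n. grad (\<phi> n) x) \<longlonglongrightarrow> g x"
  proof eventually_elim
    case (elim x)
    then have l: "(\<lambda>n. grad (\<phi> n) x) \<longlonglongrightarrow> lim (\<lambda>n. grad (\<phi> n) x)" using conv by (simp add: convergent_LIMSEQ_iff)
    then have "norm (lim (\<lambda>n. grad (\<phi> n) x)) \<le> L" using \<phi>(3) by (intro LIMSEQ_le_const2[OF tendsto_norm[OF l]]) auto
    then show ?case using l by (simp add: g_def)
  qed
  have gl: "g \<in> l2_space D" using gb by (intro l2_norm_le_of_bound(1)[OF Dl borel_imp_lebesgue_on[OF gm]])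
  have c2: "(\<lambda>n. l2_norm D (\<lambda>x. grad (\<phi> n) x - g x)) \<longlonglongrightarrow> 0"
    by (rule l2_dominated_convergence[OF Dl borel_imp_lebesgue_on[OF \<phi>m(2)] borel_imp_lebesgue_on[OF gm] \<phi>(3) gb limg])
  have vm[measurable]: "v \<in> borel_measurable borel" using vc by (rule borel_measurable_continuous_onI)
  have "\<exists>B. \<forall>x\<in>D. norm (v x) \<le> B"
  proof -
    have "compact (closure D)" using D(2) by simp
    then have "bounded (v ` closure D)" using vc by (intro compact_imp_bounded compact_continuous_image) (auto intro: continuous_on_subset)
    then show ?thesis using closure_subset[of D] by (auto simp: bounded_iff)
  qed
  then have vl: "v \<in> l2_space D" using l2_norm_le_of_bound(1)[OF Dl borel_imp_lebesgue_on[OF vm]] by blast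
  have c1: "(\<lambda>n. l2_norm D (\<lambda>x. \<phi> n x - v x)) \<longlonglongrightarrow> 0"
  proof (rule Lim_null_comparison)
    show "\<forall>\<^sub>F n in sequentially. norm (l2_norm D (\<lambda>x. \<phi> n x - v x)) \<le> (L + 1) * \<epsilon> n * sqrt (measure lebesgue D)"
    proof (rule always_eventually, rule allI)
      fix n
      have "norm (\<phi> n x - v x) \<le> (L + 1) * \<epsilon> n" for x using \<phi>(2)[of n x] wv[of n x] by (simp add: algebra_simps)
      then have l: "(\<lambda>x. \<phi> n x - v x) \<in> l2_space D" "l2_inner D (\<lambda>x. \<phi> n x - v x) (\<lambda>x. \<phi> n x - v x) \<le> ((L + 1) * \<epsilon> n)\<^sup>2 * measure lebesgue D"
        by (auto intro!: l2_norm_le_of_bound[OF Dl borel_imp_lebesgue_on])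
      from real_sqrt_le_mono[OF l(2)] show "norm (l2_norm D (\<lambda>x. \<phi> n x - v x)) \<le> (L + 1) * \<epsilon> n * sqrt (measure lebesgue D)"
        using l2.nonneg[OF l(1)] L0 \<epsilon>[of n] by (simp add: l2_norm_def real_sqrt_mult)
    qed
    show "(\<lambda>n. (L + 1) * \<epsilon> n * sqrt (measure lebesgue D)) \<longlonglongrightarrow> 0"
      using tendsto_mult_left_zero[OF tendsto_mult_right_zero[OF \<epsilon>0]] by simp
  qed
  show ?thesis by (rule H10_I(1)[OF D \<phi>(1) vl gl c1 c2])
qed

lemma fe_space_affine: "v \<in> fe_space D T \<Longrightarrow> K \<in> T \<Longrightarrow> \<exists>a c. \<forall>x\<in>K. v x = a \<bullet> x + c"
  by (simp add: fe_space_def)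

lemma partition_cell:
  assumes "partition_of D T" "K \<in> T"
  shows "compact K" "negligible (frontier K)" "interior K \<noteq> {}"
proof -
  have ne: "K \<noteq> {}" and k: "full_simplex K \<or> curved_cell D K" using assms by (auto simp: partition_of_def)
  from k show "compact K"
    by (auto simp: full_simplex_def curved_cell_def compact_simplex)
  from k show "negligible (frontier K)"
    by (auto simp: full_simplex_def curved_cell_def negligible_convex_frontier convex_simplex)
  from k show "interior K \<noteq> {}"
  proof
    assume "full_simplex K"
    then have s: "int DIM('a) simplex K" by (simp add: full_simplex_def)
    then have "affine hull K = UNIV" by (simp add: aff_dim_eq_full[symmetric] aff_dim_simplex)
    then have "interior K = rel_interior K" by (simp add: rel_interior_interior)
    then show ?thesis using ne rel_interior_eq_empty[OF convex_simplex[OF s]] by simp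
  next
    assume "curved_cell D K"
    then have "K = closure (interior K)" by (simp add: curved_cell_def)
    then show ?thesis using ne by (metis closure_empty)
  qed
qed

context
  fixes D :: "'a::euclidean_space set" and T :: "'a set set"
  assumes D: "open D" "bounded D" and T: "partition_of D T"
begin

text \<open>The function is glued from two closed sets, the closure of \<open>D\<close> and the
  complement of \<open>D\<close>, and is zero on the latter.\<close>

lemma fe_space_continuous:
  assumes "v \<in> fe_space D T" shows "continuous_on UNIV v"
proof -
  have "continuous_on (closure D) v" "\<And>x. x \<notin> D \<Longrightarrow> v x = 0" using assms by (auto simp: fe_space_def)
  moreover from this(2) have "continuous_on (- D) v"
    by (subst continuous_on_cong[OF refl, of _ v "\<lambda>_. 0"]) auto
  ultimately have "continuous_on (closure D \<union> - D) v"
    using D(1) by (intro continuous_on_closed_Un) (auto simp: closed_Compl)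
  moreover have "closure D \<union> - D = UNIV" using closure_subset[of D] by auto
  ultimately show ?thesis by simp
qed

lemma fe_space_H10:
  assumes v: "v \<in> fe_space D T" shows "v \<in> H10 D"
proof -
  have fin: "finite T" and cov: "\<Union>T = closure D" using T by (auto simp: partition_of_def)
  have out: "\<And>x. x \<notin> D \<Longrightarrow> v x = 0" using v by (simp add: fe_space_def)
  have "\<forall>K\<in>T. \<exists>a c. \<forall>x\<in>K. v x = a \<bullet> x + c" using v by (simp add: fe_space_def)
  then obtain a c where ac: "\<And>K x. K \<in> T \<Longrightarrow> x \<in> K \<Longrightarrow> v x = a K \<bullet> x + c K" by metis
  \<comment> \<open>The sum of all slopes bounds each of them and serves as a common Lipschitz
    constant for the cells and for the complement of \<open>D\<close>, which completes the
    cover.\<close>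
  define L where "L = (\<Sum>K\<in>T. norm (a K))"
  have L0: "L \<ge> 0" unfolding L_def by (intro sum_nonneg) auto
  have LK: "norm (a K) \<le> L" if "K \<in> T" for K unfolding L_def using that fin by (intro member_le_sum) auto
  have Lip: "\<bar>v x - v y\<bar> \<le> L * norm (x - y)" for x y
  proof (rule Lipschitz_closed_cover[of "insert (- D) T"])
    show "closed C" if "C \<in> insert (- D) T" for C
      using that D(1) partition_cell(1)[OF T] by (auto simp: closed_Compl intro: compact_imp_closed)
    show "\<Union>(insert (- D) T) = UNIV" using cov closure_subset[of D] by auto
    fix C x y assume C: "C \<in> insert (- D) T" "x \<in> C" "y \<in> C"
    show "\<bar>v x - v y\<bar> \<le> L * norm (x - y)"
    proof (cases "C = - D")
      case True
      then show ?thesis using C out L0 by simp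
    next
      case False
      then have CT: "C \<in> T" using C by simp
      have "v x - v y = a C \<bullet> (x - y)" using ac[OF CT] C by (simp add: inner_diff_right)
      also have "\<bar>\<dots>\<bar> \<le> norm (a C) * norm (x - y)" by (rule Cauchy_Schwarz_ineq2)
      also have "\<dots> \<le> L * norm (x - y)" by (intro mult_right_mono LK CT) auto
      finally show ?thesis .
    qed
  qed (use fin fe_space_continuous[OF v] in auto)
  \<comment> \<open>Off the cell boundaries the function is locally affine; the zero sets of the
    nonconstant pieces are removed too, so that a vanishing value forces a vanishing slope.\<close>
  define N where "N = (\<Union>K\<in>T. frontier K) \<union> (\<Union>K\<in>{K\<in>T. a K \<noteq> 0}. {x. a K \<bullet> x = - c K})"
  have "negligible N"
    unfolding N_def using fin partition_cell(2)[OF T]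
    by (intro negligible_Un negligible_Union) (auto intro: negligible_hyperplane)
  moreover have "\<exists>b r. r > 0 \<and> (\<forall>y\<in>ball x r. v y - v x = b \<bullet> (y - x)) \<and> (v x \<noteq> 0 \<or> b = 0)" if x: "x \<notin> N" for x
  proof (cases "x \<in> closure D")
    case True
    then obtain K where K: "K \<in> T" "x \<in> K" using cov by auto
    have "x \<notin> frontier K" using x K by (auto simp: N_def)
    then have "x \<in> interior K" using K by (auto simp: frontier_def closure_closed compact_imp_closed[OF partition_cell(1)[OF T K(1)]])
    then obtain r where r: "r > 0" "ball x r \<subseteq> K" by (meson mem_interior)
    have "v y - v x = a K \<bullet> (y - x)" if "y \<in> ball x r" for y
      using ac[OF K(1)] K(2) r that by (auto simp: inner_diff_right)
    moreover have "v x \<noteq> 0 \<or> a K = 0"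
      using x K ac[OF K] by (auto simp: N_def)
    ultimately show ?thesis using r(1) by blast
  next
    case False
    then have "x \<in> - closure D" by simp
    then obtain r where r: "r > 0" "ball x r \<subseteq> - closure D" by (metis open_Compl closed_closure open_contains_ball)
    have "v y = 0" if "y \<in> ball x r" for y using r(2) that closure_subset[of D] by (intro out) auto
    then show ?thesis using r(1) by (intro exI[of _ 0] exI[of _ r]) auto
  qed
  ultimately show ?thesis using Lipschitz_piecewise_affine_H10[OF D Lip L0 out] by blast
qed

lemma fe_space_lin: "u \<in> fe_space D T \<Longrightarrow> v \<in> fe_space D T \<Longrightarrow> (\<lambda>x. s * u x + t * v x) \<in> fe_space D T"
proof -
  assume u: "u \<in> fe_space D T" and v: "v \<in> fe_space D T"
  have "\<exists>a c. \<forall>x\<in>K. s * u x + t * v x = a \<bullet> x + c" if KT: "K \<in> T" for K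
  proof -
    obtain a c where "\<forall>x\<in>K. u x = a \<bullet> x + c" using fe_space_affine[OF u KT] by blast
    moreover obtain a' c' where "\<forall>x\<in>K. v x = a' \<bullet> x + c'" using fe_space_affine[OF v KT] by blast
    ultimately show ?thesis
      by (intro exI[of _ "s *\<^sub>R a + t *\<^sub>R a'"] exI[of _ "s * c + t * c'"]) (auto simp: inner_add_left algebra_simps)
  qed
  with u v show ?thesis unfolding fe_space_def by (auto intro!: continuous_intros)
qed

lemma fe_space_zero: "(\<lambda>x. 0) \<in> fe_space D T"
  by (auto simp: fe_space_def intro!: exI[of _ 0])

text \<open>An affine function is determined by its values at a point and at small shifts of it
  along the axes; an interior point of each cell therefore contributes finitely many points. This is
  the form in which finite dimension is used.\<close>

lemma fe_space_separated: "\<exists>P. finite P \<and> (\<forall>v\<in>fe_space D T. (\<forall>p\<in>P. v p = 0) \<longrightarrow> v = (\<lambda>_. 0))"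
proof -
  have fin: "finite T" and cov: "\<Union>T = closure D" using T by (auto simp: partition_of_def)
  have "\<forall>K\<in>T. \<exists>p r. r > 0 \<and> ball p r \<subseteq> K"
    using partition_cell(3)[OF T] by (metis all_not_in_conv mem_interior)
  then obtain p r where pr: "\<And>K. K \<in> T \<Longrightarrow> r K > 0" "\<And>K. K \<in> T \<Longrightarrow> ball (p K) (r K) \<subseteq> K" by metis
  define P where "P = (\<Union>K\<in>T. insert (p K) ((\<lambda>b. p K + (r K / 2) *\<^sub>R b) ` Basis))"
  have "v = (\<lambda>_. 0)" if v: "v \<in> fe_space D T" and z: "\<forall>q\<in>P. v q = 0" for v
  proof
    fix x
    show "v x = 0"
    proof (cases "x \<in> D")
      case True
      then obtain K where K: "K \<in> T" "x \<in> K" using cov closure_subset[of D] by blast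
      obtain a c where ac: "\<And>y. y \<in> K \<Longrightarrow> v y = a \<bullet> y + c" using fe_space_affine[OF v K(1)] by blast
      have pK: "p K \<in> K" using pr[OF K(1)] by (auto simp: subset_iff)
      have 0: "a \<bullet> p K + c = 0" using ac[OF pK] z K(1) by (auto simp: P_def)
      have "a \<bullet> b = 0" if b: "b \<in> Basis" for b
      proof -
        have "p K + (r K / 2) *\<^sub>R b \<in> ball (p K) (r K)" using pr(1)[OF K(1)] b by (simp add: dist_norm)
        then have "p K + (r K / 2) *\<^sub>R b \<in> K" using pr(2)[OF K(1)] by blast
        from ac[OF this] have "a \<bullet> (p K + (r K / 2) *\<^sub>R b) + c = 0" using z K(1) b by (auto simp: P_def)
        with 0 have "r K / 2 * (a \<bullet> b) = 0" unfolding inner_add_right inner_scaleR_right by linarith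
        then show ?thesis using pr(1)[OF K(1)] by simp
      qed
      then have "a = 0" by (simp add: euclidean_eq_iff[of a])
      with 0 show ?thesis using ac[OF K(2)] by simp
    qed (use v in \<open>simp add: fe_space_def\<close>)
  qed
  moreover have "finite P" unfolding P_def using fin by auto
  ultimately show ?thesis by blast
qed

text \<open>By continuity a nonzero value would occur on an open subset of \<open>D\<close> of
  positive measure; off \<open>D\<close> the elements vanish by convention.\<close>

lemma fe_space_definite:
  assumes v: "v \<in> fe_space D T" and "l2_inner D v v = 0" shows "v = (\<lambda>_. 0)"
proof -
  have Dl: "D \<in> lmeasurable" using D by (simp add: lmeasurable_open)
  then have D': "D \<in> sets lebesgue" by auto
  have "l2_eq D v (\<lambda>_. 0)" using assms l2_inner_eq_0_iff[OF H10D(1)[OF fe_space_H10[OF v]]] by simp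
  then have ae: "AE x in lebesgue. x \<in> D \<longrightarrow> v x = 0" using D' by (simp add: l2_eq_def AE_restrict_space_iff)
  have "open (v -` (- {0}))"
    using fe_space_continuous[OF v] by (intro open_vimage) auto
  then have o: "open (D \<inter> v -` (- {0}))" using D(1) by (intro open_Int)
  then have "D \<inter> v -` (- {0}) \<in> null_sets lebesgue"
    using ae by (subst AE_iff_null_sets) (auto elim: eventually_mono)
  then have "D \<inter> v -` (- {0}) = {}"
    using open_not_negligible[OF o] by (auto simp: negligible_iff_null_sets)
  then have "v x = 0" for x using v by (cases "x \<in> D") (auto simp: fe_space_def)
  then show ?thesis by blast
qed

end

subsection \<open>Orthonormal bases\<close>

lemma semi_inner_subset:
  assumes "semi_inner V B" and W: "W \<subseteq> V"
    and lin: "\<And>f g a b. f \<in> W \<Longrightarrow> g \<in> W \<Longrightarrow> (\<lambda>x. a *\<^sub>R f x + b *\<^sub>R g x) \<in> W"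
  shows "semi_inner W B"
proof -
  interpret V: semi_inner V B by fact
  show ?thesis
  proof
    fix f g h a b assume f: "f \<in> W" and g: "g \<in> W"
    note fV = subsetD[OF W f] and gV = subsetD[OF W g]
    show "(\<lambda>x. a *\<^sub>R f x + b *\<^sub>R g x) \<in> W" by (rule lin[OF f g])
    show "B f g = B g f" by (rule V.sym[OF fV gV])
    show "0 \<le> B f f" by (rule V.nonneg[OF fV])
    assume h: "h \<in> W"
    show "B (\<lambda>x. a *\<^sub>R f x + b *\<^sub>R g x) h = a * B f h + b * B g h"
      by (rule V.lin_left[OF fV gV subsetD[OF W h]])
  qed
qed

text \<open>Gram-Schmidt without a dimension: each separating point either carries no information or
  splits \<open>V\<close> into the kernel of evaluation at that point and one orthogonal direction.
  The kernel is separated by the remaining points, so \<open>V\<close> is arbitrary in the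
  induction.\<close>

lemma orthonormal_basis_exists:
  fixes V :: "('a \<Rightarrow> real) set"
  assumes "finite P" "semi_inner V B" "(\<lambda>_. 0) \<in> V"
    and "\<And>v. v \<in> V \<Longrightarrow> B v v = 0 \<Longrightarrow> v = (\<lambda>_. 0)"
    and "\<And>v. v \<in> V \<Longrightarrow> (\<And>p. p \<in> P \<Longrightarrow> v p = 0) \<Longrightarrow> v = (\<lambda>_. 0)"
  shows "\<exists>(n::nat) u. (\<forall>i<n. u i \<in> V) \<and> (\<forall>i<n. \<forall>j<n. B (u i) (u j) = (if i = j then 1 else 0)) \<and>
    (\<forall>v\<in>V. v = (\<lambda>x. \<Sum>i<n. B v (u i) * u i x))"
  using assms
proof (induction P arbitrary: V rule: finite_induct)
  case empty
  then have "\<forall>v\<in>V. v = (\<lambda>_. 0)" by blast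
  then show ?case by (intro exI[of _ 0]) auto
next
  case (insert p P)
  interpret semi_inner V B by fact
  note z = insert.prems(2)
  show ?case
  proof (cases "\<forall>v\<in>V. v p = 0")
    case True
    show ?thesis
    proof (rule insert.IH[OF insert.prems(1-3)])
      fix v assume "v \<in> V" "\<And>q. q \<in> P \<Longrightarrow> v q = 0"
      then show "v = (\<lambda>_. 0)" using True by (intro insert.prems(4)) auto
    qed
  next
    case False
    then obtain v0 where v0: "v0 \<in> V" "v0 p \<noteq> 0" by blast
    define V' where "V' = {v\<in>V. v p = 0}"
    have sub: "v \<in> V" if "v \<in> V'" for v using that by (simp add: V'_def)
    have "semi_inner V' B"
      by (rule semi_inner_subset[OF insert.prems(1)]) (use lin in \<open>auto simp: V'_def\<close>)
    then have "\<exists>(n::nat) u. (\<forall>i<n. u i \<in> V') \<and> (\<forall>i<n. \<forall>j<n. B (u i) (u j) = (if i = j then 1 else 0)) \<and>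
      (\<forall>v\<in>V'. v = (\<lambda>x. \<Sum>i<n. B v (u i) * u i x))"
    proof (rule insert.IH)
      show "(\<lambda>_. 0) \<in> V'" using z by (simp add: V'_def)
      show "v = (\<lambda>_. 0)" if "v \<in> V'" "B v v = 0" for v using insert.prems(3)[OF sub that(2)] that(1) .
      fix v assume v: "v \<in> V'" "\<And>q. q \<in> P \<Longrightarrow> v q = 0"
      then show "v = (\<lambda>_. 0)" by (intro insert.prems(4) sub) (auto simp: V'_def)
    qed
    then obtain n :: nat and u where u: "\<And>i. i < n \<Longrightarrow> u i \<in> V'" "\<And>i j. i < n \<Longrightarrow> j < n \<Longrightarrow> B (u i) (u j) = (if i = j then 1 else 0)"
      "\<And>v. v \<in> V' \<Longrightarrow> v = (\<lambda>x. \<Sum>i<n. B v (u i) * u i x)"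
      by blast
    have uV: "u i \<in> V" if "i < n" for i using u(1)[OF that] by (rule sub)
    have up: "u i p = 0" if "i < n" for i using u(1)[OF that] by (simp add: V'_def)
    \<comment> \<open>The orthogonal projection of \<open>v0\<close> onto the kernel; subtracting it
      gives the new direction and leaves the value at \<open>p\<close> unchanged.\<close>
    define s where "s x = (\<Sum>i<n. B v0 (u i) *\<^sub>R u i x)" for x
    have sV: "s \<in> V" unfolding s_def[abs_def] using uV by (intro sum_mem[OF z]) auto
    define w where "w x = v0 x - s x" for x
    have wV: "w \<in> V" unfolding w_def[abs_def] by (intro diff v0 sV)
    have wp: "w p \<noteq> 0" using v0 up by (simp add: w_def s_def)
    have wu: "B w (u j) = 0" if "j < n" for j
    proof -
      have "B s (u j) = (\<Sum>i<n. B v0 (u i) * B (u i) (u j))"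
        unfolding s_def[abs_def] using uV that by (intro sum_left) auto
      also have "\<dots> = (\<Sum>i<n. if i = j then B v0 (u i) else 0)" using u(2) that by (intro sum.cong) auto
      also have "\<dots> = B v0 (u j)" using that by simp
      finally show ?thesis unfolding w_def[abs_def] using uV[OF that] v0 sV by (simp add: diff_left)
    qed
    have "B w w \<noteq> 0" using insert.prems(3)[OF wV] wp by auto
    then have ww: "B w w > 0" using nonneg[OF wV] by simp
    define q where "q = sqrt (B w w)"
    have q: "q > 0" "q * q = B w w" using ww by (auto simp: q_def)
    define e where "e x = (1 / q) *\<^sub>R w x" for x
    have eV: "e \<in> V" unfolding e_def[abs_def] by (intro scale wV)
    have Be: "B f e = B f w / q" if "f \<in> V" for f unfolding e_def[abs_def] by (simp only: scale_right[OF wV that]) simp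
    have we: "B w e = q" using Be[OF wV] q(1) by (simp add: q(2)[symmetric])
    define u' where "u' i = (if i < n then u i else e)" for i
    have "\<forall>i<Suc n. u' i \<in> V" using uV eV by (simp add: u'_def)
    moreover have "B (u' i) (u' j) = (if i = j then 1 else 0)" if "i < Suc n" "j < Suc n" for i j
    proof -
      have ue: "B (u k) e = 0" if "k < n" for k using wu[OF that] uV[OF that] by (simp add: Be sym wV)
      have eu: "B e (u k) = 0" if "k < n" for k using ue[OF that] uV[OF that] eV by (simp add: sym)
      have ee: "B e e = 1" using Be[OF eV] sym[OF eV wV] we q by simp
      show ?thesis using that u(2)[of i j] ue eu ee by (auto simp: u'_def less_Suc_eq)
    qed
    moreover have "v = (\<lambda>x. \<Sum>i<Suc n. B v (u' i) * u' i x)" if v: "v \<in> V" for v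
    proof
      fix x
      \<comment> \<open>The multiple of \<open>w\<close> whose removal makes \<open>v\<close> vanish
        at \<open>p\<close>.\<close>
      define t where "t = v p / w p"
      define v' where "v' x = 1 *\<^sub>R v x + (- t) *\<^sub>R w x" for x
      have v'V: "v' \<in> V" unfolding v'_def[abs_def] by (intro lin v wV)
      then have v'V': "v' \<in> V'" using wp by (simp add: V'_def v'_def t_def)
      have Bv: "B v' (u i) = B v (u i)" if "i < n" for i
        unfolding v'_def[abs_def] lin_left[OF v wV uV[OF that]] using wu[OF that] by simp
      \<comment> \<open>The kernel is spanned by the \<open>u i\<close>, so orthogonality of
        \<open>w\<close> to these is orthogonality to \<open>v'\<close>.\<close>
      have "B v' w = (\<Sum>i<n. B v' (u i) * B (u i) w)"
      proof -
        have "B v' w = B (\<lambda>x. \<Sum>i<n. B v' (u i) *\<^sub>R u i x) w" using u(3)[OF v'V'] by simp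
        also have "\<dots> = (\<Sum>i<n. B v' (u i) * B (u i) w)" using uV wV by (intro sum_left) auto
        finally show ?thesis .
      qed
      also have "\<dots> = 0" using wu uV wV by (intro sum.neutral) (auto simp: sym)
      finally have "B v w = t * B w w"
        unfolding v'_def[abs_def] lin_left[OF v wV wV] by simp
      then have "B v e * e x = t * w x" using q(1) by (simp add: Be[OF v] e_def q(2)[symmetric])
      moreover have "v' x = (\<Sum>i<n. B v' (u i) * u i x)" by (rule fun_cong[OF u(3)[OF v'V']])
      then have "v' x = (\<Sum>i<n. B v (u i) * u i x)" using Bv by simp
      ultimately show "v x = (\<Sum>i<Suc n. B v (u' i) * u' i x)" by (simp add: u'_def v'_def)
    qed
    ultimately show ?thesis by (intro exI[of _ "Suc n"] exI[of _ u']) auto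
  qed
qed

section \<open>Preparations for the variational problem\<close>

text \<open>The number of coefficients is a term and not a type, so coefficient vectors are
  sequences with the entries from \<open>n\<close> on fixed at 0; compactness is that of a
  product.\<close>

lemma compact_box_nat:
  fixes n :: nat and R :: real
  shows "compact {c :: nat \<Rightarrow> real. \<forall>i. c i \<in> (if i < n then {- R..R} else {0})}"
proof -
  have "compactin (product_topology (\<lambda>_::nat. euclidean :: real topology) UNIV) (PiE UNIV (\<lambda>i. if i < n then {- R..R} else {0}))"
    by (subst compactin_PiE) auto
  then show ?thesis by (simp add: euclidean_product_topology PiE_UNIV_domain Pi_def)
qed

text \<open>Along a line through a minimiser the functional minus its minimum is such a quartic; its
  linear coefficient is the first variation.\<close>

lemma first_coefficient_zero:
  fixes a b c d \<delta> :: real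
  assumes \<delta>: "\<delta> > 0" and pos: "\<And>t. \<bar>t\<bar> < \<delta> \<Longrightarrow> 0 \<le> a * t + b * t\<^sup>2 + c * t ^ 3 + d * t ^ 4"
  shows "a = 0"
proof -
  have "DERIV (\<lambda>t. a * t + b * t\<^sup>2 + c * t ^ 3 + d * t ^ 4) 0 :> a"
    by (auto intro!: derivative_eq_intros)
  then show ?thesis by (rule DERIV_local_min[OF _ \<delta>]) (use pos in simp)
qed

text \<open>Closed under products, so that on a bounded domain all powers of finite element
  functions become square integrable.\<close>

definition bounded_borel :: "('a::euclidean_space \<Rightarrow> real) set" where
  "bounded_borel = {f. f \<in> borel_measurable borel \<and> (\<exists>B. \<forall>x. \<bar>f x\<bar> \<le> B)}"

lemma bounded_borel_mult: "f \<in> bounded_borel \<Longrightarrow> g \<in> bounded_borel \<Longrightarrow> (\<lambda>x. f x * g x) \<in> bounded_borel"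
proof -
  assume "f \<in> bounded_borel" "g \<in> bounded_borel"
  then obtain B B' where B: "\<And>x. \<bar>f x\<bar> \<le> B" "\<And>x. \<bar>g x\<bar> \<le> B'" and [measurable]: "f \<in> borel_measurable borel" "g \<in> borel_measurable borel"
    by (auto simp: bounded_borel_def)
  have "\<bar>f x * g x\<bar> \<le> B * B'" for x
    unfolding abs_mult using B[of x] by (intro mult_mono) (auto intro: order_trans[OF abs_ge_zero B(1)])
  then show ?thesis by (auto simp: bounded_borel_def)
qed

lemma bounded_borel_power: "f \<in> bounded_borel \<Longrightarrow> (\<lambda>x. f x ^ k) \<in> bounded_borel"
proof (induction k)
  case 0
  then show ?case by (auto simp: bounded_borel_def)
qed (auto intro: bounded_borel_mult)

lemma bounded_borel_l2:
  assumes "D \<in> lmeasurable" "f \<in> bounded_borel" shows "f \<in> l2_space D"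
proof -
  obtain B where "\<And>x. \<bar>f x\<bar> \<le> B" "f \<in> borel_measurable borel" using assms(2) by (auto simp: bounded_borel_def)
  then show ?thesis by (intro l2_norm_le_of_bound(1)[OF assms(1) borel_imp_lebesgue_on]) auto
qed

lemma bounded_borel_integrable:
  assumes "D \<in> lmeasurable" "f \<in> bounded_borel" shows "integrable (lebesgue_on D) f"
  by (rule l2_integrable[OF assms(1) bounded_borel_l2[OF assms]])

subsection \<open>The implicit step\<close>

locale fem =
  fixes D :: "'a::euclidean_space set" and T :: "'a set set" and \<epsilon> \<tau> :: real
  assumes D: "open D" "bounded D" "D \<noteq> {}" and T: "partition_of D T"
    and \<epsilon>: "\<epsilon> > 0" and \<tau>: "\<tau> > 0" and small: "(1 / \<epsilon>\<^sup>2 - lambda1 D) * \<tau> < 1"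
begin

abbreviation "V \<equiv> fe_space D T"
abbreviation "L \<equiv> l2_inner D :: ('a \<Rightarrow> real) \<Rightarrow> ('a \<Rightarrow> real) \<Rightarrow> real"
abbreviation "A \<equiv> dirichlet_form D"
abbreviation "nrm \<equiv> l2_norm D :: ('a \<Rightarrow> real) \<Rightarrow> real"

lemma Dl: "D \<in> lmeasurable" using D by (simp add: lmeasurable_open)

lemma VH: "v \<in> V \<Longrightarrow> v \<in> H10 D" by (rule fe_space_H10[OF D(1,2) T])
lemma Vl2: "v \<in> V \<Longrightarrow> v \<in> l2_space D" by (rule H10D(1)[OF VH])

lemma V_lin: "f \<in> V \<Longrightarrow> g \<in> V \<Longrightarrow> (\<lambda>x. a *\<^sub>R f x + b *\<^sub>R g x) \<in> V"
  using fe_space_lin[OF D(1,2) T, of f g a b] by simp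

sublocale L: semi_inner V L
  using Vl2 by (intro semi_inner_subset[OF l2.semi_inner_axioms] V_lin) auto

sublocale A: semi_inner V A
  using VH by (intro semi_inner_subset[OF semi_inner_H10[OF D(1,2)]] V_lin) auto

lemma V0: "(\<lambda>_. 0) \<in> V" by (rule fe_space_zero[OF D(1,2) T])

lemma V_definite: "v \<in> V \<Longrightarrow> L v v = 0 \<Longrightarrow> v = (\<lambda>_. 0)"
  by (rule fe_space_definite[OF D(1,2) T])

lemma V_eqI:
  assumes "f \<in> V" "g \<in> V" "\<And>v. v \<in> V \<Longrightarrow> L v f = L v g" shows "f = g"
proof -
  have d: "(\<lambda>x. f x - g x) \<in> V" by (rule L.diff[OF assms(1,2)])
  have "L (\<lambda>x. f x - g x) (\<lambda>x. f x - g x) = 0" using L.diff_right[OF assms(1,2) d] assms(3)[OF d] by simp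
  from fun_cong[OF V_definite[OF d this]] show ?thesis by auto
qed

lemma V_bounded_borel: assumes v: "v \<in> V" shows "v \<in> bounded_borel"
proof -
  have c: "continuous_on UNIV v" by (rule fe_space_continuous[OF D(1,2) T v])
  have "v x = 0" if "x \<notin> closure D" for x using v that closure_subset[of D] by (auto simp: fe_space_def)
  then have "\<exists>C\<ge>0. \<forall>x. norm (v x) \<le> C"
    using D(2) by (intro bounded_on_support[OF c, of "closure D"]) auto
  then show ?thesis using borel_measurable_continuous_onI[OF c] by (auto simp: bounded_borel_def)
qed

lemma L_basis_exists:
  "\<exists>(n::nat) u. (\<forall>i<n. u i \<in> V) \<and> (\<forall>i<n. \<forall>j<n. L (u i) (u j) = (if i = j then 1 else 0)) \<and>
    (\<forall>v\<in>V. v = (\<lambda>x. \<Sum>i<n. L v (u i) * u i x))"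
proof -
  obtain P where P: "finite P" "\<And>v. v \<in> V \<Longrightarrow> (\<And>p. p \<in> P \<Longrightarrow> v p = 0) \<Longrightarrow> v = (\<lambda>_. 0)"
    using fe_space_separated[OF D(1,2) T] by blast
  show ?thesis by (rule orthonormal_basis_exists[OF P(1) L.semi_inner_axioms V0 V_definite P(2)])
qed

lemma fe_projection_eqI:
  assumes "w \<in> V" "\<And>v. v \<in> V \<Longrightarrow> L v w = z v" shows "fe_projection D V z = w"
  unfolding fe_projection_def by (rule the_equality) (use assms V_eqI in auto)

text \<open>Riesz representation in finite dimension: the values of the functional on an orthonormal
  basis are the coefficients of its representative. Linearity on \<open>V\<close> is all that is
  asked of \<open>z\<close>.\<close>

lemma fe_projection:
  assumes z: "\<And>f g a b. f \<in> V \<Longrightarrow> g \<in> V \<Longrightarrow> z (\<lambda>x. a * f x + b * g x) = a * z f + b * z g"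
  shows "fe_projection D V z \<in> V" "v \<in> V \<Longrightarrow> L v (fe_projection D V z) = z v"
proof -
  obtain n :: nat and u where u: "\<And>i. i < n \<Longrightarrow> u i \<in> V"
      "\<And>v. v \<in> V \<Longrightarrow> v = (\<lambda>x. \<Sum>i<n. L v (u i) * u i x)"
    using L_basis_exists by blast
  have z0: "z (\<lambda>x. 0) = 0" using z[OF V0 V0, of 0 0] by simp
  have zs: "z (\<lambda>x. \<Sum>i<m. c i * u i x) = (\<Sum>i<m. c i * z (u i))" if "m \<le> n" for m and c :: "nat \<Rightarrow> real"
    using that
  proof (induction m)
    case (Suc m)
    have "(\<lambda>x. \<Sum>i<m. c i *\<^sub>R u i x) \<in> V" using Suc.prems u(1) by (intro L.sum_mem[OF V0]) auto
    then have "(\<lambda>x. \<Sum>i<m. c i * u i x) \<in> V" by simp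
    from z[OF this u(1)[of m], of 1 "c m"] Suc show ?case by simp
  qed (simp add: z0)
  define w where "w x = (\<Sum>i<n. z (u i) *\<^sub>R u i x)" for x
  have w: "w \<in> V" unfolding w_def[abs_def] using u(1) by (intro L.sum_mem[OF V0]) auto
  have wz: "L v w = z v" if v: "v \<in> V" for v
  proof -
    have "L v w = (\<Sum>i<n. z (u i) * L v (u i))" unfolding w_def[abs_def] using u(1) v by (intro L.sum_right) auto
    also have "\<dots> = z (\<lambda>x. \<Sum>i<n. L v (u i) * u i x)" by (subst zs) (simp_all add: mult.commute)
    also have "\<dots> = z v" using u(2)[OF v] by simp
    finally show ?thesis .
  qed
  have "fe_projection D V z = w" using w wz by (rule fe_projection_eqI)
  then show "fe_projection D V z \<in> V" "v \<in> V \<Longrightarrow> L v (fe_projection D V z) = z v" using w wz by auto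
qed

lemma proj_l2:
  assumes f: "f \<in> l2_space D"
  shows "fe_projection D V (l2_functional D f) \<in> V" "v \<in> V \<Longrightarrow> L v (fe_projection D V (l2_functional D f)) = L v f"
proof -
  have lin: "l2_functional D f (\<lambda>x. a * g x + b * h x) = a * l2_functional D f g + b * l2_functional D f h"
    if "g \<in> V" "h \<in> V" for g h a b
    using l2.lin_left[OF Vl2[OF that(1)] Vl2[OF that(2)] f, of a b] by (simp add: l2_functional_def)
  show "fe_projection D V (l2_functional D f) \<in> V" by (rule fe_projection(1)[OF lin])
  assume v: "v \<in> V"
  have "L v (fe_projection D V (l2_functional D f)) = l2_functional D f v" by (rule fe_projection(2)[OF lin v])
  then show "L v (fe_projection D V (l2_functional D f)) = L v f" by (simp only: l2_functional_def)
qed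

lemma discrete_laplacian:
  assumes y: "y \<in> V"
  shows "discrete_laplacian D V y \<in> V" "v \<in> V \<Longrightarrow> L v (discrete_laplacian D V y) = - A y v"
proof -
  \<comment> \<open>The discrete Laplacian is by definition the representative of a linear
    functional, hence a projection in disguise.\<close>
  have e: "discrete_laplacian D V y = fe_projection D V (\<lambda>v. - A y v)"
    by (simp add: discrete_laplacian_def fe_projection_def dirichlet_form_def)
  have lin: "- A y (\<lambda>x. a * g x + b * h x) = a * - A y g + b * - A y h" if "g \<in> V" "h \<in> V" for g h a b
    using A.lin_right[OF that y, of a b] by simp
  show "discrete_laplacian D V y \<in> V" unfolding e by (rule fe_projection(1)[OF lin])
  assume v: "v \<in> V"
  show "L v (discrete_laplacian D V y) = - A y v" unfolding e by (rule fe_projection(2)[OF lin v])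
qed

lemma cube_l2: "y \<in> V \<Longrightarrow> (\<lambda>x. y x ^ 3) \<in> l2_space D"
  by (intro bounded_borel_l2[OF Dl] bounded_borel_power V_bounded_borel)

lemma L_nemytskii:
  assumes v: "v \<in> V" and y: "y \<in> V"
  shows "nemytskii \<epsilon> y \<in> l2_space D" "L v (nemytskii \<epsilon> y) = (L v y - L v (\<lambda>x. y x ^ 3)) / \<epsilon>\<^sup>2"
proof -
  have e: "nemytskii \<epsilon> y = (\<lambda>x. (1 / \<epsilon>\<^sup>2) *\<^sub>R y x + (- 1 / \<epsilon>\<^sup>2) *\<^sub>R y x ^ 3)"
    by (simp add: nemytskii_def diff_divide_distrib)
  show "nemytskii \<epsilon> y \<in> l2_space D" unfolding e by (rule l2.lin[OF Vl2[OF y] cube_l2[OF y]])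
  show "L v (nemytskii \<epsilon> y) = (L v y - L v (\<lambda>x. y x ^ 3)) / \<epsilon>\<^sup>2"
    unfolding e l2.lin_right[OF Vl2[OF y] cube_l2[OF y] Vl2[OF v]] by (simp add: diff_divide_distrib)
qed

text \<open>The implicit step in tested form; \<open>Z\<close> stands for the previous state with
  the projected increment already added.\<close>

definition weak_sol :: "('a \<Rightarrow> real) \<Rightarrow> ('a \<Rightarrow> real) \<Rightarrow> bool" where
  "weak_sol Z y \<longleftrightarrow> y \<in> V \<and>
    (\<forall>v\<in>V. L v y + \<tau> * A y v - \<tau> * ((L v y - L v (\<lambda>x. y x ^ 3)) / \<epsilon>\<^sup>2) = L v Z)"

text \<open>Both sides of the pointwise equation lie in \<open>V\<close>, where testing with all of
  \<open>V\<close> detects equality.\<close>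

lemma dieg_equation_iff:
  assumes x: "x \<in> V" and y: "y \<in> V" and f: "f \<in> l2_space D"
  shows "dieg_equation D V \<epsilon> \<tau> x f y \<longleftrightarrow> weak_sol (\<lambda>\<xi>. x \<xi> + fe_projection D V (l2_functional D f) \<xi>) y"
proof -
  let ?P = "\<lambda>f. fe_projection D V (l2_functional D f)"
  let ?N = "nemytskii \<epsilon> y"
  note N = L_nemytskii[OF _ y]
  have PV: "?P f \<in> V" "?P ?N \<in> V" by (rule proj_l2(1)[OF f], rule proj_l2(1)[OF N(1)[OF V0]])
  note dV = discrete_laplacian(1)[OF y]
  define R where "R \<xi> = (1 *\<^sub>R (1 *\<^sub>R x \<xi> + \<tau> *\<^sub>R discrete_laplacian D V y \<xi>) + \<tau> *\<^sub>R ?P ?N \<xi>) + ?P f \<xi>" for \<xi>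
  have RV: "R \<in> V" unfolding R_def[abs_def] by (intro L.add L.lin x dV PV)
  have LR: "L v R = L v (\<lambda>\<xi>. x \<xi> + ?P f \<xi>) - \<tau> * A y v + \<tau> * ((L v y - L v (\<lambda>x. y x ^ 3)) / \<epsilon>\<^sup>2)" if v: "v \<in> V" for v
  proof -
    note l1 = L.lin[OF x dV, of 1 \<tau>]
    note l2 = L.lin[OF l1 PV(2), of 1 \<tau>]
    have "L v R = L v x - \<tau> * A y v + \<tau> * L v ?N + L v (?P f)"
      unfolding R_def[abs_def] L.add_right[OF l2 PV(1) v] L.lin_right[OF l1 PV(2) v] L.lin_right[OF x dV v]
      by (simp add: discrete_laplacian(2)[OF y v] proj_l2(2)[OF N(1)[OF v] v])
    then show ?thesis by (simp add: L.add_right[OF x PV(1) v] N(2)[OF v])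
  qed
  have "dieg_equation D V \<epsilon> \<tau> x f y \<longleftrightarrow> y = R" by (auto simp: dieg_equation_def R_def fun_eq_iff)
  also have "\<dots> \<longleftrightarrow> (\<forall>v\<in>V. L v y = L v R)" using V_eqI[OF y RV] by blast
  also have "\<dots> \<longleftrightarrow> weak_sol (\<lambda>\<xi>. x \<xi> + ?P f \<xi>) y"
  proof -
    have "L v y = L v R \<longleftrightarrow> L v y + \<tau> * A y v - \<tau> * ((L v y - L v (\<lambda>x. y x ^ 3)) / \<epsilon>\<^sup>2) = L v (\<lambda>\<xi>. x \<xi> + ?P f \<xi>)"
      if "v \<in> V" for v
      unfolding LR[OF that] by (rule iffI) linarith+
    then show ?thesis unfolding weak_sol_def using y by blast
  qed
  finally show ?thesis .
qed

text \<open>Equal to 1 minus the quantity bounded in the step condition, and thus positive exactly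
  under that condition; it bounds the linear part of the step from below.\<close>

definition coer :: real where "coer = 1 + \<tau> * lambda1 D - \<tau> / \<epsilon>\<^sup>2"

lemma coer_pos: "coer > 0"
  using small by (simp add: coer_def algebra_simps)

lemma coercive: assumes "v \<in> V" shows "coer * L v v \<le> L v v + \<tau> * A v v - \<tau> / \<epsilon>\<^sup>2 * L v v"
proof -
  have "\<tau> * (lambda1 D * L v v) \<le> \<tau> * A v v" using \<tau> Poincare[OF D VH[OF assms]] by (intro mult_left_mono) auto
  then show ?thesis by (simp add: coer_def algebra_simps)
qed

lemma L_integral: "L f g = (LINT x|lebesgue_on D. f x * g x)" by (simp add: l2_inner_def)

lemma L_quartic_nonneg: "0 \<le> L y (\<lambda>x. y x ^ 3)"
  unfolding L_integral by (intro integral_nonneg_AE AE_I2) (simp add: power_Suc[symmetric] zero_le_even_power)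

lemma L_cube_mono:
  assumes y: "y \<in> V" and y': "y' \<in> V"
  shows "0 \<le> L (\<lambda>x. y x - y' x) (\<lambda>x. y x ^ 3) - L (\<lambda>x. y x - y' x) (\<lambda>x. y' x ^ 3)"
proof -
  have d: "(\<lambda>x. y x - y' x) \<in> l2_space D" by (intro l2.diff Vl2 y y')
  have "(a - b) * (a ^ 3 - b ^ 3) \<ge> 0" for a b :: real
  proof (cases "a \<le> b")
    case True
    then have "a ^ 3 \<le> b ^ 3" by (simp add: power_mono_odd)
    then show ?thesis using True by (simp add: mult_nonpos_nonpos)
  next
    case False
    then have "b ^ 3 \<le> a ^ 3" by (simp add: power_mono_odd)
    then show ?thesis using False by simp
  qed
  then have "0 \<le> L (\<lambda>x. y x - y' x) (\<lambda>x. y x ^ 3 - y' x ^ 3)"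
    unfolding L_integral by (intro integral_nonneg_AE AE_I2) simp
  then show ?thesis using l2.diff_right[OF cube_l2[OF y] cube_l2[OF y'] d] by simp
qed

lemma nrm_nonneg: "v \<in> V \<Longrightarrow> 0 \<le> nrm v"
  and nrm_sq: "v \<in> V \<Longrightarrow> (nrm v)\<^sup>2 = L v v"
  using L.nonneg by (auto simp: l2_norm_def)

lemma CS: "u \<in> V \<Longrightarrow> v \<in> V \<Longrightarrow> \<bar>L u v\<bar> \<le> nrm u * nrm v"
  using L.Cauchy_Schwarz_abs by (simp add: l2_norm_def)

lemma weak_sol_Lipschitz:
  assumes y: "weak_sol Z y" and y': "weak_sol Z' y'" and Z: "Z \<in> V" "Z' \<in> V"
  shows "coer * nrm (\<lambda>x. y x - y' x) \<le> nrm (\<lambda>x. Z x - Z' x)"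
proof -
  have yV: "y \<in> V" "y' \<in> V" using y y' by (auto simp: weak_sol_def)
  define v where "v x = y x - y' x" for x
  have v: "v \<in> V" unfolding v_def[abs_def] by (rule L.diff[OF yV])
  have dZ: "(\<lambda>x. Z x - Z' x) \<in> V" by (rule L.diff[OF Z])
  have e1: "L v y + \<tau> * A y v - \<tau> * ((L v y - L v (\<lambda>x. y x ^ 3)) / \<epsilon>\<^sup>2) = L v Z"
    using y v by (auto simp: weak_sol_def)
  have e2: "L v y' + \<tau> * A y' v - \<tau> * ((L v y' - L v (\<lambda>x. y' x ^ 3)) / \<epsilon>\<^sup>2) = L v Z'"
    using y' v by (auto simp: weak_sol_def)
  have Lv: "L v v = L v y - L v y'" using L.diff_right[OF yV v] by (simp add: v_def[abs_def])
  have Av: "A v v = A y v - A y' v" using A.diff_left[OF yV v] by (simp add: v_def[abs_def])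
  have LZ: "L v (\<lambda>x. Z x - Z' x) = L v Z - L v Z'" by (rule L.diff_right[OF Z v])
  have cb: "0 \<le> \<tau> / \<epsilon>\<^sup>2 * (L v (\<lambda>x. y x ^ 3) - L v (\<lambda>x. y' x ^ 3))"
    using L_cube_mono[OF yV] \<tau> by (simp add: v_def[abs_def])
  have "coer * L v v \<le> L v v + \<tau> * A v v - \<tau> / \<epsilon>\<^sup>2 * L v v" by (rule coercive[OF v])
  also have "\<dots> = L v (\<lambda>x. Z x - Z' x) - \<tau> / \<epsilon>\<^sup>2 * (L v (\<lambda>x. y x ^ 3) - L v (\<lambda>x. y' x ^ 3))"
    unfolding LZ e1[symmetric] e2[symmetric] Lv Av by (simp add: diff_divide_distrib algebra_simps)
  also have "\<dots> \<le> nrm v * nrm (\<lambda>x. Z x - Z' x)" using cb CS[OF v dZ] by linarith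
  finally have "nrm v * (coer * nrm v) \<le> nrm v * nrm (\<lambda>x. Z x - Z' x)"
    by (simp add: nrm_sq[OF v, symmetric] power2_eq_square mult.left_commute)
  then have "coer * nrm v \<le> nrm (\<lambda>x. Z x - Z' x)"
    using nrm_nonneg[OF v] nrm_nonneg[OF dZ] by (cases "nrm v = 0") auto
  then show ?thesis by (simp add: v_def[abs_def])
qed

lemma weak_sol_zero: "weak_sol (\<lambda>_. 0) (\<lambda>_. 0)"
  unfolding weak_sol_def using V0 by (auto simp: L.zero_right A.zero_left)

lemma weak_sol_bound: "weak_sol Z y \<Longrightarrow> Z \<in> V \<Longrightarrow> coer * nrm y \<le> nrm Z"
  using weak_sol_Lipschitz[OF _ weak_sol_zero _ V0] by simp

text \<open>The cubic term makes the solution grow sublinearly in the data.\<close>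

lemma weak_sol_cubic_bound:
  assumes y: "weak_sol Z y" and Z: "Z \<in> V"
  shows "\<tau> / (\<epsilon>\<^sup>2 * measure lebesgue D) * nrm y ^ 3 \<le> nrm Z"
proof -
  have yV: "y \<in> V" using y by (simp add: weak_sol_def)
  have mD: "measure lebesgue D > 0"
  proof -
    have "\<not> negligible D" using open_not_negligible[OF D(1) D(3)] .
    then have "measure lebesgue D \<noteq> 0" using Dl by (simp add: negligible_iff_measure0)
    then show ?thesis by (simp add: less_le)
  qed
  have y2: "(\<lambda>x. y x ^ 2) \<in> l2_space D" by (intro bounded_borel_l2[OF Dl] bounded_borel_power V_bounded_borel yV)
  have one: "(\<lambda>x::'a. 1::real) \<in> l2_space D" "L (\<lambda>x. 1) (\<lambda>x. 1) \<le> 1 * measure lebesgue D"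
    using l2_norm_le_of_bound[OF Dl, of "\<lambda>_. 1::real" 1] by auto
  \<comment> \<open>Cauchy-Schwarz between the square of \<open>y\<close> and the constant 1
    compares the fourth power of the L2 norm with the quartic integral; the measure of
    \<open>D\<close> in the constant arises here.\<close>
  have "(L (\<lambda>x. y x ^ 2) (\<lambda>x. 1))\<^sup>2 \<le> L (\<lambda>x. y x ^ 2) (\<lambda>x. y x ^ 2) * L (\<lambda>x. 1) (\<lambda>x. 1)"
    by (rule l2.Cauchy_Schwarz[OF y2 one(1)])
  moreover have "L (\<lambda>x. y x ^ 2) (\<lambda>x. 1) = L y y" by (simp add: L_integral power2_eq_square)
  moreover have "L (\<lambda>x. y x ^ 2) (\<lambda>x. y x ^ 2) = L y (\<lambda>x. y x ^ 3)"
    by (simp add: L_integral power2_eq_square power3_eq_cube mult.assoc)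
  moreover have "L y (\<lambda>x. y x ^ 3) * L (\<lambda>x. 1) (\<lambda>x. 1) \<le> L y (\<lambda>x. y x ^ 3) * measure lebesgue D"
    using one(2) L_quartic_nonneg by (intro mult_left_mono) auto
  ultimately have "(L y y)\<^sup>2 \<le> L y (\<lambda>x. y x ^ 3) * measure lebesgue D" by simp
  then have q: "(L y y)\<^sup>2 / measure lebesgue D \<le> L y (\<lambda>x. y x ^ 3)" using mD by (simp add: divide_le_eq)
  have e: "L y y + \<tau> * A y y - \<tau> * ((L y y - L y (\<lambda>x. y x ^ 3)) / \<epsilon>\<^sup>2) = L y Z"
    using y yV by (auto simp: weak_sol_def)
  have "0 \<le> coer * L y y" using coer_pos L.nonneg[OF yV] by simp
  also have "coer * L y y \<le> L y y + \<tau> * A y y - \<tau> / \<epsilon>\<^sup>2 * L y y" by (rule coercive[OF yV])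
  finally have c: "\<tau> / \<epsilon>\<^sup>2 * L y (\<lambda>x. y x ^ 3) \<le> L y Z"
    unfolding e[symmetric] by (simp add: diff_divide_distrib algebra_simps)
  have "\<tau> / (\<epsilon>\<^sup>2 * measure lebesgue D) * (nrm y ^ 3 * nrm y) = \<tau> / \<epsilon>\<^sup>2 * ((L y y)\<^sup>2 / measure lebesgue D)"
    unfolding nrm_sq[OF yV, symmetric] by (simp add: power2_eq_square power3_eq_cube)
  also have "\<dots> \<le> \<tau> / \<epsilon>\<^sup>2 * L y (\<lambda>x. y x ^ 3)" using q \<tau> by (intro mult_left_mono) auto
  also have "\<dots> \<le> nrm Z * nrm y" using c CS[OF yV Z] by (simp add: mult.commute)
  finally have h: "(\<tau> / (\<epsilon>\<^sup>2 * measure lebesgue D) * nrm y ^ 3) * nrm y \<le> nrm Z * nrm y" by (simp add: mult.assoc)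
  show ?thesis
  proof (cases "nrm y = 0")
    case True
    then show ?thesis using nrm_nonneg[OF Z] by simp
  next
    case False
    then have "0 < nrm y" using nrm_nonneg[OF yV] by simp
    with h show ?thesis by (rule mult_right_le_imp_le)
  qed
qed

text \<open>The weak equation is the Euler-Lagrange equation of a coercive quartic functional.\<close>

lemma weak_sol_exists:
  assumes Z: "Z \<in> V" shows "\<exists>y. weak_sol Z y"
proof -
  obtain n :: nat and f where f: "\<And>i. i < n \<Longrightarrow> f i \<in> V" "\<And>i j. i < n \<Longrightarrow> j < n \<Longrightarrow> L (f i) (f j) = (if i = j then 1 else 0)"
      "\<And>v. v \<in> V \<Longrightarrow> v = (\<lambda>x. \<Sum>i<n. L v (f i) * f i x)"
    using L_basis_exists by blast
  define e where "e c x = (\<Sum>i<n. c i *\<^sub>R f i x)" for c :: "nat \<Rightarrow> real" and x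
  have eV: "e c \<in> V" for c unfolding e_def[abs_def] using f(1) by (intro L.sum_mem[OF V0]) auto
  define E where "E y = L y y + \<tau> * A y y - \<tau> / \<epsilon>\<^sup>2 * L y y" for y
  \<comment> \<open>The factors 1/2 and 1/4 are such that the derivative in direction
    \<open>v\<close> is the tested equation.\<close>
  define J where "J y = E y / 2 + \<tau> / (4 * \<epsilon>\<^sup>2) * (LINT x|lebesgue_on D. y x ^ 4) - L y Z" for y
  \<comment> \<open>In coefficients each form is a polynomial, hence continuous in the product
    topology.\<close>
  have form_cont: "continuous_on UNIV (\<lambda>c. B (e c) (e c))" if "semi_inner V B" for B
  proof -
    interpret B: semi_inner V B by fact
    have "B (e c) (e c) = (\<Sum>i<n. c i * (\<Sum>j<n. c j * B (f i) (f j)))" for c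
    proof -
      have "B (e c) (e c) = (\<Sum>i<n. c i * B (f i) (e c))"
        unfolding e_def[abs_def] using f(1) eV[of c] by (intro B.sum_left) (auto simp: e_def[abs_def])
      also have "\<dots> = (\<Sum>i<n. c i * (\<Sum>j<n. c j * B (f i) (f j)))"
        unfolding e_def[abs_def] using f(1) by (intro sum.cong refl arg_cong2[where f = "(*)"] B.sum_right) auto
      finally show ?thesis .
    qed
    then show ?thesis by (simp add: continuous_intros)
  qed
  have quartic_cont: "continuous_on UNIV (\<lambda>c. LINT x|lebesgue_on D. e c x ^ 4)"
  proof -
    define G where "G i k j l = (LINT x|lebesgue_on D. (f i x * f j x) * (f k x * f l x))" for i k j l
    have Gi: "integrable (lebesgue_on D) (\<lambda>x. a * ((f i x * f j x) * (f k x * f l x)))"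
      if "i \<in> {..<n}" "k \<in> {..<n}" "j \<in> {..<n}" "l \<in> {..<n}" for i k j l a
      using that f(1) by (intro integrable_mult_right bounded_borel_integrable[OF Dl] bounded_borel_mult V_bounded_borel) auto
    have "(LINT x|lebesgue_on D. e c x ^ 4) = (\<Sum>i<n. \<Sum>k<n. \<Sum>j<n. \<Sum>l<n. ((c i * c j) * (c k * c l)) * G i k j l)" for c
    proof -
      have "e c x ^ 4 = (\<Sum>i<n. \<Sum>k<n. \<Sum>j<n. \<Sum>l<n. ((c i * c j) * (c k * c l)) * ((f i x * f j x) * (f k x * f l x)))" for x
      proof -
        have "e c x ^ 4 = (e c x * e c x) * (e c x * e c x)" by (simp add: power4_eq_xxxx mult.assoc)
        also have "\<dots> = (\<Sum>i<n. \<Sum>k<n. \<Sum>j<n. \<Sum>l<n. ((c i * f i x) * (c j * f j x)) * ((c k * f k x) * (c l * f l x)))"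
          unfolding e_def by (simp only: sum_product real_scaleR_def)
        finally show ?thesis by (simp add: ac_simps)
      qed
      then have "(LINT x|lebesgue_on D. e c x ^ 4)
        = (LINT x|lebesgue_on D. (\<Sum>i<n. \<Sum>k<n. \<Sum>j<n. \<Sum>l<n. ((c i * c j) * (c k * c l)) * ((f i x * f j x) * (f k x * f l x))))" by simp
      also have "\<dots> = (\<Sum>i<n. \<Sum>k<n. \<Sum>j<n. \<Sum>l<n. (LINT x|lebesgue_on D. ((c i * c j) * (c k * c l)) * ((f i x * f j x) * (f k x * f l x))))"
        using Gi by (simp only: Bochner_Integration.integral_sum Bochner_Integration.integrable_sum cong: sum.cong)
      finally show ?thesis by (simp add: G_def)
    qed
    then show ?thesis by (simp add: continuous_intros)
  qed
  have lin_cont: "continuous_on UNIV (\<lambda>c. L (e c) Z)"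
  proof -
    have "L (e c) Z = (\<Sum>i<n. c i * L (f i) Z)" for c
      unfolding e_def[abs_def] using f(1) Z by (intro L.sum_left) auto
    then show ?thesis by (simp add: continuous_intros)
  qed
  have Jc: "continuous_on UNIV (\<lambda>c. J (e c))"
    unfolding J_def E_def
    by (intro continuous_intros quartic_cont lin_cont form_cont[OF L.semi_inner_axioms] form_cont[OF A.semi_inner_axioms]) simp
  \<comment> \<open>A minimiser has \<open>J\<close> at most \<open>J 0 = 0\<close>, which bounds
    its norm by \<open>R - 1\<close>. The extra 1 places its coefficients away from the faces of the
    box, so all small variations are admissible.\<close>
  define R where "R = 2 * nrm Z / coer + 1"
  have R: "R > 0" using nrm_nonneg[OF Z] coer_pos by (simp add: R_def add_nonneg_pos)
  define S where "S = {c :: nat \<Rightarrow> real. \<forall>i. c i \<in> (if i < n then {- R..R} else {0})}"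
  have "(\<lambda>_. 0) \<in> S" using R by (auto simp: S_def)
  have "compact S" unfolding S_def by (rule compact_box_nat)
  then obtain c where c: "c \<in> S" "\<And>c'. c' \<in> S \<Longrightarrow> J (e c) \<le> J (e c')"
    using continuous_attains_inf[of S "\<lambda>c. J (e c)"] \<open>(\<lambda>_. 0) \<in> S\<close> continuous_on_subset[OF Jc] by blast
  define y where "y = e c"
  have yV: "y \<in> V" by (simp add: y_def eV)
  have e0: "e (\<lambda>_. 0) = (\<lambda>_. 0)" by (simp add: e_def[abs_def])
  have J0: "J (\<lambda>_. 0) = 0" by (simp add: J_def E_def L.zero_left V0 A.zero_left Z)
  have q0: "0 \<le> (LINT x|lebesgue_on D. y x ^ 4)" by (intro integral_nonneg_AE AE_I2) (simp add: zero_le_even_power)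
  have "J y \<le> 0" using c(2)[OF \<open>(\<lambda>_. 0) \<in> S\<close>] by (simp add: y_def e0 J0)
  moreover have "0 \<le> \<tau> / (4 * \<epsilon>\<^sup>2) * (LINT x|lebesgue_on D. y x ^ 4)" using q0 \<tau> by simp
  ultimately have "E y \<le> 2 * L y Z" unfolding J_def by linarith
  then have "coer * L y y \<le> 2 * L y Z" using coercive[OF yV] by (simp add: E_def)
  also have "\<dots> \<le> 2 * (nrm y * nrm Z)" using CS[OF yV Z] by simp
  finally have "nrm y * (coer * nrm y) \<le> nrm y * (2 * nrm Z)"
    by (simp add: nrm_sq[OF yV, symmetric] power2_eq_square ac_simps)
  then have "coer * nrm y \<le> 2 * nrm Z"
    using nrm_nonneg[OF yV] nrm_nonneg[OF Z] by (cases "nrm y = 0") auto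
  then have yR: "nrm y \<le> R - 1" using coer_pos by (simp add: R_def field_simps)
  have nf: "nrm (f i) = 1" if "i < n" for i using f(2)[OF that that] by (simp add: l2_norm_def)
  have Ly: "L y (f i) = c i" if "i < n" for i
  proof -
    have "L y (f i) = (\<Sum>j<n. c j * L (f j) (f i))"
      unfolding y_def e_def[abs_def] using f(1) that by (intro L.sum_left) auto
    also have "\<dots> = (\<Sum>j<n. if j = i then c j else 0)" using f(2) that by (intro sum.cong) auto
    finally show ?thesis using that by simp
  qed
  have ci: "\<bar>c i\<bar> \<le> R - 1" if "i < n" for i
    using CS[OF yV f(1)[OF that]] nf[OF that] Ly[OF that] yR by simp
  have "L v y + \<tau> * A y v - \<tau> * ((L v y - L v (\<lambda>x. y x ^ 3)) / \<epsilon>\<^sup>2) = L v Z" if v: "v \<in> V" for v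
  proof -
    define d where "d i = (if i < n then L v (f i) else 0)" for i
    have ev: "e d = v" using f(3)[OF v] unfolding e_def[abs_def] d_def by simp
    have di: "\<bar>d i\<bar> \<le> nrm v" for i
      using CS[OF v f(1)] nf nrm_nonneg[OF v] by (cases "i < n") (auto simp: d_def)
    have ed: "e (\<lambda>i. c i + t * d i) = (\<lambda>x. y x + t * v x)" for t
      unfolding ev[symmetric] y_def e_def[abs_def] by (simp add: distrib_right sum.distrib sum_distrib_left mult.assoc)
    \<comment> \<open>For such \<open>t\<close> every coefficient moves by at most 1, the margin
      left in \<open>R\<close>; the added 1 in the denominator covers \<open>v = 0\<close>.\<close>
    define \<delta> where "\<delta> = 1 / (nrm v + 1)"
    have \<delta>: "\<delta> > 0" using nrm_nonneg[OF v] by (simp add: \<delta>_def)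
    have inS: "(\<lambda>i. c i + t * d i) \<in> S" if t: "\<bar>t\<bar> < \<delta>" for t
    proof -
      have "\<bar>c i + t * d i\<bar> \<le> R" if "i < n" for i
      proof -
        have "\<bar>t * d i\<bar> \<le> \<delta> * nrm v" unfolding abs_mult using t di by (intro mult_mono) auto
        also have "\<dots> \<le> 1" using nrm_nonneg[OF v] by (simp add: \<delta>_def)
        finally show ?thesis using ci[OF that] by linarith
      qed
      moreover have "c i + t * d i = 0" if "\<not> i < n" for i using c(1) that by (auto simp: S_def d_def dest: spec[of _ i])
      ultimately have "c i + t * d i \<in> (if i < n then {- R..R} else {0})" for i
        using abs_le_D1[of "c i + t * d i" R] abs_le_D2[of "c i + t * d i" R] by (cases "i < n") auto
      then show ?thesis by (simp add: S_def)
    qed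
    define I where "I k = (LINT x|lebesgue_on D. y x ^ (4 - k) * v x ^ k)" for k
    have Ii: "integrable (lebesgue_on D) (\<lambda>x. a * (y x ^ j * v x ^ k))" for a j k
      by (intro integrable_mult_right bounded_borel_integrable[OF Dl] bounded_borel_mult bounded_borel_power V_bounded_borel yV v)
    have quart: "(LINT x|lebesgue_on D. (y x + t * v x) ^ 4) = I 0 + 4 * t * I 1 + 6 * t\<^sup>2 * I 2 + 4 * t ^ 3 * I 3 + t ^ 4 * I 4" for t
    proof -
      have "(LINT x|lebesgue_on D. (y x + t * v x) ^ 4)
         = (LINT x|lebesgue_on D. 1 * (y x ^ 4 * v x ^ 0) + (4 * t) * (y x ^ 3 * v x ^ 1) + (6 * t\<^sup>2) * (y x ^ 2 * v x ^ 2)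
            + (4 * t ^ 3) * (y x ^ 1 * v x ^ 3) + t ^ 4 * (y x ^ 0 * v x ^ 4))"
        by (intro Bochner_Integration.integral_cong refl) (simp add: power4_eq_xxxx power3_eq_cube power2_eq_square algebra_simps)
      also have "\<dots> = 1 * I 0 + (4 * t) * I 1 + (6 * t\<^sup>2) * I 2 + (4 * t ^ 3) * I 3 + t ^ 4 * I 4"
        unfolding I_def by (subst Bochner_Integration.integral_add, (intro Bochner_Integration.integrable_add Ii)+)+ simp
      finally show ?thesis by simp
    qed
    note ex = L.expand[OF yV v, of 1] A.expand[OF yV v, of 1]
    have Jt: "J (\<lambda>x. y x + t * v x) - J y = (L y v + \<tau> * A y v - \<tau> / \<epsilon>\<^sup>2 * L y v + \<tau> / \<epsilon>\<^sup>2 * I 1 - L v Z) * t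
       + (E v / 2 + \<tau> / (4 * \<epsilon>\<^sup>2) * (6 * I 2)) * t\<^sup>2 + (\<tau> / (4 * \<epsilon>\<^sup>2) * (4 * I 3)) * t ^ 3 + (\<tau> / (4 * \<epsilon>\<^sup>2) * I 4) * t ^ 4" for t
    proof -
      have 1: "L (\<lambda>x. y x + t * v x) (\<lambda>x. y x + t * v x) = L y y + 2 * t * L y v + t\<^sup>2 * L v v"
        "A (\<lambda>x. y x + t * v x) (\<lambda>x. y x + t * v x) = A y y + 2 * t * A y v + t\<^sup>2 * A v v"
        using ex[of t] by simp_all
      have 2: "L (\<lambda>x. y x + t * v x) Z = L y Z + t * L v Z" using L.lin_left[OF yV v Z, of 1 t] by simp
      have 3: "(LINT x|lebesgue_on D. y x ^ 4) = I 0" by (simp add: I_def)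
      have 4: "\<tau> / (4 * \<epsilon>\<^sup>2) * (4 * s) = \<tau> / \<epsilon>\<^sup>2 * s" for s by simp
      show ?thesis unfolding J_def E_def 1 2 3 quart by (simp add: algebra_simps add_divide_distrib diff_divide_distrib)
    qed
    have "L y v + \<tau> * A y v - \<tau> / \<epsilon>\<^sup>2 * L y v + \<tau> / \<epsilon>\<^sup>2 * I 1 - L v Z = 0"
    proof (rule first_coefficient_zero[OF \<delta>])
      fix t :: real assume "\<bar>t\<bar> < \<delta>"
      then have "J y \<le> J (\<lambda>x. y x + t * v x)" using c(2)[OF inS] by (simp add: y_def[symmetric] ed)
      then show "0 \<le> (L y v + \<tau> * A y v - \<tau> / \<epsilon>\<^sup>2 * L y v + \<tau> / \<epsilon>\<^sup>2 * I 1 - L v Z) * t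
       + (E v / 2 + \<tau> / (4 * \<epsilon>\<^sup>2) * (6 * I 2)) * t\<^sup>2 + (\<tau> / (4 * \<epsilon>\<^sup>2) * (4 * I 3)) * t ^ 3 + (\<tau> / (4 * \<epsilon>\<^sup>2) * I 4) * t ^ 4"
        using Jt[of t] by linarith
    qed
    moreover have "I 1 = L v (\<lambda>x. y x ^ 3)" by (simp add: I_def L_integral mult.commute)
    ultimately show ?thesis by (simp add: L.sym[OF yV v] diff_divide_distrib algebra_simps)
  qed
  then have "weak_sol Z y" using yV by (simp add: weak_sol_def)
  then show ?thesis by blast
qed

definition sol :: "('a \<Rightarrow> real) \<Rightarrow> 'a \<Rightarrow> real" where "sol Z = (THE y. weak_sol Z y)"

lemma weak_sol_unique: "weak_sol Z y \<Longrightarrow> weak_sol Z y' \<Longrightarrow> Z \<in> V \<Longrightarrow> y = y'"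
proof -
  assume a: "weak_sol Z y" "weak_sol Z y'" "Z \<in> V"
  then have yV: "y \<in> V" "y' \<in> V" by (auto simp: weak_sol_def)
  have d: "(\<lambda>x. y x - y' x) \<in> V" by (rule L.diff[OF yV])
  have "coer * nrm (\<lambda>x. y x - y' x) \<le> 0"
    using weak_sol_Lipschitz[OF a(1,2,3,3)] by (simp add: l2_norm_def l2_inner_def)
  then have "nrm (\<lambda>x. y x - y' x) = 0" using coer_pos nrm_nonneg[OF d] by (simp add: mult_le_0_iff)
  then have "L (\<lambda>x. y x - y' x) (\<lambda>x. y x - y' x) = 0" using nrm_sq[OF d] by simp
  from fun_cong[OF V_definite[OF d this]] show "y = y'" by auto
qed

lemma sol: "Z \<in> V \<Longrightarrow> weak_sol Z (sol Z)"
  unfolding sol_def using weak_sol_exists weak_sol_unique by (metis theI)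

lemma sol_V: "Z \<in> V \<Longrightarrow> sol Z \<in> V" using sol by (auto simp: weak_sol_def)

lemma dieg_step_eq:
  assumes x: "x \<in> V" and f: "f \<in> l2_space D"
  shows "dieg_step D V \<epsilon> \<tau> x f = sol (\<lambda>\<xi>. x \<xi> + fe_projection D V (l2_functional D f) \<xi>)"
proof -
  have "(y \<in> V \<and> dieg_equation D V \<epsilon> \<tau> x f y) = weak_sol (\<lambda>\<xi>. x \<xi> + fe_projection D V (l2_functional D f) \<xi>) y" for y
    using dieg_equation_iff[OF x _ f, of y] by (auto simp: weak_sol_def)
  then show ?thesis by (simp add: dieg_step_def sol_def)
qed

end

subsection \<open>Gaussian vectors\<close>

text \<open>Real weights become shifts of the phase, so that factorisation of exponentials yields
  factorisation with weights cosine and sine.\<close>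

lemma cos_times_iexp: "complex_of_real (cos y) * iexp x = (iexp (x + y) + iexp (x - y)) / 2"
  and sin_times_iexp: "complex_of_real (sin y) * iexp x = (iexp (x + y) - iexp (x - y)) / (2 * \<i>)"
  unfolding cis_conv_exp[symmetric]
  by (simp_all add: complex_eq_iff cos_add sin_add cos_diff sin_diff Re_divide Im_divide
      field_simps power2_eq_square)

lemma (in prob_space) integrable_iexp_real [intro]:
  assumes [measurable]: "f \<in> borel_measurable M" shows "integrable M (\<lambda>x. iexp (f x))"
  by (rule integrable_const_bound[of _ 1]) (auto simp: norm_exp_eq_Re)

text \<open>
  If a weight \<open>w\<close> does not affect the characteristic function of \<open>X\<close> then, by uniqueness in one
  dimension, it does not affect its law either.
\<close>

lemma (in prob_space) weighted_law:
  fixes X w :: "'a \<Rightarrow> real"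
  assumes [measurable]: "X \<in> borel_measurable M" "w \<in> borel_measurable M"
    and w: "\<And>x. 1 \<le> w x" "\<And>x. w x \<le> 3"
    and ch: "\<And>s. (CLINT x|M. of_real (w x) * iexp (s * X x)) = of_real (LINT x|M. w x) * (CLINT x|M. iexp (s * X x))"
    and A[measurable]: "A \<in> sets borel"
  shows "(LINT x|M. w x * indicator A (X x)) = (LINT x|M. w x) * (LINT x|M. indicator A (X x))"
proof -
  define Z where "Z = (LINT x|M. w x)"
  have wi: "integrable M w" using w order_trans[OF zero_le_one w(1)]
    by (intro integrable_const_bound[of _ 3]) auto
  have "(LINT x|M. 1) \<le> Z" unfolding Z_def using wi w by (intro integral_mono) auto
  \<comment> \<open>The lower bound on the weight allows it to be normalised to a probability
    density; the bounds 1 and 3 are those of 2 plus a cosine or a sine.\<close>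
  then have Z: "Z \<ge> 1" by (simp add: prob_space)
  have w0: "w x \<ge> 0" for x using w(1)[of x] by simp
  let ?M = "density M (\<lambda>x. ennreal (w x / Z))"
  have pM: "prob_space ?M"
  proof
    have "emeasure ?M (space ?M) = (\<integral>\<^sup>+x. ennreal (w x / Z) \<partial>M)"
      by (simp add: emeasure_density cong: nn_integral_cong)
    also have "\<dots> = ennreal (LINT x|M. w x / Z)"
      using wi w0 Z by (intro nn_integral_eq_integral) auto
    also have "\<dots> = 1" using Z by (simp add: Z_def)
    finally show "emeasure ?M (space ?M) = 1" .
  qed
  have eq: "distr ?M borel X = distr M borel X"
  proof (rule Levy_uniqueness)
    show "real_distribution (distr ?M borel X)" using pM
      by (intro prob_space.real_distribution_distr) auto
    show "real_distribution (distr M borel X)" by (intro real_distribution_distr) auto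
    show "char (distr ?M borel X) = char (distr M borel X)"
    proof
      fix s
      have "char (distr ?M borel X) s = (CLINT x|?M. iexp (s * X x))"
        unfolding char_def by (subst integral_distr) auto
      also have "\<dots> = (CLINT x|M. (w x / Z) *\<^sub>R iexp (s * X x))"
        using w0 Z by (intro integral_density) auto
      also have "\<dots> = (CLINT x|M. of_real (w x) * iexp (s * X x) / Z)"
        by (intro Bochner_Integration.integral_cong) (auto simp: scaleR_conv_of_real)
      also have "\<dots> = (CLINT x|M. iexp (s * X x))"
        using Z ch[of s] by (simp add: Z_def[symmetric] del: of_real_mult)
      also have "\<dots> = char (distr M borel X) s"
        unfolding char_def by (subst integral_distr) auto
      finally show "char (distr ?M borel X) s = char (distr M borel X) s" .
    qed
  qed
  have "(LINT x|M. w x / Z * indicator A (X x)) = (LINT x|?M. indicator A (X x))"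
    using w0 Z by (subst integral_density) auto
  also have "\<dots> = (LINT y|distr ?M borel X. indicator A y)" by (subst integral_distr) auto
  also have "\<dots> = (LINT y|distr M borel X. indicator A y)" by (simp add: eq)
  also have "\<dots> = (LINT x|M. indicator A (X x))" by (subst integral_distr) auto
  finally show ?thesis using Z by (simp add: Z_def[symmetric] field_simps)
qed

text \<open>The hypotheses with plus and minus give the factorisation for cosine and sine of
  \<open>Y\<close>. Adding 2 turns each into a positive weight that leaves the law of
  \<open>X\<close> unaffected; the 2 is then removed by linearity and the exponential
  reassembled.\<close>

lemma (in prob_space) char_factor_indicator:
  fixes X Y :: "'a \<Rightarrow> real"
  assumes [measurable]: "X \<in> borel_measurable M" "Y \<in> borel_measurable M"
    and f: "\<And>s. (CLINT x|M. iexp (s * X x + Y x)) = (CLINT x|M. iexp (s * X x)) * a"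
    and g: "\<And>s. (CLINT x|M. iexp (s * X x - Y x)) = (CLINT x|M. iexp (s * X x)) * b"
    and A[measurable]: "A \<in> sets borel"
  shows "(CLINT x|M. of_real (indicator A (X x)) * iexp (Y x)) = of_real (LINT x|M. indicator A (X x)) * a"
proof -
  note [simp del] = of_real_mult of_real_add of_real_diff
  have ii: "integrable M (\<lambda>x. iexp (s * X x + Y x))" "integrable M (\<lambda>x. iexp (s * X x - Y x))"
    "integrable M (\<lambda>x. iexp (s * X x))" for s by (auto intro!: integrable_iexp_real)
  have C: "(CLINT x|M. of_real (cos (Y x)) * iexp (s * X x)) = (CLINT x|M. iexp (s * X x)) * ((a + b) / 2)" for s
    using ii[of s] by (simp add: cos_times_iexp f g ring_distribs add_divide_distrib)
  have S: "(CLINT x|M. of_real (sin (Y x)) * iexp (s * X x)) = (CLINT x|M. iexp (s * X x)) * ((a - b) / (2 * \<i>))" for s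
    using ii[of s] by (simp add: sin_times_iexp f g right_diff_distrib diff_divide_distrib mult.left_commute)
  have W: "(LINT x|M. u (Y x) * indicator A (X x)) = (LINT x|M. u (Y x)) * (LINT x|M. indicator A (X x))"
    if u: "u = cos \<or> u = sin"
      and ch: "\<And>s. (CLINT x|M. of_real (u (Y x)) * iexp (s * X x)) = (CLINT x|M. iexp (s * X x)) * c"
    for u :: "real \<Rightarrow> real" and c
  proof -

    have [measurable]: "u \<in> borel_measurable borel" using u by auto
    have ub: "\<bar>u y\<bar> \<le> 1" for y using u by auto
    have u1: "1 \<le> 2 + u y" "2 + u y \<le> 3" for y using ub[of y] by auto
    have ui: "integrable M (\<lambda>x. u (Y x))" using ub by (intro integrable_const_bound[of _ 1]) auto
    have uIi: "integrable M (\<lambda>x. u (Y x) * indicator A (X x))"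
      using ub by (intro integrable_const_bound[of _ 1]) (auto simp: indicator_def)
    have Ii: "integrable M (\<lambda>x. indicator A (X x) :: real)"
      by (intro integrable_const_bound[of _ 1]) (auto simp: indicator_def)
    have uei: "integrable M (\<lambda>x. of_real (u (Y x)) * iexp (s * X x))" for s
      using ub by (intro integrable_const_bound[of _ 1]) (auto simp: norm_mult norm_exp_eq_Re)
    have c: "c = of_real (LINT x|M. u (Y x))"
      using ch[of 0] by (simp add: prob_space del: integral_of_real)
    have "(LINT x|M. (2 + u (Y x)) * indicator A (X x))
        = (LINT x|M. 2 + u (Y x)) * (LINT x|M. indicator A (X x))"
    proof (rule weighted_law)
      fix s
      have "(CLINT x|M. of_real (2 + u (Y x)) * iexp (s * X x))
         = (CLINT x|M. 2 * iexp (s * X x) + of_real (u (Y x)) * iexp (s * X x))"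
        by (simp add: distrib_right of_real_add)
      also have "\<dots> = 2 * (CLINT x|M. iexp (s * X x)) + (CLINT x|M. iexp (s * X x)) * c"
        using ii(3)[of s] uei[of s] by (subst Bochner_Integration.integral_add) (auto simp: ch)
      finally show "(CLINT x|M. of_real (2 + u (Y x)) * iexp (s * X x))
         = of_real (LINT x|M. 2 + u (Y x)) * (CLINT x|M. iexp (s * X x))"
        using ui by (simp add: c prob_space of_real_add algebra_simps)
    qed (use u1 in auto)
    then show ?thesis using ui uIi Ii by (simp add: distrib_right prob_space)
  qed
  have int: "integrable M (\<lambda>x. of_real (indicator A (X x) * u (Y x)) :: complex)"
    "integrable M (\<lambda>x. u (Y x) :: real)"
    if "u = cos \<or> u = sin" for u
    using that by (intro integrable_const_bound[of _ 1]; auto simp: indicator_def norm_mult)+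
  have e: "iexp y = of_real (cos y) + \<i> * of_real (sin y)" for y
    by (simp add: cis_conv_exp[symmetric] complex_eq_iff)
  have a: "a = of_real (LINT x|M. cos (Y x)) + \<i> * of_real (LINT x|M. sin (Y x))"
  proof -
    have "a = (CLINT x|M. iexp (Y x))" using f[of 0] by (simp add: prob_space)
    also have "\<dots> = (CLINT x|M. of_real (cos (Y x)) + \<i> * of_real (sin (Y x)))" by (simp only: e)
    also have "\<dots> = of_real (LINT x|M. cos (Y x)) + \<i> * of_real (LINT x|M. sin (Y x))"
      using int(2)[of cos] int(2)[of sin] by (subst Bochner_Integration.integral_add) auto
    finally show ?thesis .
  qed
  have "(CLINT x|M. of_real (indicator A (X x)) * iexp (Y x))
     = (CLINT x|M. of_real (indicator A (X x) * cos (Y x)) + \<i> * of_real (indicator A (X x) * sin (Y x)))"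
    unfolding e by (simp add: algebra_simps of_real_mult)
  also have "\<dots> = of_real (LINT x|M. indicator A (X x) * cos (Y x)) + \<i> * of_real (LINT x|M. indicator A (X x) * sin (Y x))"
    using int(1)[of cos] int(1)[of sin]
    by (subst Bochner_Integration.integral_add) auto
  finally show ?thesis
    using W[of cos, OF _ C] W[of sin, OF _ S] by (simp add: a mult.commute algebra_simps of_real_mult)
qed

text \<open>Only uniqueness of one-dimensional characteristic functions is used. The induction
  conditions on the event for one coordinate; under the conditioned measure the remaining
  coordinates have the same product of characteristic functions, so \<open>M\<close> must be
  arbitrary.\<close>

lemma char_product_imp_indep:
  fixes X :: "'i \<Rightarrow> 'w \<Rightarrow> real" and N :: "'i \<Rightarrow> real measure"
  assumes "finite I" "prob_space M"
    and "\<And>i. i \<in> I \<Longrightarrow> X i \<in> borel_measurable M"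
    and "\<And>i. i \<in> I \<Longrightarrow> real_distribution (N i)"
    and "\<And>t. (CLINT x|M. iexp (\<Sum>i\<in>I. t i * X i x)) = (\<Prod>i\<in>I. char (N i) (t i))"
    and "\<And>i. i \<in> I \<Longrightarrow> A i \<in> sets borel"
  shows "measure M {x\<in>space M. \<forall>i\<in>I. X i x \<in> A i} = (\<Prod>i\<in>I. measure (N i) (A i))"
  using assms
proof (induction I arbitrary: M rule: finite_induct)
  case empty
  then show ?case by (simp add: prob_space.prob_space)
next
  case (insert k I)
  interpret prob_space M by fact
  have Xm[measurable]: "X k \<in> borel_measurable M" "\<And>i. i \<in> I \<Longrightarrow> X i \<in> borel_measurable M"
    and Am[measurable]: "A k \<in> sets borel" "\<And>i. i \<in> I \<Longrightarrow> A i \<in> sets borel"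
    and Nr: "real_distribution (N k)" "\<And>i. i \<in> I \<Longrightarrow> real_distribution (N i)"
    using insert.prems by auto
  define Y where "Y t x = (\<Sum>i\<in>I. t i * X i x)" for t x
  have Ym[measurable]: "Y t \<in> borel_measurable M" for t unfolding Y_def by measurable
  have split: "(CLINT x|M. iexp (s * X k x + Y t x)) = char (N k) s * (\<Prod>i\<in>I. char (N i) (t i))" for s t
  proof -
    have "(\<Sum>i\<in>insert k I. (t(k := s)) i * X i x) = s * X k x + Y t x" for x
      unfolding Y_def using insert.hyps by (auto intro!: sum.cong)
    moreover have "(\<Prod>i\<in>insert k I. char (N i) ((t(k := s)) i)) = char (N k) s * (\<Prod>i\<in>I. char (N i) (t i))"
      using insert.hyps by (auto intro!: prod.cong)
    ultimately show ?thesis using insert.prems(4)[of "t(k := s)"] by simp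
  qed
  have z: "(\<Prod>i\<in>I. char (N i) 0) = 1" using Nr(2) by (auto intro!: prod.neutral real_distribution.char_zero)
  have chk: "(CLINT x|M. iexp (s * X k x)) = char (N k) s" for s
    using split[of s "\<lambda>_. 0"] by (simp add: Y_def z del: of_real_mult)
  have "distr M borel (X k) = N k"
  proof (rule Levy_uniqueness)
    show "char (distr M borel (X k)) = char (N k)"
      by (rule ext) (subst char_def, subst integral_distr, auto simp: chk simp del: of_real_mult)
  qed (auto intro: Nr real_distribution_distr)
  define p where "p = measure (N k) (A k)"
  have "p = measure (distr M borel (X k)) (A k)" by (simp add: p_def \<open>distr M borel (X k) = N k\<close>)
  also have "\<dots> = measure M (X k -` A k \<inter> space M)" by (rule measure_distr) auto
  finally have pX: "p = measure M (X k -` A k \<inter> space M)" .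
  have "(LINT x|M. indicator (A k) (X k x) :: real) = (LINT x|M. indicator (X k -` A k \<inter> space M) x)"
    by (intro Bochner_Integration.integral_cong) (auto simp: indicator_def)
  then have pI: "(LINT x|M. indicator (A k) (X k x)) = p" by (simp add: pX)
  have split': "(CLINT x|M. of_real (indicator (A k) (X k x)) * iexp (Y t x)) = of_real p * (\<Prod>i\<in>I. char (N i) (t i))" for t
  proof -
    have "(CLINT x|M. iexp (s * X k x - Y t x)) = (CLINT x|M. iexp (s * X k x)) * (\<Prod>i\<in>I. char (N i) (- t i))" for s
      using split[of s "\<lambda>i. - t i"] by (simp add: Y_def sum_negf chk del: of_real_mult of_real_diff of_real_add)
    from char_factor_indicator[OF _ _ _ this, of "\<Prod>i\<in>I. char (N i) (t i)" "A k"] show ?thesis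
      by (simp add: split chk pI del: of_real_mult of_real_diff of_real_add)
  qed
  let ?B = "{x\<in>space M. \<forall>i\<in>I. X i x \<in> A i}"
  have B[measurable]: "?B \<in> sets M" using insert.hyps(1) by measurable
  have goal: "{x\<in>space M. \<forall>i\<in>insert k I. X i x \<in> A i} = (X k -` A k \<inter> space M) \<inter> ?B" by auto
  show ?case
  \<comment> \<open>A null event cannot be conditioned on, but then both sides vanish.\<close>
  proof (cases "p = 0")
    case True
    have "measure M ((X k -` A k \<inter> space M) \<inter> ?B) \<le> p"
      unfolding pX by (intro finite_measure_mono) auto
    then show ?thesis unfolding goal using insert.hyps True
      by (simp add: p_def[symmetric] antisym)
  next
    case False
    then have p: "p > 0" unfolding pX by (simp add: zero_less_measure_iff)
    let ?w = "\<lambda>x. indicator (A k) (X k x) / p :: real"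
    let ?M = "density M (\<lambda>x. ennreal (?w x))"
    have Ii: "integrable M ?w" by (intro integrable_const_bound[of _ "1/p"]) (auto simp: indicator_def p less_imp_le)
    have meas: "measure ?M C = (LINT x|M. ?w x * indicator C x)" if [measurable]: "C \<in> sets M" for C
    proof -
      have "measure ?M C = (LINT x|?M. indicator C x)" by simp
      also have "\<dots> = (LINT x|M. ?w x * indicator C x)"
        using p by (subst integral_density) auto
      finally show ?thesis .
    qed
    have pM: "prob_space ?M"
    proof
      have "emeasure ?M (space ?M) = (\<integral>\<^sup>+x. ennreal (?w x) \<partial>M)"
        by (simp add: emeasure_density cong: nn_integral_cong)
      also have "\<dots> = ennreal (LINT x|M. ?w x)"
        using Ii p by (intro nn_integral_eq_integral) auto
      also have "\<dots> = 1" using p pI by simp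
      finally show "emeasure ?M (space ?M) = 1" .
    qed
    have "measure ?M {x\<in>space ?M. \<forall>i\<in>I. X i x \<in> A i} = (\<Prod>i\<in>I. measure (N i) (A i))"
    proof (rule insert.IH[OF pM])
      fix t
      have "(CLINT x|?M. iexp (Y t x)) = (CLINT x|M. ?w x *\<^sub>R iexp (Y t x))"
        using p by (intro integral_density) auto
      also have "\<dots> = (CLINT x|M. of_real (indicator (A k) (X k x)) * iexp (Y t x) / p)"
        by (intro Bochner_Integration.integral_cong) (auto simp: scaleR_conv_of_real)
      also have "\<dots> = (\<Prod>i\<in>I. char (N i) (t i))" using p by (simp add: split')
      finally show "(CLINT x|?M. iexp (\<Sum>i\<in>I. t i * X i x)) = (\<Prod>i\<in>I. char (N i) (t i))"
        by (simp add: Y_def)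
    qed (use Nr in auto)
    then have "(\<Prod>i\<in>I. measure (N i) (A i)) = (LINT x|M. ?w x * indicator ?B x)"
      using meas[OF B] by simp
    also have "\<dots> = (LINT x|M. indicator ((X k -` A k \<inter> space M) \<inter> ?B) x / p)"
      by (intro Bochner_Integration.integral_cong) (auto simp: indicator_def)
    also have "\<dots> = measure M ((X k -` A k \<inter> space M) \<inter> ?B) / p"
      by simp
    finally show ?thesis unfolding goal using insert.hyps p by (simp add: p_def[symmetric])
  qed
qed

lemma normal_density_distr:
  fixes \<sigma> :: real
  assumes "\<sigma> > 0"
  shows "distr std_normal_distribution borel (\<lambda>x. m + \<sigma> * x) = density lborel (normal_density m \<sigma>)"
proof -
  interpret prob_space std_normal_distribution
    using real_dist_normal_dist real_distribution.axioms(1) by blast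
  have "distributed std_normal_distribution lborel (\<lambda>x. x) (normal_density 0 1)"
    by (auto simp: distributed_def intro!: measure_eqI)
      (simp add: emeasure_distr)
  from normal_density_affine[OF this _ , of \<sigma> m] assms
  have "distributed std_normal_distribution lborel (\<lambda>x. m + \<sigma> * x) (normal_density m \<sigma>)" by simp
  from distributed_distr_eq_density[OF this] show ?thesis by (simp cong: distr_cong)
qed

lemma char_normal:
  assumes "\<sigma> > 0"
  shows "char (density lborel (normal_density 0 \<sigma>)) t = of_real (exp (- (\<sigma>\<^sup>2 * t\<^sup>2) / 2))"
proof -
  have "char (density lborel (normal_density 0 \<sigma>)) t = (CLINT x|std_normal_distribution. iexp (t * (0 + \<sigma> * x)))"
    unfolding normal_density_distr[OF assms, symmetric] char_def by (subst integral_distr) auto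
  also have "\<dots> = char std_normal_distribution (t * \<sigma>)" by (simp add: char_def mult.assoc)
  finally show ?thesis by (simp add: char_std_normal_distribution power_mult_distrib mult.commute)
qed

lemma char_normal_law:
  assumes "v \<ge> 0" shows "char (normal_law 0 v) t = of_real (exp (- (v * t\<^sup>2) / 2))"
proof (cases "v = 0")
  case True
  then show ?thesis by (simp add: normal_law_def char_def integral_return)
next
  case False
  then show ?thesis using char_normal[of "sqrt v" t] assms by (simp add: normal_law_def)
qed

text \<open>The characteristic function of a linear combination at 1 is the joint one at the vector
  of coefficients, and here it is a product. Both sides are then identified with a product measure
  through their values on rectangles; \<open>g\<close> will be the vector of coordinates of the
  current state.\<close>

lemma gaussian_vector_density:
  fixes X :: "'i \<Rightarrow> 'w \<Rightarrow> real"
  assumes I: "finite I" and M: "prob_space M" and \<tau>: "\<tau> > 0"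
    and Xm: "\<And>i. i \<in> I \<Longrightarrow> X i \<in> borel_measurable M"
    and law: "\<And>t. distr M borel (\<lambda>x. \<Sum>i\<in>I. t i * X i x) = normal_law 0 (\<tau> * (\<Sum>i\<in>I. (t i)\<^sup>2))"
  shows "distr M (PiM I (\<lambda>_. lborel)) (\<lambda>x. \<lambda>i\<in>I. g i + X i x)
    = density (PiM I (\<lambda>_. lborel)) (\<lambda>z. \<Prod>i\<in>I. ennreal (normal_density (g i) (sqrt \<tau>) (z i)))"
proof -
  interpret prob_space M by fact
  note [measurable] = Xm
  define N where "N i = density lborel (\<lambda>x. ennreal (normal_density (g i) (sqrt \<tau>) x))" for i
  let ?N0 = "density lborel (\<lambda>x. ennreal (normal_density 0 (sqrt \<tau>) x))"
  interpret L: product_sigma_finite "\<lambda>_ :: 'i. lborel :: real measure" by standard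
  have [simp]: "sets (N i) = sets borel" for i by (simp add: N_def)
  interpret NP: product_prob_space N
    unfolding N_def by (intro product_prob_spaceI prob_space_normal_density) (simp add: \<tau>)
  have c: "(CLINT x|M. iexp (\<Sum>i\<in>I. t i * X i x)) = (\<Prod>i\<in>I. char ?N0 (t i))" for t
  proof -
    have "(CLINT x|M. iexp (\<Sum>i\<in>I. t i * X i x)) = char (distr M borel (\<lambda>x. \<Sum>i\<in>I. t i * X i x)) 1"
      unfolding char_def by (subst integral_distr) auto
    also have "\<dots> = of_real (exp (- (\<tau> * (\<Sum>i\<in>I. (t i)\<^sup>2)) / 2))"
      unfolding law using \<tau> by (subst char_normal_law) (auto simp: sum_nonneg)
    also have "- (\<tau> * (\<Sum>i\<in>I. (t i)\<^sup>2)) / 2 = (\<Sum>i\<in>I. - (\<tau> * (t i)\<^sup>2) / 2)"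
      by (simp add: sum_distrib_left sum_divide_distrib sum_negf)
    also have "of_real (exp (\<Sum>i\<in>I. - (\<tau> * (t i)\<^sup>2) / 2)) = (\<Prod>i\<in>I. char ?N0 (t i))"
      using \<tau> I by (simp add: char_normal exp_sum)
    finally show ?thesis .
  qed
  have ind: "measure M {x\<in>space M. \<forall>i\<in>I. X i x \<in> A i} = (\<Prod>i\<in>I. measure ?N0 (A i))"
    if "\<And>i. i \<in> I \<Longrightarrow> A i \<in> sets borel" for A
    using \<tau> c that
    by (intro char_product_imp_indep[OF I M])
      (auto simp: real_distribution_def real_distribution_axioms_def prob_space_normal_density)
  have shift: "measure ?N0 {x. a + x \<in> A} = measure (density lborel (\<lambda>x. ennreal (normal_density a (sqrt \<tau>) x))) A"
    if [measurable]: "A \<in> sets borel" for A a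
  proof -
    have "measure (density lborel (\<lambda>x. ennreal (normal_density b (sqrt \<tau>) x))) B
       = measure std_normal_distribution {x. b + sqrt \<tau> * x \<in> B}" if [measurable]: "B \<in> sets borel" for b B
      using \<tau> by (subst normal_density_distr[symmetric]) (auto simp: measure_distr vimage_def)
    from this[of A a] this[of "{x. a + x \<in> A}" 0] show ?thesis by (simp add: add.assoc)
  qed
  have d1: "distr M (PiM I (\<lambda>_. lborel)) (\<lambda>x. \<lambda>i\<in>I. g i + X i x) = PiM I N"
  proof (rule NP.PiM_eqI[OF I])
    show "sets (distr M (PiM I (\<lambda>_. lborel)) (\<lambda>x. \<lambda>i\<in>I. g i + X i x)) = sets (PiM I N)"
      by (simp cong: sets_PiM_cong)
    fix A assume A: "\<And>i. i \<in> I \<Longrightarrow> A i \<in> sets (N i)"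
    then have Am[measurable]: "\<And>i. i \<in> I \<Longrightarrow> A i \<in> sets borel" by simp
    have [measurable]: "PiE I A \<in> sets (PiM I (\<lambda>_. lborel))" using I A by (intro sets_PiM_I_finite) auto
    have "emeasure (distr M (PiM I (\<lambda>_. lborel)) (\<lambda>x. \<lambda>i\<in>I. g i + X i x)) (PiE I A)
      = emeasure M ((\<lambda>x. \<lambda>i\<in>I. g i + X i x) -` PiE I A \<inter> space M)"
      by (rule emeasure_distr) auto
    also have "(\<lambda>x. \<lambda>i\<in>I. g i + X i x) -` PiE I A \<inter> space M = {x\<in>space M. \<forall>i\<in>I. X i x \<in> {y. g i + y \<in> A i}}"
      by (auto simp: PiE_iff)
    also have "emeasure M \<dots> = ennreal (measure M \<dots>)" by (rule emeasure_eq_measure)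
    also have "\<dots> = ennreal (\<Prod>i\<in>I. measure ?N0 {y. g i + y \<in> A i})"
      by (subst ind) auto
    also have "\<dots> = (\<Prod>i\<in>I. emeasure (N i) (A i))"
      using Am \<tau> by (simp add: shift N_def[symmetric] prod_ennreal[symmetric] NP.M.emeasure_eq_measure)
    finally show "emeasure (distr M (PiM I (\<lambda>_. lborel)) (\<lambda>x. \<lambda>i\<in>I. g i + X i x)) (PiE I A) = (\<Prod>i\<in>I. emeasure (N i) (A i))" .
  qed
  have d2: "density (PiM I (\<lambda>_. lborel)) (\<lambda>z. \<Prod>i\<in>I. ennreal (normal_density (g i) (sqrt \<tau>) (z i))) = PiM I N"
  proof (rule NP.PiM_eqI[OF I])
    show "sets (density (PiM I (\<lambda>_. lborel)) (\<lambda>z. \<Prod>i\<in>I. ennreal (normal_density (g i) (sqrt \<tau>) (z i)))) = sets (PiM I N)"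
      by (simp cong: sets_PiM_cong)
    fix A assume A: "\<And>i. i \<in> I \<Longrightarrow> A i \<in> sets (N i)"
    then have Am[measurable]: "\<And>i. i \<in> I \<Longrightarrow> A i \<in> sets borel" by simp
    have [measurable]: "PiE I A \<in> sets (PiM I (\<lambda>_. lborel))" using I A by (intro sets_PiM_I_finite) auto
    have "emeasure (density (PiM I (\<lambda>_. lborel)) (\<lambda>z. \<Prod>i\<in>I. ennreal (normal_density (g i) (sqrt \<tau>) (z i)))) (PiE I A)
      = (\<integral>\<^sup>+z. (\<Prod>i\<in>I. ennreal (normal_density (g i) (sqrt \<tau>) (z i))) * indicator (PiE I A) z \<partial>PiM I (\<lambda>_. lborel))"
      by (rule emeasure_density) auto
    also have "\<dots> = (\<integral>\<^sup>+z. (\<Prod>i\<in>I. ennreal (normal_density (g i) (sqrt \<tau>) (z i)) * indicator (A i) (z i)) \<partial>PiM I (\<lambda>_. lborel))"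
    proof (intro nn_integral_cong)
      fix z assume "z \<in> space (PiM I (\<lambda>_. lborel :: real measure))"
      then have "indicator (PiE I A) z = (\<Prod>i\<in>I. indicator (A i) (z i) :: ennreal)"
        using I by (auto simp: indicator_def space_PiM PiE_iff prod_zero_iff)
      then show "(\<Prod>i\<in>I. ennreal (normal_density (g i) (sqrt \<tau>) (z i))) * indicator (PiE I A) z
         = (\<Prod>i\<in>I. ennreal (normal_density (g i) (sqrt \<tau>) (z i)) * indicator (A i) (z i))"
        by (simp add: prod.distrib)
    qed
    also have "\<dots> = (\<Prod>i\<in>I. (\<integral>\<^sup>+x. ennreal (normal_density (g i) (sqrt \<tau>) x) * indicator (A i) x \<partial>lborel))"
      by (rule L.product_nn_integral_prod[OF I]) auto
    also have "\<dots> = (\<Prod>i\<in>I. emeasure (N i) (A i))"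
      unfolding N_def by (intro prod.cong refl emeasure_density[symmetric]) auto
    finally show "emeasure (density (PiM I (\<lambda>_. lborel)) (\<lambda>z. \<Prod>i\<in>I. ennreal (normal_density (g i) (sqrt \<tau>) (z i)))) (PiE I A)
      = (\<Prod>i\<in>I. emeasure (N i) (A i))" .
  qed
  show ?thesis by (simp only: d1 d2)
qed

subsection \<open>Invariant probability measures\<close>

text \<open>As a fixed point equation for \<open>bind\<close>, invariance becomes accessible to the
  laws relating \<open>bind\<close> and \<open>distr\<close>.\<close>

lemma invariant_probability_iff_bind:
  assumes "P \<in> N \<rightarrow>\<^sub>M prob_algebra N"
  shows "invariant_probability N P \<mu> \<longleftrightarrow> \<mu> \<in> space (prob_algebra N) \<and> \<mu> \<bind> P = \<mu>"
proof (cases "\<mu> \<in> space (prob_algebra N)")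
  case True
  then have s: "sets \<mu> = sets N" and p: "prob_space \<mu>" by (auto simp: space_prob_algebra)
  have "emeasure (\<mu> \<bind> P) A = (\<integral>\<^sup>+x. emeasure (P x) A \<partial>\<mu>)" if "A \<in> sets N" for A
    using True assms that by (rule emeasure_bind_prob_algebra)
  moreover have "sets (\<mu> \<bind> P) = sets N" using True assms by (rule sets_bind')
  ultimately show ?thesis using s p True
    by (auto simp: invariant_probability_def intro!: measure_eqI)
next
  case False
  then show ?thesis by (auto simp: invariant_probability_def space_prob_algebra)
qed

text \<open>A random stage \<open>T\<close> alternates with a deterministic stage \<open>s\<close>,
  and the two kernels observe the same chain at different stages. An invariant \<mu> at the one
  stage is the image under \<open>s\<close> of the invariant measure \<open>\<mu> \<bind> T\<close>
  at the other, so uniqueness is inherited, and existence likewise.\<close>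

lemma uniquely_ergodic_factor:
  assumes T: "T \<in> A \<rightarrow>\<^sub>M prob_algebra B" and s: "s \<in> B \<rightarrow>\<^sub>M A"
    and ue: "uniquely_ergodic B (\<lambda>z. T (s z))"
  shows "uniquely_ergodic A (\<lambda>x. distr (T x) A s)"
proof -
  let ?P = "\<lambda>x. distr (T x) A s" and ?R = "\<lambda>z. T (s z)"
  have P: "?P \<in> A \<rightarrow>\<^sub>M prob_algebra A"
    by (rule measurable_compose[OF T measurable_distr_prob_space[OF s]])
  have R: "?R \<in> B \<rightarrow>\<^sub>M prob_algebra B" by (rule measurable_compose[OF s T])
  note T' = measurable_prob_algebraD[OF T] and P' = measurable_prob_algebraD[OF P]
    and R' = measurable_prob_algebraD[OF R]
  have ne: "space \<mu> \<noteq> {}" if "\<mu> \<in> space (prob_algebra N)" for \<mu> :: "'z measure" and N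
    using that prob_space.not_empty by (auto simp: space_prob_algebra)
  have AB: "\<mu> \<bind> T \<bind> ?R = \<mu> \<bind> T \<and> distr (\<mu> \<bind> T) A s = \<mu> \<and> \<mu> \<bind> T \<in> space (prob_algebra B)"
    if \<mu>: "\<mu> \<in> space (prob_algebra A)" "\<mu> \<bind> ?P = \<mu>" for \<mu>
  proof -
    have [measurable_cong]: "sets \<mu> = sets A" using \<mu> by (auto simp: space_prob_algebra)
    have T1: "T \<in> \<mu> \<rightarrow>\<^sub>M subprob_algebra B" using T' by simp
    have 1: "distr (\<mu> \<bind> T) A s = \<mu>"
      using distr_bind[OF T1 ne[OF \<mu>(1)] s] \<mu>(2) by simp
    have "\<mu> \<bind> T \<in> space (prob_algebra B)"
      using prob_space_bind'[OF \<mu>(1) T] sets_bind'[OF \<mu>(1) T] by (simp add: space_prob_algebra)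
    moreover have "distr (\<mu> \<bind> T) A s \<bind> T = \<mu> \<bind> T \<bind> ?R"
      using s sets_bind'[OF \<mu>(1) T] ne[OF calculation]
      by (intro bind_distr[OF _ T']) (auto simp: measurable_cong_sets[OF sets_bind'[OF \<mu>(1) T] refl])
    ultimately show ?thesis using 1 by simp
  qed
  have BA: "distr \<nu> A s \<bind> ?P = distr \<nu> A s \<and> distr \<nu> A s \<in> space (prob_algebra A)"
    if \<nu>: "\<nu> \<in> space (prob_algebra B)" "\<nu> \<bind> ?R = \<nu>" for \<nu>
  proof -
    have sn[measurable_cong]: "sets \<nu> = sets B" using \<nu> by (auto simp: space_prob_algebra)
    have s1: "s \<in> \<nu> \<rightarrow>\<^sub>M A" using s by simp
    have "distr \<nu> A s \<bind> ?P = \<nu> \<bind> (\<lambda>z. distr (?R z) A s)"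
      by (rule bind_distr[OF s1 P' ne[OF \<nu>(1)]])
    also have "\<dots> = distr (\<nu> \<bind> ?R) A s"
      using R' by (intro distr_bind[OF _ ne[OF \<nu>(1)] s, symmetric]) simp
    finally have "distr \<nu> A s \<bind> ?P = distr \<nu> A s" using \<nu>(2) by simp
    moreover have "distr \<nu> A s \<in> space (prob_algebra A)"
      using \<nu>(1) prob_space.prob_space_distr[OF _ s1] by (auto simp: space_prob_algebra)
    ultimately show ?thesis by simp
  qed
  from ue obtain \<nu> where \<nu>: "\<nu> \<in> space (prob_algebra B)" "\<nu> \<bind> ?R = \<nu>"
    and un: "\<And>\<nu>'. \<nu>' \<in> space (prob_algebra B) \<Longrightarrow> \<nu>' \<bind> ?R = \<nu>' \<Longrightarrow> \<nu>' = \<nu>"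
    unfolding uniquely_ergodic_def Ex1_def invariant_probability_iff_bind[OF R] by blast
  have "\<exists>!\<mu>. invariant_probability A ?P \<mu>"
    unfolding invariant_probability_iff_bind[OF P]
  proof (rule ex1I[of _ "distr \<nu> A s"])
    fix \<mu> assume "\<mu> \<in> space (prob_algebra A) \<and> \<mu> \<bind> ?P = \<mu>"
    with AB[of \<mu>] un[of "\<mu> \<bind> T"] show "\<mu> = distr \<nu> A s" by auto
  qed (use BA[OF \<nu>] in auto)
  with P show ?thesis by (simp add: uniquely_ergodic_def)
qed

section \<open>Kernels with a density\<close>

lemma density_kernel_measurable:
  fixes p :: "'x \<Rightarrow> 'y \<Rightarrow> ennreal"
  assumes "sigma_finite_measure m" "case_prod p \<in> borel_measurable (N \<Otimes>\<^sub>M m)"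
    and "\<And>x. x \<in> space N \<Longrightarrow> (\<integral>\<^sup>+y. p x y \<partial>m) = 1"
  shows "(\<lambda>x. density m (p x)) \<in> N \<rightarrow>\<^sub>M prob_algebra m"
proof -
  interpret sigma_finite_measure m by fact
  note [measurable] = assms(2)
  have pm: "p x \<in> borel_measurable m" if "x \<in> space N" for x
    using measurable_compose[OF measurable_Pair1' assms(2)] that by simp
  have pr: "prob_space (density m (p x))" if "x \<in> space N" for x
    using assms(3)[OF that] pm[OF that] by (intro prob_spaceI) (simp add: emeasure_density cong: nn_integral_cong)
  show ?thesis
  proof (rule measurable_prob_algebraI[OF pr measurable_subprob_algebra])
    fix A assume [measurable]: "A \<in> sets m"
    have "(\<lambda>x. \<integral>\<^sup>+y. p x y * indicator A y \<partial>m) \<in> borel_measurable N" by measurable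
    then show "(\<lambda>x. emeasure (density m (p x)) A) \<in> borel_measurable N"
      by (rule measurable_cong[THEN iffD1, rotated]) (simp add: emeasure_density pm)
  qed (auto intro: pr prob_space_imp_subprob_space)
qed

text \<open>
  The invariant measure is the regeneration series \<open>\<Sum>\<^sub>n \<eta> k\<^sup>n\<close>, where \<open>k\<close> is what remains of the
  kernel \<open>p\<close> after removal of the minorising part; the drift condition, corrected by a constant,
  becomes \<open>k V' + 1 \<le> V'\<close> and bounds the total mass of the series.
\<close>

lemma invariant_density_exists:
  fixes p k :: "'s \<Rightarrow> 's \<Rightarrow> ennreal" and \<eta> V :: "'s \<Rightarrow> ennreal" and b :: real
  assumes sf: "sigma_finite_measure m"
    and km[measurable]: "case_prod k \<in> borel_measurable (m \<Otimes>\<^sub>M m)"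
    and em[measurable]: "\<eta> \<in> borel_measurable m" and Vm[measurable]: "V \<in> borel_measurable m"
    and C[measurable]: "C \<in> sets m"
    and dec: "\<And>x y. x \<in> space m \<Longrightarrow> y \<in> space m \<Longrightarrow> p x y = k x y + indicator C x * \<eta> y"
    and p1: "\<And>x. x \<in> space m \<Longrightarrow> (\<integral>\<^sup>+y. p x y \<partial>m) = 1"
    and eta: "0 < integral\<^sup>N m \<eta>" "integral\<^sup>N m \<eta> < \<infinity>" "(\<integral>\<^sup>+y. \<eta> y * V y \<partial>m) < \<infinity>"
    and b: "b \<ge> 0"
    and drift: "\<And>x. x \<in> space m \<Longrightarrow> (\<integral>\<^sup>+y. p x y * V y \<partial>m) + 1 \<le> V x + ennreal b * indicator C x"
  shows "\<exists>f\<in>borel_measurable m. integral\<^sup>N m f = 1 \<and> (\<forall>y\<in>space m. (\<integral>\<^sup>+x. f x * p x y \<partial>m) = f y)"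
proof -
  interpret sigma_finite_measure m by fact
  interpret pair_sigma_finite m m by standard
  define \<beta> where "\<beta> = integral\<^sup>N m \<eta>"
  have \<beta>: "\<beta> \<noteq> 0" "\<beta> \<noteq> \<infinity>" using eta by (auto simp: \<beta>_def)
  \<comment> \<open>The kernel \<open>k\<close> has lost mass \<beta> on \<open>C\<close>, so adding
    this constant to \<open>V\<close> gains exactly \<open>b\<close> there and absorbs the
    exceptional term of the drift condition.\<close>
  define c where "c = ennreal b / \<beta>"
  have c\<beta>: "c * \<beta> = ennreal b" unfolding c_def using \<beta>
    by (simp add: ennreal_divide_times[symmetric] divide_mult_eq ennreal_times_divide)
      (metis \<beta> ennreal_mult_divide_eq ennreal_times_divide infinity_ennreal_def mult.commute)
  have cfin: "c < \<infinity>" unfolding c_def using \<beta> by (simp add: ennreal_divide_eq_top_iff less_top[symmetric])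
  have kx[measurable]: "k x \<in> borel_measurable m" if "x \<in> space m" for x
    using measurable_compose[OF measurable_Pair1' km] that by simp
  define K1 where "K1 x = (\<integral>\<^sup>+y. k x y \<partial>m)" for x
  have K1m[measurable]: "K1 \<in> borel_measurable m" unfolding K1_def by measurable
  have K1: "K1 x + \<beta> * indicator C x = 1" if x: "x \<in> space m" for x
  proof -
    have "(\<integral>\<^sup>+y. p x y \<partial>m) = (\<integral>\<^sup>+y. k x y + indicator C x * \<eta> y \<partial>m)"
      using x by (intro nn_integral_cong) (simp add: dec)
    also have "\<dots> = K1 x + indicator C x * \<beta>"
      using x kx[OF x] by (simp add: K1_def \<beta>_def nn_integral_add nn_integral_cmult)
    finally show ?thesis using p1[OF x] by (simp add: mult.commute)
  qed
  define V' where "V' x = V x + c" for x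
  have V'm[measurable]: "V' \<in> borel_measurable m" unfolding V'_def by measurable
  have KV: "(\<integral>\<^sup>+y. k x y * V' y \<partial>m) + 1 \<le> V' x" if x: "x \<in> space m" for x
  proof -
    have "(\<integral>\<^sup>+y. k x y * V' y \<partial>m) = (\<integral>\<^sup>+y. k x y * V y \<partial>m) + K1 x * c"
      using kx[OF x] by (simp add: V'_def K1_def distrib_left nn_integral_add nn_integral_multc)
    also have "\<dots> + 1 \<le> (\<integral>\<^sup>+y. p x y * V y \<partial>m) + 1 + K1 x * c"
      unfolding add.assoc add.commute[of 1] using x
      by (intro add_mono nn_integral_mono order_refl mult_right_mono) (auto simp: dec)
    also have "\<dots> \<le> V x + ennreal b * indicator C x + K1 x * c"
      by (intro add_mono drift x order_refl)
    also have "\<dots> = V x + c * (K1 x + \<beta> * indicator C x)"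
      by (simp add: distrib_left c\<beta>[symmetric] ac_simps)
    finally show ?thesis using K1[OF x] by (simp add: V'_def)
  qed
  define f where "f = rec_nat \<eta> (\<lambda>_ g y. \<integral>\<^sup>+x. g x * k x y \<partial>m)"
  have f0: "f 0 = \<eta>" and fS: "f (Suc n) y = (\<integral>\<^sup>+x. f n x * k x y \<partial>m)" for n y
    by (auto simp: f_def)
  have fm[measurable]: "f n \<in> borel_measurable m" for n
  proof (induction n)
    case (Suc n)
    note [measurable] = Suc
    have "(\<lambda>y. \<integral>\<^sup>+x. f n x * k x y \<partial>m) \<in> borel_measurable m" by measurable
    then show ?case by (simp add: fS[abs_def])
  qed (simp add: f0)
  have flow: "(\<integral>\<^sup>+y. (\<integral>\<^sup>+x. g x * k x y \<partial>m) * u y \<partial>m) = (\<integral>\<^sup>+x. g x * (\<integral>\<^sup>+y. k x y * u y \<partial>m) \<partial>m)"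
    if [measurable]: "g \<in> borel_measurable m" "u \<in> borel_measurable m" for g u
  proof -
    have "(\<integral>\<^sup>+y. (\<integral>\<^sup>+x. g x * k x y \<partial>m) * u y \<partial>m) = (\<integral>\<^sup>+y. (\<integral>\<^sup>+x. g x * k x y * u y \<partial>m) \<partial>m)"
      by (intro nn_integral_cong nn_integral_multc[symmetric]) measurable
    also have "\<dots> = (\<integral>\<^sup>+x. (\<integral>\<^sup>+y. g x * k x y * u y \<partial>m) \<partial>m)"
      by (rule Fubini'[symmetric]) measurable
    also have "\<dots> = (\<integral>\<^sup>+x. g x * (\<integral>\<^sup>+y. k x y * u y \<partial>m) \<partial>m)"
      by (intro nn_integral_cong) (simp add: mult.assoc nn_integral_cmult)
    finally show ?thesis .
  qed
  have step: "(\<integral>\<^sup>+y. f (Suc n) y * V' y \<partial>m) + integral\<^sup>N m (f n) \<le> (\<integral>\<^sup>+y. f n y * V' y \<partial>m)" for n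
  proof -
    have "(\<integral>\<^sup>+y. f (Suc n) y * V' y \<partial>m) + integral\<^sup>N m (f n)
       = (\<integral>\<^sup>+x. f n x * ((\<integral>\<^sup>+y. k x y * V' y \<partial>m) + 1) \<partial>m)"
      by (simp add: fS flow distrib_left nn_integral_add)
    also have "\<dots> \<le> (\<integral>\<^sup>+y. f n y * V' y \<partial>m)"
      by (intro nn_integral_mono mult_left_mono KV) auto
    finally show ?thesis .
  qed
  have J0: "(\<integral>\<^sup>+y. f 0 y * V' y \<partial>m) < \<infinity>"
    using eta(2,3) cfin by (simp add: f0 V'_def distrib_left nn_integral_add nn_integral_multc
        ennreal_mult_less_top)
  \<comment> \<open>The drift inequality telescopes: the masses of the terms together never exceed
    the initial integral of \<open>V'\<close>.\<close>
  have part: "(\<Sum>i<n. integral\<^sup>N m (f i)) + (\<integral>\<^sup>+y. f n y * V' y \<partial>m) \<le> (\<integral>\<^sup>+y. f 0 y * V' y \<partial>m)" for n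
  proof (induction n)
    case (Suc n)
    have "(\<Sum>i<Suc n. integral\<^sup>N m (f i)) + (\<integral>\<^sup>+y. f (Suc n) y * V' y \<partial>m)
       = (\<Sum>i<n. integral\<^sup>N m (f i)) + ((\<integral>\<^sup>+y. f (Suc n) y * V' y \<partial>m) + integral\<^sup>N m (f n))"
      by (simp add: ac_simps)
    also have "\<dots> \<le> (\<Sum>i<n. integral\<^sup>N m (f i)) + (\<integral>\<^sup>+y. f n y * V' y \<partial>m)"
      by (intro add_left_mono step)
    finally show ?case using Suc by (rule order_trans)
  qed simp
  define \<pi> where "\<pi> x = (\<Sum>n. f n x)" for x
  have \<pi>m[measurable]: "\<pi> \<in> borel_measurable m" unfolding \<pi>_def by measurable
  define Z where "Z = integral\<^sup>N m \<pi>"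
  have Zsum: "Z = (\<Sum>n. integral\<^sup>N m (f n))"
    unfolding Z_def \<pi>_def by (rule nn_integral_suminf) measurable
  have "(\<Sum>n. integral\<^sup>N m (f n)) \<le> (\<integral>\<^sup>+y. f 0 y * V' y \<partial>m)"
    by (intro suminf_le_const summableI order_trans[OF add_increasing2[OF zero_le order_refl] part])
  then have Zfin: "Z < \<infinity>" using J0 Zsum by auto
  have \<pi>k: "\<eta> y + (\<integral>\<^sup>+x. \<pi> x * k x y \<partial>m) = \<pi> y" if [measurable]: "y \<in> space m" for y
  proof -
    have "(\<integral>\<^sup>+x. \<pi> x * k x y \<partial>m) = (\<integral>\<^sup>+x. (\<Sum>n. f n x * k x y) \<partial>m)"
      by (simp add: \<pi>_def)
    also have "\<dots> = (\<Sum>n. f (Suc n) y)" unfolding fS by (rule nn_integral_suminf) measurable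
    finally show ?thesis
      using suminf_offset[of "\<lambda>n. f n y" 1] by (simp add: \<pi>_def f0 add.commute)
  qed
  have \<beta>Z: "\<beta> \<le> Z"
    unfolding \<beta>_def Z_def using \<pi>k by (intro nn_integral_mono) (metis le_iff_add)
  have 1: "Z = \<beta> + (\<integral>\<^sup>+x. \<pi> x * K1 x \<partial>m)"
  proof -
    have "Z = (\<integral>\<^sup>+y. \<eta> y + (\<integral>\<^sup>+x. \<pi> x * k x y \<partial>m) \<partial>m)"
      unfolding Z_def by (intro nn_integral_cong) (simp add: \<pi>k)
    also have "\<dots> = \<beta> + (\<integral>\<^sup>+y. (\<integral>\<^sup>+x. \<pi> x * k x y \<partial>m) * 1 \<partial>m)"
      by (simp add: nn_integral_add \<beta>_def)
    also have "(\<integral>\<^sup>+y. (\<integral>\<^sup>+x. \<pi> x * k x y \<partial>m) * 1 \<partial>m) = (\<integral>\<^sup>+x. \<pi> x * K1 x \<partial>m)"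
      by (subst flow) (auto simp: K1_def)
    finally show ?thesis .
  qed
  have 2: "Z = (\<integral>\<^sup>+x. \<pi> x * K1 x \<partial>m) + \<beta> * (\<integral>\<^sup>+x. \<pi> x * indicator C x \<partial>m)"
  proof -
    have "Z = (\<integral>\<^sup>+x. \<pi> x * (K1 x + \<beta> * indicator C x) \<partial>m)"
      unfolding Z_def by (intro nn_integral_cong) (simp add: K1)
    also have "\<dots> = (\<integral>\<^sup>+x. \<pi> x * K1 x \<partial>m) + (\<integral>\<^sup>+x. \<beta> * (\<pi> x * indicator C x) \<partial>m)"
      by (simp add: distrib_left nn_integral_add ac_simps)
    finally show ?thesis by (simp add: nn_integral_cmult)
  qed
  have "(\<integral>\<^sup>+x. \<pi> x * K1 x \<partial>m) < \<infinity>"     using 1 Zfin by (cases "(\<integral>\<^sup>+x. \<pi> x * K1 x \<partial>m) = \<top>") (auto simp: less_top)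
  moreover have "(\<integral>\<^sup>+x. \<pi> x * K1 x \<partial>m) + \<beta> * (\<integral>\<^sup>+x. \<pi> x * indicator C x \<partial>m) = (\<integral>\<^sup>+x. \<pi> x * K1 x \<partial>m) + \<beta>"
    using 1 2 by (simp add: add.commute)
  ultimately have "\<beta> * (\<integral>\<^sup>+x. \<pi> x * indicator C x \<partial>m) = \<beta> * 1"
    by (auto simp: ennreal_add_left_cancel)
  \<comment> \<open>Comparing two expressions for the total mass, with the finite common term
    cancelled. That the series gives \<open>C\<close> mass 1 is what turns \<open>\<eta>\<close>
    plus \<pi> propagated by \<open>k\<close> into \<pi> propagated by \<open>p\<close>.\<close>
  then have C1: "(\<integral>\<^sup>+x. \<pi> x * indicator C x \<partial>m) = 1"
    using \<beta> by (subst (asm) ennreal_mult_cancel_left) auto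
  have inv: "(\<integral>\<^sup>+x. \<pi> x * p x y \<partial>m) = \<pi> y" if [measurable]: "y \<in> space m" for y
  proof -
    have "(\<integral>\<^sup>+x. \<pi> x * p x y \<partial>m) = (\<integral>\<^sup>+x. \<pi> x * k x y + \<eta> y * (\<pi> x * indicator C x) \<partial>m)"
      by (intro nn_integral_cong) (simp add: dec that distrib_left ac_simps)
    also have "\<dots> = (\<integral>\<^sup>+x. \<pi> x * k x y \<partial>m) + \<eta> y * (\<integral>\<^sup>+x. \<pi> x * indicator C x \<partial>m)"
      by (subst nn_integral_add) (auto simp: nn_integral_cmult)
    finally show ?thesis using \<pi>k[OF that] by (simp add: C1 add.commute)
  qed
  have Z0: "Z \<noteq> 0" using \<beta>Z \<beta> by auto
  show ?thesis
  proof (intro bexI conjI ballI)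
    show "integral\<^sup>N m (\<lambda>x. \<pi> x / Z) = 1"
      using Z0 Zfin by (simp add: nn_integral_divide Z_def[symmetric] ennreal_divide_self less_top)
    fix y assume [measurable]: "y \<in> space m"
    have "p x y = k x y + indicator C x * \<eta> y" if "x \<in> space m" for x
      using dec that \<open>y \<in> space m\<close> by simp
    then have [measurable]: "(\<lambda>x. p x y) \<in> borel_measurable m"
      by (subst measurable_cong) measurable
    have "(\<integral>\<^sup>+x. \<pi> x / Z * p x y \<partial>m) = (\<integral>\<^sup>+x. \<pi> x * p x y / Z \<partial>m)"
      by (simp add: divide_ennreal_def ac_simps)
    also have "\<dots> = \<pi> y / Z" by (subst nn_integral_divide) (auto simp: inv \<open>y \<in> space m\<close>)
    finally show "(\<integral>\<^sup>+x. \<pi> x / Z * p x y \<partial>m) = \<pi> y / Z" .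
  qed measurable
qed

text \<open>An invariant measure is a mixture of the measures \<open>density m (p x)\<close>; by
  Tonelli the mixed densities form a density.\<close>

lemma invariant_has_density:
  fixes p :: "'s \<Rightarrow> 's \<Rightarrow> ennreal"
  assumes sf: "sigma_finite_measure m"
    and pm[measurable]: "case_prod p \<in> borel_measurable (m \<Otimes>\<^sub>M m)"
    and inv: "invariant_probability m (\<lambda>x. density m (p x)) \<mu>"
  shows "\<exists>f\<in>borel_measurable m. \<mu> = density m f"
proof
  have s[measurable_cong]: "sets \<mu> = sets m" and pr: "prob_space \<mu>"
    using inv by (auto simp: invariant_probability_def)
  interpret m: sigma_finite_measure m by fact
  interpret \<mu>: prob_space \<mu> by fact
  interpret pair_sigma_finite m \<mu> by standard
  have sp: "space \<mu> = space m" using s by (rule sets_eq_imp_space_eq)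
  define f where "f y = (\<integral>\<^sup>+x. p x y \<partial>\<mu>)" for y
  show fm[measurable]: "f \<in> borel_measurable m" unfolding f_def by measurable
  show "\<mu> = density m f"
  proof (rule measure_eqI)
    fix A assume "A \<in> sets \<mu>"
    then have A[measurable]: "A \<in> sets m" using s by simp
    have "emeasure \<mu> A = (\<integral>\<^sup>+x. emeasure (density m (p x)) A \<partial>\<mu>)"
      using inv A by (simp add: invariant_probability_def)
    also have "\<dots> = (\<integral>\<^sup>+x. (\<integral>\<^sup>+y. p x y * indicator A y \<partial>m) \<partial>\<mu>)"
      using measurable_compose[OF measurable_Pair1' pm] sp
      by (intro nn_integral_cong emeasure_density) auto
    also have "\<dots> = (\<integral>\<^sup>+y. (\<integral>\<^sup>+x. p x y * indicator A y \<partial>\<mu>) \<partial>m)"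
      by (rule Fubini') measurable
    also have "\<dots> = (\<integral>\<^sup>+y. f y * indicator A y \<partial>m)"
      unfolding f_def by (intro nn_integral_cong nn_integral_multc) measurable
    also have "\<dots> = emeasure (density m f) A" by (simp add: emeasure_density)
    finally show "emeasure \<mu> A = emeasure (density m f) A" .
  qed (simp add: s)
qed

text \<open>Compare two invariant densities on the set \<open>A\<close> where the first is larger.
  If \<open>A\<close> is not null, invariance produces a point of \<open>A\<close> from which
  \<open>A\<close> is reached with probability 1; positivity of \<open>p\<close> then makes
  \<open>A\<close> of full measure, which equality of the total masses turns into equality of the
  densities.\<close>

lemma invariant_unique:
  fixes p :: "'s \<Rightarrow> 's \<Rightarrow> ennreal"
  assumes sf: "sigma_finite_measure m"
    and pm[measurable]: "case_prod p \<in> borel_measurable (m \<Otimes>\<^sub>M m)"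
    and p1: "\<And>x. x \<in> space m \<Longrightarrow> (\<integral>\<^sup>+y. p x y \<partial>m) = 1"
    and pos: "\<And>x y. x \<in> space m \<Longrightarrow> y \<in> space m \<Longrightarrow> p x y > 0"
    and inv1: "invariant_probability m (\<lambda>x. density m (p x)) \<mu>1"
    and inv2: "invariant_probability m (\<lambda>x. density m (p x)) \<mu>2"
  shows "\<mu>1 = \<mu>2"
proof -
  interpret m: sigma_finite_measure m by fact
  have D: "\<exists>g\<in>borel_measurable m. (\<forall>x. g x \<ge> 0) \<and> \<mu> = density m (\<lambda>x. ennreal (g x)) \<and> integrable m g \<and> integral\<^sup>L m g = 1"
    if i: "invariant_probability m (\<lambda>x. density m (p x)) \<mu>" for \<mu>
  proof -
    obtain f where f[measurable]: "f \<in> borel_measurable m" and \<mu>: "\<mu> = density m f"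
      using invariant_has_density[OF sf pm i] by blast
    interpret \<mu>: prob_space \<mu> using i by (simp add: invariant_probability_def)
    have 1: "integral\<^sup>N m f = 1"
      using \<mu>.emeasure_space_1 by (simp add: \<mu> emeasure_density cong: nn_integral_cong)
    then have "AE x in m. f x \<noteq> \<infinity>" by (intro nn_integral_PInf_AE) auto
    then have ae: "AE x in m. f x = ennreal (enn2real (f x))"
      by eventually_elim (simp add: less_top)
    have nn: "(\<integral>\<^sup>+x. ennreal (enn2real (f x)) \<partial>m) = 1"
      using nn_integral_cong_AE[OF ae] 1 by simp
    have "integrable m (\<lambda>x. enn2real (f x))"
      by (rule integrableI_nonneg) (auto simp: nn)
    moreover have "(LINT x|m. enn2real (f x)) = 1"
      by (subst integral_eq_nn_integral) (auto simp: nn)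
    moreover have "\<mu> = density m (\<lambda>x. ennreal (enn2real (f x)))"
      unfolding \<mu> by (rule density_cong) (use ae in auto)
    ultimately show ?thesis by (intro bexI[of _ "\<lambda>x. enn2real (f x)"]) auto
  qed
  obtain g1 where g1[measurable]: "g1 \<in> borel_measurable m" and g1': "\<And>x. g1 x \<ge> 0"
    "\<mu>1 = density m (\<lambda>x. ennreal (g1 x))" "integrable m g1" "integral\<^sup>L m g1 = 1" using D[OF inv1] by blast
  obtain g2 where g2[measurable]: "g2 \<in> borel_measurable m" and g2': "\<And>x. g2 x \<ge> 0"
    "\<mu>2 = density m (\<lambda>x. ennreal (g2 x))" "integrable m g2" "integral\<^sup>L m g2 = 1" using D[OF inv2] by blast
  define A where "A = {x\<in>space m. g1 x > g2 x}"
  have A[measurable]: "A \<in> sets m" unfolding A_def by measurable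
  define \<pi> where "\<pi> x = (\<integral>\<^sup>+y. p x y * indicator A y \<partial>m)" for x
  have [measurable]: "\<pi> \<in> borel_measurable m" unfolding \<pi>_def by measurable
  have px[measurable]: "p x \<in> borel_measurable m" if "x \<in> space m" for x
    using measurable_compose[OF measurable_Pair1' pm] that by simp
  have \<pi>1: "\<pi> x \<le> 1" if "x \<in> space m" for x
    unfolding \<pi>_def p1[OF that, symmetric] by (intro nn_integral_mono) (auto simp: indicator_def)
  define r where "r x = enn2real (\<pi> x)" for x
  have r: "ennreal (r x) = \<pi> x" "0 \<le> r x" "r x \<le> 1" if "x \<in> space m" for x
    using \<pi>1[OF that] unfolding r_def
    by (auto simp: enn2real_leI ennreal_enn2real_if top_unique)
  have rm[measurable]: "r \<in> borel_measurable m" unfolding r_def by measurable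
  \<comment> \<open>Invariance tested on \<open>A\<close>: the chance \<open>r\<close> of moving
    into \<open>A\<close> and the indicator of \<open>A\<close> have the same mean. Passing to real
    densities makes the two identities subtractable.\<close>
  have E: "integrable m (\<lambda>x. g x * r x) \<and> integrable m (\<lambda>x. g x * indicator A x) \<and>
      (LINT x|m. g x * r x) = (LINT x|m. g x * indicator A x)"
    if g[measurable]: "g \<in> borel_measurable m" and g': "\<And>x. g x \<ge> 0"
    "\<mu> = density m (\<lambda>x. ennreal (g x))" "integrable m g"
    and inv: "invariant_probability m (\<lambda>x. density m (p x)) \<mu>" for g \<mu>
  proof -
    have "emeasure \<mu> A = (\<integral>\<^sup>+x. emeasure (density m (p x)) A \<partial>\<mu>)"
      using inv A by (simp add: invariant_probability_def)
    also have "\<dots> = (\<integral>\<^sup>+x. \<pi> x \<partial>\<mu>)"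
      unfolding \<pi>_def by (intro nn_integral_cong emeasure_density) (auto simp: g'(2))
    also have "\<dots> = (\<integral>\<^sup>+x. ennreal (g x) * \<pi> x \<partial>m)" unfolding g'(2) by (rule nn_integral_density) auto
    also have "\<dots> = (\<integral>\<^sup>+x. ennreal (g x * r x) \<partial>m)"
      by (intro nn_integral_cong) (simp add: r(1)[symmetric] g' r(2) ennreal_mult)
    finally have 1: "emeasure \<mu> A = (\<integral>\<^sup>+x. ennreal (g x * r x) \<partial>m)" .
    have 2: "emeasure \<mu> A = (\<integral>\<^sup>+x. ennreal (g x * indicator A x) \<partial>m)"
      unfolding g'(2) by (subst emeasure_density) (auto intro!: nn_integral_cong simp: indicator_def)
    have i1: "integrable m (\<lambda>x. g x * r x)"
      using g' r by (intro Bochner_Integration.integrable_bound[OF g'(3)])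
        (auto simp: abs_mult intro!: AE_I2 mult_left_le)
    have i2: "integrable m (\<lambda>x. g x * indicator A x)"
      using integrable_mult_indicator[OF A g'(3)] by (simp add: mult.commute)
    have "ennreal (LINT x|m. g x * r x) = ennreal (LINT x|m. g x * indicator A x)"
      using nn_integral_eq_integral[OF i1] nn_integral_eq_integral[OF i2] 1 2 g' r by auto
    moreover have "0 \<le> (LINT x|m. g x * r x)" "0 \<le> (LINT x|m. g x * indicator A x)"
      using g' r by (auto intro!: integral_nonneg_AE)
    ultimately show ?thesis using i1 i2 by simp
  qed
  note E1 = E[OF g1 g1'(1-3) inv1] and E2 = E[OF g2 g2'(1-3) inv2]
  \<comment> \<open>Both factors are nonnegative on \<open>A\<close> and nonpositive off
    \<open>A\<close>, while the integral is zero; hence \<open>r\<close> is 1 almost everywhere on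
    \<open>A\<close>.\<close>
  define h where "h x = (g1 x - g2 x) * (indicator A x - r x)" for x
  have hi: "integrable m h" and h0: "integral\<^sup>L m h = 0"
    using E1 E2 by (auto simp: h_def[abs_def] algebra_simps)
  have hpos: "h x \<ge> 0" if "x \<in> space m" for x
    unfolding h_def using r[OF that] that
    by (cases "x \<in> A") (auto simp: A_def intro: mult_nonpos_nonneg)
  have "AE x in m. h x = 0"
    using integral_nonneg_eq_0_iff_AE[OF hi] hpos h0 by auto
  then have ae: "AE x in m. (x \<in> A \<longrightarrow> r x = 1) \<and> (x \<notin> A \<longrightarrow> g1 x = g2 x \<or> r x = 0)"
    by eventually_elim (auto simp: h_def A_def)
  have le: "AE x in m. g1 x \<le> g2 x"
  proof (cases "emeasure m A = 0")
    case True
    then have "AE x in m. x \<notin> A" by (intro AE_not_in) auto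
    then show ?thesis by (rule AE_mp) (auto simp: A_def)
  next
    case False
    have "\<not> (AE x in m. x \<notin> A)" using False by (subst AE_iff_measurable[OF A]) (auto simp: A_def)
    with ae have "\<exists>x\<in>space m. x \<in> A \<and> r x = 1"
      by (rule_tac ccontr) (auto elim!: AE_mp intro!: AE_I2)
    then obtain x where x: "x \<in> space m" "x \<in> A" "r x = 1" by blast
    note [measurable] = px[OF x(1)]
    have "(\<integral>\<^sup>+y. p x y * indicator A y \<partial>m) + (\<integral>\<^sup>+y. p x y * indicator (space m - A) y \<partial>m)
       = (\<integral>\<^sup>+y. p x y * indicator A y + p x y * indicator (space m - A) y \<partial>m)"
      by (intro nn_integral_add[symmetric]) auto
    also have "\<dots> = (\<integral>\<^sup>+y. p x y \<partial>m)" by (intro nn_integral_cong) (auto simp: indicator_def)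
    also have "\<dots> = 1" using p1 x by simp
    finally have "1 + (\<integral>\<^sup>+y. p x y * indicator (space m - A) y \<partial>m) = 1 + 0"
      using r(1)[OF x(1)] x(3) by (simp add: \<pi>_def)
    then have "(\<integral>\<^sup>+y. p x y * indicator (space m - A) y \<partial>m) = 0"
      unfolding ennreal_add_left_cancel by simp
    then have "AE y in m. p x y * indicator (space m - A) y = 0"
      by (subst (asm) nn_integral_0_iff_AE) auto
    \<comment> \<open>The complement of \<open>A\<close> carries no mass under a density that is
      nowhere zero, so it is null.\<close>
    then have inA: "AE y in m. y \<in> A"
      using AE_space by eventually_elim (use pos[OF x(1)] in \<open>force simp: indicator_def split: if_splits\<close>)
    have "(LINT x|m. g1 x - g2 x) = 0" using g1' g2' by simp
    moreover have "integrable m (\<lambda>x. g1 x - g2 x)" using g1' g2' by simp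
    moreover have "AE x in m. 0 \<le> g1 x - g2 x" using inA by eventually_elim (auto simp: A_def)
    ultimately have "AE x in m. g1 x - g2 x = 0" using integral_nonneg_eq_0_iff_AE by blast
    then show ?thesis by eventually_elim auto
  qed
  have "(LINT x|m. g2 x - g1 x) = 0" using g1' g2' by simp
  moreover have "integrable m (\<lambda>x. g2 x - g1 x)" using g1' g2' by simp
  moreover have "AE x in m. 0 \<le> g2 x - g1 x" using le by eventually_elim auto
  ultimately have "AE x in m. g2 x - g1 x = 0" using integral_nonneg_eq_0_iff_AE by blast
  then have "AE x in m. ennreal (g1 x) = ennreal (g2 x)" by eventually_elim auto
  then show ?thesis unfolding g1'(2) g2'(2) by (intro density_cong) auto
qed

text \<open>\<open>V\<close> is the Lyapunov function and \<eta> the common lower bound on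
  \<open>C\<close>. The remainder \<open>k\<close> is a parameter with an additive decomposition,
  which avoids subtraction of extended reals.\<close>

theorem uniquely_ergodic_density:
  fixes p k :: "'s \<Rightarrow> 's \<Rightarrow> ennreal" and \<eta> V :: "'s \<Rightarrow> ennreal" and b :: real
  assumes sf: "sigma_finite_measure m"
    and pm[measurable]: "case_prod p \<in> borel_measurable (m \<Otimes>\<^sub>M m)"
    and pos: "\<And>x y. x \<in> space m \<Longrightarrow> y \<in> space m \<Longrightarrow> p x y > 0"
    and km: "case_prod k \<in> borel_measurable (m \<Otimes>\<^sub>M m)"
    and em: "\<eta> \<in> borel_measurable m" and Vm: "V \<in> borel_measurable m"
    and C: "C \<in> sets m"
    and dec: "\<And>x y. x \<in> space m \<Longrightarrow> y \<in> space m \<Longrightarrow> p x y = k x y + indicator C x * \<eta> y"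
    and p1: "\<And>x. x \<in> space m \<Longrightarrow> (\<integral>\<^sup>+y. p x y \<partial>m) = 1"
    and eta: "0 < integral\<^sup>N m \<eta>" "integral\<^sup>N m \<eta> < \<infinity>" "(\<integral>\<^sup>+y. \<eta> y * V y \<partial>m) < \<infinity>"
    and b: "b \<ge> 0"
    and drift: "\<And>x. x \<in> space m \<Longrightarrow> (\<integral>\<^sup>+y. p x y * V y \<partial>m) + 1 \<le> V x + ennreal b * indicator C x"
  shows "uniquely_ergodic m (\<lambda>x. density m (p x))"
proof -
  interpret m: sigma_finite_measure m by fact
  interpret pair_sigma_finite m m by standard
  obtain f where f[measurable]: "f \<in> borel_measurable m" and f1: "integral\<^sup>N m f = 1"
    and fp: "\<And>y. y \<in> space m \<Longrightarrow> (\<integral>\<^sup>+x. f x * p x y \<partial>m) = f y"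
    using invariant_density_exists[OF sf km em Vm C dec p1 eta b drift] by auto
  have "invariant_probability m (\<lambda>x. density m (p x)) (density m f)"
    unfolding invariant_probability_def
  proof (intro conjI ballI)
    show "prob_space (density m f)"
      by (intro prob_spaceI) (simp add: emeasure_density f1 cong: nn_integral_cong)
    fix A assume A[measurable]: "A \<in> sets m"
    have "(\<integral>\<^sup>+x. emeasure (density m (p x)) A \<partial>density m f)
       = (\<integral>\<^sup>+x. (\<integral>\<^sup>+y. p x y * indicator A y \<partial>m) \<partial>density m f)"
      using measurable_compose[OF measurable_Pair1' pm]
      by (intro nn_integral_cong emeasure_density) auto
    also have "\<dots> = (\<integral>\<^sup>+x. f x * (\<integral>\<^sup>+y. p x y * indicator A y \<partial>m) \<partial>m)"
      by (rule nn_integral_density) measurable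
    also have "\<dots> = (\<integral>\<^sup>+x. (\<integral>\<^sup>+y. f x * (p x y * indicator A y) \<partial>m) \<partial>m)"
      by (intro nn_integral_cong nn_integral_cmult[symmetric]) measurable
    also have "\<dots> = (\<integral>\<^sup>+y. (\<integral>\<^sup>+x. f x * (p x y * indicator A y) \<partial>m) \<partial>m)"
      by (rule Fubini') measurable
    also have "\<dots> = (\<integral>\<^sup>+y. (\<integral>\<^sup>+x. f x * p x y \<partial>m) * indicator A y \<partial>m)"
      by (intro nn_integral_cong, subst nn_integral_multc[symmetric]) (auto simp: mult.assoc)
    also have "\<dots> = (\<integral>\<^sup>+y. f y * indicator A y \<partial>m)" by (intro nn_integral_cong) (simp add: fp)
    also have "\<dots> = emeasure (density m f) A" by (simp add: emeasure_density)
    finally show "emeasure (density m f) A = (\<integral>\<^sup>+x. emeasure (density m (p x)) A \<partial>density m f)" by simp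
  qed simp
  then have "\<exists>!\<mu>. invariant_probability m (\<lambda>x. density m (p x)) \<mu>"
    using invariant_unique[OF sf pm p1 pos] by blast
  with density_kernel_measurable[OF sf pm p1] show ?thesis by (simp add: uniquely_ergodic_def)
qed

lemma uniquely_ergodic_cong:
  assumes "\<And>x. x \<in> space N \<Longrightarrow> P x = P' x" shows "uniquely_ergodic N P \<longleftrightarrow> uniquely_ergodic N P'"
proof -
  have "invariant_probability N P \<mu> \<longleftrightarrow> invariant_probability N P' \<mu>" for \<mu>
  proof (cases "sets \<mu> = sets N")
    case True
    then have "space \<mu> = space N" by (rule sets_eq_imp_space_eq)
    then have "(\<integral>\<^sup>+x. emeasure (P x) A \<partial>\<mu>) = (\<integral>\<^sup>+x. emeasure (P' x) A \<partial>\<mu>)" for A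
      using assms by (intro nn_integral_cong) simp
    then show ?thesis by (simp add: invariant_probability_def)
  qed (simp add: invariant_probability_def)
  moreover have "P \<in> N \<rightarrow>\<^sub>M prob_algebra N \<longleftrightarrow> P' \<in> N \<rightarrow>\<^sub>M prob_algebra N" using assms by (rule measurable_cong)
  ultimately show ?thesis by (simp add: uniquely_ergodic_def)
qed

lemma nn_integral_abs_normal_law:
  assumes \<tau>: "\<tau> > 0" shows "(\<integral>\<^sup>+x. ennreal \<bar>x\<bar> \<partial>normal_law 0 \<tau>) < \<infinity>"
proof -
  have s: "sqrt \<tau> > 0" using \<tau> by simp
  have i: "integrable lborel (\<lambda>x. normal_density 0 (sqrt \<tau>) x * \<bar>x\<bar>)"
    using normal_moment_abs_odd[OF s, of 0 0] by (auto simp: has_bochner_integral_iff)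
  have "(\<integral>\<^sup>+x. ennreal \<bar>x\<bar> \<partial>normal_law 0 \<tau>) = (\<integral>\<^sup>+x. ennreal (normal_density 0 (sqrt \<tau>) x) * ennreal \<bar>x\<bar> \<partial>lborel)"
    using \<tau> by (simp add: normal_law_def nn_integral_density)
  also have "\<dots> = (\<integral>\<^sup>+x. ennreal (normal_density 0 (sqrt \<tau>) x * \<bar>x\<bar>) \<partial>lborel)"
    by (intro nn_integral_cong) (simp add: ennreal_mult)
  also have "\<dots> = ennreal (LINT x|lborel. normal_density 0 (sqrt \<tau>) x * \<bar>x\<bar>)"
    using i by (intro nn_integral_eq_integral) auto
  finally show ?thesis by simp
qed

section \<open>Coordinates on the finite element space\<close>

text \<open>Two families in duality: the \<open>u i\<close> read off coordinates through the L2
  product and the \<open>b i\<close> rebuild the function. They are kept apart because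
  \<open>u\<close> will be orthonormal for the covariance form and not for the L2 product.\<close>

locale fem_coords = fem +
  fixes n :: nat and u b :: "nat \<Rightarrow> 'a \<Rightarrow> real"
  assumes uV: "i < n \<Longrightarrow> u i \<in> V" and bV: "i < n \<Longrightarrow> b i \<in> V"
    and span: "v \<in> V \<Longrightarrow> v = (\<lambda>x. \<Sum>i<n. L v (u i) *\<^sub>R b i x)"
begin

definition emb :: "(nat \<Rightarrow> real) \<Rightarrow> 'a \<Rightarrow> real" where "emb z x = (\<Sum>i<n. z i *\<^sub>R b i x)"

abbreviation "N \<equiv> fe_borel D V"
abbreviation "m \<equiv> PiM {..<n} (\<lambda>_. lborel :: real measure)"

lemma emb_V: "emb z \<in> V" unfolding emb_def[abs_def] using bV by (intro L.sum_mem[OF V0]) auto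

lemma emb_restrict: "emb (\<lambda>i\<in>{..<n}. z i) = emb z" by (simp add: emb_def[abs_def])

lemma emb_coords: "v \<in> V \<Longrightarrow> emb (\<lambda>i. L v (u i)) = v"
  using span[of v] by (simp add: emb_def[abs_def])

lemma emb_add: "emb (\<lambda>i. z i + z' i) = (\<lambda>x. emb z x + emb z' x)"
  by (simp add: emb_def[abs_def] distrib_right sum.distrib)

lemma emb_diff: "emb (\<lambda>i. z i - z' i) = (\<lambda>x. emb z x - emb z' x)"
  by (simp add: emb_def[abs_def] left_diff_distrib sum_subtractf)

text \<open>The triangle inequality for \<open>n\<close> summands, obtained by expanding the squared
  norm in one argument and dividing by the norm.\<close>

lemma nrm_emb_le: "nrm (emb z) \<le> (\<Sum>i<n. \<bar>z i\<bar> * nrm (b i))"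
proof -
  have "(nrm (emb z))\<^sup>2 = L (emb z) (emb z)" by (rule nrm_sq[OF emb_V])
  also have "\<dots> = (\<Sum>i<n. z i * L (b i) (emb z))"
  proof -
    have "L (\<lambda>x. \<Sum>i<n. z i *\<^sub>R b i x) (emb z) = (\<Sum>i<n. z i * L (b i) (emb z))"
      using bV emb_V by (intro L.sum_left) auto
    then show ?thesis by (simp add: emb_def[abs_def])
  qed
  also have "\<dots> \<le> (\<Sum>i<n. \<bar>z i\<bar> * (nrm (b i) * nrm (emb z)))"
  proof (rule sum_mono)
    fix i assume "i \<in> {..<n}"
    then have "\<bar>L (b i) (emb z)\<bar> \<le> nrm (b i) * nrm (emb z)" by (intro CS bV emb_V) auto
    then have "\<bar>z i * L (b i) (emb z)\<bar> \<le> \<bar>z i\<bar> * (nrm (b i) * nrm (emb z))" unfolding abs_mult by (intro mult_left_mono) auto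
    then show "z i * L (b i) (emb z) \<le> \<bar>z i\<bar> * (nrm (b i) * nrm (emb z))" by linarith
  qed
  also have "\<dots> = (\<Sum>i<n. \<bar>z i\<bar> * nrm (b i)) * nrm (emb z)" by (simp add: sum_distrib_right mult.assoc)
  finally have "nrm (emb z) * nrm (emb z) \<le> (\<Sum>i<n. \<bar>z i\<bar> * nrm (b i)) * nrm (emb z)" by (simp add: power2_eq_square)
  moreover have "0 \<le> (\<Sum>i<n. \<bar>z i\<bar> * nrm (b i))" using nrm_nonneg[OF bV] by (intro sum_nonneg) auto
  ultimately show ?thesis using nrm_nonneg[OF emb_V, of z] by (cases "nrm (emb z) = 0") auto
qed

lemma nrm_emb_measurable[measurable]: "(\<lambda>z. nrm (emb z)) \<in> borel_measurable m"
proof -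
  have "nrm (emb z) = sqrt (\<Sum>i<n. z i * (\<Sum>j<n. z j * L (b i) (b j)))" for z
  proof -
    have "L (emb z) (emb z) = (\<Sum>i<n. z i * L (b i) (emb z))"
    proof -
      have "L (\<lambda>x. \<Sum>i<n. z i *\<^sub>R b i x) (emb z) = (\<Sum>i<n. z i * L (b i) (emb z))"
        using bV emb_V by (intro L.sum_left) auto
      then show ?thesis by (simp add: emb_def[abs_def])
    qed
    also have "\<dots> = (\<Sum>i<n. z i * (\<Sum>j<n. z j * L (b i) (b j)))"
      unfolding emb_def[abs_def] using bV by (intro sum.cong refl arg_cong2[where f = "(*)"] L.sum_right) auto
    finally show ?thesis by (simp add: l2_norm_def)
  qed
  then show ?thesis by simp
qed

subsection \<open>The Borel sets of the finite element space\<close>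

lemma metric: "Metric_space V (\<lambda>f g. nrm (\<lambda>x. f x - g x))"
proof
  show "0 \<le> nrm (\<lambda>x. f x - g x)" for f g
    unfolding l2_norm_def l2_inner_def by (simp add: integral_nonneg_AE)
  show "nrm (\<lambda>x. f x - g x) = nrm (\<lambda>x. g x - f x)" for f g
  proof -
    have "(f x - g x) * (f x - g x) = (g x - f x) * (g x - f x)" for x by (simp add: algebra_simps)
    then show ?thesis by (simp add: l2_norm_def l2_inner_def)
  qed
  show "nrm (\<lambda>x. f x - g x) = 0 \<longleftrightarrow> f = g" if "f \<in> V" "g \<in> V" for f g
  proof
    assume "nrm (\<lambda>x. f x - g x) = 0"
    then have "L (\<lambda>x. f x - g x) (\<lambda>x. f x - g x) = 0" using nrm_sq[OF L.diff[OF that]] by simp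
    from fun_cong[OF V_definite[OF L.diff[OF that] this]] show "f = g" by auto
  qed (simp add: l2_norm_def l2_inner_def)
  show "nrm (\<lambda>x. f x - h x) \<le> nrm (\<lambda>x. f x - g x) + nrm (\<lambda>x. g x - h x)" if "f \<in> V" "g \<in> V" "h \<in> V" for f g h
    using L.triangle_diff[OF that(1,3,2)] by (simp add: l2_norm_def)
qed

interpretation ms: Metric_space V "\<lambda>f g. nrm (\<lambda>x. f x - g x)" by (rule metric)

lemma open_sub: "{U. openin ms.mtopology U} \<subseteq> Pow V"
  using openin_subset[of ms.mtopology] by auto

lemma space_N: "space N = V"
  unfolding fe_borel_def by (rule space_measure_of[OF open_sub])

lemma sets_N: "sets N = sigma_sets V {U. openin ms.mtopology U}"
  unfolding fe_borel_def by (rule sets_measure_of[OF open_sub])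

lemma coord_measurable[measurable]:
  assumes i: "i < n" shows "(\<lambda>v. L v (u i)) \<in> borel_measurable N"
proof (rule borel_measurableI)
  fix O' :: "real set" assume O': "open O'"
  have "openin ms.mtopology {v\<in>V. L v (u i) \<in> O'}"
    unfolding ms.openin_mtopology
  proof (intro conjI ballI allI impI)
    fix v assume "v \<in> {v\<in>V. L v (u i) \<in> O'}"
    then have v: "v \<in> V" "L v (u i) \<in> O'" by auto
    obtain e where e: "e > 0" "\<And>t. \<bar>t - L v (u i)\<bar> < e \<Longrightarrow> t \<in> O'"
      using O' v(2) unfolding open_dist dist_real_def by blast
    \<comment> \<open>The functional is Lipschitz with constant \<open>nrm (u i)\<close>; adding 1
      keeps the denominator positive.\<close>
    define r where "r = e / (nrm (u i) + 1)"
    have np: "0 < nrm (u i) + 1" using nrm_nonneg[OF uV[OF i]] by simp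
    have r: "r > 0" using e np by (simp add: r_def)
    have "ms.mball v r \<subseteq> {v\<in>V. L v (u i) \<in> O'}"
    proof
      fix w assume "w \<in> ms.mball v r"
      then have w: "w \<in> V" "nrm (\<lambda>x. v x - w x) < r" by auto
      have d: "(\<lambda>x. v x - w x) \<in> V" by (rule L.diff[OF v(1) w(1)])
      have "\<bar>L w (u i) - L v (u i)\<bar> = \<bar>L (\<lambda>x. v x - w x) (u i)\<bar>" using L.diff_left[OF v(1) w(1) uV[OF i]] by simp
      also have "\<dots> \<le> nrm (\<lambda>x. v x - w x) * nrm (u i)" by (rule CS[OF d uV[OF i]])
      also have "\<dots> \<le> nrm (\<lambda>x. v x - w x) * (nrm (u i) + 1)" using nrm_nonneg[OF d] by (intro mult_left_mono) auto
      also have "\<dots> < r * (nrm (u i) + 1)" using w(2) np by (rule mult_strict_right_mono)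
      also have "\<dots> = e" using np by (simp add: r_def)
      finally show "w \<in> {v\<in>V. L v (u i) \<in> O'}" using e(2) w(1) by simp
    qed
    then show "\<exists>r>0. ms.mball v r \<subseteq> {v\<in>V. L v (u i) \<in> O'}" using r by blast
  qed auto
  then have "{v\<in>V. L v (u i) \<in> O'} \<in> sets N" unfolding sets_N by (intro sigma_sets.Basic) simp
  moreover have "(\<lambda>v. L v (u i)) -` O' \<inter> space N = {v\<in>V. L v (u i) \<in> O'}" by (auto simp: space_N)
  ultimately show "(\<lambda>v. L v (u i)) -` O' \<inter> space N \<in> sets N" by simp
qed

definition S :: "(nat \<Rightarrow> real) \<Rightarrow> 'a \<Rightarrow> real" where "S z = sol (emb z)"

lemma S_V: "S z \<in> V" unfolding S_def by (rule sol_V[OF emb_V])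

lemma component_measurable: "i < n \<Longrightarrow> (\<lambda>z. z i) \<in> borel_measurable m"
  unfolding measurable_lborel1[symmetric] by (rule measurable_component_singleton) simp

text \<open>Connects the product over the indices below \<open>n\<close> with the Borel sets of the
  function space, where continuity is formulated; on the former the components from \<open>n\<close>
  on are the constant \<open>undefined\<close>.\<close>

lemma id_measurable: "(\<lambda>z. z) \<in> m \<rightarrow>\<^sub>M (borel :: (nat \<Rightarrow> real) measure)"
proof (rule measurable_coordinatewise_then_product)
  fix i
  show "(\<lambda>z. z i) \<in> borel_measurable m"
  proof (cases "i < n")
    case True
    then show ?thesis by (rule component_measurable)
  next
    case False
    have u: "z i = undefined" if z: "z \<in> space m" for z
      using PiE_arb[OF z[unfolded space_PiM], of i] False by simp
    have "(\<lambda>z. z i) \<in> borel_measurable m \<longleftrightarrow> (\<lambda>_. undefined :: real) \<in> borel_measurable m"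
      by (rule measurable_cong) (rule u)
    then show ?thesis by simp
  qed
qed

lemma S_measurable: "S \<in> m \<rightarrow>\<^sub>M N"
proof (rule measurableI)
  show "S z \<in> space N" for z by (simp add: space_N S_V)
  have op: "open (S -` U)" if U: "openin ms.mtopology U" for U
    unfolding open_subopen[of "S -` U"]
  proof
    fix z assume "z \<in> S -` U"
    then have "S z \<in> U" by simp
    then obtain r where r: "r > 0" "ms.mball (S z) r \<subseteq> U" using U unfolding ms.openin_mtopology by blast
    \<comment> \<open>Open in the product topology because only \<open>n\<close> coordinates occur;
      the Lipschitz bound of the implicit step maps it into the given ball.\<close>
    define O' where "O' = {z'. (\<Sum>i<n. \<bar>z i - z' i\<bar> * nrm (b i)) < coer * r}"
    have "open O'" unfolding O'_def by (intro open_Collect_less continuous_intros) simp_all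
    moreover have "z \<in> O'" using coer_pos r by (simp add: O'_def)
    moreover have "O' \<subseteq> S -` U"
    proof
      fix z' assume "z' \<in> O'"
      have "coer * nrm (\<lambda>x. S z x - S z' x) \<le> nrm (\<lambda>x. emb z x - emb z' x)"
        unfolding S_def by (rule weak_sol_Lipschitz[OF sol[OF emb_V] sol[OF emb_V] emb_V emb_V])
      also have "\<dots> \<le> (\<Sum>i<n. \<bar>z i - z' i\<bar> * nrm (b i))" unfolding emb_diff[symmetric] by (rule nrm_emb_le)
      also have "\<dots> < coer * r" using \<open>z' \<in> O'\<close> by (simp add: O'_def)
      finally have "nrm (\<lambda>x. S z x - S z' x) < r" using coer_pos by simp
      then have "S z' \<in> ms.mball (S z) r" by (simp add: S_V)
      then show "z' \<in> S -` U" using r(2) by auto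
    qed
    ultimately show "\<exists>O'. open O' \<and> z \<in> O' \<and> O' \<subseteq> S -` U" by blast
  qed
  have S': "S \<in> (borel :: (nat \<Rightarrow> real) measure) \<rightarrow>\<^sub>M N"
    unfolding fe_borel_def
  proof (rule measurable_measure_of[OF open_sub])
    show "S \<in> space borel \<rightarrow> V" by (simp add: S_V)
    show "S -` U \<inter> space borel \<in> sets borel" if "U \<in> {U. openin ms.mtopology U}" for U
      using op that by simp
  qed
  show "S -` B \<inter> space m \<in> sets m" if "B \<in> sets N" for B
    using measurable_sets[OF measurable_compose[OF id_measurable S'] that] .
qed

subsection \<open>Unique ergodicity\<close>

text \<open>The density, in coordinates, of the state \<open>v\<close> with one increment added:
  independent normal components of variance \<tau> centred at the coordinates of
  \<open>v\<close>.\<close>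

definition trans_density :: "('a \<Rightarrow> real) \<Rightarrow> (nat \<Rightarrow> real) \<Rightarrow> ennreal" where
  "trans_density v z = (\<Prod>i<n. ennreal (normal_density (L v (u i)) (sqrt \<tau>) (z i)))"

lemma trans_density_measurable[measurable]:
  "(\<lambda>(v, z). trans_density v z) \<in> borel_measurable (N \<Otimes>\<^sub>M m)"
proof -
  have 1: "(\<lambda>p. L (fst p) (u i)) \<in> borel_measurable (N \<Otimes>\<^sub>M m)" if "i \<in> {..<n}" for i
    using that by (intro measurable_compose[OF measurable_fst coord_measurable]) auto
  have 2: "(\<lambda>p. snd p i) \<in> borel_measurable (N \<Otimes>\<^sub>M m)" if "i \<in> {..<n}" for i
    using that by (intro measurable_compose[OF measurable_snd component_measurable]) auto
  show ?thesis
    unfolding trans_density_def split_beta normal_density_def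
    using 1 2 by (intro borel_measurable_prod_ennreal measurable_compose[OF _ measurable_ennreal]) measurable
qed

text \<open>What one increment must provide: in the coordinates given by \<open>u\<close> its linear
  combinations are those of independent centred normal variables of variance \<tau>.\<close>

context
  fixes M :: "'w measure" and dW :: "'w \<Rightarrow> 'a \<Rightarrow> real"
  assumes M: "prob_space M" and dW: "\<And>\<omega>. \<omega> \<in> space M \<Longrightarrow> dW \<omega> \<in> l2_space D"
    and Xm: "\<And>i. i < n \<Longrightarrow> (\<lambda>\<omega>. L (dW \<omega>) (u i)) \<in> borel_measurable M"
    and law: "\<And>t. distr M borel (\<lambda>\<omega>. \<Sum>i<n. t i * L (dW \<omega>) (u i)) = normal_law 0 (\<tau> * (\<Sum>i<n. (t i)\<^sup>2))"
begin

lemma trans_density_law: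
  "density m (trans_density v) = distr M m (\<lambda>\<omega>. \<lambda>i\<in>{..<n}. L v (u i) + L (dW \<omega>) (u i))"
  using gaussian_vector_density[OF finite_lessThan M \<tau>, of n "\<lambda>i \<omega>. L (dW \<omega>) (u i)" "\<lambda>i. L v (u i)"] Xm law
  by (simp add: trans_density_def[abs_def])

lemma step_measurable: "(\<lambda>\<omega>. \<lambda>i\<in>{..<n}. L v (u i) + L (dW \<omega>) (u i)) \<in> M \<rightarrow>\<^sub>M m"
  using Xm by (intro measurable_restrict) auto

lemma trans_density_measurable1[measurable]: "v \<in> V \<Longrightarrow> trans_density v \<in> borel_measurable m"
  using measurable_compose[OF measurable_Pair1' trans_density_measurable, of v] by (simp add: space_N)

lemma trans_density_prob: assumes "v \<in> V" shows "(\<integral>\<^sup>+z. trans_density v z \<partial>m) = 1"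
proof -
  interpret prob_space "distr M m (\<lambda>\<omega>. \<lambda>i\<in>{..<n}. L v (u i) + L (dW \<omega>) (u i))"
    by (rule prob_space.prob_space_distr[OF M step_measurable])
  have "(\<integral>\<^sup>+z. trans_density v z \<partial>m) = emeasure (density m (trans_density v)) (space m)"
    using trans_density_measurable1[OF assms] by (simp add: emeasure_density cong: nn_integral_cong)
  also have "\<dots> = 1" unfolding trans_density_law using emeasure_space_1 by simp
  finally show ?thesis .
qed

text \<open>Since the \<open>u i\<close> lie in \<open>V\<close>, projecting the increment does not
  change its coordinates; the step is thus noise in coordinates followed by the map
  \<open>S\<close>.\<close>

lemma kernel_eq:
  assumes v: "v \<in> V"
  shows "distr M N (\<lambda>\<omega>. dieg_step D V \<epsilon> \<tau> v (dW \<omega>)) = distr (density m (trans_density v)) N S"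
proof -
  have "distr (density m (trans_density v)) N S = distr M N (S \<circ> (\<lambda>\<omega>. \<lambda>i\<in>{..<n}. L v (u i) + L (dW \<omega>) (u i)))"
    unfolding trans_density_law by (rule distr_distr[OF S_measurable step_measurable])
  also have "\<dots> = distr M N (\<lambda>\<omega>. dieg_step D V \<epsilon> \<tau> v (dW \<omega>))"
  proof (rule distr_cong[OF refl refl])
    fix \<omega> assume "\<omega> \<in> space M"
    then have l: "dW \<omega> \<in> l2_space D" by (rule dW)
    let ?w = "fe_projection D V (l2_functional D (dW \<omega>))"
    note w = proj_l2[OF l]
    have vw: "(\<lambda>x. v x + ?w x) \<in> V" by (rule L.add[OF v w(1)])
    have "L (\<lambda>x. v x + ?w x) (u i) = L v (u i) + L (dW \<omega>) (u i)" if "i < n" for i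
      using L.add_left[OF v w(1) uV[OF that]] L.sym[OF w(1) uV[OF that]] w(2)[OF uV[OF that]]
        l2.sym[OF Vl2[OF uV[OF that]] l] by simp
    then have "emb (\<lambda>i\<in>{..<n}. L v (u i) + L (dW \<omega>) (u i)) = emb (\<lambda>i. L (\<lambda>x. v x + ?w x) (u i))"
      by (simp add: emb_def[abs_def])
    also have "\<dots> = (\<lambda>x. v x + ?w x)" by (rule emb_coords[OF vw])
    finally show "(S \<circ> (\<lambda>\<omega>. \<lambda>i\<in>{..<n}. L v (u i) + L (dW \<omega>) (u i))) \<omega> = dieg_step D V \<epsilon> \<tau> v (dW \<omega>)"
      by (simp add: S_def dieg_step_eq[OF v l])
  qed
  finally show ?thesis by simp
qed

text \<open>By the triangle inequality the noise adds at most a sum of absolute values of normal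
  variables; its expectation is finite and does not depend on the state.\<close>

lemma noise_moment: "\<exists>C0\<ge>0. \<forall>v\<in>V. (\<integral>\<^sup>+z. trans_density v z * ennreal (nrm (emb z)) \<partial>m) \<le> ennreal (nrm v + C0)"
proof -
  interpret prob_space M by (rule M)
  define X where "X i \<omega> = L (dW \<omega>) (u i)" for i \<omega>
  have [measurable]: "i < n \<Longrightarrow> X i \<in> borel_measurable M" for i unfolding X_def by (rule Xm)
  have E: "(\<integral>\<^sup>+\<omega>. ennreal \<bar>X i \<omega>\<bar> \<partial>M) < \<infinity>" if i: "i < n" for i
  proof -
    \<comment> \<open>A unit vector of coefficients singles out the law of one coordinate.\<close>
    have "(\<Sum>j<n. (if j = i then 1 else 0) * L (dW \<omega>) (u j)) = X i \<omega>" for \<omega>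
      using i by (simp add: X_def if_distrib[of "\<lambda>c. c * _"] cong: if_cong)
    moreover have "(\<Sum>j<n. ((if j = i then 1 else 0) :: real)\<^sup>2) = 1"
      using i by (simp add: if_distrib[of "\<lambda>c. c\<^sup>2"] cong: if_cong)
    ultimately have "distr M borel (X i) = normal_law 0 \<tau>"
      using law[of "\<lambda>j. if j = i then 1 else 0"] by (simp add: X_def[abs_def])
    then have "(\<integral>\<^sup>+x. ennreal \<bar>x\<bar> \<partial>distr M borel (X i)) < \<infinity>" using nn_integral_abs_normal_law[OF \<tau>] by simp
    then show ?thesis using i by (simp add: nn_integral_distr)
  qed
  define c where "c = (\<integral>\<^sup>+\<omega>. (\<Sum>i<n. ennreal \<bar>X i \<omega>\<bar> * ennreal (nrm (b i))) \<partial>M)"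
  have "c = (\<Sum>i<n. (\<integral>\<^sup>+\<omega>. ennreal \<bar>X i \<omega>\<bar> * ennreal (nrm (b i)) \<partial>M))"
    unfolding c_def by (intro nn_integral_sum) auto
  also have "\<dots> = (\<Sum>i<n. (\<integral>\<^sup>+\<omega>. ennreal \<bar>X i \<omega>\<bar> \<partial>M) * ennreal (nrm (b i)))"
    by (intro sum.cong refl nn_integral_multc) auto
  also have "\<dots> < \<infinity>" using E by (auto simp: ennreal_mult_less_top less_top)
  finally have c: "c = ennreal (enn2real c)" by (simp add: less_top)
  have "(\<integral>\<^sup>+z. trans_density v z * ennreal (nrm (emb z)) \<partial>m) \<le> ennreal (nrm v + enn2real c)" if v: "v \<in> V" for v
  proof -
    note [measurable] = trans_density_measurable1[OF v]
    have "(\<integral>\<^sup>+z. trans_density v z * ennreal (nrm (emb z)) \<partial>m) = (\<integral>\<^sup>+z. ennreal (nrm (emb z)) \<partial>density m (trans_density v))"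
      by (rule nn_integral_density[symmetric]) measurable
    also have "\<dots> = (\<integral>\<^sup>+\<omega>. ennreal (nrm (emb (\<lambda>i\<in>{..<n}. L v (u i) + L (dW \<omega>) (u i)))) \<partial>M)"
      unfolding trans_density_law by (rule nn_integral_distr[OF step_measurable]) measurable
    also have "\<dots> \<le> (\<integral>\<^sup>+\<omega>. ennreal (nrm v) + (\<Sum>i<n. ennreal \<bar>X i \<omega>\<bar> * ennreal (nrm (b i))) \<partial>M)"
    proof (rule nn_integral_mono)
      fix \<omega>
      have "nrm (emb (\<lambda>i\<in>{..<n}. L v (u i) + L (dW \<omega>) (u i))) = nrm (\<lambda>x. emb (\<lambda>i. L v (u i)) x + emb (\<lambda>i. X i \<omega>) x)"
        by (simp only: emb_restrict emb_add X_def)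
      also have "\<dots> = nrm (\<lambda>x. v x + emb (\<lambda>i. X i \<omega>) x)" by (simp only: emb_coords[OF v])
      also have "\<dots> \<le> nrm v + nrm (emb (\<lambda>i. X i \<omega>))"
        using L.triangle[OF v emb_V] by (simp add: l2_norm_def)
      also have "\<dots> \<le> nrm v + (\<Sum>i<n. \<bar>X i \<omega>\<bar> * nrm (b i))" using nrm_emb_le by simp
      finally have "ennreal (nrm (emb (\<lambda>i\<in>{..<n}. L v (u i) + L (dW \<omega>) (u i)))) \<le> ennreal (nrm v + (\<Sum>i<n. \<bar>X i \<omega>\<bar> * nrm (b i)))"
        by (rule ennreal_leI)
      also have "\<dots> = ennreal (nrm v) + (\<Sum>i<n. ennreal \<bar>X i \<omega>\<bar> * ennreal (nrm (b i)))"
      proof -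
        have nn: "0 \<le> \<bar>X i \<omega>\<bar> * nrm (b i)" if "i \<in> {..<n}" for i using nrm_nonneg[OF bV] that by simp
        have "(\<Sum>i<n. ennreal \<bar>X i \<omega>\<bar> * ennreal (nrm (b i))) = (\<Sum>i<n. ennreal (\<bar>X i \<omega>\<bar> * nrm (b i)))"
          using nrm_nonneg[OF bV] by (intro sum.cong) (auto simp: ennreal_mult)
        also have "\<dots> = ennreal (\<Sum>i<n. \<bar>X i \<omega>\<bar> * nrm (b i))" by (rule sum_ennreal[OF nn])
        finally show ?thesis by (simp only: ennreal_plus[OF nrm_nonneg[OF v] sum_nonneg[OF nn]])
      qed
      finally show "ennreal (nrm (emb (\<lambda>i\<in>{..<n}. L v (u i) + L (dW \<omega>) (u i)))) \<le> ennreal (nrm v) + (\<Sum>i<n. ennreal \<bar>X i \<omega>\<bar> * ennreal (nrm (b i)))" .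
    qed
    also have "\<dots> = ennreal (nrm v) + c"
      unfolding c_def by (subst nn_integral_add) (auto simp: emeasure_space_1)
    also have "\<dots> = ennreal (nrm v + enn2real c)" using nrm_nonneg[OF v] by (subst c) (simp add: ennreal_plus)
    finally show ?thesis .
  qed
  then show ?thesis by (intro exI[of _ "enn2real c"]) auto
qed

text \<open>
  In coordinates, the chain observed between the implicit step and the addition of the next
  increment has a Gaussian transition density; the drift condition holds for the norm.
\<close>

lemma uniquely_ergodic_coords: "uniquely_ergodic m (\<lambda>z. density m (trans_density (S z)))"
proof -
  have sf: "sigma_finite_measure m"
  proof -
    interpret product_sigma_finite "\<lambda>_ :: nat. lborel :: real measure" by standard
    show ?thesis by (rule sigma_finite) simp
  qed
  define p where "p z = trans_density (S z)" for z
  have pm[measurable]: "case_prod p \<in> borel_measurable (m \<Otimes>\<^sub>M m)"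
  proof -
    have "(\<lambda>q. (S (fst q), snd q)) \<in> m \<Otimes>\<^sub>M m \<rightarrow>\<^sub>M N \<Otimes>\<^sub>M m"
      using measurable_compose[OF measurable_fst S_measurable] by (intro measurable_Pair) auto
    from measurable_compose[OF this trans_density_measurable] show ?thesis by (simp add: p_def[abs_def] split_beta')
  qed
  have s: "sqrt \<tau> > 0" using \<tau> by simp
  have pos: "p z z' > 0" for z z'
    unfolding p_def trans_density_def using normal_density_pos[OF s]
    by (simp add: prod_ennreal normal_density_nonneg prod_pos)
  obtain C0 where C0: "C0 \<ge> 0" "\<And>v. v \<in> V \<Longrightarrow> (\<integral>\<^sup>+z. trans_density v z * ennreal (nrm (emb z)) \<partial>m) \<le> ennreal (nrm v + C0)"
    using noise_moment by blast
  define \<kappa> where "\<kappa> = \<tau> / (\<epsilon>\<^sup>2 * measure lebesgue D)"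
  have \<kappa>: "\<kappa> > 0"
  proof -
    have "\<not> negligible D" using open_not_negligible[OF D(1) D(3)] .
    then have "measure lebesgue D \<noteq> 0" using Dl by (simp add: negligible_iff_measure0)
    then have "measure lebesgue D > 0" by (simp add: less_le)
    then show ?thesis using \<tau> \<epsilon> by (simp add: \<kappa>_def)
  qed
  \<comment> \<open>From this norm of \<open>S z\<close> on, the cubic bound dominates twice the
    norm, so the implicit step at least halves the norm.\<close>
  define r0 where "r0 = sqrt (2 / \<kappa>)"
  \<comment> \<open>Beyond \<open>R\<close> the drift has room \<open>C0 + 1\<close> in either case:
    half the norm is at least that large, and so is the excess over \<open>r0\<close> when the step
    ends below \<open>r0\<close>.\<close>
  define R where "R = 2 * (C0 + 1) + r0"
  have r0: "r0 > 0" "\<kappa> * r0\<^sup>2 = 2" using \<kappa> by (auto simp: r0_def)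
  have R: "R > 0" "2 * (C0 + 1) \<le> R" "r0 + (C0 + 1) \<le> R" using r0 C0 by (auto simp: R_def)
  have Sb: "coer * nrm (S z) \<le> nrm (emb z)" "\<kappa> * nrm (S z) ^ 3 \<le> nrm (emb z)" for z
    unfolding S_def \<kappa>_def by (rule weak_sol_bound weak_sol_cubic_bound, rule sol[OF emb_V], rule emb_V)+
  have far: "nrm (S z) + C0 + 1 \<le> nrm (emb z)" if z: "nrm (emb z) > R" for z
  proof (cases "nrm (S z) \<ge> r0")
    case True
    have "2 * nrm (S z) = \<kappa> * r0\<^sup>2 * nrm (S z)" by (simp add: r0)
    also have "\<dots> \<le> \<kappa> * (nrm (S z))\<^sup>2 * nrm (S z)"
      using True r0 \<kappa> by (intro mult_right_mono mult_left_mono power_mono) auto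
    also have "\<dots> = \<kappa> * nrm (S z) ^ 3" by (simp add: power2_eq_square power3_eq_cube)
    also have "\<dots> \<le> nrm (emb z)" by (rule Sb(2))
    finally have a: "2 * nrm (S z) \<le> nrm (emb z)" .
    have "t + C0 + 1 \<le> s" if "2 * t \<le> s" "R < s" for s t :: real using that R by simp
    then show ?thesis using a z .
  next
    case False
    have "t + C0 + 1 \<le> s" if "\<not> r0 \<le> t" "R < s" for s t :: real using that R by simp
    then show ?thesis using False z .
  qed
  define C where "C = {z\<in>space m. nrm (emb z) \<le> R}"
  have Cm[measurable]: "C \<in> sets m" unfolding C_def by measurable
  \<comment> \<open>A common bound, for starting points in \<open>C\<close>, on all means of the
    normal components after the implicit step.\<close>
  define \<rho> where "\<rho> = (\<Sum>i<n. (R / coer) * nrm (u i))"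
  have near: "nrm (S z) \<le> R / coer" if "z \<in> C" for z
    using that Sb(1)[of z] coer_pos by (simp add: C_def field_simps)
  have \<rho>: "\<bar>L (S z) (u i)\<bar> \<le> \<rho>" if "z \<in> C" "i < n" for z i
  proof -
    have "\<bar>L (S z) (u i)\<bar> \<le> nrm (S z) * nrm (u i)" by (rule CS[OF S_V uV[OF that(2)]])
    also have "\<dots> \<le> (R / coer) * nrm (u i)" by (intro mult_right_mono near that nrm_nonneg uV)
    also have "\<dots> \<le> \<rho>" unfolding \<rho>_def using that(2) R coer_pos nrm_nonneg[OF uV]
      by (intro member_le_sum[of i "{..<n}" "\<lambda>i. (R / coer) * nrm (u i)"]) auto
    finally show ?thesis .
  qed
  \<comment> \<open>The largest possible distance from \<open>t\<close> to a mean in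
    [-\<rho>, \<rho>] is inserted into the normal density; this bounds all these densities from
    below at once.\<close>
  define h where "h t = 1 / sqrt (2 * pi * \<tau>) * exp (- (\<bar>t\<bar> + \<rho>)\<^sup>2 / (2 * \<tau>))" for t
  have hpos: "h t > 0" for t using \<tau> by (simp add: h_def)
  have hle: "h t \<le> normal_density g (sqrt \<tau>) t" if "\<bar>g\<bar> \<le> \<rho>" for g t
  proof -
    have "\<bar>t - g\<bar> \<le> \<bar>\<bar>t\<bar> + \<rho>\<bar>" using that by linarith
    then have "(t - g)\<^sup>2 \<le> (\<bar>t\<bar> + \<rho>)\<^sup>2" by (simp add: abs_le_square_iff)
    then have "- (\<bar>t\<bar> + \<rho>)\<^sup>2 / (2 * \<tau>) \<le> - (t - g)\<^sup>2 / (2 * \<tau>)" using \<tau> by (simp add: divide_right_mono)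
    then show ?thesis unfolding h_def normal_density_def using \<tau> by (intro mult_mono) auto
  qed
  have [measurable]: "h \<in> borel_measurable borel" unfolding h_def by measurable
  define \<eta> where "\<eta> z = (\<Prod>i<n. ennreal (h (z i)))" for z
  have \<eta>m[measurable]: "\<eta> \<in> borel_measurable m" unfolding \<eta>_def by measurable
  have \<eta>pos: "\<eta> z > 0" for z unfolding \<eta>_def using hpos by (simp add: prod_ennreal less_imp_le prod_pos)
  have \<eta>le: "indicator C z * \<eta> z' \<le> p z z'" for z z'
  proof (cases "z \<in> C")
    case True
    have "\<eta> z' \<le> p z z'"
      unfolding \<eta>_def p_def trans_density_def using \<rho>[OF True] by (intro prod_mono_ennreal ennreal_leI hle) auto
    then show ?thesis using True by simp
  qed simp
  \<comment> \<open>Subtraction of extended reals truncates at 0; \<open>\<eta>le\<close> ensures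
    that adding the minorant back recovers \<open>p\<close>.\<close>
  define k where "k z z' = p z z' - indicator C z * \<eta> z'" for z z'
  have km: "case_prod k \<in> borel_measurable (m \<Otimes>\<^sub>M m)"
    unfolding k_def split_beta using pm by (intro borel_measurable_minus_ennreal) (simp_all add: split_beta)
  define U where "U z = ennreal (nrm (emb z))" for z
  have Um: "U \<in> borel_measurable m" unfolding U_def by measurable
  have p1: "(\<integral>\<^sup>+z'. p z z' \<partial>m) = 1" for z unfolding p_def by (rule trans_density_prob[OF S_V])
  have pU: "(\<integral>\<^sup>+z'. p z z' * U z' \<partial>m) \<le> ennreal (nrm (S z) + C0)" for z unfolding p_def U_def by (rule C0(2)[OF S_V])
  \<comment> \<open>A point of \<open>C\<close>: there the minorant lies below the probability
    density \<open>p z0\<close>, from which it inherits finite mass and a finite first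
    moment.\<close>
  define z0 :: "nat \<Rightarrow> real" where "z0 = (\<lambda>i\<in>{..<n}. 0)"
  have z0: "z0 \<in> C"
  proof -
    have "emb z0 = (\<lambda>_. 0)" by (simp add: z0_def emb_def[abs_def])
    then have "nrm (emb z0) = 0" by (simp add: l2_norm_def L.zero_left V0)
    then show ?thesis using R by (simp add: C_def z0_def space_PiM)
  qed
  have \<eta>z0: "\<eta> z \<le> p z0 z" for z using \<eta>le[of z0 z] z0 by simp
  show ?thesis unfolding p_def[symmetric]
  proof (rule uniquely_ergodic_density[OF sf pm pos km \<eta>m Um Cm _ p1])
    show "p z z' = k z z' + indicator C z * \<eta> z'" for z z'
      unfolding k_def by (rule diff_add_cancel_ennreal[OF \<eta>le, symmetric])
    show "0 < integral\<^sup>N m \<eta>"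
    proof (rule ccontr)
      assume "\<not> 0 < integral\<^sup>N m \<eta>"
      then have "integral\<^sup>N m \<eta> = 0" by (simp add: zero_less_iff_neq_zero)
      then have "AE z in m. \<eta> z = 0" by (subst (asm) nn_integral_0_iff_AE) auto
      then have "AE z in m. p z0 z = 0" by eventually_elim (use \<eta>pos in \<open>metis less_irrefl\<close>)
      then have "(\<integral>\<^sup>+z. p z0 z \<partial>m) = (\<integral>\<^sup>+z. 0 \<partial>m)" by (rule nn_integral_cong_AE)
      then show False using p1[of z0] by simp
    qed
    have "integral\<^sup>N m \<eta> \<le> 1" unfolding p1[of z0, symmetric] by (intro nn_integral_mono \<eta>z0)
    then show "integral\<^sup>N m \<eta> < \<infinity>" by (rule order.strict_trans1) simp
    have "(\<integral>\<^sup>+z. \<eta> z * U z \<partial>m) \<le> ennreal (nrm (S z0) + C0)"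
      by (rule order_trans[OF _ pU]) (intro nn_integral_mono mult_right_mono \<eta>z0, simp)
    then show "(\<integral>\<^sup>+z. \<eta> z * U z \<partial>m) < \<infinity>" by (rule order.strict_trans1) simp
    \<comment> \<open>On \<open>C\<close> the implicit step ends within \<open>R / coer\<close>, so
      this constant dominates the left side of the drift condition there.\<close>
    show "0 \<le> R / coer + C0 + 1" using R coer_pos C0 by simp
    fix z assume z: "z \<in> space m"
    have "(\<integral>\<^sup>+z'. p z z' * U z' \<partial>m) + 1 \<le> ennreal (nrm (S z) + C0) + 1" using pU by (intro add_right_mono)
    also have "\<dots> = ennreal (nrm (S z) + C0 + 1)" using C0 nrm_nonneg[OF S_V, of z] by (simp add: ennreal_plus)
    also have "\<dots> \<le> U z + ennreal (R / coer + C0 + 1) * indicator C z"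
    proof (cases "z \<in> C")
      case True
      have "ennreal (nrm (S z) + C0 + 1) \<le> ennreal (R / coer + C0 + 1)" using near[OF True] by (intro ennreal_leI) simp
      also have "\<dots> \<le> U z + ennreal (R / coer + C0 + 1)" by (simp add: add_increasing)
      finally show ?thesis using True by simp
    next
      case False
      then have "nrm (S z) + C0 + 1 \<le> nrm (emb z)" using z by (intro far) (simp add: C_def)
      then show ?thesis using False by (simp add: U_def ennreal_leI)
    qed
    finally show "(\<integral>\<^sup>+z'. p z z' * U z' \<partial>m) + 1 \<le> U z + ennreal (R / coer + C0 + 1) * indicator C z" .
  qed
qed

text \<open>The two stages are the addition of noise, a kernel from \<open>V\<close> to coordinates,
  and the implicit step \<open>S\<close> back to \<open>V\<close>.\<close>

lemma uniquely_ergodic_step: "uniquely_ergodic N (\<lambda>v. distr M N (\<lambda>\<omega>. dieg_step D V \<epsilon> \<tau> v (dW \<omega>)))"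
proof -
  have sf: "sigma_finite_measure m"
  proof -
    interpret product_sigma_finite "\<lambda>_ :: nat. lborel :: real measure" by standard
    show ?thesis by (rule sigma_finite) simp
  qed
  have "(\<lambda>v. density m (trans_density v)) \<in> N \<rightarrow>\<^sub>M prob_algebra m"
    by (rule density_kernel_measurable[OF sf trans_density_measurable]) (simp add: trans_density_prob space_N)
  from uniquely_ergodic_factor[where T = "\<lambda>v. density m (trans_density v)" and s = S, OF this S_measurable]
    uniquely_ergodic_coords
  have "uniquely_ergodic N (\<lambda>v. distr (density m (trans_density v)) N S)" by simp
  then show ?thesis by (subst uniquely_ergodic_cong[OF kernel_eq]) (simp_all add: space_N)
qed

end

end

subsection \<open>Coordinates adapted to the noise\<close>

lemma semi_inner_covariance:
  assumes Q: "covariance_operator D Q"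
  shows "semi_inner (l2_space D) (\<lambda>f g. l2_inner D (Q f) g)"
proof
  have Ql: "Q f \<in> l2_space D" if "f \<in> l2_space D" for f
    using Q that by (auto simp: covariance_operator_def l2_operator_def)
  fix f g :: "'a \<Rightarrow> real" and a b assume f: "f \<in> l2_space D" and g: "g \<in> l2_space D"
  show fg: "(\<lambda>x. a *\<^sub>R f x + b *\<^sub>R g x) \<in> l2_space D" by (rule l2.lin[OF f g])
  have "l2_inner D (Q f) g = l2_inner D f (Q g)" using Q f g by (simp add: covariance_operator_def)
  then show "l2_inner D (Q f) g = l2_inner D (Q g) f" using l2.sym[OF f Ql[OF g]] by simp
  \<comment> \<open>Strict positivity of \<open>Q\<close> leaves out functions that vanish almost
    everywhere; for these the value is 0.\<close>
  show "0 \<le> l2_inner D (Q f) f"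
  proof (cases "l2_eq D f (\<lambda>_. 0)")
    case True
    have "l2_inner D (Q f) f = l2_inner D (Q f) (\<lambda>_. 0)"
      using True by (intro l2_inner_cong_AE Ql f l2.zero[OF f]) (auto simp: l2_eq_def)
    then show ?thesis by (simp add: l2_inner_def)
  next
    case False
    then have "l2_inner D (Q f) f > 0" using Q f by (auto simp: covariance_operator_def)
    then show ?thesis by simp
  qed
  fix h :: "'a \<Rightarrow> real" assume h: "h \<in> l2_space D"
  have "l2_eq D (Q (\<lambda>x. a * f x + b * g x)) (\<lambda>x. a * Q f x + b * Q g x)"
    using Q f g by (auto simp: covariance_operator_def l2_operator_def)
  then have "l2_inner D (Q (\<lambda>x. a *\<^sub>R f x + b *\<^sub>R g x)) h = l2_inner D (\<lambda>x. a *\<^sub>R Q f x + b *\<^sub>R Q g x) h"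
    by (intro l2_inner_cong_AE Ql fg l2.lin f g h) (simp_all add: l2_eq_def)
  also have "\<dots> = a * l2_inner D (Q f) h + b * l2_inner D (Q g) h" by (rule l2.lin_left[OF Ql[OF f] Ql[OF g] h])
  finally show "l2_inner D (Q (\<lambda>x. a *\<^sub>R f x + b *\<^sub>R g x)) h = a * l2_inner D (Q f) h + b * l2_inner D (Q g) h" .
qed

text \<open>Strict positivity of \<open>Q\<close> makes its form definite on \<open>V\<close>, so
  Gram-Schmidt applies to it and gives the \<open>u i\<close>. The dual family consists of the
  representatives of the functionals \<open>q v (u i)\<close>, which are the projections of
  \<open>Q (u i)\<close>.\<close>

lemma (in fem) noise_coordinates_exist:
  assumes Q: "covariance_operator D Q"
  shows "\<exists>(n::nat) u b. fem_coords D T \<epsilon> \<tau> n u b \<and>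
    (\<forall>i<n. \<forall>j<n. L (Q (u i)) (u j) = (if i = j then 1 else 0))"
proof -
  define q where "q f g = L (Q f) g" for f g
  interpret q2: semi_inner "l2_space D" q unfolding q_def[abs_def] by (rule semi_inner_covariance[OF Q])
  have "semi_inner V q" using Vl2 by (intro semi_inner_subset[OF q2.semi_inner_axioms] V_lin) auto
  then interpret q: semi_inner V q .
  have qdef: "v = (\<lambda>_. 0)" if v: "v \<in> V" "q v v = 0" for v
  proof -
    have "l2_eq D v (\<lambda>_. 0)"
      using Q Vl2[OF v(1)] v(2) by (force simp: covariance_operator_def q_def)
    then show ?thesis using l2_inner_eq_0_iff[OF Vl2[OF v(1)]] V_definite[OF v(1)] by simp
  qed
  obtain P where P: "finite P" "\<And>v. v \<in> V \<Longrightarrow> (\<And>p. p \<in> P \<Longrightarrow> v p = 0) \<Longrightarrow> v = (\<lambda>_. 0)"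
    using fe_space_separated[OF D(1,2) T] by blast
  obtain n :: nat and u where u: "\<And>i. i < n \<Longrightarrow> u i \<in> V" "\<And>i j. i < n \<Longrightarrow> j < n \<Longrightarrow> q (u i) (u j) = (if i = j then 1 else 0)"
    "\<And>v. v \<in> V \<Longrightarrow> v = (\<lambda>x. \<Sum>i<n. q v (u i) * u i x)"
    using orthonormal_basis_exists[OF P(1) q.semi_inner_axioms V0 qdef P(2)] by blast
  define b where "b i = fe_projection D V (\<lambda>v. q v (u i))" for i
  have lin: "q (\<lambda>x. a * f x + c * g x) (u i) = a * q f (u i) + c * q g (u i)"
    if "i < n" "f \<in> V" "g \<in> V" for i f g a c
    using q.lin_left[OF that(2,3) u(1)[OF that(1)], of a c] by simp
  have b1: "b i \<in> V" if i: "i < n" for i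
    unfolding b_def by (rule fe_projection(1)[OF lin[OF i]])
  have b2: "L v (b i) = q v (u i)" if i: "i < n" and v: "v \<in> V" for i v
    unfolding b_def by (rule fe_projection(2)[OF lin[OF i] v])
  \<comment> \<open>Checked by testing with \<open>w\<close>: duality moves the coefficients onto
    \<open>w\<close>, whose expansion in the \<open>u i\<close> is already known.\<close>
  have "v = (\<lambda>x. \<Sum>i<n. L v (u i) *\<^sub>R b i x)" if v: "v \<in> V" for v
  proof (rule V_eqI[OF v])
    show sV: "(\<lambda>x. \<Sum>i<n. L v (u i) *\<^sub>R b i x) \<in> V" using b1 by (intro L.sum_mem[OF V0]) auto
    fix w assume w: "w \<in> V"
    have "L w (\<lambda>x. \<Sum>i<n. L v (u i) *\<^sub>R b i x) = (\<Sum>i<n. L v (u i) * L w (b i))"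
      using b1 w by (intro L.sum_right) auto
    also have "\<dots> = (\<Sum>i<n. q w (u i) * L v (u i))" using b2[OF _ w] by (intro sum.cong) auto
    also have "\<dots> = L v (\<lambda>x. \<Sum>i<n. q w (u i) *\<^sub>R u i x)" using u(1) v by (intro L.sum_right[symmetric]) auto
    also have "(\<lambda>x. \<Sum>i<n. q w (u i) *\<^sub>R u i x) = w" using u(3)[OF w] by simp
    finally show "L w v = L w (\<lambda>x. \<Sum>i<n. L v (u i) *\<^sub>R b i x)" by (simp add: L.sym[OF v w])
  qed
  then have "fem_coords D T \<epsilon> \<tau> n u b" using u(1) b1 by unfold_locales auto
  then show ?thesis using u(2) unfolding q_def by blast
qed

section \<open>The scheme driven by the Wiener process\<close>

theorem theorem5:
  fixes D :: "'a::euclidean_space set"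
    and Q :: "('a \<Rightarrow> real) \<Rightarrow> ('a \<Rightarrow> real)"
    and M :: "'w measure" and F :: "real \<Rightarrow> 'w measure"
    and W :: "real \<Rightarrow> 'w \<Rightarrow> 'a \<Rightarrow> real"
    and S :: "real set" and T :: "real \<Rightarrow> 'a set set"
    and \<epsilon> h \<tau> :: real
  assumes "DIM('a) \<in> {1, 2, 3}"
    and "admissible_domain D"
    and "covariance_operator D Q"
    and "filtered_prob_space M F"
    and "wiener_process D Q M F W"
    and "S \<subseteq> {0<..<1}"
    and "regular_quasi_uniform_partitions D S T"
    and "\<epsilon> > 0" and "h \<in> S" and "\<tau> \<in> {0<..<1}"
    and "(1 / \<epsilon>\<^sup>2 - lambda1 D) * \<tau> < 1"
  shows "uniquely_ergodic (fe_borel D (fe_space D (T h)))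
           (dieg_kernel M D (fe_space D (T h)) \<epsilon> \<tau> W)"
proof -
  note Q = assms(3) and W = assms(5)
  have \<tau>: "0 < \<tau>" using assms(10) by simp
  interpret fem D "T h" \<epsilon> \<tau>
    using assms \<tau> by unfold_locales (auto simp: admissible_domain_def regular_quasi_uniform_partitions_def)
  interpret prob_space M using assms(4) by (simp add: filtered_prob_space_def)
  obtain n :: nat and u b where c: "fem_coords D (T h) \<epsilon> \<tau> n u b"
    and qu: "\<And>i j. i < n \<Longrightarrow> j < n \<Longrightarrow> L (Q (u i)) (u j) = (if i = j then 1 else 0)"
    using noise_coordinates_exist[OF Q] by blast
  interpret fem_coords D "T h" \<epsilon> \<tau> n u b by (rule c)
  interpret q: semi_inner "l2_space D" "\<lambda>f g. L (Q f) g" by (rule semi_inner_covariance[OF Q])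
  \<comment> \<open>The increment over the first step, with the time points written as
    \<open>dieg_chain\<close> produces them; one step determines the kernel.\<close>
  define dW where "dW \<omega> x = W (real (Suc 0) * \<tau>) \<omega> x - W (real 0 * \<tau>) \<omega> x" for \<omega> x
  have Wl: "W t \<omega> \<in> l2_space D" if "t \<ge> 0" "\<omega> \<in> space M" for t \<omega>
    using W that by (simp add: wiener_process_def)
  have dWl: "dW \<omega> \<in> l2_space D" if "\<omega> \<in> space M" for \<omega>
    unfolding dW_def[abs_def] using \<tau> that by (intro l2.diff Wl) auto
  have ul: "u i \<in> l2_space D" if "i < n" for i by (rule Vl2[OF uV[OF that]])
  have Wm: "(\<lambda>\<omega>. L (W t \<omega>) f) \<in> borel_measurable M" if "t \<ge> 0" "f \<in> l2_space D" for t f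
  proof -
    have "(\<lambda>\<omega>. L (W t \<omega>) f) \<in> borel_measurable (F t)" using W that by (simp add: wiener_process_def)
    moreover have "subalgebra M (F t)" using assms(4) that(1) by (simp add: filtered_prob_space_def)
    ultimately show ?thesis using measurable_from_subalg by blast
  qed
  have Xm: "(\<lambda>\<omega>. L (dW \<omega>) f) \<in> borel_measurable M" if f: "f \<in> l2_space D" for f
  proof -
    have "L (dW \<omega>) f = L (W (real (Suc 0) * \<tau>) \<omega>) f - L (W (real 0 * \<tau>) \<omega>) f" if "\<omega> \<in> space M" for \<omega>
      unfolding dW_def[abs_def] using \<tau> that f by (intro l2.diff_left Wl) auto
    moreover have "(\<lambda>\<omega>. L (W (real (Suc 0) * \<tau>) \<omega>) f - L (W (real 0 * \<tau>) \<omega>) f) \<in> borel_measurable M"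
      using \<tau> f by (intro borel_measurable_diff Wm) auto
    ultimately show ?thesis by (simp cong: measurable_cong)
  qed
  have law: "distr M borel (\<lambda>\<omega>. \<Sum>i<n. t i * L (dW \<omega>) (u i)) = normal_law 0 (\<tau> * (\<Sum>i<n. (t i)\<^sup>2))" for t
  proof -
    \<comment> \<open>A linear combination of coordinates is the functional of the increment at this
      \<open>f\<close>; its variance involves \<open>L (Q f) f\<close>, a plain sum of squares by
      Q-orthonormality.\<close>
    define f where "f x = (\<Sum>i<n. t i *\<^sub>R u i x)" for x
    have fl: "f \<in> l2_space D" unfolding f_def[abs_def] using ul by (intro l2.sum_mem[OF Vl2[OF V0]]) auto
    have inc: "distr M borel (\<lambda>\<omega>. L (dW \<omega>) f) = normal_law 0 ((real (Suc 0) * \<tau> - real 0 * \<tau>) * L (Q f) f)"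
      unfolding dW_def[abs_def] using W \<tau> fl by (simp add: wiener_process_def)
    have e1: "L (dW \<omega>) f = (\<Sum>i<n. t i * L (dW \<omega>) (u i))" if "\<omega> \<in> space M" for \<omega>
      unfolding f_def[abs_def] using ul dWl[OF that] by (intro l2.sum_right) auto
    have "L (Q f) f = (\<Sum>i<n. t i * L (Q (u i)) f)"
    proof -
      have "L (Q (\<lambda>x. \<Sum>i<n. t i *\<^sub>R u i x)) f = (\<Sum>i<n. t i * L (Q (u i)) f)"
        using ul fl by (intro q.sum_left) auto
      then show ?thesis by (simp add: f_def[abs_def])
    qed
    also have "\<dots> = (\<Sum>i<n. t i * t i)"
    proof (intro sum.cong refl arg_cong2[where f = "(*)"])
      fix i assume i: "i \<in> {..<n}"
      have "L (Q (u i)) (\<lambda>x. \<Sum>j<n. t j *\<^sub>R u j x) = (\<Sum>j<n. t j * L (Q (u i)) (u j))"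
        using ul i by (intro q.sum_right) auto
      also have "\<dots> = (\<Sum>j<n. if i = j then t j else 0)" using qu i by (intro sum.cong) auto
      finally show "L (Q (u i)) f = t i" using i by (simp add: f_def[abs_def])
    qed
    finally have "L (Q f) f = (\<Sum>i<n. (t i)\<^sup>2)" by (simp add: power2_eq_square)
    moreover have "distr M borel (\<lambda>\<omega>. \<Sum>i<n. t i * L (dW \<omega>) (u i)) = distr M borel (\<lambda>\<omega>. L (dW \<omega>) f)"
      by (intro distr_cong refl e1[symmetric])
    ultimately show ?thesis using inc by simp
  qed
  have ue: "uniquely_ergodic N (\<lambda>v. distr M N (\<lambda>\<omega>. dieg_step D V \<epsilon> \<tau> v (dW \<omega>)))"
    by (rule uniquely_ergodic_step[OF prob_space_axioms dWl Xm[OF ul] law])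
  have "dieg_kernel M D V \<epsilon> \<tau> W v = distr M N (\<lambda>\<omega>. dieg_step D V \<epsilon> \<tau> v (dW \<omega>))" if "v \<in> space N" for v
  proof -
    have v: "v \<in> V" using that by (simp add: space_N)
    \<comment> \<open>The kernel starts the chain at the projection of the state, which on
      \<open>V\<close> is the state itself.\<close>
    have "fe_projection D V (l2_functional D v) = v" by (rule fe_projection_eqI[OF v]) (simp add: l2_functional_def)
    then show ?thesis by (simp add: dieg_kernel_def One_nat_def dW_def[abs_def] del: of_nat_Suc)
  qed
  with ue show ?thesis by (subst uniquely_ergodic_cong)
qed

end
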